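(* Let $\Omega\subset\mathbb{R}^3$ be open and bounded, let $\Omega'\Subset\Omega$ be open with Lipschitz boundary, and let $\boldsymbol F\in\mathscr{CM}^\infty(\Omega)$. Then: (a) There exist $(\boldsymbol F\times\nu_{\partial\Omega'})_{\partial\Omega'}^{\mathrm{int}},(\boldsymbol F\times\nu_{\partial\Omega'})_{\partial\Omega'}^{\mathrm{ext}}\in L^\infty(\partial\Omega';\mathbb{R}^3)$ such that for every $\varphi\in C_c^1(\Omega)$ $$\int_{\partial\Omega'}\varphi\,(\boldsymbol F\times\nu_{\partial\Omega'})_{\partial\Omega'}^{\mathrm{int}}\,d\mathscr H^2=\langle(\boldsymbol F\times\nu)_{\Omega'}^{\mathrm{int}},\varphi\rangle_{\partial\Omega'},\qquad \int_{\partial\Omega'}\varphi\,(\boldsymbol F\times\nu_{\partial\Omega'})_{\partial\Omega'}^{\mathrm{ext}}\,d\mathscr H^2=\langle(\boldsymbol F\times\nu)_{\Omega'}^{\mathrm{ext}},\varphi\rangle_{\partial\Omega'}.$$ (b) For $\mathscr H^2$-a.e. $x\in\partial\Omega'$, both $(\boldsymbol F\times\nu_{\partial\Omega'})_{\partial\Omega'}^{\mathrm{int}}(x)$ and $(\boldsymbol F\times\nu_{\partial\Omega'})_{\partial\Omega'}^{\mathrm{ext}}(x)$ belong to the tangent space $T_{\partial\Omega'}(x)$. (c) For every $\boldsymbol\varphi\in C_c^1(\Omega;\mathbb{R}^3)$, $$\int_{\partial\Omega'}(\boldsymbol F\times\nu_{\partial\Omega'})_{\partial\Omega'}^{\mathrm{int}}\cdot\boldsymbol\varphi\,d\mathscr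 H^2=\int_{\Omega'}\boldsymbol\varphi\cdot d(\operatorname{curl}\boldsymbol F)-\int_{\Omega'}(\operatorname{curl}\boldsymbol\varphi)\cdot\boldsymbol F\,dx,$$ $$\int_{\partial\Omega'}(\boldsymbol F\times\nu_{\partial\Omega'})_{\partial\Omega'}^{\mathrm{ext}}\cdot\boldsymbol\varphi\,d\mathscr H^2=-\int_{\Omega\setminus\overline{\Omega'}}\boldsymbol\varphi\cdot d(\operatorname{curl}\boldsymbol F)+\int_{\Omega\setminus\overline{\Omega'}}(\operatorname{curl}\boldsymbol\varphi)\cdot\boldsymbol F\,dx.$$
   Context: $\mathscr{CM}^\infty(\Omega)$ is the space of all $\boldsymbol F\in L^\infty(\Omega;\mathbb{R}^3)$ whose distributional curl is a finite $\mathbb{R}^3$-valued Radon measure on $\Omega$. $\nu_{\partial\Omega'}$ is the inner unit normal of $\Omega'$. The ($\mathbb{R}^3$-valued) tangential trace functionals are $$\langle(\boldsymbol F\times\nu)_{\Omega'}^{\mathrm{int}},\varphi\rangle_{\partial\Omega'}:=\int_{\Omega'}\varphi\,d(\operatorname{curl}\boldsymbol F)-\int_{\Omega'}\boldsymbol F\times\nabla\varphi\,dx,\quad \langle(\boldsymbol F\times\nu)_{\Omega'}^{\mathrm{ext}},\varphi\rangle_{\partial\Omega'}:=-\int_{\Omega\setminus\overline{\Omega'}}\varphi\,d(\operatorname{curl}\boldsymbol F)+\int_{\Omega\setminus\overline{\Omega'}}\boldsymbol F\times\nabla\varphi\,dx$$ for compactly supported $C^1$ functions $\varphi$ on $\Omega$.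 *)

theory Defs
  imports "HOL-Analysis.Analysis"
begin

section \<open>Test functions and differential operators\<close>

definition pd :: "3 \<Rightarrow> (real^3 \<Rightarrow> 'b::real_normed_vector) \<Rightarrow> real^3 \<Rightarrow> 'b" where
  "pd i f x = frechet_derivative f (at x) (axis i 1)"

fun C_k :: "nat \<Rightarrow> (real^3 \<Rightarrow> 'b::real_normed_vector) \<Rightarrow> bool" where
  "C_k 0 f \<longleftrightarrow> continuous_on UNIV f"
| "C_k (Suc k) f \<longleftrightarrow> (\<forall>x. f differentiable (at x)) \<and> (\<forall>i. C_k k (pd i f))"

text \<open>Compactly supported functions on an open set \<open>\<Omega>\<close> are identified with their extensions
  by zero to the whole space.\<close>

definition Cc :: "nat \<Rightarrow> (real^3) set \<Rightarrow> (real^3 \<Rightarrow> 'b::real_normed_vector) set" where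
  "Cc k \<Omega> = {\<phi>. C_k k \<phi> \<and> compact (closure {x. \<phi> x \<noteq> 0}) \<and> closure {x. \<phi> x \<noteq> 0} \<subseteq> \<Omega>}"

definition Cc_infty :: "(real^3) set \<Rightarrow> (real^3 \<Rightarrow> 'b::real_normed_vector) set" where
  "Cc_infty \<Omega> = (\<Inter>k. Cc k \<Omega>)"

definition grad :: "(real^3 \<Rightarrow> real) \<Rightarrow> real^3 \<Rightarrow> real^3" where
  "grad \<phi> x = (\<chi> i. pd i \<phi> x)"

definition curl :: "(real^3 \<Rightarrow> real^3) \<Rightarrow> real^3 \<Rightarrow> real^3" where
  "curl \<phi> x = vector [pd 2 \<phi> x $ 3 - pd 3 \<phi> x $ 2,
                      pd 3 \<phi> x $ 1 - pd 1 \<phi> x $ 3,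
                      pd 1 \<phi> x $ 2 - pd 2 \<phi> x $ 1]"

definition L_infty :: "'a measure \<Rightarrow> ('a \<Rightarrow> real^3) set" where
  "L_infty M = {f \<in> borel_measurable M. \<exists>C. AE x in M. norm (f x) \<le> C}"


section \<open>Vector-valued Radon measures\<close>

text \<open>A finite vector-valued Radon measure on an open set \<open>\<Omega>\<close> is a countably additive vector-valued
  set function on the Borel subsets of \<open>\<Omega>\<close>.  Finiteness of the total variation and inner and outer
  regularity are automatic for such set functions.  The values of \<open>\<mu>\<close> on other sets are irrelevant.\<close>

definition vector_radon_measure :: "(real^3) set \<Rightarrow> ((real^3) set \<Rightarrow> real^3) \<Rightarrow> bool" where
  "vector_radon_measure \<Omega> \<mu> \<longleftrightarrow>
    (\<forall>A :: nat \<Rightarrow> (real^3) set.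
       range A \<subseteq> {B \<in> sets borel. B \<subseteq> \<Omega>} \<longrightarrow> disjoint_family A \<longrightarrow>
       (\<lambda>i. \<mu> (A i)) sums \<mu> (\<Union>i. A i))"

text \<open>The positive part in the Jordan decomposition of a signed measure \<open>s\<close> on \<open>\<Omega>\<close>; the negative part
  is the positive part of \<open>-s\<close>.  Since \<open>s {} = 0\<close>, the truncation of negative numbers
  by \<open>ennreal\<close> does not change the supremum.\<close>

definition pos_part_measure :: "(real^3) set \<Rightarrow> ((real^3) set \<Rightarrow> real) \<Rightarrow> (real^3) measure" where
  "pos_part_measure \<Omega> s =
    measure_of \<Omega> {B \<in> sets borel. B \<subseteq> \<Omega>}
      (\<lambda>A. SUP B \<in> {B \<in> sets borel. B \<subseteq> A}. ennreal (s B))"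

definition signed_integral ::
    "(real^3) set \<Rightarrow> ((real^3) set \<Rightarrow> real) \<Rightarrow> (real^3) set \<Rightarrow> (real^3 \<Rightarrow> real) \<Rightarrow> real" where
  "signed_integral \<Omega> s A f =
    (LINT x:A|pos_part_measure \<Omega> s. f x) - (LINT x:A|pos_part_measure \<Omega> (\<lambda>B. - s B). f x)"

text \<open>For \<open>A \<subseteq> \<Omega>\<close>, the integrals over \<open>A\<close> of a scalar function (with values in the space of \<open>\<mu>\<close>)
  and of a vector field (scalar-valued, using the dot product) against a vector measure \<open>\<mu>\<close> on \<open>\<Omega>\<close>.\<close>

definition vm_integral ::
    "(real^3) set \<Rightarrow> ((real^3) set \<Rightarrow> real^3) \<Rightarrow> (real^3) set \<Rightarrow> (real^3 \<Rightarrow> real) \<Rightarrow> real^3" where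
  "vm_integral \<Omega> \<mu> A \<phi> = (\<chi> i. signed_integral \<Omega> (\<lambda>B. \<mu> B $ i) A \<phi>)"

definition vm_integral_dot ::
    "(real^3) set \<Rightarrow> ((real^3) set \<Rightarrow> real^3) \<Rightarrow> (real^3) set \<Rightarrow> (real^3 \<Rightarrow> real^3) \<Rightarrow> real" where
  "vm_integral_dot \<Omega> \<mu> A \<phi> = (\<Sum>i\<in>UNIV. signed_integral \<Omega> (\<lambda>B. \<mu> B $ i) A (\<lambda>x. \<phi> x $ i))"


section \<open>Curl-measure fields and their tangential trace functionals\<close>

definition has_curl_measure ::
    "(real^3) set \<Rightarrow> (real^3 \<Rightarrow> real^3) \<Rightarrow> ((real^3) set \<Rightarrow> real^3) \<Rightarrow> bool" where
  "has_curl_measure \<Omega> F \<mu> \<longleftrightarrow> vector_radon_measure \<Omega> \<mu> \<and>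
    (\<forall>\<phi> \<in> Cc_infty \<Omega>. (LINT x:\<Omega>|lebesgue. F x \<bullet> curl \<phi> x) = vm_integral_dot \<Omega> \<mu> \<Omega> \<phi>)"

definition CM_infty :: "(real^3) set \<Rightarrow> (real^3 \<Rightarrow> real^3) set" where
  "CM_infty \<Omega> = {F \<in> L_infty (lebesgue_on \<Omega>). \<exists>\<mu>. has_curl_measure \<Omega> F \<mu>}"

definition int_trace ::
    "(real^3) set \<Rightarrow> (real^3 \<Rightarrow> real^3) \<Rightarrow> ((real^3) set \<Rightarrow> real^3) \<Rightarrow> (real^3) set
      \<Rightarrow> (real^3 \<Rightarrow> real) \<Rightarrow> real^3" where
  "int_trace \<Omega> F \<mu> \<Omega>' \<phi> =
    vm_integral \<Omega> \<mu> \<Omega>' \<phi> - (LINT x:\<Omega>'|lebesgue. cross3 (F x) (grad \<phi> x))"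

definition ext_trace ::
    "(real^3) set \<Rightarrow> (real^3 \<Rightarrow> real^3) \<Rightarrow> ((real^3) set \<Rightarrow> real^3) \<Rightarrow> (real^3) set
      \<Rightarrow> (real^3 \<Rightarrow> real) \<Rightarrow> real^3" where
  "ext_trace \<Omega> F \<mu> \<Omega>' \<phi> =
    - vm_integral \<Omega> \<mu> (\<Omega> - closure \<Omega>') \<phi>
    + (LINT x:\<Omega> - closure \<Omega>'|lebesgue. cross3 (F x) (grad \<phi> x))"


section \<open>Hausdorff measure\<close>

text \<open>The factor \<open>unit_ball_vol k\<close> gives the usual normalisation, for which the \<open>k\<close>-dimensional
  Hausdorff measure agrees with Lebesgue measure on \<open>k\<close>-planes.  Boundedness has to be demanded
  separately, since \<open>diameter\<close> is unspecified on unbounded sets.\<close>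

definition hausdorff_pre :: "nat \<Rightarrow> real \<Rightarrow> 'a::metric_space set \<Rightarrow> ennreal" where
  "hausdorff_pre k \<delta> A =
    (INF U \<in> {U :: nat \<Rightarrow> 'a set. A \<subseteq> (\<Union>i. U i) \<and> (\<forall>i. bounded (U i) \<and> diameter (U i) \<le> \<delta>)}.
      \<Sum>i. if U i = {} then 0 else ennreal (unit_ball_vol (real k) * (diameter (U i) / 2) ^ k))"

definition hausdorff_outer :: "nat \<Rightarrow> 'a::metric_space set \<Rightarrow> ennreal" where
  "hausdorff_outer k A = (SUP \<delta> \<in> {0<..}. hausdorff_pre k \<delta> A)"

definition hausdorff_measure :: "nat \<Rightarrow> 'a::metric_space measure" where
  "hausdorff_measure k = measure_of UNIV (sets borel) (hausdorff_outer k)"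

abbreviation boundary_measure :: "(real^3) set \<Rightarrow> (real^3) measure" where
  "boundary_measure U \<equiv> restrict_space (hausdorff_measure 2) (frontier U)"


section \<open>Lipschitz boundaries and tangent spaces\<close>

text \<open>Up to a change \<open>R\<close> of orthonormal coordinates, the set is locally the epigraph of a
  Lipschitz function.\<close>

definition lipschitz_boundary :: "(real^3) set \<Rightarrow> bool" where
  "lipschitz_boundary U \<longleftrightarrow>
    (\<forall>x \<in> frontier U. \<exists>r>0. \<exists>R :: real^3 \<Rightarrow> real^3. \<exists>L. \<exists>\<gamma> :: real^2 \<Rightarrow> real.
       orthogonal_transformation R \<and> L-lipschitz_on UNIV \<gamma> \<and>
       U \<inter> ball x r = {y \<in> ball x r. \<gamma> (vector [R y $ 1, R y $ 2]) < R y $ 3})"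

definition tangent_cone :: "'a::real_normed_vector set \<Rightarrow> 'a \<Rightarrow> 'a set" where
  "tangent_cone S x =
    {v. \<exists>y t. (\<forall>n::nat. y n \<in> S \<and> t n > 0) \<and> t \<longlonglongrightarrow> 0 \<and> (\<lambda>n. (y n - x) /\<^sub>R t n) \<longlonglongrightarrow> v}"

text \<open>A surface has the tangent space \<open>T\<close> at \<open>x\<close> if its tangent vectors at \<open>x\<close> form the
  plane \<open>T\<close>.  For the graph of a Lipschitz function such a \<open>T\<close> exists exactly at
  the points lying over points of differentiability, and it is then the orthogonal complement of
  the normal vector.\<close>

definition is_tangent_space :: "(real^3) set \<Rightarrow> real^3 \<Rightarrow> (real^3) set \<Rightarrow> bool" where
  "is_tangent_space S x T \<longleftrightarrow> T = tangent_cone S x \<and> subspace T \<and> dim T = 2"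

end

theory Submission
  imports Defs
begin

text \<open>
Let \<open>E\<close> be \<open>\<Omega>'\<close> or \<open>\<Omega> - closure \<Omega>'\<close>, let \<open>S\<close> be the boundary of \<open>\<Omega>'\<close>, and write \<open>\<mu>\<close> for the curl measure. Up to
the sign of the exterior trace, both trace functionals have the components
\<open>T\<^sub>i \<phi> = \<integral>\<^sub>E \<phi> d\<mu>\<^sub>i - \<integral>\<^sub>E (F \<times> \<nabla>\<phi>)\<^sub>i dx\<close>. If \<open>\<phi>\<close> vanishes near \<open>S\<close>, then \<open>\<phi>\<close> cut off outside \<open>E\<close> is still a
test function on \<open>\<Omega>\<close>, and \<open>T\<^sub>i \<phi> = 0\<close> by the definition of the distributional curl (\<open>T_eq_0\<close>).

Hence \<open>T\<^sub>i \<phi>\<close> does not change if \<open>\<phi>\<close> is multiplied by a cutoff function that is one near \<open>S\<close>, lives in the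
\<open>\<epsilon>\<close>-neighbourhood of \<open>S\<close>, and has gradient at most \<open>3/\<epsilon>\<close>. As \<open>\<epsilon>\<close> tends to zero, the integral against \<open>\<mu>\<close>
disappears, since the neighbourhoods intersected with \<open>E\<close> decrease to the empty set. What survives is at
most \<open>3 B / \<epsilon>\<close> times the integral of \<open>\<bar>\<phi>\<bar>\<close> over the neighbourhood, \<open>B\<close> being a bound of \<open>\<bar>F\<bar>\<close>. A Lipschitz
surface satisfies \<open>H\<^sup>2 (S \<inter> cball y \<rho>) \<ge> c \<rho>\<^sup>2\<close>, so by Vitali's covering lemma this integral is at most a
constant times \<open>\<epsilon> \<integral>\<^sub>S \<bar>\<phi>\<bar> dH\<^sup>2\<close> (\<open>neighbourhood_integral_le\<close>). Therefore \<open>T\<^sub>i\<close> is bounded by the \<open>L\<^sup>1\<close> norm on \<open>S\<close>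
(\<open>T_bound\<close>) and is represented by a bounded density (\<open>trace_density\<close>). The formula for vector fields is the
sum of the scalar formulas for the components.

For tangentiality, let \<open>u\<close> be a Lipschitz function that locally defines \<open>S\<close> as its zero set. On gradients the
field drops out: \<open>\<Sum>\<^sub>i (F \<times> \<nabla>\<partial>\<^sub>iw)\<^sub>i\<close> is the inner product of \<open>F\<close> with the curl of \<open>\<nabla>w\<close>. So \<open>\<Sum>\<^sub>i T\<^sub>i (\<partial>\<^sub>iw)\<close> is, after the
cutoff, an integral against \<open>\<mu>\<close> over the part of \<open>E\<close> within distance \<open>\<epsilon>\<close> of \<open>S\<close>, with an integrand that stays
bounded if \<open>w\<close> is of order \<open>\<epsilon>\<close> there. Taking \<open>w = \<psi> u\<^sub>\<epsilon>\<close> with \<open>u\<^sub>\<epsilon>\<close> the mollification of \<open>u\<close> at scale \<open>\<epsilon>\<close> gives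
\<open>\<integral>\<^sub>S \<psi> g \<bullet> \<nabla>u dH\<^sup>2 = 0\<close> for the vector density \<open>g\<close>, so \<open>g\<close> is orthogonal to \<open>\<nabla>u\<close> almost everywhere
(\<open>trace_orthogonal_gradient\<close>). By Rademacher's theorem for the function whose graph is \<open>S\<close>, \<open>u\<close> is
differentiable at almost every point of \<open>S\<close>, and there the tangent cone of \<open>S\<close> is the plane orthogonal to \<open>\<nabla>u\<close>
(\<open>tangent_cone_level_set\<close>).

The measure theory behind this consists of the Hausdorff measure on Borel sets, which is additive by
Caratheodory's criterion, the finiteness of the Jordan parts of \<open>\<mu>\<close>, and a proof of Rademacher's theorem by
mollification at the Lebesgue points of the weak derivatives.
\<close>

section \<open>Hausdorff measure on Borel sets\<close>

definition hcost :: "nat \<Rightarrow> 'a::metric_space set \<Rightarrow> ennreal" where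
  "hcost k U = (if U = {} then 0 else ennreal (unit_ball_vol (real k) * (diameter U / 2) ^ k))"

definition hcovers :: "real \<Rightarrow> 'a::metric_space set \<Rightarrow> (nat \<Rightarrow> 'a set) set" where
  "hcovers \<delta> A = {U. A \<subseteq> (\<Union>i. U i) \<and> (\<forall>i. bounded (U i) \<and> diameter (U i) \<le> \<delta>)}"

lemma hausdorff_pre_alt: "hausdorff_pre k \<delta> A = (INF U \<in> hcovers \<delta> A. \<Sum>i. hcost k (U i))"
  by (simp add: hausdorff_pre_def hcovers_def hcost_def)

lemma hcost_mono:
  assumes "U \<subseteq> V" "bounded V"
  shows "hcost k U \<le> hcost k V"
proof (cases "U = {}")
  case False
  have "bounded U" using assms bounded_subset by blast
  then have "0 \<le> diameter U" "diameter U \<le> diameter V"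
    using assms by (auto intro: diameter_ge_0 diameter_subset)
  then have "unit_ball_vol (real k) * (diameter U / 2) ^ k \<le> unit_ball_vol (real k) * (diameter V / 2) ^ k"
    by (intro mult_left_mono power_mono divide_right_mono) auto
  then show ?thesis using False assms(1) by (auto simp: hcost_def intro: ennreal_leI)
qed (simp add: hcost_def)

lemma hcost_empty [simp]: "hcost k {} = 0"
  by (simp add: hcost_def)

lemma hausdorff_pre_le: "U \<in> hcovers \<delta> A \<Longrightarrow> hausdorff_pre k \<delta> A \<le> (\<Sum>i. hcost k (U i))"
  unfolding hausdorff_pre_alt by (rule INF_lower)

lemma hausdorff_pre_antimono: "\<delta> \<le> \<delta>' \<Longrightarrow> hausdorff_pre k \<delta>' A \<le> hausdorff_pre k \<delta> A"
  unfolding hausdorff_pre_alt by (rule INF_superset_mono) (auto simp: hcovers_def intro: order_trans)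

lemma hausdorff_pre_mono: "A \<subseteq> B \<Longrightarrow> hausdorff_pre k \<delta> A \<le> hausdorff_pre k \<delta> B"
  unfolding hausdorff_pre_alt by (rule INF_superset_mono) (auto simp: hcovers_def)

lemma hausdorff_pre_le_outer: "\<delta> > 0 \<Longrightarrow> hausdorff_pre k \<delta> A \<le> hausdorff_outer k A"
  unfolding hausdorff_outer_def by (rule SUP_upper) auto

lemma hausdorff_outer_mono: "A \<subseteq> B \<Longrightarrow> hausdorff_outer k A \<le> hausdorff_outer k B"
  unfolding hausdorff_outer_def by (rule SUP_mono) (use hausdorff_pre_mono in blast)

lemma hausdorff_outer_empty: "hausdorff_outer k {} = 0"
proof -
  have "hausdorff_pre k \<delta> ({}::'a set) = 0" if "\<delta> > 0" for \<delta>
  proof -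
    have "(\<lambda>_. {}) \<in> hcovers \<delta> ({}::'a set)"
      using that by (auto simp: hcovers_def)
    from hausdorff_pre_le[OF this, of k] show ?thesis by simp
  qed
  then show ?thesis by (simp add: hausdorff_outer_def)
qed

lemma hausdorff_pre_countably_subadditive:
  "hausdorff_pre k \<delta> (\<Union>n. A n) \<le> (\<Sum>n. hausdorff_pre k \<delta> (A n))"
proof (rule ennreal_le_epsilon)
  fix e :: real
  assume fin: "(\<Sum>n. hausdorff_pre k \<delta> (A n)) < top" and e: "0 < e"
  have "\<exists>U \<in> hcovers \<delta> (A n). (\<Sum>i. hcost k (U i)) \<le> hausdorff_pre k \<delta> (A n) + ennreal (e * (1/2) ^ Suc n)" for n
  proof -
    have "hausdorff_pre k \<delta> (A n) < top"
      using fin by (meson ennreal_suminf_lessD)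
    then have "hausdorff_pre k \<delta> (A n) < hausdorff_pre k \<delta> (A n) + ennreal (e * (1/2) ^ Suc n)"
      using e by (simp add: ennreal_zero_less_mult_iff)
    then show ?thesis
      unfolding hausdorff_pre_alt[of k \<delta> "A n"] INF_less_iff by (auto intro: less_imp_le)
  qed
  then obtain U where U: "\<And>n. U n \<in> hcovers \<delta> (A n)"
    and le: "\<And>n. (\<Sum>i. hcost k (U n i)) \<le> hausdorff_pre k \<delta> (A n) + ennreal (e * (1/2) ^ Suc n)"
    by metis
  define V where "V j = case_prod U (prod_decode j)" for j
  have "x \<in> (\<Union>j. V j)" if xA: "x \<in> A n" for x n
  proof -
    obtain i where "x \<in> U n i" using U[of n] xA unfolding hcovers_def by auto
    then have "x \<in> V (prod_encode (n, i))" by (simp add: V_def)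
    then show ?thesis by blast
  qed
  moreover have "bounded (V j) \<and> diameter (V j) \<le> \<delta>" for j
    using U[of "fst (prod_decode j)"] by (auto simp: V_def hcovers_def case_prod_beta)
  ultimately have "V \<in> hcovers \<delta> (\<Union>n. A n)"
    unfolding hcovers_def by blast
  then have "hausdorff_pre k \<delta> (\<Union>n. A n) \<le> (\<Sum>j. hcost k (V j))"
    by (rule hausdorff_pre_le)
  also have "\<dots> = (\<Sum>j. (\<lambda>(n,i). hcost k (U n i)) (prod_decode j))"
    by (simp add: V_def case_prod_beta)
  also have "\<dots> = (\<Sum>n. \<Sum>i. hcost k (U n i))"
    by (rule suminf_ennreal_2dimen) simp
  also have "\<dots> \<le> (\<Sum>n. hausdorff_pre k \<delta> (A n) + ennreal (e * (1/2) ^ Suc n))"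
    by (rule suminf_le) (use le in auto)
  also have "\<dots> = (\<Sum>n. hausdorff_pre k \<delta> (A n)) + (\<Sum>n. ennreal (e * (1/2) ^ Suc n))"
    by (simp add: suminf_add)
  also have "(\<Sum>n. ennreal (e * (1/2) ^ Suc n)) = ennreal e"
  proof (rule suminf_ennreal_eq)
    show "(\<lambda>n. e * (1/2) ^ Suc n) sums e"
      using sums_mult[OF power_half_series, of e] by simp
  qed (use e in auto)
  finally show "hausdorff_pre k \<delta> (\<Union>n. A n) \<le> (\<Sum>n. hausdorff_pre k \<delta> (A n)) + ennreal e" .
qed

lemma hausdorff_outer_countably_subadditive:
  "hausdorff_outer k (\<Union>n. A n) \<le> (\<Sum>n. hausdorff_outer k (A n))"
  unfolding hausdorff_outer_def[of k "\<Union>n. A n"]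
proof (rule SUP_least)
  fix \<delta> :: real assume "\<delta> \<in> {0<..}"
  then show "hausdorff_pre k \<delta> (\<Union>n. A n) \<le> (\<Sum>n. hausdorff_outer k (A n))"
    by (intro order_trans[OF hausdorff_pre_countably_subadditive] suminf_le
        hausdorff_pre_le_outer) auto
qed

lemma outer_measure_space_hausdorff: "outer_measure_space (Pow UNIV) (hausdorff_outer k)"
  unfolding outer_measure_space_def positive_def increasing_def countably_subadditive_def
  by (auto simp: hausdorff_outer_empty hausdorff_outer_mono
      intro: hausdorff_outer_countably_subadditive)

lemma hausdorff_outer_Un: "hausdorff_outer k (A \<union> B) \<le> hausdorff_outer k A + hausdorff_outer k B"
proof -
  have "hausdorff_outer k (A \<union> B) = hausdorff_outer k (\<Union>n. binaryset A B n)"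
    by (simp add: UN_binaryset_eq)
  also have "\<dots> \<le> (\<Sum>n. hausdorff_outer k (binaryset A B n))"
    by (rule hausdorff_outer_countably_subadditive)
  also have "\<dots> = hausdorff_outer k A + hausdorff_outer k B"
    by (rule suminf_binaryset_eq) (simp add: hausdorff_outer_empty)
  finally show ?thesis .
qed

text \<open>Once the covering sets are smaller than the gap between the two sets, none of them meets both,
  so that a cover of the union splits into two covers without extra cost.\<close>

lemma hausdorff_outer_separated:
  assumes d: "d > 0" and sep: "\<And>x y. x \<in> A \<Longrightarrow> y \<in> B \<Longrightarrow> d \<le> dist x y"
  shows "hausdorff_outer k A + hausdorff_outer k B \<le> hausdorff_outer k (A \<union> B)"
proof -
  have pre: "hausdorff_pre k \<delta> A + hausdorff_pre k \<delta> B \<le> hausdorff_pre k \<delta> (A \<union> B)"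
    if \<delta>: "0 < \<delta>" "\<delta> < d" for \<delta>
    unfolding hausdorff_pre_alt[of k \<delta> "A \<union> B"]
  proof (rule INF_greatest)
    fix U assume U: "U \<in> hcovers \<delta> (A \<union> B)"
    have bd: "bounded (U i)" "diameter (U i) \<le> \<delta>" for i
      using U by (auto simp: hcovers_def)
    have cov: "(\<lambda>i. U i \<inter> C) \<in> hcovers \<delta> C" if "C \<subseteq> A \<union> B" for C
    proof -
      have "bounded (U i \<inter> C) \<and> diameter (U i \<inter> C) \<le> \<delta>" for i
        using bounded_subset[OF bd(1)[of i], of "U i \<inter> C"] diameter_subset[OF _ bd(1)[of i], of "U i \<inter> C"] bd(2)[of i]
        by auto
      moreover have "C \<subseteq> (\<Union>i. U i \<inter> C)" using that U by (auto simp: hcovers_def)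
      ultimately show ?thesis by (simp add: hcovers_def)
    qed
    have one: "U i \<inter> A = {} \<or> U i \<inter> B = {}" for i
    proof (rule ccontr)
      assume "\<not> ?thesis"
      then obtain x y where "x \<in> U i" "x \<in> A" "y \<in> U i" "y \<in> B" by blast
      then show False
        using sep[of x y] diameter_bounded_bound[OF bd(1), of x i y] bd(2)[of i] \<delta> by linarith
    qed
    have "hausdorff_pre k \<delta> A + hausdorff_pre k \<delta> B
        \<le> (\<Sum>i. hcost k (U i \<inter> A)) + (\<Sum>i. hcost k (U i \<inter> B))"
      by (intro add_mono hausdorff_pre_le cov) auto
    also have "\<dots> = (\<Sum>i. hcost k (U i \<inter> A) + hcost k (U i \<inter> B))"
      by (simp add: suminf_add)
    also have "\<dots> \<le> (\<Sum>i. hcost k (U i))"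
    proof (rule suminf_le)
      fix i show "hcost k (U i \<inter> A) + hcost k (U i \<inter> B) \<le> hcost k (U i)"
        using one[of i] hcost_mono[OF Int_lower1 bd(1), of k i A] hcost_mono[OF Int_lower1 bd(1), of k i B]
        by (elim disjE) simp_all
    qed auto
    finally show "hausdorff_pre k \<delta> A + hausdorff_pre k \<delta> B \<le> (\<Sum>i. hcost k (U i))" .
  qed
  have "hausdorff_outer k A + hausdorff_outer k B =
      (SUP \<delta>1\<in>{0<..}. SUP \<delta>2\<in>{0<..}. hausdorff_pre k \<delta>1 A + hausdorff_pre k \<delta>2 B)"
  proof -
    have "hausdorff_outer k A + hausdorff_outer k B =
        (SUP \<delta>1\<in>{0<..}. hausdorff_pre k \<delta>1 A + hausdorff_outer k B)"
      unfolding hausdorff_outer_def[of k A] by (rule ennreal_SUP_add_left[symmetric]) simp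
    also have "\<dots> = (SUP \<delta>1\<in>{0<..}. SUP \<delta>2\<in>{0<..}. hausdorff_pre k \<delta>1 A + hausdorff_pre k \<delta>2 B)"
      unfolding hausdorff_outer_def[of k B] by (intro SUP_cong refl ennreal_SUP_add_right) simp
    finally show ?thesis .
  qed
  also have "\<dots> \<le> hausdorff_outer k (A \<union> B)"
  proof (intro SUP_least)
    fix \<delta>1 \<delta>2 :: real assume \<delta>: "\<delta>1 \<in> {0<..}" "\<delta>2 \<in> {0<..}"
    define \<delta> where "\<delta> = min (min \<delta>1 \<delta>2) (d / 2)"
    have *: "0 < \<delta>" "\<delta> < d" "\<delta> \<le> \<delta>1" "\<delta> \<le> \<delta>2" using \<delta> d by (auto simp: \<delta>_def)
    have "hausdorff_pre k \<delta>1 A + hausdorff_pre k \<delta>2 B \<le> hausdorff_pre k \<delta> A + hausdorff_pre k \<delta> B"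
      by (intro add_mono hausdorff_pre_antimono *)
    also have "\<dots> \<le> hausdorff_outer k (A \<union> B)"
      using pre[of \<delta>] hausdorff_pre_le_outer[of \<delta> k "A \<union> B"] * by (meson order_trans)
    finally show "hausdorff_pre k \<delta>1 A + hausdorff_pre k \<delta>2 B \<le> hausdorff_outer k (A \<union> B)" .
  qed
  finally show ?thesis .
qed

lemma hausdorff_outer_separated_sum:
  fixes R :: "nat \<Rightarrow> 'a::metric_space set" and n :: nat
  assumes "\<And>i j. i < j \<Longrightarrow> j < n \<Longrightarrow> \<exists>d>0. \<forall>x\<in>R i. \<forall>y\<in>R j. d \<le> dist x y"
  shows "(\<Sum>i<n. hausdorff_outer k (R i)) \<le> hausdorff_outer k (\<Union>i<n. R i)"
  using assms
proof (induction n)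
  case (Suc n)
  have "\<exists>e>0. \<forall>x\<in>R i. \<forall>y\<in>R n. e \<le> dist x y" if "i < n" for i
    using Suc.prems[of i n] that by simp
  then obtain d where d: "\<And>i. i < n \<Longrightarrow> d i > 0 \<and> (\<forall>x\<in>R i. \<forall>y\<in>R n. d i \<le> dist x y)"
    by metis
  define e where "e = Min (insert 1 (d ` {..<n}))"
  have "e > 0" using d by (auto simp: e_def)
  moreover have "e \<le> dist x y" if "x \<in> (\<Union>i<n. R i)" "y \<in> R n" for x y
  proof -
    obtain i where i: "i < n" "x \<in> R i" using \<open>x \<in> _\<close> by blast
    have "e \<le> d i" using i by (auto simp: e_def)
    then show ?thesis using d i that by (meson order_trans)
  qed
  ultimately have "hausdorff_outer k (\<Union>i<n. R i) + hausdorff_outer k (R n)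
      \<le> hausdorff_outer k ((\<Union>i<n. R i) \<union> R n)"
    by (rule hausdorff_outer_separated)
  moreover have "(\<Sum>i<n. hausdorff_outer k (R i)) \<le> hausdorff_outer k (\<Union>i<n. R i)"
    using Suc by (metis less_SucI)
  moreover have "(\<Union>i<Suc n. R i) = (\<Union>i<n. R i) \<union> R n"
    by (auto simp: less_Suc_eq)
  ultimately show ?case
    by (metis (no_types, lifting) add_right_mono order_trans sum.lessThan_Suc)
qed simp

text \<open>Caratheodory's criterion for a closed set \<open>C\<close>: the shells of \<open>T\<close> around \<open>C\<close> with non-adjacent
  indices have positive distance, so the sum of all their outer measures is finite and its tails
  control the part of \<open>T - C\<close> that is not yet separated from \<open>C\<close>.\<close>

lemma hausdorff_outer_closed_split:
  fixes C T :: "'a::metric_space set"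
  assumes C: "closed C"
  shows "hausdorff_outer k (T \<inter> C) + hausdorff_outer k (T - C) \<le> hausdorff_outer k T"
proof (cases "C = {} \<or> hausdorff_outer k T = top")
  case True
  then show ?thesis by (auto simp: hausdorff_outer_empty)
next
  case False
  then have ne: "C \<noteq> {}" and fin: "hausdorff_outer k T < top" by (auto simp: top.not_eq_extremum)
  define D where "D n = {x \<in> T. 1 / real (Suc n) \<le> infdist x C}" for n
  define R where "R n = D (Suc n) - D n" for n
  have D_mono: "D m \<subseteq> D n" if "m \<le> n" for m n
  proof -
    have "1 / real (Suc n) \<le> 1 / real (Suc m)" using that by (simp add: frac_le)
    then show ?thesis by (auto simp del: of_nat_Suc simp: D_def)
  qed
  have inf_le: "infdist x C \<le> infdist y C + dist x y" for x y
    by (rule infdist_triangle)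
  have gap: "\<exists>d>0. \<forall>x\<in>R i. \<forall>y\<in>R j. d \<le> dist x y" if "Suc i < j" for i j
  proof (intro exI[of _ "1 / real (Suc (Suc i)) - 1 / real (Suc j)"] conjI ballI)
    show "1 / real (Suc (Suc i)) - 1 / real (Suc j) > 0" using that by (simp add: frac_less2)
    fix x y assume "x \<in> R i" "y \<in> R j"
    then have "1 / real (Suc (Suc i)) \<le> infdist x C" "infdist y C < 1 / real (Suc j)"
      by (auto simp: R_def D_def)
    then show "1 / real (Suc (Suc i)) - 1 / real (Suc j) \<le> dist x y"
      using inf_le[of x y] by linarith
  qed
  have half: "(\<Sum>i<n. hausdorff_outer k (R (2 * i + c))) \<le> hausdorff_outer k T" for n c
    by (intro order_trans[OF hausdorff_outer_separated_sum hausdorff_outer_mono] gap)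
      (auto simp: R_def D_def)
  have sum_le: "(\<Sum>i<n. hausdorff_outer k (R i)) \<le> 2 * hausdorff_outer k T" for n
  proof -
    have "(\<Sum>i<n. hausdorff_outer k (R i)) \<le> (\<Sum>i<2*n. hausdorff_outer k (R i))"
      by (rule sum_mono2) auto
    also have "\<dots> = (\<Sum>i<n. hausdorff_outer k (R (2 * i + 0))) + (\<Sum>i<n. hausdorff_outer k (R (2 * i + 1)))"
      by (induction n) (auto simp: algebra_simps)
    also have "\<dots> \<le> 2 * hausdorff_outer k T"
      using add_mono[OF half[where n=n and c=0] half[where n=n and c=1]] by (simp only: mult_2[of "hausdorff_outer k T"])
    finally show ?thesis .
  qed
  have "(\<Sum>i. hausdorff_outer k (R i)) \<le> 2 * hausdorff_outer k T"
    by (intro suminf_le_const sum_le) auto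
  then have finR: "(\<Sum>i. hausdorff_outer k (R i)) \<noteq> top"
    using fin by (auto simp: ennreal_mult_less_top top.not_eq_extremum intro: le_less_trans)
  have shells: "T - C \<subseteq> D n \<union> (\<Union>i. R (i + n))" for n
  proof
    fix x assume x: "x \<in> T - C"
    then have "0 < infdist x C"
      using infdist_pos_not_in_closed[OF C ne] by simp
    then obtain m where "1 / real (Suc m) < infdist x C"
      by (rule nat_approx_posE)
    then have ex: "\<exists>m. x \<in> D m" using x by (auto simp: D_def intro: less_imp_le)
    define m where "m = (LEAST m. x \<in> D m)"
    have m: "x \<in> D m" using ex unfolding m_def by (rule LeastI_ex)
    show "x \<in> D n \<union> (\<Union>i. R (i + n))"
    proof (cases "m \<le> n")
      case True then show ?thesis using D_mono m by blast
    next
      case False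
      then obtain l where l: "m = Suc l" "n \<le> l" by (cases m) auto
      then have "x \<notin> D l" using not_less_Least[of l "\<lambda>m. x \<in> D m"] by (simp add: m_def)
      then have "x \<in> R l" using m l by (simp add: R_def)
      then have "x \<in> R (l - n + n)" using l by simp
      then show ?thesis by blast
    qed
  qed
  have step: "hausdorff_outer k (T \<inter> C) + hausdorff_outer k (T - C)
      \<le> hausdorff_outer k T + (\<Sum>i. hausdorff_outer k (R (i + n)))" for n
  proof -
    have "hausdorff_outer k (T - C) \<le> hausdorff_outer k (D n \<union> (\<Union>i. R (i + n)))"
      by (rule hausdorff_outer_mono[OF shells])
    also have "\<dots> \<le> hausdorff_outer k (D n) + (\<Sum>i. hausdorff_outer k (R (i + n)))"
      by (intro order_trans[OF hausdorff_outer_Un] add_left_mono hausdorff_outer_countably_subadditive)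
    finally have "hausdorff_outer k (T \<inter> C) + hausdorff_outer k (T - C)
        \<le> (hausdorff_outer k (T \<inter> C) + hausdorff_outer k (D n)) + (\<Sum>i. hausdorff_outer k (R (i + n)))"
      by (simp add: add.assoc add_left_mono)
    also have "hausdorff_outer k (T \<inter> C) + hausdorff_outer k (D n) \<le> hausdorff_outer k ((T \<inter> C) \<union> D n)"
    proof (rule hausdorff_outer_separated)
      show "1 / real (Suc n) > 0" by simp
      fix x y assume "x \<in> T \<inter> C" "y \<in> D n"
      then show "1 / real (Suc n) \<le> dist x y"
        using infdist_le[of x C y] by (auto simp: D_def dist_commute)
    qed
    also have "\<dots> \<le> hausdorff_outer k T"
      by (rule hausdorff_outer_mono) (auto simp: D_def)
    finally show ?thesis by (simp add: add_right_mono)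
  qed
  have "(\<lambda>n. \<Sum>i. hausdorff_outer k (R (i + n))) \<longlonglongrightarrow> 0"
  proof -
    define r where "r i = enn2real (hausdorff_outer k (R i))" for i
    have ne_top: "hausdorff_outer k (R i) \<noteq> top" for i
      using ennreal_suminf_lessD[of "\<lambda>i. hausdorff_outer k (R i)" top i] finR by (auto simp: less_top)
    have r: "hausdorff_outer k (R i) = ennreal (r i)" for i
      using ne_top[of i] by (simp add: r_def top.not_eq_extremum)
    have r0: "r i \<ge> 0" for i by (simp add: r_def)
    have s: "summable r" using finR r0 unfolding r by (intro summable_suminf_not_top)
    have "(\<Sum>i. hausdorff_outer k (R (i + n))) = ennreal (\<Sum>i. r (i + n))" for n
      unfolding r by (rule suminf_ennreal2) (use r0 s summable_iff_shift[of r n] in auto)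
    moreover have "(\<lambda>n. ennreal (\<Sum>i. r (i + n))) \<longlonglongrightarrow> ennreal 0"
      by (intro tendsto_ennrealI suminf_exist_split2 s)
    ultimately show ?thesis by simp
  qed
  then have "(\<lambda>n. hausdorff_outer k T + (\<Sum>i. hausdorff_outer k (R (i + n)))) \<longlonglongrightarrow> hausdorff_outer k T + 0"
    by (intro tendsto_add) auto
  then show ?thesis
    by (intro LIMSEQ_le_const[of _ "hausdorff_outer k T"]) (use step in auto)
qed

lemma measure_space_hausdorff: "measure_space UNIV (sets borel) (hausdorff_outer k :: 'a::metric_space set \<Rightarrow> ennreal)"
proof -
  define L where "L = lambda_system UNIV (Pow UNIV) (hausdorff_outer k :: 'a set \<Rightarrow> ennreal)"
  interpret P: sigma_algebra UNIV "Pow UNIV :: 'a set set" by (rule sigma_algebra_Pow)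
  have ms: "measure_space UNIV L (hausdorff_outer k)"
    unfolding L_def by (rule P.caratheodory_lemma[OF outer_measure_space_hausdorff])
  then interpret L: sigma_algebra UNIV L by (simp add: measure_space_def)
  have closed_L: "C \<in> L" if "closed C" for C
    unfolding L_def P.lambda_system_eq
  proof (clarsimp, rule antisym)
    fix T
    show "hausdorff_outer k (T \<inter> C) + hausdorff_outer k (T - C) \<le> hausdorff_outer k T"
      by (rule hausdorff_outer_closed_split[OF that])
    show "hausdorff_outer k T \<le> hausdorff_outer k (T \<inter> C) + hausdorff_outer k (T - C)"
      using hausdorff_outer_Un[of k "T \<inter> C" "T - C"] by (simp add: Int_Diff_Un)
  qed
  have sub: "sets borel \<subseteq> L"
    unfolding borel_eq_closed using L.sigma_sets_subset[of "Collect closed"] closed_L by auto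
  show ?thesis
    unfolding measure_space_def
  proof (intro conjI)
    show "sigma_algebra UNIV (sets (borel :: 'a measure))"
      using sets.sigma_algebra_axioms[of "borel :: 'a measure"] by simp
    show "positive (sets borel) (hausdorff_outer k :: 'a set \<Rightarrow> ennreal)"
      by (simp add: positive_def hausdorff_outer_empty)
    show "countably_additive (sets borel) (hausdorff_outer k :: 'a set \<Rightarrow> ennreal)"
      using ms sub unfolding measure_space_def countably_additive_def by (meson subset_trans subsetD)
  qed
qed

lemma sets_hausdorff_measure [measurable_cong, simp]:
  "sets (hausdorff_measure k) = sets (borel :: 'a::metric_space measure)"
  using sets.space_closed[of "borel :: 'a measure"] sets.sigma_sets_eq[of "borel :: 'a measure"]
  by (simp add: hausdorff_measure_def)

lemma space_hausdorff_measure [simp]: "space (hausdorff_measure k) = UNIV"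
  by (simp add: hausdorff_measure_def space_measure_of_conv)

lemma emeasure_hausdorff_measure:
  "A \<in> sets borel \<Longrightarrow> emeasure (hausdorff_measure k) A = hausdorff_outer k A"
  unfolding hausdorff_measure_def
  by (rule emeasure_measure_of_sigma)
    (use measure_space_hausdorff[of k, where 'a='a] in \<open>auto simp: measure_space_def\<close>)

subsection \<open>Lipschitz images and projections\<close>

text \<open>Small cubes have diameter comparable to their side length, so that covering an open set by
  almost disjoint small cubes and taking images bounds the Hausdorff measure by the volume.\<close>

lemma hausdorff_outer_lipschitz_image_open:
  fixes f :: "'a::euclidean_space \<Rightarrow> 'b::metric_space"
  assumes f: "M-lipschitz_on UNIV f" and E: "E \<subseteq> U" and U: "open U" and bd: "bounded E"
  shows "hausdorff_outer DIM('a) (f ` E)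
    \<le> ennreal (unit_ball_vol DIM('a) * (M * DIM('a) / 2) ^ DIM('a)) * emeasure lborel U"
  unfolding hausdorff_outer_def
proof (rule SUP_least)
  fix \<delta> :: real assume "\<delta> \<in> {0<..}"
  then have \<delta>: "\<delta> > 0" by simp
  have M: "M \<ge> 0" using f by (rule lipschitz_on_nonneg)
  define d where "d = \<delta> / (2 * (M + 1))"
  have d: "d > 0" using \<delta> M by (simp add: d_def)
  obtain c where c: "c > 0" and Ec: "E \<subseteq> cbox (- (c *\<^sub>R One)) (c *\<^sub>R One)"
  proof -
    obtain B where B: "B > 0" "\<forall>x\<in>E. norm x \<le> B" using bd bounded_pos by blast
    have "E \<subseteq> cbox (- (B *\<^sub>R One)) (B *\<^sub>R One)"
    proof
      fix x assume "x \<in> E"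
      then have "\<bar>x \<bullet> b\<bar> \<le> B" if "b \<in> Basis" for b
        using B Basis_le_norm[OF that, of x] by (meson order_trans)
      then show "x \<in> cbox (- (B *\<^sub>R One)) (B *\<^sub>R One)"
        by (auto simp: mem_box abs_le_iff minus_le_iff)
    qed
    then show ?thesis using B that by blast
  qed
  \<comment> \<open>The gauge keeps the cubes inside \<open>U\<close> and makes their images smaller than \<open>\<delta>\<close>.\<close>
  define g where "g x = (if x \<in> U then U \<inter> ball x d else ball x d)" for x
  have g: "gauge g" using U d by (auto simp: gauge_def g_def)
  have ne: "box (- (c *\<^sub>R One)) (c *\<^sub>R One :: 'a) \<noteq> {}"
    using c by (auto simp: box_ne_empty)
  obtain \<D> where \<D>: "countable \<D>" "\<And>K. K \<in> \<D> \<Longrightarrow> interior K \<noteq> {} \<and> (\<exists>c d. K = cbox c d)"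
    "pairwise (\<lambda>A B. interior A \<inter> interior B = {}) \<D>"
    "\<And>K. K \<in> \<D> \<Longrightarrow> \<exists>x \<in> E \<inter> K. K \<subseteq> g x"
    "\<And>u v. cbox u v \<in> \<D> \<Longrightarrow> \<exists>n. \<forall>i \<in> Basis. v \<bullet> i - u \<bullet> i = (c *\<^sub>R One \<bullet> i - (- (c *\<^sub>R One)) \<bullet> i) / 2^n"
    "E \<subseteq> \<Union>\<D>"
    using covering_lemma[OF Ec ne g] by metis
  have DU: "K \<subseteq> U" if "K \<in> \<D>" for K
    using \<D>(4)[OF that] E by (fastforce simp: g_def)
  have cost: "bounded (f ` K) \<and> diameter (f ` K) \<le> \<delta> \<and>
      hcost DIM('a) (f ` K) \<le> ennreal (unit_ball_vol DIM('a) * (M * DIM('a) / 2) ^ DIM('a)) * emeasure lborel (interior K)"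
    if K: "K \<in> \<D>" for K
  proof -
    obtain u v where uv: "K = cbox u v" using \<D>(2)[OF K] by blast
    obtain n where n: "\<And>i. i \<in> Basis \<Longrightarrow> v \<bullet> i - u \<bullet> i = 2 * c / 2^n"
      using \<D>(5)[of u v] K uv by auto
    define s where "s = 2 * c / 2 ^ n"
    have s: "s > 0" using c by (simp add: s_def)
    have vol: "emeasure lborel (interior K) = ennreal (s ^ DIM('a))"
    proof -
      have "emeasure lborel (box u v) = ennreal (\<Prod>b\<in>Basis. (v - u) \<bullet> b)"
      proof (rule emeasure_lborel_box)
        fix i :: 'a assume "i \<in> Basis"
        then show "u \<bullet> i \<le> v \<bullet> i" using n[of i] s by (simp add: s_def)
      qed
      also have "(\<Prod>b\<in>Basis. (v - u) \<bullet> b) = (\<Prod>b\<in>(Basis::'a set). s)"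
        by (rule prod.cong) (use n in \<open>auto simp: inner_diff_left s_def\<close>)
      finally show ?thesis by (simp add: uv interior_cbox)
    qed
    obtain x where x: "x \<in> E" "x \<in> K" "K \<subseteq> g x" using \<D>(4)[OF K] by blast
    have Kb: "K \<subseteq> ball x d" using x(3) by (auto simp: g_def split: if_splits)
    have dd: "dist (f y) (f z) \<le> \<delta>" if "y \<in> K" "z \<in> K" for y z
    proof -
      have "dist x y < d" "dist x z < d" using that Kb by auto
      then have "dist y z < 2 * d" using dist_triangle3[of y z x] by linarith
      then have "M * dist y z \<le> M * (2 * d)" using M by (intro mult_left_mono) auto
      also have "\<dots> \<le> \<delta>" using \<delta> M by (simp add: d_def field_simps)
      finally show ?thesis using lipschitz_onD[OF f, of y z] by simp
    qed
    have ds: "dist (f y) (f z) \<le> M * (DIM('a) * s)" if "y \<in> K" "z \<in> K" for y z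
    proof -
      have "dist y z \<le> (\<Sum>i\<in>Basis. \<bar>(y - z) \<bullet> i\<bar>)"
        unfolding dist_norm by (rule norm_le_l1)
      also have "\<dots> \<le> (\<Sum>i\<in>(Basis::'a set). s)"
      proof (rule sum_mono)
        fix i :: 'a assume i: "i \<in> Basis"
        show "\<bar>(y - z) \<bullet> i\<bar> \<le> s"
        proof -
          have "u \<bullet> i \<le> y \<bullet> i" "y \<bullet> i \<le> v \<bullet> i" "u \<bullet> i \<le> z \<bullet> i" "z \<bullet> i \<le> v \<bullet> i"
            using that i by (auto simp: uv mem_box)
          then show ?thesis using n[OF i] unfolding s_def[symmetric] inner_diff_left by linarith
        qed
      qed
      finally have "dist y z \<le> DIM('a) * s" by simp
      then show ?thesis
        using lipschitz_onD[OF f, of y z] M by (smt (verit) UNIV_I mult_left_mono)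
    qed
    have ne': "f ` K \<noteq> {}" using x by auto
    have bdK: "bounded (f ` K)"
      using dd x unfolding bounded_def by (intro exI[of _ "f x"] exI[of _ \<delta>]) auto
    have diam: "diameter (f ` K) \<le> \<delta>" "diameter (f ` K) \<le> M * (DIM('a) * s)"
      unfolding diameter_def using dd ds ne' by (auto intro!: cSUP_least)
    have "hcost DIM('a) (f ` K) \<le> ennreal (unit_ball_vol DIM('a) * (M * (DIM('a) * s) / 2) ^ DIM('a))"
      unfolding hcost_def using ne' diam diameter_ge_0[OF bdK]
      by (auto intro!: ennreal_leI mult_left_mono power_mono divide_right_mono)
    also have "\<dots> = ennreal (unit_ball_vol DIM('a) * (M * DIM('a) / 2) ^ DIM('a)) * emeasure lborel (interior K)"
      using s M by (simp add: vol ennreal_mult[symmetric] power_mult_distrib power_divide algebra_simps)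
    finally show ?thesis using bdK diam by blast
  qed
  show "hausdorff_pre DIM('a) \<delta> (f ` E)
      \<le> ennreal (unit_ball_vol DIM('a) * (M * DIM('a) / 2) ^ DIM('a)) * emeasure lborel U"
  proof (cases "\<D> = {}")
    case True
    then have "E = {}" using \<D>(6) by auto
    then show ?thesis
      using hausdorff_pre_le_outer[OF \<delta>, of "DIM('a)" "{}::'b set"] by (simp add: hausdorff_outer_empty)
  next
    case False
    define N where "N = {i. i \<in> to_nat_on \<D> ` \<D>}"
    define K where "K i = (if i \<in> N then from_nat_into \<D> i else {})" for i
    have KD: "K i \<in> \<D> \<or> K i = {}" for i
      using from_nat_into[OF False] by (auto simp: K_def)
    have inj: "K i \<noteq> K j" if "i \<noteq> j" "i \<in> N" "j \<in> N" for i j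
      using that \<D>(1) by (auto simp: K_def N_def)
    have cov: "(\<Union>i. K i) = \<Union>\<D>"
    proof
      show "(\<Union>i. K i) \<subseteq> \<Union>\<D>" using KD by fastforce
      show "\<Union>\<D> \<subseteq> (\<Union>i. K i)"
      proof
        fix x assume "x \<in> \<Union>\<D>"
        then obtain A where A: "A \<in> \<D>" "x \<in> A" by blast
        then have "K (to_nat_on \<D> A) = A" using \<D>(1) by (simp add: K_def N_def)
        then show "x \<in> (\<Union>i. K i)" using A by blast
      qed
    qed
    have disj: "disjoint_family (\<lambda>i. interior (K i))"
      unfolding disjoint_family_on_def
    proof (intro ballI impI)
      fix i j :: nat assume "i \<noteq> j"
      show "interior (K i) \<inter> interior (K j) = {}"
      proof (cases "i \<in> N \<and> j \<in> N")
        case True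
        then have "K i \<noteq> K j" "K i \<in> \<D>" "K j \<in> \<D>"
          using inj \<open>i \<noteq> j\<close> from_nat_into[OF False] by (auto simp: K_def)
        then show ?thesis using \<D>(3) by (auto simp: pairwise_def)
      qed (auto simp: K_def)
    qed
    have "(\<lambda>i. f ` K i) \<in> hcovers \<delta> (f ` E)"
      unfolding hcovers_def
    proof (intro CollectI conjI allI)
      show "f ` E \<subseteq> (\<Union>i. f ` K i)" using \<D>(6) cov by blast
      show "bounded (f ` K i)" "diameter (f ` K i) \<le> \<delta>" for i
        using KD[of i] cost \<delta> by auto
    qed
    then have "hausdorff_pre DIM('a) \<delta> (f ` E) \<le> (\<Sum>i. hcost DIM('a) (f ` K i))"
      by (rule hausdorff_pre_le)
    also have "\<dots> \<le> (\<Sum>i. ennreal (unit_ball_vol DIM('a) * (M * DIM('a) / 2) ^ DIM('a)) * emeasure lborel (interior (K i)))"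
    proof (rule suminf_le)
      fix i show "hcost DIM('a) (f ` K i) \<le> ennreal (unit_ball_vol DIM('a) * (M * DIM('a) / 2) ^ DIM('a)) * emeasure lborel (interior (K i))"
        using KD[of i] cost[of "K i"] by auto
    qed auto
    also have "\<dots> = ennreal (unit_ball_vol DIM('a) * (M * DIM('a) / 2) ^ DIM('a)) * (\<Sum>i. emeasure lborel (interior (K i)))"
      by (rule ennreal_suminf_cmult)
    also have "(\<Sum>i. emeasure lborel (interior (K i))) = emeasure lborel (\<Union>i. interior (K i))"
      by (rule suminf_emeasure) (use disj in auto)
    also have "\<dots> \<le> emeasure lborel U"
      using KD DU interior_subset by (intro emeasure_mono) (fastforce intro: borel_open U)+
    finally show ?thesis by (simp add: mult_left_mono)
  qed
qed

lemma hausdorff_outer_lipschitz_image_finite: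
  fixes f :: "'a::euclidean_space \<Rightarrow> 'b::metric_space"
  assumes "M-lipschitz_on UNIV f" "bounded E"
  shows "hausdorff_outer DIM('a) (f ` E) < top"
proof -
  obtain x e where "E \<subseteq> cball x e" using assms(2) by (auto simp: bounded_def subset_eq)
  then have "E \<subseteq> ball x (e + 1)" by force
  then have "hausdorff_outer DIM('a) (f ` E)
    \<le> ennreal (unit_ball_vol DIM('a) * (M * DIM('a) / 2) ^ DIM('a)) * emeasure lborel (ball x (e + 1))"
    using hausdorff_outer_lipschitz_image_open assms open_ball by blast
  also have "\<dots> < top"
    using emeasure_bounded_finite[of "ball x (e+1)"] by (simp add: ennreal_mult_less_top)
  finally show ?thesis .
qed

text \<open>A null set has open neighbourhoods of arbitrarily small volume.\<close>

lemma hausdorff_outer_lipschitz_image_null: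
  fixes f :: "'a::euclidean_space \<Rightarrow> 'b::metric_space"
  assumes f: "M-lipschitz_on UNIV f" and E: "negligible E" "bounded E"
  shows "hausdorff_outer DIM('a) (f ` E) = 0"
proof -
  define c where "c = unit_ball_vol DIM('a) * (M * DIM('a) / 2) ^ DIM('a)"
  have c: "c \<ge> 0" using lipschitz_on_nonneg[OF f] by (simp add: c_def)
  have "hausdorff_outer DIM('a) (f ` E) \<le> 0 + ennreal e" if e: "e > 0" for e
  proof -
    have "E \<in> lmeasurable" "measure lebesgue E = 0"
      using E by (simp_all add: negligible_iff_measure)
    then obtain U where U: "open U" "E \<subseteq> U" "U - E \<in> lmeasurable" "emeasure lebesgue (U - E) < ennreal (e / (c + 1))"
      using sets_lebesgue_outer_open[of E "e / (c + 1)"] e c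
      by (metis add_nonneg_pos divide_pos_pos zero_less_one fmeasurableD)
    have "emeasure lborel U = emeasure lebesgue U" using U(1) by simp
    also have "\<dots> \<le> emeasure lebesgue (U - E) + emeasure lebesgue E"
    proof -
      have "U = (U - E) \<union> E" using U by auto
      then show ?thesis
        using emeasure_subadditive[of "U - E" lebesgue E] U(3) \<open>E \<in> lmeasurable\<close>
        by (metis fmeasurableD)
    qed
    also have "emeasure lebesgue E = 0"
      using E(1) by (simp add: negligible_iff_emeasure0 \<open>E \<in> lmeasurable\<close> fmeasurableD)
    finally have vol: "emeasure lborel U \<le> ennreal (e / (c + 1))" using U(4) by simp
    have "hausdorff_outer DIM('a) (f ` E) \<le> ennreal c * emeasure lborel U"
      unfolding c_def by (rule hausdorff_outer_lipschitz_image_open[OF f U(2,1) E(2)])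
    also have "\<dots> \<le> ennreal c * ennreal (e / (c + 1))" by (rule mult_left_mono[OF vol]) simp
    also have "\<dots> \<le> ennreal e"
      using c e by (simp add: ennreal_mult[symmetric] field_simps ennreal_leI)
    finally show ?thesis by simp
  qed
  then show ?thesis using ennreal_le_epsilon[of 0] by (metis le_zero_eq)
qed

text \<open>Each covering set projects into a ball whose radius is its diameter, so the volume of the
  projection is a lower bound, up to a constant factor.\<close>

lemma hausdorff_outer_projection_ge:
  fixes p :: "'b::metric_space \<Rightarrow> 'a::euclidean_space"
  assumes p: "1-lipschitz_on UNIV p" and sub: "cball c \<rho> \<subseteq> p ` A" and \<rho>: "\<rho> \<ge> 0"
  shows "ennreal (unit_ball_vol DIM('a) * (\<rho> / 2) ^ DIM('a)) \<le> hausdorff_outer DIM('a) A"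
proof -
  have "ennreal (unit_ball_vol DIM('a) * (\<rho> / 2) ^ DIM('a)) \<le> (\<Sum>i. hcost DIM('a) (U i))"
    if U: "U \<in> hcovers 1 A" for U
  proof -
    have bd: "bounded (U i)" for i using U by (auto simp: hcovers_def)
    have "\<exists>x. p ` U i \<subseteq> cball x (diameter (U i))" for i
    proof (cases "U i = {}")
      case False
      then obtain x where x: "x \<in> U i" by blast
      have "dist (p x) (p y) \<le> diameter (U i)" if "y \<in> U i" for y
        using lipschitz_onD[OF p, of x y] diameter_bounded_bound[OF bd x that] by simp
      then show ?thesis by (intro exI[of _ "p x"]) auto
    qed auto
    then obtain x where x: "\<And>i. p ` U i \<subseteq> cball (x i) (diameter (U i))" by metis
    define B where "B i = (if U i = {} then {} else cball (x i) (diameter (U i)))" for i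
    have cover: "cball c \<rho> \<subseteq> (\<Union>i. B i)"
    proof
      fix z assume "z \<in> cball c \<rho>"
      then obtain a where "a \<in> A" "z = p a" using sub by blast
      then obtain i where "a \<in> U i" using U by (auto simp: hcovers_def)
      then have "z \<in> B i" using x[of i] \<open>z = p a\<close> by (auto simp: B_def)
      then show "z \<in> (\<Union>i. B i)" by blast
    qed
    have B: "emeasure lborel (B i) = ennreal (2 ^ DIM('a)) * hcost DIM('a) (U i)" for i
      using diameter_ge_0[OF bd[of i]]
      by (simp add: B_def hcost_def emeasure_cball ennreal_mult[symmetric] power_divide)
    have "ennreal (2 ^ DIM('a)) * ennreal (unit_ball_vol DIM('a) * (\<rho> / 2) ^ DIM('a)) = emeasure lborel (cball c \<rho>)"
      using \<rho> by (simp add: emeasure_cball ennreal_mult[symmetric] power_divide)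
    also have "\<dots> \<le> emeasure lborel (\<Union>i. B i)"
      by (rule emeasure_mono[OF cover]) (auto simp: B_def)
    also have "\<dots> \<le> (\<Sum>i. emeasure lborel (B i))"
      by (rule emeasure_subadditive_countably) (auto simp: B_def)
    also have "\<dots> = ennreal (2 ^ DIM('a)) * (\<Sum>i. hcost DIM('a) (U i))"
      unfolding B by (rule ennreal_suminf_cmult)
    finally show ?thesis
      by (subst (asm) ennreal_mult_le_mult_iff) auto
  qed
  then have "ennreal (unit_ball_vol DIM('a) * (\<rho> / 2) ^ DIM('a)) \<le> hausdorff_pre DIM('a) 1 A"
    unfolding hausdorff_pre_alt by (intro INF_greatest)
  also have "\<dots> \<le> hausdorff_outer DIM('a) A" by (rule hausdorff_pre_le_outer) simp
  finally show ?thesis .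
qed

section \<open>The Jordan decomposition of a finite signed measure\<close>

locale signed_set_function = sigma_algebra \<Omega> M for \<Omega> :: "'a set" and M +
  fixes s :: "'a set \<Rightarrow> real"
  assumes countably_additive_sums:
    "range A \<subseteq> M \<Longrightarrow> disjoint_family A \<Longrightarrow> (\<lambda>i::nat. s (A i)) sums s (\<Union>i. A i)"
begin

lemma s_empty: "s {} = 0"
proof -
  have "(\<lambda>i::nat. s {}) sums s (\<Union>i::nat. {})"
    by (rule countably_additive_sums) (auto simp: disjoint_family_on_def)
  then have "summable (\<lambda>i::nat. s {})" by (rule sums_summable)
  then show ?thesis using summable_LIMSEQ_zero LIMSEQ_const_iff by blast
qed

lemma s_Un:
  assumes "A \<in> M" "B \<in> M" "A \<inter> B = {}"
  shows "s (A \<union> B) = s A + s B"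
proof -
  have "(\<lambda>i. s (binaryset A B i)) sums s (\<Union>i. binaryset A B i)"
    using assms by (intro countably_additive_sums)
      (auto simp: disjoint_family_on_def binaryset_def range_binaryset_eq)
  moreover have "(\<lambda>i. s (binaryset A B i)) sums (s A + s B)"
    by (rule binaryset_sums) (rule s_empty)
  ultimately show ?thesis using sums_unique2 by (simp add: UN_binaryset_eq) blast
qed

lemma s_split:
  assumes "A \<in> M" "B \<in> M"
  shows "s A = s (A \<inter> B) + s (A - B)"
  using s_Un[of "A \<inter> B" "A - B"] assms by (simp add: Int_Diff_Un Int Diff) (metis Int_Diff_Un Diff_disjoint Int_assoc inf_bot_right)

text \<open>If the values were unbounded, one could split off again and again a piece of
  value at least one in modulus and keep a set with the same property; the values of these disjoint
  pieces would form a convergent series.\<close>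

lemma s_bounded: "\<exists>K. \<forall>B\<in>M. \<bar>s B\<bar> \<le> K"
proof (rule ccontr)
  define unb where "unb A \<longleftrightarrow> A \<in> M \<and> (\<forall>K. \<exists>B\<in>M. B \<subseteq> A \<and> K < \<bar>s B\<bar>)" for A
  assume contr: "\<nexists>K. \<forall>B\<in>M. \<bar>s B\<bar> \<le> K"
  have "\<exists>B\<in>M. B \<subseteq> \<Omega> \<and> K < \<bar>s B\<bar>" for K
    using contr sets_into_space by (meson not_le)
  then have unb0: "unb \<Omega>" unfolding unb_def using top by blast
  have step: "\<exists>B. unb B \<and> B \<subseteq> A \<and> 1 \<le> \<bar>s (A - B)\<bar>" if A: "unb A" for A
  proof -
    obtain C where C: "C \<in> M" "C \<subseteq> A" "\<bar>s A\<bar> + 1 < \<bar>s C\<bar>"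
      using A unfolding unb_def by blast
    have AM: "A \<in> M" using A by (simp add: unb_def)
    have "A \<inter> C = C" using C by blast
    then have "s A = s C + s (A - C)" using s_split[OF AM C(1)] by simp
    then have big: "1 \<le> \<bar>s C\<bar>" "1 \<le> \<bar>s (A - C)\<bar>"
      using C(3) by (linarith, linarith)
    have "unb C \<or> unb (A - C)"
    proof (rule ccontr)
      assume "\<not> ?thesis"
      moreover have "\<exists>K. \<forall>B\<in>M. B \<subseteq> D \<longrightarrow> \<bar>s B\<bar> \<le> K" if "\<not> unb D" "D \<in> M" for D
        using that unfolding unb_def by (meson not_le)
      ultimately obtain K1 K2 where K: "\<And>B. B \<in> M \<Longrightarrow> B \<subseteq> C \<Longrightarrow> \<bar>s B\<bar> \<le> K1"
        "\<And>B. B \<in> M \<Longrightarrow> B \<subseteq> A - C \<Longrightarrow> \<bar>s B\<bar> \<le> K2"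
        using C(1) AM by (metis Diff)
      obtain D where D: "D \<in> M" "D \<subseteq> A" "K1 + K2 < \<bar>s D\<bar>"
        using A unfolding unb_def by blast
      have "\<bar>s (D \<inter> C)\<bar> \<le> K1" "\<bar>s (D - C)\<bar> \<le> K2"
        using D C by (auto intro!: K)
      then show False using s_split[OF D(1) C(1)] D(3) by linarith
    qed
    moreover have "A - (A - C) = C" using C by blast
    ultimately show ?thesis using big C by (metis Diff_subset)
  qed
  have "\<exists>B. \<forall>n::nat. unb (B n) \<and> B (Suc n) \<subseteq> B n \<and> 1 \<le> \<bar>s (B n - B (Suc n))\<bar>"
    by (rule dependent_nat_choice) (use unb0 step in blast)+
  then obtain B where B: "\<And>n::nat. unb (B n)" "\<And>n. B (Suc n) \<subseteq> B n \<and> 1 \<le> \<bar>s (B n - B (Suc n))\<bar>"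
    by blast
  have dec: "decseq B" using B(2) by (intro decseq_SucI) auto
  have "(\<lambda>n. s (B n - B (Suc n))) sums s (\<Union>n. B n - B (Suc n))"
  proof (rule countably_additive_sums)
    show "range (\<lambda>n. B n - B (Suc n)) \<subseteq> M" using B(1) unb_def by auto
    have "(B i - B (Suc i)) \<inter> (B j - B (Suc j)) = {}" if "i < j" for i j
      using decseqD[OF dec, of "Suc i" j] that by auto
    then show "disjoint_family (\<lambda>n. B n - B (Suc n))"
      unfolding disjoint_family_on_def by (metis Int_commute linorder_neqE_nat)
  qed
  then have "(\<lambda>n. s (B n - B (Suc n))) \<longlonglongrightarrow> 0"
    by (intro summable_LIMSEQ_zero sums_summable)
  from LIMSEQ_D[OF this, of 1] obtain N where "\<forall>n\<ge>N. \<bar>s (B n - B (Suc n))\<bar> < 1" by auto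
  then have "\<bar>s (B N - B (Suc N))\<bar> < 1" by blast
  then show False using B(2)[of N] by linarith
qed

text \<open>The positive part of \<open>s\<close>.\<close>

definition p :: "'a set \<Rightarrow> real" where
  "p A = (SUP B \<in> {B \<in> M. B \<subseteq> A}. s B)"

lemma bdd: "bdd_above (s ` {B \<in> M. B \<subseteq> A})"
proof -
  obtain K where "\<forall>B\<in>M. \<bar>s B\<bar> \<le> K" using s_bounded by blast
  then show ?thesis by (intro bdd_aboveI[of _ K]) (auto simp: abs_le_iff)
qed

lemma s_le_p: "B \<in> M \<Longrightarrow> B \<subseteq> A \<Longrightarrow> s B \<le> p A"
  unfolding p_def by (rule cSUP_upper[OF _ bdd]) simp

lemma p_least: "(\<And>B. B \<in> M \<Longrightarrow> B \<subseteq> A \<Longrightarrow> s B \<le> c) \<Longrightarrow> p A \<le> c"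
  unfolding p_def by (rule cSUP_least) auto

lemma p_nonneg: "0 \<le> p A"
  using s_le_p[of "{}" A] s_empty by simp

lemma p_mono: "A \<subseteq> B \<Longrightarrow> p A \<le> p B"
  by (rule p_least) (auto intro: s_le_p)

lemma p_empty: "p {} = 0"
  using p_nonneg[of "{}"] p_least[of "{}" 0] s_empty by (simp add: order_antisym)

lemma p_Un:
  assumes "A \<in> M" "B \<in> M" "A \<inter> B = {}"
  shows "p (A \<union> B) = p A + p B"
proof (rule antisym)
  show "p (A \<union> B) \<le> p A + p B"
  proof (rule p_least)
    fix D assume D: "D \<in> M" "D \<subseteq> A \<union> B"
    have "D - A \<subseteq> B" using D by blast
    then have "s (D \<inter> A) \<le> p A" "s (D - A) \<le> p B"
      using D assms by (auto intro!: s_le_p)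
    then show "s D \<le> p A + p B" using s_split[OF D(1) assms(1)] by linarith
  qed
  have "p A \<le> p (A \<union> B) - p B"
  proof (rule p_least)
    fix C assume C: "C \<in> M" "C \<subseteq> A"
    have "p B \<le> p (A \<union> B) - s C"
    proof (rule p_least)
      fix D assume D: "D \<in> M" "D \<subseteq> B"
      have "s (C \<union> D) = s C + s D" using C D assms by (intro s_Un) auto
      moreover have "s (C \<union> D) \<le> p (A \<union> B)" using C D by (intro s_le_p) auto
      ultimately show "s D \<le> p (A \<union> B) - s C" by linarith
    qed
    then show "s C \<le> p (A \<union> B) - p B" by linarith
  qed
  then show "p A + p B \<le> p (A \<union> B)" by linarith
qed

lemma p_sums:
  assumes A: "range A \<subseteq> M" "disjoint_family A"
  shows "(\<lambda>i::nat. p (A i)) sums p (\<Union>i. A i)"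
proof -
  have AM: "A i \<in> M" for i using A by auto
  have fin: "(\<Sum>i<n. p (A i)) = p (\<Union>i<n. A i)" for n
  proof (induction n)
    case (Suc n)
    have "A i \<inter> A n = {}" if "i < n" for i
      using disjoint_family_onD[OF A(2), of i n] that by simp
    then have "(\<Union>i<n. A i) \<inter> A n = {}" by auto
    then have "p ((\<Union>i<n. A i) \<union> A n) = p (\<Union>i<n. A i) + p (A n)"
      using AM by (intro p_Un) auto
    then show ?case using Suc by (simp add: lessThan_Suc Un_commute)
  qed (simp add: p_empty)
  have le: "(\<Sum>i<n. p (A i)) \<le> p (\<Union>i. A i)" for n
    unfolding fin by (rule p_mono) auto
  have summ: "summable (\<lambda>i. p (A i))"
    by (rule summableI_nonneg_bounded[OF p_nonneg le])
  have "p (\<Union>i. A i) \<le> (\<Sum>i. p (A i))"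
  proof (rule p_least)
    fix B assume B: "B \<in> M" "B \<subseteq> (\<Union>i. A i)"
    have "(\<lambda>i. s (B \<inter> A i)) sums s (\<Union>i. B \<inter> A i)"
      using A B AM by (intro countably_additive_sums) (auto simp: disjoint_family_on_def)
    moreover have "(\<Union>i. B \<inter> A i) = B" using B by auto
    ultimately have sB: "(\<lambda>i. s (B \<inter> A i)) sums s B" by simp
    have "(\<Sum>i. s (B \<inter> A i)) \<le> (\<Sum>i. p (A i))"
      by (rule suminf_le[OF _ sums_summable[OF sB] summ]) (use B AM in \<open>auto intro!: s_le_p\<close>)
    then show "s B \<le> (\<Sum>i. p (A i))" using sums_unique[OF sB] by simp
  qed
  moreover have "(\<Sum>i. p (A i)) \<le> p (\<Union>i. A i)"
    by (rule suminf_le_const[OF summ le])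
  ultimately have "(\<Sum>i. p (A i)) = p (\<Union>i. A i)" by (rule antisym[rotated])
  then show ?thesis using summable_sums[OF summ] by simp
qed

text \<open>The empty set contributes the value zero, so truncating the negative values does not affect the
  supremum.\<close>

lemma SUP_ennreal_eq_p: "(SUP B \<in> {B \<in> M. B \<subseteq> A}. ennreal (s B)) = ennreal (p A)"
proof (rule antisym)
  show "(SUP B \<in> {B \<in> M. B \<subseteq> A}. ennreal (s B)) \<le> ennreal (p A)"
    by (rule SUP_least) (auto intro!: ennreal_leI s_le_p)
  define S where "S = (SUP B \<in> {B \<in> M. B \<subseteq> A}. ennreal (s B))"
  have "S \<le> ennreal (p A)"
    unfolding S_def by (rule SUP_least) (auto intro!: ennreal_leI s_le_p)
  then obtain r where r: "0 \<le> r" "S = ennreal r"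
    by (metis ennreal_cases ennreal_neq_top top.extremum_uniqueI)
  have "p A \<le> r"
  proof (rule p_least)
    fix B assume B: "B \<in> M" "B \<subseteq> A"
    then have "ennreal (s B) \<le> S" unfolding S_def by (intro SUP_upper) auto
    then show "s B \<le> r" using r by (simp add: ennreal_le_iff)
  qed
  then show "ennreal (p A) \<le> (SUP B \<in> {B \<in> M. B \<subseteq> A}. ennreal (s B))"
    unfolding S_def[symmetric] r(2) by (rule ennreal_leI)
qed

end

lemma pos_part_measure_finite:
  fixes \<Omega> :: "(real^3) set"
  assumes \<Omega>: "open \<Omega>"
    and s: "\<And>A :: nat \<Rightarrow> (real^3) set. range A \<subseteq> {B \<in> sets borel. B \<subseteq> \<Omega>} \<Longrightarrow> disjoint_family A \<Longrightarrow>
       (\<lambda>i. s (A i)) sums s (\<Union>i. A i)"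
  shows "finite_measure (pos_part_measure \<Omega> s)"
    and "sets (pos_part_measure \<Omega> s) = sets (restrict_space borel \<Omega>)"
    and "space (pos_part_measure \<Omega> s) = \<Omega>"
proof -
  define M where "M = {B \<in> sets borel. B \<subseteq> \<Omega>}"
  have M: "M = sets (restrict_space borel \<Omega>)"
    using \<Omega> by (auto simp: M_def sets_restrict_space image_iff)
  have sa: "sigma_algebra \<Omega> M"
    using sets.sigma_algebra_axioms[of "restrict_space borel \<Omega>"] unfolding M
    by (simp add: space_restrict_space)
  interpret signed_set_function \<Omega> M s
    by (intro signed_set_function.intro sa signed_set_function_axioms.intro) (use s in \<open>simp add: M_def\<close>)
  define f where "f A = (SUP B \<in> {B \<in> sets borel. B \<subseteq> A}. ennreal (s B))" for A
  have pm: "pos_part_measure \<Omega> s = measure_of \<Omega> M f"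
    by (simp add: pos_part_measure_def f_def[abs_def] M_def)
  have f: "f A = ennreal (p A)" if "A \<in> M" for A
  proof -
    have "{B \<in> sets borel. B \<subseteq> A} = {B \<in> M. B \<subseteq> A}" using that by (auto simp: M_def)
    then show ?thesis by (simp add: f_def SUP_ennreal_eq_p)
  qed
  have "positive M f" using f[of "{}"] by (simp add: positive_def p_empty)
  moreover have "countably_additive M f"
    unfolding countably_additive_def
  proof (intro allI impI)
    fix A :: "nat \<Rightarrow> _" assume A: "range A \<subseteq> M" "disjoint_family A" "\<Union> (range A) \<in> M"
    have "(\<Sum>i. f (A i)) = (\<Sum>i. ennreal (p (A i)))" using A(1) f by (metis range_subsetD)
    also have "\<dots> = ennreal (p (\<Union> (range A)))"
      using p_sums[OF A(1,2)] by (intro suminf_ennreal_eq p_nonneg)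
    finally show "(\<Sum>i. f (A i)) = f (\<Union> (range A))" using f A(3) by simp
  qed
  ultimately have em: "emeasure (pos_part_measure \<Omega> s) A = f A" if "A \<in> M" for A
    unfolding pm using sa that by (intro emeasure_measure_of_sigma)
  show "space (pos_part_measure \<Omega> s) = \<Omega>"
    unfolding pm using sets_into_space by (intro space_measure_of) auto
  show "sets (pos_part_measure \<Omega> s) = sets (restrict_space borel \<Omega>)"
    unfolding pm M[symmetric] using sa by (simp add: sigma_algebra.sets_measure_of_eq)
  show "finite_measure (pos_part_measure \<Omega> s)"
    using em[OF top] f[OF top] \<open>space (pos_part_measure \<Omega> s) = \<Omega>\<close> by (intro finite_measureI) simp
qed

section \<open>Integral representation of functionals bounded by an \<open>L\<^sup>1\<close> norm\<close>

text \<open>A minimiser of \<open>\<integral> u\<^sup>2 - 2 T u\<close> represents \<open>T\<close>. This quadratic functional is bounded below on \<open>V\<close> because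
  \<open>T\<close> is controlled by the \<open>L\<^sup>1\<close> norm and \<open>(\<bar>u\<bar> - C)\<^sup>2\<close> is nonnegative. There may be no minimiser
  in \<open>V\<close>, which need not be complete; a minimising sequence with geometric rate converges in \<open>L\<^sup>1\<close> and almost
  everywhere, which is enough as the members of \<open>V\<close> are bounded.\<close>

lemma L1_bounded_functional_representation:
  fixes M :: "'a measure" and V :: "('a \<Rightarrow> real) set" and T :: "('a \<Rightarrow> real) \<Rightarrow> real"
  assumes "finite_measure M"
    and meas: "\<And>u. u \<in> V \<Longrightarrow> u \<in> borel_measurable M"
    and bounded: "\<And>u. u \<in> V \<Longrightarrow> \<exists>K. \<forall>x\<in>space M. \<bar>u x\<bar> \<le> K"
    and ne: "u0 \<in> V"
    and lin: "\<And>u v a b. u \<in> V \<Longrightarrow> v \<in> V \<Longrightarrow> (\<lambda>x. a * u x + b * v x) \<in> V"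
    and T_lin: "\<And>u v a b. u \<in> V \<Longrightarrow> v \<in> V \<Longrightarrow> T (\<lambda>x. a * u x + b * v x) = a * T u + b * T v"
    and T_le: "\<And>u. u \<in> V \<Longrightarrow> \<bar>T u\<bar> \<le> C * (LINT x|M. \<bar>u x\<bar>)"
  obtains g u where "\<And>n::nat. u n \<in> V" "integrable M g" "AE x in M. (\<lambda>n. u n x) \<longlonglongrightarrow> g x"
    "(\<lambda>n. LINT x|M. \<bar>u n x - g x\<bar>) \<longlonglongrightarrow> 0" "\<And>\<phi>. \<phi> \<in> V \<Longrightarrow> (LINT x|M. \<phi> x * g x) = T \<phi>"
proof -
  interpret finite_measure M by fact
  note [measurable] = meas
  have int1: "integrable M u" if uV: "u \<in> V" for u
  proof -
    obtain K where "\<forall>x\<in>space M. \<bar>u x\<bar> \<le> K" using bounded[OF uV] by blast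
    then show ?thesis using uV by (intro integrable_const_bound[of _ K]) auto
  qed
  have int2: "integrable M (\<lambda>x. u x * v x)" if uV: "u \<in> V" "v \<in> V" for u v
  proof -
    obtain K L where "\<forall>x\<in>space M. \<bar>u x\<bar> \<le> K" "\<forall>x\<in>space M. \<bar>v x\<bar> \<le> L"
      using bounded[OF uV(1)] bounded[OF uV(2)] by blast
    then have "\<bar>u x * v x\<bar> \<le> K * L" if "x \<in> space M" for x
      using that by (auto simp: abs_mult intro!: mult_mono intro: order_trans[OF abs_ge_zero])
    then show ?thesis using uV by (intro integrable_const_bound[of _ "K * L"]) auto
  qed
  have int2': "integrable M (\<lambda>x. (u x)\<^sup>2)" if "u \<in> V" for u
    using int2[OF that that] by (simp add: power2_eq_square)
  define J where "J u = (LINT x|M. (u x)\<^sup>2) - 2 * T u" for u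
  have J_expand: "J (\<lambda>x. u x + t * v x) = J u + 2 * t * ((LINT x|M. u x * v x) - T v) + t\<^sup>2 * (LINT x|M. (v x)\<^sup>2)"
    if uv: "u \<in> V" "v \<in> V" for u v t
  proof -
    have "(LINT x|M. (u x + t * v x)\<^sup>2) = (LINT x|M. (u x)\<^sup>2 + (2 * t * (u x * v x) + t\<^sup>2 * (v x)\<^sup>2))"
      by (rule Bochner_Integration.integral_cong) (auto simp: power2_eq_square algebra_simps)
    also have "\<dots> = (LINT x|M. (u x)\<^sup>2) + (2 * t * (LINT x|M. u x * v x) + t\<^sup>2 * (LINT x|M. (v x)\<^sup>2))"
      using int2 int2' uv by simp
    finally show ?thesis
      using T_lin[OF uv, of 1 t] by (simp add: J_def algebra_simps)
  qed
  have J_lower: "J u \<ge> - (C\<^sup>2 * measure M (space M))" if u: "u \<in> V" for u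
  proof -
    have "0 \<le> (LINT x|M. (\<bar>u x\<bar> - C)\<^sup>2)" by simp
    also have "\<dots> = (LINT x|M. (u x)\<^sup>2 + (C\<^sup>2 - 2 * C * \<bar>u x\<bar>))"
      by (rule Bochner_Integration.integral_cong) (auto simp: power2_eq_square algebra_simps)
    also have "\<dots> = (LINT x|M. (u x)\<^sup>2) + (C\<^sup>2 * measure M (space M) - 2 * C * (LINT x|M. \<bar>u x\<bar>))"
      using int1[OF u] int2'[OF u] by (simp add: mult.commute)
    finally show ?thesis using T_le[OF u] unfolding J_def by linarith
  qed
  define I where "I = (INF u\<in>V. J u)"
  have bdd: "bdd_below (J ` V)" using J_lower by (intro bdd_belowI2) auto
  have I_le: "I \<le> J u" if "u \<in> V" for u unfolding I_def by (rule cINF_lower[OF bdd that])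
  have "\<exists>u\<in>V. J u < I + (1/4)^n" for n
    using cINF_less_iff[of V J "I + (1/4)^n"] bdd ne by (auto simp: I_def)
  then obtain u where uV: "\<And>n. u n \<in> V" and Ju: "\<And>n. J (u n) < I + (1/4)^n" by metis
  \<comment> \<open>By the parallelogram identity, a minimising sequence is a Cauchy sequence in \<open>L\<^sup>2\<close>.\<close>
  define f where "f n x = u (Suc n) x - u n x" for n x
  have fV: "f n \<in> V" for n
    using lin[OF uV[of "Suc n"] uV[of n], of 1 "-1"] by (simp add: f_def[abs_def])
  have f2: "(LINT x|M. (f n x)\<^sup>2) \<le> 4 * (1/4)^n" for n
  proof -
    have "I \<le> J (\<lambda>x. u n x + 1/2 * f n x)"
      using lin[OF uV[of n] fV[of n], of 1 "1/2"] by (intro I_le) simp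
    also have "\<dots> = J (u n) + ((LINT x|M. u n x * f n x) - T (f n)) + 1/4 * (LINT x|M. (f n x)\<^sup>2)"
      by (subst J_expand[OF uV fV]) (simp add: power2_eq_square)
    finally have 1: "I \<le> J (u n) + ((LINT x|M. u n x * f n x) - T (f n)) + 1/4 * (LINT x|M. (f n x)\<^sup>2)" .
    have "J (u (Suc n)) = J (\<lambda>x. u n x + 1 * f n x)" by (simp add: f_def)
    also have "\<dots> = J (u n) + 2 * ((LINT x|M. u n x * f n x) - T (f n)) + (LINT x|M. (f n x)\<^sup>2)"
      by (subst J_expand[OF uV fV]) simp
    finally have "(LINT x|M. (f n x)\<^sup>2) \<le> 2 * (J (u n) - I) + 2 * (J (u (Suc n)) - I)"
      using 1 by (simp add: algebra_simps)
    moreover have "J (u (Suc n)) < I + (1/4)^n"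
      by (rule less_le_trans[OF Ju]) simp
    ultimately show ?thesis using Ju[of n] by argo
  qed
  define c where "c = 2 + measure M (space M)"
  \<comment> \<open>Young's inequality with weight \<open>2\<^sup>n\<close> turns the \<open>L\<^sup>2\<close> bound into a summable \<open>L\<^sup>1\<close> bound.\<close>
  have f1: "(LINT x|M. \<bar>f n x\<bar>) \<le> c * (1/2)^n" for n
  proof -
    have "(LINT x|M. \<bar>f n x\<bar>) \<le> (LINT x|M. 2^n / 2 * (f n x)\<^sup>2 + (1/2)^n / 2)"
    proof (rule integral_mono)
      fix x
      have "0 \<le> (2^n * \<bar>f n x\<bar> - 1)\<^sup>2" by simp
      then have "2 * 2^n * \<bar>f n x\<bar> \<le> 2^n * 2^n * (f n x)\<^sup>2 + 1"
        by (simp add: power2_eq_square algebra_simps)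
      then show "\<bar>f n x\<bar> \<le> 2^n / 2 * (f n x)\<^sup>2 + (1/2)^n / 2"
        by (simp add: field_simps power_divide)
    qed (use int1 int2' fV in auto)
    also have "\<dots> = 2^n / 2 * (LINT x|M. (f n x)\<^sup>2) + (1/2)^n / 2 * measure M (space M)"
      using int2' fV by (simp add: mult.commute)
    also have "\<dots> \<le> 2^n / 2 * (4 * (1/4)^n) + (1/2)^n / 2 * measure M (space M)"
      using f2[of n] by (intro add_right_mono mult_left_mono) auto
    also have "2^n / 2 * (4 * (1/4)^n) = (2::real) * (1/2)^n"
      by (simp add: power_divide field_simps flip: power_mult_distrib)
    also have "2 * (1/2)^n + (1/2)^n / 2 * measure M (space M) \<le> c * (1/2)^n"
      by (simp add: c_def algebra_simps)
    finally show ?thesis by simp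
  qed
  have summ: "summable (\<lambda>n. LINT x|M. \<bar>f n x\<bar>)"
    by (rule summable_comparison_test'[of "\<lambda>n. c * (1/2)^n" 0]) (use f1 in \<open>auto intro!: summable_mult\<close>)
  have AE_summ: "AE x in M. summable (\<lambda>n. \<bar>f n x\<bar>)"
  proof -
    have "(\<integral>\<^sup>+x. (\<Sum>n. ennreal \<bar>f n x\<bar>) \<partial>M) = (\<Sum>n. \<integral>\<^sup>+x. ennreal \<bar>f n x\<bar> \<partial>M)"
      using fV by (intro nn_integral_suminf) auto
    also have "\<dots> = (\<Sum>n. ennreal (LINT x|M. \<bar>f n x\<bar>))"
      using int1 fV by (intro suminf_cong nn_integral_eq_integral) auto
    also have "\<dots> = ennreal (\<Sum>n. LINT x|M. \<bar>f n x\<bar>)"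
      by (rule suminf_ennreal2[OF _ summ]) simp
    finally have "(\<integral>\<^sup>+x. (\<Sum>n. ennreal \<bar>f n x\<bar>) \<partial>M) \<noteq> \<infinity>" by simp
    then have "AE x in M. (\<Sum>n. ennreal \<bar>f n x\<bar>) \<noteq> \<infinity>"
      using fV by (intro nn_integral_PInf_AE) (auto simp: infinity_ennreal_def)
    then show ?thesis by eventually_elim (auto intro: summable_suminf_not_top simp: infinity_ennreal_def)
  qed
  define w where "w x = (\<Sum>n. \<bar>f n x\<bar>)" for x
  define g where "g x = u 0 x + (\<Sum>n. f n x)" for x
  have w: "integrable M w"
    unfolding w_def using int1 fV AE_summ summ by (intro integrable_suminf) auto
  have g: "integrable M g"
    unfolding g_def using int1 fV uV AE_summ summ by (intro Bochner_Integration.integrable_add integrable_suminf) auto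
  have un: "u n x = u 0 x + (\<Sum>i<n. f i x)" for n x
    by (induction n) (auto simp: f_def)
  have conv: "AE x in M. (\<lambda>n. u n x) \<longlonglongrightarrow> g x"
    using AE_summ
  proof eventually_elim
    case (elim x)
    then have "(\<lambda>n. f n x) sums (\<Sum>n. f n x)"
      by (rule summable_sums[OF summable_rabs_cancel])
    moreover have "(\<lambda>n. u n x) = (\<lambda>n. u 0 x + (\<Sum>i<n. f i x))"
      by (rule ext) (rule un)
    ultimately show ?case unfolding g_def sums_def by (simp add: tendsto_intros)
  qed
  have L1: "(\<lambda>n. LINT x|M. \<bar>u n x - g x\<bar>) \<longlonglongrightarrow> (LINT x|M. 0)"
  proof (rule integral_dominated_convergence)
    show "integrable M (\<lambda>x. 2 * w x)" using w by simp
    show "AE x in M. (\<lambda>n. \<bar>u n x - g x\<bar>) \<longlonglongrightarrow> 0"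
      using conv by eventually_elim (auto intro!: tendsto_rabs_zero LIM_zero)
    show "AE x in M. norm \<bar>u n x - g x\<bar> \<le> 2 * w x" for n
      using AE_summ
    proof eventually_elim
      case (elim x)
      have "\<bar>\<Sum>i<n. f i x\<bar> \<le> (\<Sum>i<n. \<bar>f i x\<bar>)" by (rule sum_abs)
      also have "\<dots> \<le> w x" unfolding w_def by (rule sum_le_suminf[OF elim]) auto
      finally have "\<bar>\<Sum>i<n. f i x\<bar> \<le> w x" .
      moreover have "\<bar>\<Sum>i. f i x\<bar> \<le> w x" unfolding w_def by (rule summable_rabs[OF elim])
      ultimately show ?case unfolding un[of n x] g_def by simp
    qed
  qed (use uV g in auto)
  have rep: "(LINT x|M. \<phi> x * g x) = T \<phi>" if \<phi>: "\<phi> \<in> V" for \<phi>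
  proof -
    obtain K where K: "\<forall>x\<in>space M. \<bar>\<phi> x\<bar> \<le> K" using bounded[OF \<phi>] by blast
    have [measurable]: "\<phi> \<in> borel_measurable M" "g \<in> borel_measurable M" using \<phi> g by auto
    have gi: "integrable M (\<lambda>x. \<phi> x * g x)"
      using g K by (intro Bochner_Integration.integrable_bound[of M "\<lambda>x. K * g x" "\<lambda>x. \<phi> x * g x"])
        (auto simp: abs_mult intro!: mult_right_mono AE_I2 intro: order_trans[OF _ abs_ge_self])
    have "(\<lambda>n. (LINT x|M. u n x * \<phi> x) - (LINT x|M. \<phi> x * g x)) \<longlonglongrightarrow> 0"
    proof (rule Lim_null_comparison)
      show "(\<lambda>n. \<bar>K\<bar> * (LINT x|M. \<bar>u n x - g x\<bar>)) \<longlonglongrightarrow> 0"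
        using tendsto_mult_right_zero[OF L1[simplified]] by simp
      show "eventually (\<lambda>n. norm ((LINT x|M. u n x * \<phi> x) - (LINT x|M. \<phi> x * g x)) \<le> \<bar>K\<bar> * (LINT x|M. \<bar>u n x - g x\<bar>)) sequentially"
      proof (rule always_eventually, rule allI)
        fix n
        have "(LINT x|M. u n x * \<phi> x) - (LINT x|M. \<phi> x * g x) = (LINT x|M. \<phi> x * (u n x - g x))"
          using int2[OF uV \<phi>] gi by (subst Bochner_Integration.integral_diff[symmetric]) (auto simp: algebra_simps)
        also have "norm \<dots> \<le> (LINT x|M. \<bar>K\<bar> * \<bar>u n x - g x\<bar>)"
        proof (rule order_trans[OF integral_norm_bound integral_mono])
          show "integrable M (\<lambda>x. norm (\<phi> x * (u n x - g x)))"
            using Bochner_Integration.integrable_diff[OF int2[OF \<phi> uV[of n]] gi]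
            by (intro integrable_norm) (simp add: right_diff_distrib)
          show "integrable M (\<lambda>x. \<bar>K\<bar> * \<bar>u n x - g x\<bar>)" using int1[OF uV[of n]] g by simp
          fix x assume "x \<in> space M"
          then show "norm (\<phi> x * (u n x - g x)) \<le> \<bar>K\<bar> * \<bar>u n x - g x\<bar>"
            using K by (fastforce simp: abs_mult intro!: mult_right_mono)
        qed
        finally show "norm ((LINT x|M. u n x * \<phi> x) - (LINT x|M. \<phi> x * g x)) \<le> \<bar>K\<bar> * (LINT x|M. \<bar>u n x - g x\<bar>)" by simp
      qed
    qed
    then have lim1: "(\<lambda>n. LINT x|M. u n x * \<phi> x) \<longlonglongrightarrow> (LINT x|M. \<phi> x * g x)"
      by (rule LIM_zero_cancel)
    define q where "q = (LINT x|M. (\<phi> x)\<^sup>2)"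
    \<comment> \<open>Near-minimality of \<open>u n\<close> under the perturbations \<open>u n + t \<phi>\<close> with \<open>t = \<plusminus>2\<^sup>-\<^sup>n\<close> bounds the
      first variation.\<close>
    have est: "\<bar>(LINT x|M. u n x * \<phi> x) - T \<phi>\<bar> \<le> (1 + q) * (1/2)^n" for n
    proof -
      have "- ((1/4)^n) \<le> 2 * t * ((LINT x|M. u n x * \<phi> x) - T \<phi>) + t\<^sup>2 * q" for t
        using I_le[OF lin[OF uV[of n] \<phi>, of 1 t]] Ju[of n] J_expand[OF uV \<phi>, of n t]
        by (simp add: q_def)
      from this[of "(1/2)^n"] this[of "- ((1/2)^n)"]
      have "2 * (1/2)^n * \<bar>(LINT x|M. u n x * \<phi> x) - T \<phi>\<bar> \<le> (1/2)^n * ((1/2)^n * (1 + q))"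
        by (simp add: power2_eq_square abs_if algebra_simps flip: power_mult_distrib)
      then have "2 * \<bar>(LINT x|M. u n x * \<phi> x) - T \<phi>\<bar> \<le> (1/2)^n * (1 + q)"
        by (simp add: field_simps)
      moreover have "0 \<le> (1/2::real)^n * (1 + q)" by (simp add: q_def)
      ultimately show ?thesis by (simp add: mult.commute)
    qed
    have "(\<lambda>n. (LINT x|M. u n x * \<phi> x) - T \<phi>) \<longlonglongrightarrow> 0"
    proof (rule Lim_null_comparison)
      show "(\<lambda>n. (1 + q) * (1/2)^n) \<longlonglongrightarrow> 0"
        by (intro tendsto_mult_right_zero LIMSEQ_power_zero) auto
    qed (use est in auto)
    then have "(\<lambda>n. LINT x|M. u n x * \<phi> x) \<longlonglongrightarrow> T \<phi>" by (rule LIM_zero_cancel)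
    then show ?thesis using LIMSEQ_unique lim1 by blast
  qed
  from that[OF uV g conv _ rep] L1 show ?thesis by simp
qed

text \<open>The functions \<open>h \<circ> u\<^sub>n\<close> are admissible test functions and converge to \<open>h \<circ> g\<close>, so that in the limit
  \<open>\<integral> (\<bar>g\<bar> - C) \<bar>h \<circ> g\<bar> \<le> 0\<close>, although the integrand is nonnegative and vanishes only where \<open>\<bar>g\<bar> \<le> C\<close>.\<close>

lemma L1_bounded_functional_density_le:
  fixes M :: "'a measure" and V :: "('a \<Rightarrow> real) set" and T :: "('a \<Rightarrow> real) \<Rightarrow> real" and h :: "real \<Rightarrow> real"
  assumes "finite_measure M"
    and meas: "\<And>u. u \<in> V \<Longrightarrow> u \<in> borel_measurable M"
    and T_le: "\<And>u. u \<in> V \<Longrightarrow> \<bar>T u\<bar> \<le> C * (LINT x|M. \<bar>u x\<bar>)"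
    and h: "continuous_on UNIV h" "\<And>t. \<bar>h t\<bar> \<le> 1" "\<And>t. h t * t = \<bar>h t\<bar> * \<bar>t\<bar>" "\<And>t. h t = 0 \<longleftrightarrow> \<bar>t\<bar> \<le> C"
    and hV: "\<And>u. u \<in> V \<Longrightarrow> (\<lambda>x. h (u x)) \<in> V"
    and u: "\<And>n::nat. u n \<in> V" and g: "integrable M g" and lim: "AE x in M. (\<lambda>n. u n x) \<longlonglongrightarrow> g x"
    and rep: "\<And>\<phi>. \<phi> \<in> V \<Longrightarrow> (LINT x|M. \<phi> x * g x) = T \<phi>"
  shows "AE x in M. \<bar>g x\<bar> \<le> C"
proof -
  interpret finite_measure M by fact
  have [measurable]: "h \<in> borel_measurable borel"
    by (rule borel_measurable_continuous_onI[OF h(1)])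
  note [measurable] = meas[OF u] borel_measurable_integrable[OF g]
  have hlim: "AE x in M. (\<lambda>n. h (u n x)) \<longlonglongrightarrow> h (g x)"
    using lim by eventually_elim (rule continuous_on_tendsto_compose[OF h(1)], auto)
  have hg: "integrable M (\<lambda>x. h (g x) * g x)"
    by (rule Bochner_Integration.integrable_bound[OF g])
      (use h(2) in \<open>auto simp: abs_mult intro!: mult_left_le_one_le\<close>)
  have h1: "integrable M (\<lambda>x. \<bar>h (g x)\<bar>)"
    using h(2) by (intro integrable_const_bound[of _ 1]) auto
  have 1: "(\<lambda>n. LINT x|M. h (u n x) * g x) \<longlonglongrightarrow> (LINT x|M. h (g x) * g x)"
  proof (rule integral_dominated_convergence[where w="\<lambda>x. \<bar>g x\<bar>"])
    show "AE x in M. (\<lambda>n. h (u n x) * g x) \<longlonglongrightarrow> h (g x) * g x"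
      using hlim by eventually_elim (intro tendsto_mult tendsto_const)
    show "AE x in M. norm (h (u n x) * g x) \<le> \<bar>g x\<bar>" for n
      using h(2) by (auto simp: abs_mult intro!: mult_left_le_one_le)
  qed (use g in auto)
  have 2: "(\<lambda>n. LINT x|M. \<bar>h (u n x)\<bar>) \<longlonglongrightarrow> (LINT x|M. \<bar>h (g x)\<bar>)"
  proof (rule integral_dominated_convergence[where w="\<lambda>x. 1"])
    show "AE x in M. (\<lambda>n. \<bar>h (u n x)\<bar>) \<longlonglongrightarrow> \<bar>h (g x)\<bar>"
      using hlim by eventually_elim (rule tendsto_rabs)
  qed (use h(2) in auto)
  have "(LINT x|M. h (g x) * g x) \<le> C * (LINT x|M. \<bar>h (g x)\<bar>)"
  proof (rule LIMSEQ_le[OF 1 tendsto_mult_left[OF 2]], intro exI allI impI)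
    fix n
    show "(LINT x|M. h (u n x) * g x) \<le> C * (LINT x|M. \<bar>h (u n x)\<bar>)"
      using rep[OF hV[OF u[of n]]] T_le[OF hV[OF u[of n]]] by linarith
  qed
  then have le: "(LINT x|M. h (g x) * g x - C * \<bar>h (g x)\<bar>) \<le> 0"
    using hg h1 by simp
  have nn: "0 \<le> h t * t - C * \<bar>h t\<bar>" for t
  proof (cases "\<bar>t\<bar> \<le> C")
    case True
    then have "h t = 0" using h(4) by blast
    then show ?thesis by simp
  next
    case False
    then have "0 \<le> (\<bar>t\<bar> - C) * \<bar>h t\<bar>" by (intro mult_nonneg_nonneg) auto
    then show ?thesis using h(3)[of t] by (simp add: algebra_simps)
  qed
  have "(LINT x|M. h (g x) * g x - C * \<bar>h (g x)\<bar>) = 0"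
    using le nn by (intro antisym integral_nonneg_AE) auto
  then have "AE x in M. h (g x) * g x - C * \<bar>h (g x)\<bar> = 0"
    using hg h1 nn by (subst (asm) integral_nonneg_eq_0_iff_AE) auto
  then show ?thesis
  proof eventually_elim
    case (elim x)
    show ?case
    proof (rule ccontr)
      assume "\<not> \<bar>g x\<bar> \<le> C"
      then have "h (g x) \<noteq> 0" "C < \<bar>g x\<bar>" using h(4) by auto
      then have "0 < (\<bar>g x\<bar> - C) * \<bar>h (g x)\<bar>" by simp
      moreover have "\<bar>h (g x)\<bar> * \<bar>g x\<bar> - C * \<bar>h (g x)\<bar> = 0" using elim h(3)[of "g x"] by simp
      moreover have "(\<bar>g x\<bar> - C) * \<bar>h (g x)\<bar> = \<bar>h (g x)\<bar> * \<bar>g x\<bar> - C * \<bar>h (g x)\<bar>"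
        by (subst mult.commute[of "\<bar>h (g x)\<bar>"]) (rule left_diff_distrib)
      ultimately show False by linarith
    qed
  qed
qed

section \<open>Mollification\<close>

subsection \<open>A smooth bump function\<close>

text \<open>The family over all \<open>n\<close> is closed under differentiation up to linear combinations, which yields
  smoothness without computing higher derivatives.\<close>

definition flat_exp :: "nat \<Rightarrow> real \<Rightarrow> real" where
  "flat_exp n t = (if t \<le> 0 then 0 else exp (- (1 / t)) / t ^ n)"

lemma flat_exp_nonneg: "0 \<le> flat_exp n t"
  by (simp add: flat_exp_def)

lemma flat_exp_tendsto_0: "(flat_exp n \<longlongrightarrow> 0) (at 0)"
proof -
  have "((\<lambda>x::real. x ^ n / exp x) \<longlongrightarrow> 0) at_top"
    by (rule tendsto_power_div_exp_0)
  then have "((\<lambda>x. flat_exp n (inverse x)) \<longlongrightarrow> 0) at_top"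
  proof (rule Lim_transform_eventually)
    show "eventually (\<lambda>x. x ^ n / exp x = flat_exp n (inverse x)) at_top"
      using eventually_gt_at_top[of 0]
      by eventually_elim (auto simp: flat_exp_def exp_minus field_simps)
  qed
  then have "(flat_exp n \<longlongrightarrow> 0) (at_right 0)"
    by (simp add: filterlim_at_right_to_top)
  moreover have "(flat_exp n \<longlongrightarrow> 0) (at_left 0)"
  proof (rule Lim_transform_eventually[OF tendsto_const])
    show "eventually (\<lambda>x. 0 = flat_exp n x) (at_left 0)"
      by (auto simp: eventually_at_filter flat_exp_def)
  qed
  ultimately show ?thesis by (rule filterlim_split_at[rotated])
qed

lemma flat_exp_has_derivative:
  "(flat_exp n has_real_derivative (flat_exp (n + 2) t - n * flat_exp (n + 1) t)) (at t)"
proof -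
  consider "t > 0" | "t < 0" | "t = 0" by linarith
  then show ?thesis
  proof cases
    case 1
    have e: "((\<lambda>t. exp (- (1 / t))) has_real_derivative (exp (- (1 / t)) / t\<^sup>2)) (at t)"
      using 1 by (auto intro!: derivative_eq_intros simp: power2_eq_square)
    have "((\<lambda>t. exp (- (1 / t)) / t ^ n) has_real_derivative (flat_exp (n + 2) t - n * flat_exp (n + 1) t)) (at t)"
    proof (cases n)
      case 0
      then show ?thesis using e 1 by (simp add: flat_exp_def power2_eq_square)
    next
      case (Suc m)
      have "((\<lambda>t. exp (- (1 / t)) / t ^ Suc m) has_real_derivative
          (exp (- (1 / t)) / t\<^sup>2 * t ^ Suc m - exp (- (1 / t)) * (real (Suc m) * t ^ m)) / (t ^ Suc m * t ^ Suc m)) (at t)"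
        using DERIV_divide[OF e DERIV_pow[of "Suc m" t]] 1 by simp
      moreover have "(exp (- (1 / t)) / t\<^sup>2 * t ^ Suc m - exp (- (1 / t)) * (real (Suc m) * t ^ m)) / (t ^ Suc m * t ^ Suc m)
          = flat_exp (Suc m + 2) t - real (Suc m) * flat_exp (Suc m + 1) t"
        using 1 by (simp add: flat_exp_def divide_simps power2_eq_square) (simp add: algebra_simps)
      ultimately show ?thesis using Suc by simp
    qed
    moreover have "eventually (\<lambda>s. exp (- (1 / s)) / s ^ n = flat_exp n s) (nhds t)"
      using eventually_nhds_in_open[of "{0<..}" t] 1 by (auto elim!: eventually_mono simp: flat_exp_def)
    ultimately show ?thesis by (subst (asm) DERIV_cong_ev[OF refl _ refl])
  next
    case 2
    have "eventually (\<lambda>s. 0 = flat_exp n s) (nhds t)"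
      using eventually_nhds_in_open[of "{..<0}" t] 2 by (auto elim!: eventually_mono simp: flat_exp_def)
    moreover have "((\<lambda>_. 0) has_real_derivative (flat_exp (n + 2) t - n * flat_exp (n + 1) t)) (at t)"
      using 2 by (simp add: flat_exp_def)
    ultimately show ?thesis by (subst (asm) DERIV_cong_ev[OF refl _ refl])
  next
    case 3
    have "((\<lambda>h. (flat_exp n (0 + h) - flat_exp n 0) / h) \<longlongrightarrow> 0) (at 0)"
    proof (rule Lim_transform_eventually[OF flat_exp_tendsto_0[of "n + 1"]])
      show "eventually (\<lambda>h. flat_exp (n + 1) h = (flat_exp n (0 + h) - flat_exp n 0) / h) (at 0)"
        by (auto simp: eventually_at_filter flat_exp_def field_simps)
    qed
    then show ?thesis using 3 by (simp add: DERIV_def flat_exp_def)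
  qed
qed

lemma continuous_on_flat_exp: "continuous_on S (flat_exp n)"
  using flat_exp_has_derivative by (meson DERIV_isCont continuous_at_imp_continuous_on)

lemma flat_exp_0_less_1: "flat_exp 0 t < 1"
  by (auto simp: flat_exp_def)

lemma flat_exp_0_eq_0_iff: "flat_exp 0 t = 0 \<longleftrightarrow> t \<le> 0"
  by (auto simp: flat_exp_def)

definition bump :: "nat \<Rightarrow> 'a::euclidean_space \<Rightarrow> real" where
  "bump n z = flat_exp n (1 - z \<bullet> z)"

definition bump_grad :: "nat \<Rightarrow> 'a::euclidean_space \<Rightarrow> 'a" where
  "bump_grad n z = (- 2 * (bump (n + 2) z - n * bump (n + 1) z)) *\<^sub>R z"

lemma bump_has_derivative: "(bump n has_derivative (\<lambda>v. bump_grad n z \<bullet> v)) (at z)"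
proof -
  have 1: "((\<lambda>z::'a. 1 - z \<bullet> z) has_derivative (\<lambda>v. - 2 * (z \<bullet> v))) (at z)"
    by (auto intro!: derivative_eq_intros simp: inner_commute algebra_simps)
  have "(flat_exp n has_derivative (\<lambda>h. h * (flat_exp (n + 2) (1 - z \<bullet> z) - n * flat_exp (n + 1) (1 - z \<bullet> z)))) (at (1 - z \<bullet> z))"
    using flat_exp_has_derivative by (simp add: has_field_derivative_def mult.commute[of _ "flat_exp _ _ - _"])
  from has_derivative_compose[OF 1 this] show ?thesis
    by (simp add: bump_def[abs_def] bump_grad_def algebra_simps)
qed

lemma continuous_on_bump: "continuous_on S (bump n)"
  using bump_has_derivative by (meson has_derivative_continuous continuous_at_imp_continuous_on)

lemma continuous_on_bump_grad: "continuous_on S (bump_grad n)"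
  unfolding bump_grad_def[abs_def] by (intro continuous_intros continuous_on_bump)

lemma bump_eq_0: "1 \<le> norm z \<Longrightarrow> bump n z = 0"
proof -
  assume "1 \<le> norm z"
  then have "1 \<le> z \<bullet> z" by (simp add: dot_square_norm one_le_power)
  then show ?thesis by (simp add: bump_def flat_exp_def)
qed

lemma bump_grad_eq_0: "1 \<le> norm z \<Longrightarrow> bump_grad n z = 0"
  by (simp add: bump_grad_def bump_eq_0)

lemma bump_nonneg: "0 \<le> bump n z"
  by (simp add: bump_def flat_exp_nonneg)

lemma bump_0_pos: "norm z < 1 \<Longrightarrow> 0 < bump 0 z"
proof -
  assume "norm z < 1"
  then have "z \<bullet> z < 1" by (simp add: dot_square_norm power_less_one_iff)
  then show ?thesis by (simp add: bump_def flat_exp_def)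
qed

lemma bump_le_1: "bump 0 z \<le> 1"
  by (simp add: bump_def flat_exp_0_less_1 less_imp_le)

subsection \<open>Convolution with a compactly supported function\<close>

lemma integrable_continuous_compact_support:
  fixes f :: "'a::euclidean_space \<Rightarrow> 'b::{banach, second_countable_topology}"
  assumes "continuous_on UNIV f" "\<And>y. y \<notin> K \<Longrightarrow> f y = 0" "compact K"
  shows "integrable lborel f"
proof -
  have "integrable lborel (\<lambda>x. indicator K x *\<^sub>R f x)"
    using assms by (intro borel_integrable_compact continuous_on_subset[OF assms(1)]) auto
  moreover have "(\<lambda>x. indicator K x *\<^sub>R f x) = f"
    using assms(2) by (auto simp: indicator_def fun_eq_iff)
  ultimately show ?thesis by simp
qed

lemma uniformly_continuous_compact_support:
  fixes g :: "'a::euclidean_space \<Rightarrow> 'b::real_normed_vector"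
  assumes g: "continuous_on UNIV g" "\<And>z. R < norm z \<Longrightarrow> g z = 0" and e: "e > 0"
  obtains d where "d > 0" "\<And>z h. norm h < d \<Longrightarrow> norm (g (z + h) - g z) < e"
proof -
  have "uniformly_continuous_on (cball 0 (R + 1)) g"
    by (intro compact_uniformly_continuous continuous_on_subset[OF g(1)]) auto
  then obtain d where d: "d > 0"
    "\<And>x y. x \<in> cball 0 (R + 1) \<Longrightarrow> y \<in> cball 0 (R + 1) \<Longrightarrow> dist y x < d \<Longrightarrow> dist (g y) (g x) < e"
    unfolding uniformly_continuous_on_def using e by metis
  show ?thesis
  proof (rule that[of "min d (1/2)"])
    fix z h :: 'a assume h: "norm h < min d (1/2)"
    show "norm (g (z + h) - g z) < e"
    proof (cases "norm z \<le> R + 1/2")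
      case True
      then have "norm (z + h) \<le> R + 1" using h norm_triangle_ineq[of z h] by simp
      then have "dist (g (z + h)) (g z) < e"
        using True h by (intro d(2)) (simp_all only: mem_cball_0, auto simp: dist_norm)
      then show ?thesis by (simp add: dist_norm)
    next
      case False
      have "norm z \<le> norm (z + h) + norm h" using norm_triangle_ineq4[of "z + h" h] by simp
      then have "R < norm (z + h)" using h False by simp
      then show ?thesis using g(2)[of z] g(2)[of "z + h"] False e by simp
    qed
  qed (use d in auto)
qed

lemma lborel_integral_affine:
  fixes f :: "'a::euclidean_space \<Rightarrow> 'b::{banach, second_countable_topology}"
  assumes [measurable]: "f \<in> borel_measurable borel" and c: "c \<noteq> 0"
  shows "(LINT x|lborel. f x) = \<bar>c\<bar> ^ DIM('a) *\<^sub>R (LINT x|lborel. f (t + c *\<^sub>R x))"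
proof -
  have "(LINT x|lborel. f x) = (LINT x|density (distr lborel borel (\<lambda>x. t + c *\<^sub>R x)) (\<lambda>_. ennreal (\<bar>c\<bar> ^ DIM('a))). f x)"
    using lborel_affine[OF c, of t] by simp
  also have "\<dots> = (LINT x|distr lborel borel (\<lambda>x. t + c *\<^sub>R x). \<bar>c\<bar> ^ DIM('a) *\<^sub>R f x)"
    by (rule integral_density) auto
  also have "\<dots> = (LINT x|lborel. \<bar>c\<bar> ^ DIM('a) *\<^sub>R f (t + c *\<^sub>R x))"
    by (rule integral_distr) auto
  finally show ?thesis by simp
qed

definition conv :: "('a::euclidean_space \<Rightarrow> real) \<Rightarrow> ('a \<Rightarrow> real) \<Rightarrow> 'a \<Rightarrow> real" where
  "conv f k x = (LINT y|lborel. f y * k (x - y))"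

lemma continuous_on_reflect: "continuous_on UNIV k \<Longrightarrow> continuous_on UNIV (\<lambda>y. k (x - y :: 'a::real_normed_vector))"
  by (rule continuous_on_compose2[of UNIV k]) (auto intro: continuous_intros)

lemma conv_integrable:
  fixes f k :: "'a::euclidean_space \<Rightarrow> real"
  assumes "continuous_on UNIV f" "continuous_on UNIV k" "\<And>z. R < norm z \<Longrightarrow> k z = 0"
  shows "integrable lborel (\<lambda>y. f y * k (x - y))"
  by (rule integrable_continuous_compact_support[where K="cball x R"])
    (use assms in \<open>auto intro!: continuous_intros continuous_on_reflect simp: dist_norm\<close>)

lemma conv_commute:
  assumes "continuous_on UNIV f" "continuous_on UNIV k"
  shows "conv f k x = conv k f x"
proof -
  have "(\<lambda>y. f y * k (x - y)) \<in> borel_measurable borel"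
    by (intro borel_measurable_continuous_onI continuous_intros continuous_on_reflect assms)
  from lborel_integral_affine[OF this, of "- 1" x] show ?thesis
    by (simp add: conv_def mult.commute)
qed

text \<open>The difference quotients of the kernel converge uniformly, and only a bounded part of \<open>f\<close> is seen.\<close>

lemma conv_has_derivative:
  fixes f k :: "'a::euclidean_space \<Rightarrow> real"
  assumes f: "continuous_on UNIV f" and k: "\<And>z. (k has_derivative (\<lambda>v. gk z \<bullet> v)) (at z)"
    and gk: "continuous_on UNIV gk" and supp: "\<And>z. R < norm z \<Longrightarrow> k z = 0" "\<And>z. R < norm z \<Longrightarrow> gk z = 0"
  shows "(conv f k has_derivative (\<lambda>v. (LINT y|lborel. f y *\<^sub>R gk (x - y)) \<bullet> v)) (at x)"
proof -
  have kc: "continuous_on UNIV k"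
    using k by (meson has_derivative_continuous continuous_at_imp_continuous_on)
  have i1: "integrable lborel (\<lambda>y. f y * k (x - y))" for x
    by (rule conv_integrable[OF f kc supp(1)])
  have i2: "integrable lborel (\<lambda>y. f y *\<^sub>R gk (x - y))" for x
    by (rule integrable_continuous_compact_support[where K="cball x R"])
      (use supp in \<open>auto intro!: continuous_intros continuous_on_reflect f gk simp: dist_norm\<close>)
  define A where "A = (LINT y|lborel. indicator (cball x (R + 1)) y *\<^sub>R \<bar>f y\<bar>)"
  have iA: "integrable lborel (\<lambda>y. indicator (cball x (R + 1)) y *\<^sub>R \<bar>f y\<bar>)"
    by (intro borel_integrable_compact continuous_intros continuous_on_subset[OF f]) auto
  have A: "A \<ge> 0" unfolding A_def by (intro integral_nonneg_AE) auto
  show ?thesis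
    unfolding has_derivative_at_alt
  proof (intro conjI allI impI)
    show "bounded_linear (\<lambda>v. (LINT y|lborel. f y *\<^sub>R gk (x - y)) \<bullet> v)"
      by (rule bounded_linear_inner_right)
    fix e :: real assume e: "e > 0"
    define e' where "e' = e / (A + 1)"
    have e': "e' > 0" using e A by (simp add: e'_def)
    obtain d where d: "d > 0" "\<And>z h. norm h < d \<Longrightarrow> norm (gk (z + h) - gk z) < e'"
      using uniformly_continuous_compact_support[OF gk supp(2) e'] by blast
    show "\<exists>d>0. \<forall>y. norm (y - x) < d \<longrightarrow>
        norm (conv f k y - conv f k x - (LINT y|lborel. f y *\<^sub>R gk (x - y)) \<bullet> (y - x)) \<le> e * norm (y - x)"
    proof (intro exI[of _ "min d 1"] conjI allI impI)
      fix x' assume x': "norm (x' - x) < min d 1"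
      define h where "h = x' - x"
      have x'h: "x' = x + h" by (simp add: h_def)
      have kest: "\<bar>k (z + h) - k z - gk z \<bullet> h\<bar> \<le> e' * norm h" for z
      proof -
        have "norm (k (z + h) - k z - (gk z \<bullet> ((z + h) - z))) \<le> norm ((z + h) - z) * e'"
        proof (rule differentiable_bound_linearization[of z "z + h" "ball z d" k "\<lambda>w v. gk w \<bullet> v"])
          fix w show "(k has_derivative (\<bullet>) (gk w)) (at w within ball z d)"
            using k[of w] by (rule has_derivative_at_withinI)
        next
          fix t :: real assume t: "t \<in> {0..1}"
          then have "t * norm h \<le> norm h" by (intro mult_left_le_one_le) auto
          then show "z + t *\<^sub>R (z + h - z) \<in> ball z d"
            using t x' by (auto simp: dist_norm h_def)
        next
          fix w assume "w \<in> ball z d"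
          then have "norm (w - z) < d" by (simp add: dist_norm norm_minus_commute)
          then have le: "norm (gk w - gk z) \<le> e'" using d(2)[of "w - z" z] by simp
          have "onorm ((\<bullet>) (gk w) - (\<bullet>) (gk z)) \<le> norm (gk w - gk z)"
            by (rule onorm_le) (simp add: Cauchy_Schwarz_ineq2 flip: inner_diff_left)
          then show "onorm ((\<bullet>) (gk w) - (\<bullet>) (gk z)) \<le> e'" using le by simp
        qed (use d in auto)
        then show ?thesis by (simp add: mult.commute)
      qed
      have eq: "conv f k x' - conv f k x - (LINT y|lborel. f y *\<^sub>R gk (x - y)) \<bullet> h
          = (LINT y|lborel. f y * k (x' - y) - f y * k (x - y) - (f y *\<^sub>R gk (x - y)) \<bullet> h)"
      proof -
        have "(LINT y|lborel. (f y *\<^sub>R gk (x - y)) \<bullet> h) = (LINT y|lborel. f y *\<^sub>R gk (x - y)) \<bullet> h"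
          by (rule integral_inner_left) (rule i2)
        moreover have "integrable lborel (\<lambda>y. (f y *\<^sub>R gk (x - y)) \<bullet> h)"
          by (rule integrable_inner_left) (rule i2)
        ultimately show ?thesis unfolding conv_def using i1 by simp
      qed
      have "norm (conv f k x' - conv f k x - (LINT y|lborel. f y *\<^sub>R gk (x - y)) \<bullet> h)
          \<le> (LINT y|lborel. norm (f y * k (x' - y) - f y * k (x - y) - (f y *\<^sub>R gk (x - y)) \<bullet> h))"
        unfolding eq by (rule integral_norm_bound)
      also have "\<dots> \<le> (LINT y|lborel. e' * norm h * (indicator (cball x (R + 1)) y *\<^sub>R \<bar>f y\<bar>))"
      proof (rule integral_mono)
        show "integrable lborel (\<lambda>y. norm (f y * k (x' - y) - f y * k (x - y) - (f y *\<^sub>R gk (x - y)) \<bullet> h))"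
          by (rule integrable_norm, rule Bochner_Integration.integrable_diff,
              rule Bochner_Integration.integrable_diff, rule i1, rule i1, rule integrable_inner_left, rule i2)
        show "integrable lborel (\<lambda>y. e' * norm h * (indicator (cball x (R + 1)) y *\<^sub>R \<bar>f y\<bar>))"
          by (rule integrable_mult_right[OF iA])
        fix y
        have eq: "f y * k (x' - y) - f y * k (x - y) - (f y *\<^sub>R gk (x - y)) \<bullet> h
            = f y * (k ((x - y) + h) - k (x - y) - gk (x - y) \<bullet> h)"
          by (simp add: x'h algebra_simps)
        show "norm (f y * k (x' - y) - f y * k (x - y) - (f y *\<^sub>R gk (x - y)) \<bullet> h)
            \<le> e' * norm h * (indicator (cball x (R + 1)) y *\<^sub>R \<bar>f y\<bar>)"
        proof (cases "y \<in> cball x (R + 1)")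
          case True
          then show ?thesis
            unfolding eq using mult_left_mono[OF kest[of "x - y"], of "\<bar>f y\<bar>"] by (simp add: abs_mult mult_ac)
        next
          case False
          then have "R + 1 < norm (x - y)" by (simp add: dist_norm)
          moreover have "norm (x - y) \<le> norm (x - y + h) + norm h"
            using norm_triangle_ineq4[of "x - y + h" h] by simp
          ultimately have "R < norm (x - y)" "R < norm (x - y + h)" using x' by (auto simp: h_def)
          then show ?thesis unfolding eq using supp False by simp
        qed
      qed
      also have "\<dots> = e' * norm h * A" unfolding A_def by simp
      also have "\<dots> \<le> e * norm h"
      proof -
        have "e' * A \<le> e" using A e by (simp add: e'_def field_simps)
        then show ?thesis using mult_right_mono[of "e' * A" e "norm h"] by (simp add: mult_ac)
      qed
      finally show "norm (conv f k x' - conv f k x - (LINT y|lborel. f y *\<^sub>R gk (x - y)) \<bullet> (x' - x)) \<le> e * norm (x' - x)"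
        by (simp add: h_def)
    qed (use d in auto)
  qed
qed

subsection \<open>The standard mollifier\<close>

definition moll :: "real \<Rightarrow> 'a::euclidean_space \<Rightarrow> real" where
  "moll \<delta> z = bump 0 (z /\<^sub>R \<delta>) / (\<delta> ^ DIM('a) * (LINT z|lborel. bump 0 (z::'a)))"

definition moll_grad :: "real \<Rightarrow> 'a::euclidean_space \<Rightarrow> 'a" where
  "moll_grad \<delta> z = (1 / (\<delta> ^ DIM('a) * (LINT z|lborel. bump 0 (z::'a)))) *\<^sub>R (bump_grad 0 (z /\<^sub>R \<delta>) /\<^sub>R \<delta>)"

abbreviation mollify :: "real \<Rightarrow> ('a::euclidean_space \<Rightarrow> real) \<Rightarrow> 'a \<Rightarrow> real" where
  "mollify \<delta> f \<equiv> conv f (moll \<delta>)"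

definition mollify_grad :: "real \<Rightarrow> ('a::euclidean_space \<Rightarrow> real) \<Rightarrow> 'a \<Rightarrow> 'a" where
  "mollify_grad \<delta> f x = (LINT y|lborel. f y *\<^sub>R moll_grad \<delta> (x - y))"

lemma integrable_bump: "integrable lborel (bump n :: 'a::euclidean_space \<Rightarrow> real)"
  by (rule integrable_continuous_compact_support[OF continuous_on_bump, of "cball 0 1"]) (auto intro: bump_eq_0)

lemma bump_integral_pos: "0 < (LINT z|lborel. bump 0 (z::'a::euclidean_space))"
proof -
  have "(LINT z|lborel. bump 0 (z::'a)) \<noteq> 0"
  proof
    assume "(LINT z|lborel. bump 0 (z::'a)) = 0"
    then have "AE z in lborel. bump 0 (z::'a) = 0"
      using integrable_bump bump_nonneg by (subst (asm) integral_nonneg_eq_0_iff_AE) auto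
    then have "AE z in lborel. \<not> norm (z::'a) < 1"
      by eventually_elim (use bump_0_pos in force)
    then have "emeasure lborel {z \<in> space lborel. norm (z::'a) < 1} = 0"
      by (rule emeasure_eq_0_AE)
    moreover have "{z \<in> space lborel. norm (z::'a) < 1} = ball 0 1" by auto
    ultimately have "emeasure lborel (ball (0::'a) 1) = 0" by simp
    then show False using unit_ball_vol_pos[of "real DIM('a)"] by (simp add: emeasure_ball)
  qed
  moreover have "0 \<le> (LINT z|lborel. bump 0 (z::'a))"
    by (intro integral_nonneg_AE AE_I2 bump_nonneg)
  ultimately show ?thesis by simp
qed

lemma moll_nonneg: "\<delta> > 0 \<Longrightarrow> 0 \<le> moll \<delta> z"
  unfolding moll_def using bump_integral_pos[where 'a='a]
  by (intro divide_nonneg_nonneg mult_nonneg_nonneg bump_nonneg) auto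

lemma continuous_on_moll: "continuous_on S (moll \<delta>)"
proof -
  have "continuous_on S (\<lambda>z. bump 0 (z /\<^sub>R \<delta>))"
    by (rule continuous_on_compose2[OF continuous_on_bump[of UNIV]]) (auto intro: continuous_intros)
  then show ?thesis unfolding moll_def[abs_def] divide_inverse by (intro continuous_intros)
qed

lemma continuous_on_moll_grad: "continuous_on S (moll_grad \<delta>)"
proof -
  have "continuous_on S (\<lambda>z. bump_grad 0 (z /\<^sub>R \<delta>))"
    by (rule continuous_on_compose2[OF continuous_on_bump_grad[of UNIV]]) (auto intro: continuous_intros)
  then show ?thesis unfolding moll_grad_def[abs_def] by (intro continuous_intros)
qed

lemma scaled_norm_ge_1: "\<delta> > 0 \<Longrightarrow> \<delta> \<le> norm z \<Longrightarrow> 1 \<le> norm (z /\<^sub>R \<delta>)"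
  by (simp add: field_simps)

lemma moll_eq_0: "\<delta> > 0 \<Longrightarrow> \<delta> \<le> norm z \<Longrightarrow> moll \<delta> z = 0"
  unfolding moll_def using bump_eq_0[OF scaled_norm_ge_1] by (metis div_0)

lemma moll_grad_eq_0: "\<delta> > 0 \<Longrightarrow> \<delta> \<le> norm z \<Longrightarrow> moll_grad \<delta> z = 0"
  unfolding moll_grad_def using bump_grad_eq_0[OF scaled_norm_ge_1] by (metis scaleR_zero_right)

lemma moll_has_derivative:
  assumes "\<delta> > 0"
  shows "(moll \<delta> has_derivative (\<lambda>v. moll_grad \<delta> z \<bullet> v)) (at z)"
proof -
  have "((\<lambda>z::'a. z /\<^sub>R \<delta>) has_derivative (\<lambda>v. v /\<^sub>R \<delta>)) (at z)"
    by (auto intro!: derivative_eq_intros)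
  from has_derivative_compose[OF this bump_has_derivative[of 0 "z /\<^sub>R \<delta>"]]
  have "((\<lambda>z::'a. bump 0 (z /\<^sub>R \<delta>)) has_derivative (\<lambda>v. bump_grad 0 (z /\<^sub>R \<delta>) \<bullet> (v /\<^sub>R \<delta>))) (at z)" .
  from has_derivative_mult_right[OF this, of "1 / (\<delta> ^ DIM('a) * (LINT z|lborel. bump 0 (z::'a)))"]
  show ?thesis
    by (simp add: moll_def[abs_def] moll_grad_def mult_ac)
qed

lemma integrable_moll: "\<delta> > 0 \<Longrightarrow> integrable lborel (moll \<delta> :: 'a::euclidean_space \<Rightarrow> real)"
  by (rule integrable_continuous_compact_support[OF continuous_on_moll, of "cball 0 \<delta>"]) (auto intro: moll_eq_0)

lemma moll_integral:
  assumes "\<delta> > 0"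
  shows "(LINT z|lborel. moll \<delta> (z::'a::euclidean_space)) = 1"
proof -
  have "(moll \<delta> :: 'a \<Rightarrow> real) \<in> borel_measurable borel"
    by (rule borel_measurable_continuous_onI[OF continuous_on_moll])
  from lborel_integral_affine[OF this, of \<delta> 0] assms
  have "(LINT z|lborel. moll \<delta> (z::'a)) = \<delta> ^ DIM('a) * (LINT x|lborel. moll \<delta> (\<delta> *\<^sub>R x :: 'a))"
    by simp
  also have "(\<lambda>x. moll \<delta> (\<delta> *\<^sub>R x :: 'a)) = (\<lambda>x. bump 0 x / (\<delta> ^ DIM('a) * (LINT z|lborel. bump 0 (z::'a))))"
    using assms by (simp add: moll_def)
  finally show ?thesis using assms bump_integral_pos[where 'a='a] by simp
qed

lemma mollify_alt:
  assumes "continuous_on UNIV f"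
  shows "mollify \<delta> f x = (LINT z|lborel. moll \<delta> z * f (x - z))"
  using conv_commute[OF assms continuous_on_moll] by (simp add: conv_def)

lemma mollify_alt_integrable:
  assumes "continuous_on UNIV f" "\<delta> > 0"
  shows "integrable lborel (\<lambda>z. moll \<delta> z * f (x - z))"
  by (rule integrable_continuous_compact_support[where K="cball 0 \<delta>"])
    (use assms in \<open>auto intro!: continuous_intros continuous_on_reflect continuous_on_moll moll_eq_0\<close>)

text \<open>The mollification is an average over the ball of radius \<open>\<delta>\<close>.\<close>

lemma mollify_diff_le:
  fixes f :: "'a::euclidean_space \<Rightarrow> real"
  assumes f: "continuous_on UNIV f" and \<delta>: "\<delta> > 0" and le: "\<And>z. norm z < \<delta> \<Longrightarrow> \<bar>f (x - z) - c\<bar> \<le> e"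
  shows "\<bar>mollify \<delta> f x - c\<bar> \<le> e"
proof -
  have "mollify \<delta> f x - c = (LINT z|lborel. moll \<delta> z * f (x - z)) - (LINT z|lborel. moll \<delta> (z::'a) * c)"
    using moll_integral[OF \<delta>, where 'a='a] by (simp add: mollify_alt[OF f])
  also have "\<dots> = (LINT z|lborel. moll \<delta> z * (f (x - z) - c))"
    using mollify_alt_integrable[OF f \<delta>] integrable_moll[OF \<delta>, where 'a='a]
    by (simp add: right_diff_distrib)
  finally have eq: "mollify \<delta> f x - c = (LINT z|lborel. moll \<delta> z * (f (x - z) - c))" .
  have "norm (mollify \<delta> f x - c) \<le> (LINT z|lborel. norm (moll \<delta> z * (f (x - z) - c)))"
    unfolding eq by (rule integral_norm_bound)
  also have "\<dots> \<le> (LINT z|lborel. moll \<delta> (z::'a) * e)"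
  proof (rule integral_mono)
    show "integrable lborel (\<lambda>z. norm (moll \<delta> z * (f (x - z) - c)))"
      using mollify_alt_integrable[OF f \<delta>] integrable_moll[OF \<delta>, where 'a='a]
      by (intro integrable_norm) (simp add: right_diff_distrib)
    show "integrable lborel (\<lambda>z::'a. moll \<delta> z * e)" using integrable_moll[OF \<delta>, where 'a='a] by simp
    fix z
    show "norm (moll \<delta> z * (f (x - z) - c)) \<le> moll \<delta> z * e"
    proof (cases "norm z < \<delta>")
      case True
      then show ?thesis using le[OF True] moll_nonneg[OF \<delta>, of z] by (simp add: abs_mult mult_left_mono)
    next
      case False
      then show ?thesis using moll_eq_0[OF \<delta>, of z] by simp
    qed
  qed
  also have "\<dots> = e" using moll_integral[OF \<delta>, where 'a='a] by simp
  finally show ?thesis by simp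
qed

lemma mollify_eq_0:
  assumes "\<delta> > 0" "\<And>y. norm (y - x) < \<delta> \<Longrightarrow> f y = 0"
  shows "mollify \<delta> f x = 0"
proof -
  have "f y * moll \<delta> (x - y) = 0" for y
    using assms(2)[of y] moll_eq_0[OF assms(1), of "x - y"] by (cases "norm (y - x) < \<delta>") (auto simp: norm_minus_commute)
  then have "(\<lambda>y. f y * moll \<delta> (x - y)) = (\<lambda>_. 0)" by blast
  then show ?thesis by (simp add: conv_def del: mult_eq_0_iff)
qed

lemma lipschitz_imp_continuous: "L-lipschitz_on UNIV f \<Longrightarrow> continuous_on UNIV f"
  by (rule lipschitz_on_continuous_on)

lemma mollify_lipschitz_diff_le:
  assumes f: "L-lipschitz_on UNIV f" and \<delta>: "\<delta> > 0"
  shows "\<bar>mollify \<delta> f x - f x\<bar> \<le> L * \<delta>"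
proof (rule mollify_diff_le[OF lipschitz_imp_continuous[OF f] \<delta>])
  fix z :: 'a assume "norm z < \<delta>"
  then have "L * norm z \<le> L * \<delta>" using lipschitz_on_nonneg[OF f] by (intro mult_left_mono) auto
  then show "\<bar>f (x - z) - f x\<bar> \<le> L * \<delta>"
    using lipschitz_onD[OF f, of "x - z" x] by (simp add: dist_norm)
qed

lemma mollify_lipschitz:
  assumes f: "L-lipschitz_on UNIV f" and \<delta>: "\<delta> > 0"
  shows "L-lipschitz_on UNIV (mollify \<delta> f)"
proof (rule lipschitz_onI)
  fix x y :: 'a
  note c = lipschitz_imp_continuous[OF f]
  have eq: "mollify \<delta> f x - mollify \<delta> f y = (LINT z|lborel. moll \<delta> z * f (x - z) - moll \<delta> z * f (y - z))"
    using mollify_alt_integrable[OF c \<delta>] by (simp add: mollify_alt[OF c])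
  have "norm (mollify \<delta> f x - mollify \<delta> f y) \<le> (LINT z|lborel. norm (moll \<delta> z * f (x - z) - moll \<delta> z * f (y - z)))"
    unfolding eq by (rule integral_norm_bound)
  also have "\<dots> \<le> (LINT z|lborel. moll \<delta> (z::'a) * (L * dist x y))"
  proof (rule integral_mono)
    show "integrable lborel (\<lambda>z. norm (moll \<delta> z * f (x - z) - moll \<delta> z * f (y - z)))"
      using mollify_alt_integrable[OF c \<delta>] by (intro integrable_norm Bochner_Integration.integrable_diff)
    show "integrable lborel (\<lambda>z::'a. moll \<delta> z * (L * dist x y))"
      using integrable_moll[OF \<delta>, where 'a='a] by simp
    fix z
    have "norm (f (x - z) - f (y - z)) \<le> L * dist x y"
      using lipschitz_onD[OF f, of "x - z" "y - z"] by (simp add: dist_norm)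
    then show "norm (moll \<delta> z * f (x - z) - moll \<delta> z * f (y - z)) \<le> moll \<delta> z * (L * dist x y)"
      using moll_nonneg[OF \<delta>, of z] by (simp add: abs_mult mult_left_mono flip: right_diff_distrib)
  qed
  also have "\<dots> = L * dist x y" using moll_integral[OF \<delta>, where 'a='a] by simp
  finally show "dist (mollify \<delta> f x) (mollify \<delta> f y) \<le> L * dist x y" by (simp add: dist_norm)
qed (rule lipschitz_on_nonneg[OF f])

lemma mollify_has_derivative:
  assumes "continuous_on UNIV f" "\<delta> > 0"
  shows "(mollify \<delta> f has_derivative (\<lambda>v. mollify_grad \<delta> f x \<bullet> v)) (at x)"
  unfolding mollify_grad_def
  by (rule conv_has_derivative[where R=\<delta>])
    (use assms in \<open>auto intro: moll_has_derivative continuous_on_moll_grad moll_eq_0 moll_grad_eq_0\<close>)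

lemma lipschitz_grad_norm_le:
  fixes f :: "'a::euclidean_space \<Rightarrow> real"
  assumes f: "L-lipschitz_on UNIV f" and D: "(f has_derivative (\<lambda>v. g \<bullet> v)) (at x)"
  shows "norm g \<le> L"
proof (cases "g = 0")
  case True then show ?thesis using lipschitz_on_nonneg[OF f] by simp
next
  case False
  have "((\<lambda>t. x + t *\<^sub>R g) has_derivative (\<lambda>t. t *\<^sub>R g)) (at 0)"
    by (auto intro!: derivative_eq_intros)
  from has_derivative_compose[OF this, of f "\<lambda>v. g \<bullet> v"] D
  have "((\<lambda>t. f (x + t *\<^sub>R g)) has_derivative (\<lambda>t. t * (g \<bullet> g))) (at 0)" by simp
  moreover have "(\<lambda>t. t * (g \<bullet> g)) = (*) (g \<bullet> g)" by (auto simp: fun_eq_iff)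
  ultimately have "((\<lambda>t. f (x + t *\<^sub>R g)) has_real_derivative (g \<bullet> g)) (at 0)"
    by (simp add: has_field_derivative_def)
  then have "((\<lambda>h. (f (x + h *\<^sub>R g) - f x) / h) \<longlongrightarrow> g \<bullet> g) (at 0)"
    by (simp add: DERIV_def)
  moreover have "eventually (\<lambda>h. (f (x + h *\<^sub>R g) - f x) / h \<le> L * norm g) (at 0)"
  proof (rule eventually_at_filter[THEN iffD2], rule always_eventually, intro allI impI)
    fix h :: real assume "h \<noteq> 0"
    have "\<bar>f (x + h *\<^sub>R g) - f x\<bar> \<le> L * (\<bar>h\<bar> * norm g)"
      using lipschitz_onD[OF f, of "x + h *\<^sub>R g" x] by (simp add: dist_norm)
    then have "\<bar>(f (x + h *\<^sub>R g) - f x) / h\<bar> \<le> L * norm g"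
      using \<open>h \<noteq> 0\<close> by (simp add: field_simps)
    then show "(f (x + h *\<^sub>R g) - f x) / h \<le> L * norm g" by linarith
  qed
  ultimately have "g \<bullet> g \<le> L * norm g"
    by (intro tendsto_upperbound) auto
  then show ?thesis using False by (simp add: dot_square_norm power2_eq_square)
qed

lemma mollify_grad_norm_le:
  assumes "L-lipschitz_on UNIV f" "\<delta> > 0"
  shows "norm (mollify_grad \<delta> f x) \<le> L"
  by (rule lipschitz_grad_norm_le[OF mollify_lipschitz[OF assms]
        mollify_has_derivative[OF lipschitz_imp_continuous[OF assms(1)] assms(2)]])

text \<open>The gradient of the mollification reproduces affine functions exactly, and the remainder of the
  first-order expansion is \<open>o(\<delta>)\<close> on the support of a kernel whose gradient has \<open>L\<^sup>1\<close> norm \<open>O(1/\<delta>)\<close>.\<close>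

lemma mollify_grad_tendsto:
  fixes f :: "'a::euclidean_space \<Rightarrow> real"
  assumes f: "continuous_on UNIV f" and D: "(f has_derivative (\<lambda>v. g \<bullet> v)) (at x)"
  shows "((\<lambda>\<delta>. mollify_grad \<delta> f x) \<longlongrightarrow> g) (at_right 0)"
proof -
  define I where "I = (LINT z|lborel. bump 0 (z::'a))"
  have I: "I > 0" using bump_integral_pos by (simp add: I_def)
  define l where "l y = f x + g \<bullet> (y - x)" for y
  have lc: "continuous_on UNIV l" unfolding l_def[abs_def] by (intro continuous_intros)
  \<comment> \<open>Mollifying the affine function \<open>l\<close> adds a constant to it.\<close>
  have l_grad: "mollify_grad \<delta> l x = g" if \<delta>: "\<delta> > 0" for \<delta>
  proof -
    have "mollify \<delta> l y = l y + (mollify \<delta> l x - l x)" for y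
    proof -
      have "mollify \<delta> l y - mollify \<delta> l x = (LINT z|lborel. moll \<delta> z * l (y - z) - moll \<delta> z * l (x - z))"
        using mollify_alt_integrable[OF lc \<delta>] by (simp add: mollify_alt[OF lc])
      also have "\<dots> = (LINT z|lborel. moll \<delta> (z::'a) * (g \<bullet> (y - x)))"
        by (rule Bochner_Integration.integral_cong) (auto simp: l_def algebra_simps)
      also have "\<dots> = g \<bullet> (y - x)" using moll_integral[OF \<delta>, where 'a='a] by simp
      finally show ?thesis by (simp add: l_def)
    qed
    then have eq: "mollify \<delta> l = (\<lambda>y. l y + (mollify \<delta> l x - l x))" by blast
    have "((\<lambda>y. l y + (mollify \<delta> l x - l x)) has_derivative (\<lambda>v. g \<bullet> v)) (at x)"
      unfolding l_def by (auto intro!: derivative_eq_intros)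
    then have "(mollify \<delta> l has_derivative (\<lambda>v. g \<bullet> v)) (at x)" using eq by simp
    from has_derivative_unique[OF this mollify_has_derivative[OF lc \<delta>]]
    have "g \<bullet> v = mollify_grad \<delta> l x \<bullet> v" for v by meson
    then show ?thesis by (metis vector_eq_rdot)
  qed
  obtain K where K: "\<And>z::'a. norm (bump_grad 0 z) \<le> K" "K \<ge> 0"
  proof -
    have "compact (bump_grad 0 ` cball (0::'a) 1)"
      by (intro compact_continuous_image continuous_on_bump_grad) auto
    then obtain K where K: "\<forall>z\<in>cball (0::'a) 1. norm (bump_grad 0 z) \<le> K"
      by (force dest!: compact_imp_bounded simp: bounded_iff)
    have K0: "0 \<le> K" using K[rule_format, of 0] order_trans[OF norm_ge_zero] by simp
    have "norm (bump_grad 0 z) \<le> K" for z :: 'a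
      using K K0 bump_grad_eq_0[of z 0] by (cases "norm z \<le> 1") auto
    then show ?thesis using that K0 by blast
  qed
  define V where "V = unit_ball_vol DIM('a)"
  have V: "V \<ge> 0" by (simp add: V_def)
  show ?thesis
  proof (rule tendstoI)
    fix e :: real assume e: "e > 0"
    define c where "c = V * K / I"
    define \<eta> where "\<eta> = e / (2 * (c + 1))"
    have c: "0 \<le> c" using V K I by (simp add: c_def)
    then have \<eta>: "\<eta> > 0" using e by (simp add: \<eta>_def)
    obtain d where d: "d > 0" "\<And>y. norm (y - x) < d \<Longrightarrow> \<bar>f y - l y\<bar> \<le> \<eta> * norm (y - x)"
      using D \<eta> unfolding has_derivative_at_alt l_def by (auto simp: diff_diff_eq)
    show "eventually (\<lambda>\<delta>. dist (mollify_grad \<delta> f x) g < e) (at_right 0)"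
      unfolding eventually_at_right_field
    proof (intro exI[of _ d] conjI allI impI)
      fix \<delta> assume \<delta>: "0 < \<delta>" "\<delta> < d"
      have i: "integrable lborel (\<lambda>y. h y *\<^sub>R moll_grad \<delta> (x - y))" if "continuous_on UNIV h" for h
        by (rule integrable_continuous_compact_support[where K="cball x \<delta>"])
          (use \<delta> in \<open>auto intro!: continuous_intros continuous_on_reflect continuous_on_moll_grad moll_grad_eq_0 that simp: dist_norm\<close>)
      have "mollify_grad \<delta> f x - g = mollify_grad \<delta> f x - mollify_grad \<delta> l x" using l_grad[OF \<delta>(1)] by simp
      also have "\<dots> = (LINT y|lborel. f y *\<^sub>R moll_grad \<delta> (x - y) - l y *\<^sub>R moll_grad \<delta> (x - y))"
        unfolding mollify_grad_def using i f lc by simp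
      finally have eq: "mollify_grad \<delta> f x - g = (LINT y|lborel. f y *\<^sub>R moll_grad \<delta> (x - y) - l y *\<^sub>R moll_grad \<delta> (x - y))" .
      have "norm (mollify_grad \<delta> f x - g) \<le> (LINT y|lborel. norm (f y *\<^sub>R moll_grad \<delta> (x - y) - l y *\<^sub>R moll_grad \<delta> (x - y)))"
        unfolding eq by (rule integral_norm_bound)
      also have "\<dots> \<le> (LINT y|lborel. \<eta> * K / (\<delta> ^ DIM('a) * I) * indicator (cball x \<delta>) y)"
      proof (rule integral_mono)
        show "integrable lborel (\<lambda>y. norm (f y *\<^sub>R moll_grad \<delta> (x - y) - l y *\<^sub>R moll_grad \<delta> (x - y)))"
          using i f lc by (intro integrable_norm Bochner_Integration.integrable_diff)
        show "integrable lborel (\<lambda>y. \<eta> * K / (\<delta> ^ DIM('a) * I) * indicator (cball x \<delta>) y)"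
          using emeasure_bounded_finite[OF bounded_cball, of x \<delta>]
          by (intro integrable_mult_right integrable_real_indicator) auto
        fix y
        show "norm (f y *\<^sub>R moll_grad \<delta> (x - y) - l y *\<^sub>R moll_grad \<delta> (x - y))
            \<le> \<eta> * K / (\<delta> ^ DIM('a) * I) * indicator (cball x \<delta>) y"
        proof (cases "norm (x - y) < \<delta>")
          case False
          then have "moll_grad \<delta> (x - y) = 0" by (intro moll_grad_eq_0 \<delta>(1)) simp
          then show ?thesis using \<eta> K \<delta> I by (simp add: indicator_def)
        next
          case True
          have "norm (f y *\<^sub>R moll_grad \<delta> (x - y) - l y *\<^sub>R moll_grad \<delta> (x - y)) = \<bar>f y - l y\<bar> * norm (moll_grad \<delta> (x - y))"
            by (simp flip: scaleR_diff_left)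
          also have "\<dots> \<le> (\<eta> * \<delta>) * (1 / (\<delta> ^ DIM('a) * I) * (K / \<delta>))"
          proof (rule mult_mono)
            have "norm (y - x) < d" using True \<delta> by (simp add: norm_minus_commute)
            then have "\<bar>f y - l y\<bar> \<le> \<eta> * norm (y - x)" by (rule d(2))
            also have "\<dots> \<le> \<eta> * \<delta>" using True \<eta> by (simp add: norm_minus_commute)
            finally show "\<bar>f y - l y\<bar> \<le> \<eta> * \<delta>" .
            have "norm (bump_grad 0 ((x - y) /\<^sub>R \<delta>)) / \<delta> \<le> K / \<delta>" using K \<delta> by (intro divide_right_mono) auto
            then show "norm (moll_grad \<delta> (x - y)) \<le> 1 / (\<delta> ^ DIM('a) * I) * (K / \<delta>)"
              unfolding moll_grad_def I_def[symmetric] using \<delta> I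
              by (auto simp: divide_inverse mult.commute intro!: mult_left_mono)
          qed (use \<eta> \<delta> in auto)
          also have "\<dots> = \<eta> * K / (\<delta> ^ DIM('a) * I)" using \<delta> by simp
          finally show ?thesis using True by (simp add: dist_norm)
        qed
      qed
      also have "\<dots> = \<eta> * K / (\<delta> ^ DIM('a) * I) * (V * \<delta> ^ DIM('a))"
        using \<delta> by (simp add: V_def content_cball)
      also have "\<dots> = \<eta> * c" using \<delta> by (simp add: c_def)
      also have "\<dots> \<le> \<eta> * (c + 1)" using \<eta> by simp
      also have "\<dots> = e / 2" using c by (simp add: \<eta>_def field_simps)
      also have "\<dots> < e" using e by simp
      finally show "dist (mollify_grad \<delta> f x) g < e" by (simp add: dist_norm)
    qed (use d in auto)
  qed
qed

section \<open>Lebesgue points\<close>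

definition ball_int :: "('a::euclidean_space \<Rightarrow> real) \<Rightarrow> 'a \<Rightarrow> real \<Rightarrow> real" where
  "ball_int h x r = (LINT y|lborel. indicator (cball x r) y * \<bar>h y\<bar>)"

lemma ball_int_integrable:
  fixes h :: "'a::euclidean_space \<Rightarrow> real"
  assumes "integrable lborel h"
  shows "integrable lborel (\<lambda>y. indicator (cball x r) y * \<bar>h y\<bar>)"
  using integrable_mult_indicator[of "cball x r" lborel "\<lambda>y. \<bar>h y\<bar>"] assms by simp

text \<open>The balls over which the average exceeds \<open>l\<close> contain, by Vitali's covering lemma, a disjoint
  family whose fivefold enlargements cover all their centres.\<close>

lemma maximal_inequality:
  fixes h :: "'a::euclidean_space \<Rightarrow> real"
  assumes h: "integrable lborel h" and l: "l > 0"
  obtains U where "U \<in> lmeasurable" "{x. \<exists>r. 0 < r \<and> r \<le> 1 \<and> l * r ^ DIM('a) < ball_int h x r} \<subseteq> U"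
    "measure lebesgue U \<le> unit_ball_vol DIM('a) * 5 ^ DIM('a) / l * (LINT y|lborel. \<bar>h y\<bar>)"
proof -
  define K where "K = {x. \<exists>r. 0 < r \<and> r \<le> 1 \<and> l * r ^ DIM('a) < ball_int h x r}"
  have "\<forall>x\<in>K. \<exists>r. 0 < r \<and> r \<le> 1 \<and> l * r ^ DIM('a) < ball_int h x r" by (simp add: K_def)
  from bchoice[OF this] obtain r
    where r: "\<And>x. x \<in> K \<Longrightarrow> 0 < r x \<and> r x \<le> 1 \<and> l * r x ^ DIM('a) < ball_int h x (r x)"
    by blast
  have r1: "\<And>x. x \<in> K \<Longrightarrow> 0 < r x \<and> r x \<le> 1" using r by blast
  obtain C where C: "countable C" "C \<subseteq> K"
     "pairwise (\<lambda>i j. disjnt (cball i (r i)) (cball j (r j))) C"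
     "\<And>i. i \<in> K \<Longrightarrow> \<exists>j. j \<in> C \<and> \<not> disjnt (cball i (r i)) (cball j (r j)) \<and> cball i (r i) \<subseteq> ball j (5 * r j)"
    using Vitali_covering_lemma_cballs_balls[of K r 1 "\<lambda>x. x", OF r1] by blast
  define c where "c = unit_ball_vol DIM('a) * 5 ^ DIM('a)"
  have fin: "measure lebesgue (\<Union>i\<in>I. ball i (5 * r i)) \<le> c / l * (LINT y|lborel. \<bar>h y\<bar>)"
    if I: "I \<subseteq> C" "finite I" for I
  proof -
    have rI: "0 < r i \<and> l * r i ^ DIM('a) < ball_int h i (r i)" if "i \<in> I" for i
      using r C(2) I that by blast
    have "measure lebesgue (\<Union>i\<in>I. ball i (5 * r i)) \<le> (\<Sum>i\<in>I. measure lebesgue (ball i (5 * r i)))"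
      by (rule measure_UNION_le) (use I in auto)
    also have "\<dots> \<le> (\<Sum>i\<in>I. c / l * ball_int h i (r i))"
    proof (rule sum_mono)
      fix i assume i: "i \<in> I"
      have "measure lebesgue (ball i (5 * r i)) = c * r i ^ DIM('a)"
        using rI[OF i] by (simp add: content_ball c_def power_mult_distrib)
      also have "\<dots> = c / l * (l * r i ^ DIM('a))" using l by simp
      also have "\<dots> \<le> c / l * ball_int h i (r i)"
        using rI[OF i] l by (intro mult_left_mono) (auto simp: c_def)
      finally show "measure lebesgue (ball i (5 * r i)) \<le> c / l * ball_int h i (r i)" .
    qed
    also have "\<dots> = c / l * (LINT y|lborel. (\<Sum>i\<in>I. indicator (cball i (r i)) y * \<bar>h y\<bar>))"
      using ball_int_integrable[OF h] by (simp add: ball_int_def sum_distrib_left)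
    also have "\<dots> \<le> c / l * (LINT y|lborel. \<bar>h y\<bar>)"
    proof (intro mult_left_mono integral_mono)
      show "integrable lborel (\<lambda>y. \<Sum>i\<in>I. indicator (cball i (r i)) y * \<bar>h y\<bar>)"
        using ball_int_integrable[OF h] by (intro Bochner_Integration.integrable_sum)
      show "integrable lborel (\<lambda>y. \<bar>h y\<bar>)" using h by simp
      fix y
      have disj: "disjoint_family_on (\<lambda>i. cball i (r i)) I"
        using C(3) I(1) unfolding disjoint_family_on_def pairwise_def disjnt_def by blast
      have "(\<Sum>i\<in>I. indicator (cball i (r i)) y) = (indicator (\<Union>i\<in>I. cball i (r i)) y :: real)"
        by (rule indicator_UN_disjoint[OF I(2) disj, symmetric])
      then have "(\<Sum>i\<in>I. indicator (cball i (r i)) y * \<bar>h y\<bar>) = indicator (\<Union>i\<in>I. cball i (r i)) y * \<bar>h y\<bar>"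
        by (simp flip: sum_distrib_right)
      also have "\<dots> \<le> \<bar>h y\<bar>" by (simp add: indicator_def)
      finally show "(\<Sum>i\<in>I. indicator (cball i (r i)) y * \<bar>h y\<bar>) \<le> \<bar>h y\<bar>" .
    qed (use l in \<open>auto simp: c_def\<close>)
    finally show ?thesis .
  qed
  show ?thesis
  proof (rule that)
    show "(\<Union>i\<in>C. ball i (5 * r i)) \<in> lmeasurable"
      by (rule fmeasurable_UN_bound[OF C(1) _ fin]) auto
    show "measure lebesgue (\<Union>i\<in>C. ball i (5 * r i)) \<le> unit_ball_vol DIM('a) * 5 ^ DIM('a) / l * (LINT y|lborel. \<bar>h y\<bar>)"
      unfolding c_def[symmetric] by (rule measure_UN_bound[OF C(1) _ fin]) auto
    show "{x. \<exists>r. 0 < r \<and> r \<le> 1 \<and> l * r ^ DIM('a) < ball_int h x r} \<subseteq> (\<Union>i\<in>C. ball i (5 * r i))"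
    proof
      fix x assume "x \<in> {x. \<exists>r. 0 < r \<and> r \<le> 1 \<and> l * r ^ DIM('a) < ball_int h x r}"
      then have x: "x \<in> K" by (simp add: K_def)
      then obtain j where j: "j \<in> C" "cball x (r x) \<subseteq> ball j (5 * r j)" using C(4) by blast
      moreover have "x \<in> cball x (r x)" using r[OF x] by simp
      ultimately show "x \<in> (\<Union>i\<in>C. ball i (5 * r i))" by blast
    qed
  qed
qed

definition lebesgue_point :: "('a::euclidean_space \<Rightarrow> real) \<Rightarrow> 'a \<Rightarrow> bool" where
  "lebesgue_point G x \<longleftrightarrow>
    (\<forall>\<eta>>0. \<exists>d>0. \<forall>r. 0 < r \<and> r < d \<longrightarrow> (LINT y|lborel. indicator (cball x r) y * \<bar>G y - G x\<bar>) \<le> \<eta> * r ^ DIM('a))"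

lemma integrable_indicator_cball: "integrable lborel (\<lambda>y. indicator (cball x r) y * c :: real)"
  using emeasure_bounded_finite[OF bounded_cball, of x r]
  by (intro integrable_mult_left integrable_real_indicator) auto

text \<open>Continuous functions satisfy the claim everywhere; the maximal inequality controls the error
  made when an integrable function is replaced by a continuous one that is close in \<open>L\<^sup>1\<close>.\<close>

lemma negligible_not_lebesgue_point:
  fixes G :: "'a::euclidean_space \<Rightarrow> real"
  assumes G: "integrable lborel G"
    and u: "\<And>n::nat. continuous_on UNIV (u n)" "\<And>n. integrable lborel (u n)"
    and lim: "(\<lambda>n. LINT y|lborel. \<bar>u n y - G y\<bar>) \<longlonglongrightarrow> 0"
  shows "negligible {x. \<not> lebesgue_point G x}"
proof -
  define N where "N \<eta> = {x. \<forall>d>0. \<exists>r. 0 < r \<and> r < d \<and>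
    \<eta> * r ^ DIM('a) < (LINT y|lborel. indicator (cball x r) y * \<bar>G y - G x\<bar>)}" for \<eta>
  define V where "V = unit_ball_vol DIM('a)"
  have V: "V > 0" by (simp add: V_def)
  have "negligible (N \<eta>)" if \<eta>: "\<eta> > 0" for \<eta>
    unfolding negligible_outer_le
  proof (intro allI impI)
    fix e :: real assume e: "e > 0"
    \<comment> \<open>The two summands come from the maximal inequality at level \<open>\<eta>/3\<close> and from Markov's
      inequality at level \<open>\<eta>/(3 V)\<close>.\<close>
    define B where "B = 3 * V * 5 ^ DIM('a) / \<eta> + 3 * V / \<eta>"
    have B: "B > 0" using V \<eta> by (simp add: B_def add_pos_pos)
    obtain n where n: "(LINT y|lborel. \<bar>u n y - G y\<bar>) < e / B"
    proof -
      have "0 < e / B" using e B by simp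
      from LIMSEQ_D[OF lim this] obtain N where "\<forall>n\<ge>N. norm ((LINT y|lborel. \<bar>u n y - G y\<bar>) - 0) < e / B" by blast
      then have "norm ((LINT y|lborel. \<bar>u N y - G y\<bar>) - 0) < e / B" by blast
      then show ?thesis using that[of N] by simp
    qed
    define v where "v = u n"
    define A where "A = (LINT y|lborel. \<bar>v y - G y\<bar>)"
    have v: "continuous_on UNIV v" "integrable lborel v" using u by (auto simp: v_def)
    have vG: "integrable lborel (\<lambda>y. v y - G y)" using v G by simp
    obtain U where U: "U \<in> lmeasurable"
      "{x. \<exists>r. 0 < r \<and> r \<le> 1 \<and> \<eta> / 3 * r ^ DIM('a) < ball_int (\<lambda>y. v y - G y) x r} \<subseteq> U"
      "measure lebesgue U \<le> V * 5 ^ DIM('a) / (\<eta> / 3) * A"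
      using maximal_inequality[OF vG, of "\<eta> / 3"] \<eta> unfolding A_def V_def by auto
    define W where "W = {x \<in> space lborel. \<eta> / (3 * V) \<le> \<bar>v x - G x\<bar>}"
    have meas: "W \<in> sets borel"
      using vG unfolding W_def by measurable
    have Wle: "emeasure lborel W \<le> ennreal (3 * V / \<eta> * A)"
      using integral_Markov_inequality[of lborel "\<lambda>x. \<bar>v x - G x\<bar>" "\<eta> / (3 * V)"] vG V \<eta>
      by (simp add: W_def A_def)
    have W: "W \<in> lmeasurable" "measure lebesgue W \<le> 3 * V / \<eta> * A"
    proof -
      have A0: "0 \<le> 3 * V / \<eta> * A" using V \<eta> by (auto simp: A_def intro!: mult_nonneg_nonneg integral_nonneg_AE)
      have "emeasure lebesgue W \<le> ennreal (3 * V / \<eta> * A)" using Wle meas by simp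
      then show "W \<in> lmeasurable" "measure lebesgue W \<le> 3 * V / \<eta> * A"
        using meas A0 le_less_trans[OF \<open>emeasure lebesgue W \<le> _\<close> ennreal_less_top]
        by (simp_all add: fmeasurableI measure_def enn2real_leI)
    qed
    have "N \<eta> \<subseteq> U \<union> W"
    proof
      fix x assume x: "x \<in> N \<eta>"
      show "x \<in> U \<union> W"
      proof (rule ccontr)
        assume nin: "x \<notin> U \<union> W"
        then have nW: "\<bar>v x - G x\<bar> < \<eta> / (3 * V)" by (auto simp: W_def)
        have nU: "ball_int (\<lambda>y. v y - G y) x r \<le> \<eta> / 3 * r ^ DIM('a)" if "0 < r" "r \<le> 1" for r
        proof (rule ccontr)
          assume "\<not> ?thesis"
          then have "\<exists>r. 0 < r \<and> r \<le> 1 \<and> \<eta> / 3 * r ^ DIM('a) < ball_int (\<lambda>y. v y - G y) x r"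
            using that by (intro exI[of _ r]) simp
          then show False using U(2) nin by blast
        qed
        obtain d where d: "d > 0" "\<And>y. dist y x < d \<Longrightarrow> \<bar>v y - v x\<bar> < \<eta> / (3 * V)"
        proof -
          have "isCont v x" using v(1) by (simp add: continuous_on_eq_continuous_at)
          moreover have "0 < \<eta> / (3 * V)" using \<eta> V by simp
          ultimately have "eventually (\<lambda>y. dist (v y) (v x) < \<eta> / (3 * V)) (nhds x)"
            unfolding isCont_def tendsto_at_iff_tendsto_nhds by (rule tendstoD)
          then have "\<exists>d>0. \<forall>y. dist y x < d \<longrightarrow> dist (v y) (v x) < \<eta> / (3 * V)"
            by (simp add: eventually_nhds_metric)
          then obtain d where "d > 0" "\<forall>y. dist y x < d \<longrightarrow> dist (v y) (v x) < \<eta> / (3 * V)" by blast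
          then show ?thesis using that[of d] by (simp add: dist_real_def)
        qed
        have "\<forall>d>0. \<exists>r. 0 < r \<and> r < d \<and> \<eta> * r ^ DIM('a) < (LINT y|lborel. indicator (cball x r) y * \<bar>G y - G x\<bar>)"
          using x by (simp add: N_def)
        moreover have "min d 1 > 0" using d(1) by simp
        ultimately obtain r where r: "0 < r" "r < min d 1"
          "\<eta> * r ^ DIM('a) < (LINT y|lborel. indicator (cball x r) y * \<bar>G y - G x\<bar>)"
          by blast
        have "(LINT y|lborel. indicator (cball x r) y * \<bar>G y - G x\<bar>)
            \<le> (LINT y|lborel. indicator (cball x r) y * \<bar>v y - G y\<bar> + indicator (cball x r) y * (2 * \<eta> / (3 * V)))"
        proof (rule integral_mono)
          have "integrable lborel (\<lambda>y. indicator (cball x r) y * G y - indicator (cball x r) y * G x)"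
            using integrable_mult_indicator[of "cball x r" lborel G] G
            by (intro Bochner_Integration.integrable_diff integrable_indicator_cball) auto
          then have "integrable lborel (\<lambda>y. \<bar>indicator (cball x r) y * G y - indicator (cball x r) y * G x\<bar>)"
            by (rule integrable_abs)
          then show "integrable lborel (\<lambda>y. indicator (cball x r) y * \<bar>G y - G x\<bar>)"
            by (simp add: abs_mult flip: right_diff_distrib)
          show "integrable lborel (\<lambda>y. indicator (cball x r) y * \<bar>v y - G y\<bar> + indicator (cball x r) y * (2 * \<eta> / (3 * V)))"
            by (intro Bochner_Integration.integrable_add ball_int_integrable[OF vG] integrable_indicator_cball)
          fix y
          show "indicator (cball x r) y * \<bar>G y - G x\<bar>
              \<le> indicator (cball x r) y * \<bar>v y - G y\<bar> + indicator (cball x r) y * (2 * \<eta> / (3 * V))"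
          proof (cases "y \<in> cball x r")
            case True
            then have "\<bar>v y - v x\<bar> < \<eta> / (3 * V)" using r d(2)[of y] by (simp add: dist_commute)
            moreover have "2 * \<eta> / (3 * V) = \<eta> / (3 * V) + \<eta> / (3 * V)" by simp
            ultimately have "\<bar>G y - G x\<bar> \<le> \<bar>v y - G y\<bar> + 2 * \<eta> / (3 * V)" using nW by linarith
            then show ?thesis using True by simp
          qed simp
        qed
        also have "\<dots> = ball_int (\<lambda>y. v y - G y) x r + measure lborel (cball x r) * (2 * \<eta> / (3 * V))"
          unfolding ball_int_def
          by (subst Bochner_Integration.integral_add[OF ball_int_integrable[OF vG] integrable_indicator_cball]) simp
        also have "measure lborel (cball x r) * (2 * \<eta> / (3 * V)) = 2 * \<eta> / 3 * r ^ DIM('a)"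
          using r V by (simp add: content_cball V_def[symmetric])
        finally show False using r nU[of r] by (simp add: algebra_simps)
      qed
    qed
    moreover have "measure lebesgue (U \<union> W) \<le> e"
    proof -
      have "measure lebesgue (U \<union> W) \<le> measure lebesgue U + measure lebesgue W"
        using U(1) W(1) by (intro measure_Un_le) (auto simp: fmeasurableD)
      also have "\<dots> \<le> B * A"
        using U(3) W(2) by (simp add: B_def algebra_simps)
      also have "\<dots> \<le> B * (e / B)" using n B by (intro mult_left_mono) (auto simp: A_def v_def)
      finally show ?thesis using B by simp
    qed
    ultimately show "\<exists>T. N \<eta> \<subseteq> T \<and> T \<in> lmeasurable \<and> measure lebesgue T \<le> e"
      using U(1) W(1) by (intro exI[of _ "U \<union> W"]) auto
  qed
  then have "negligible (\<Union>k::nat. N (1 / real (Suc k)))"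
    by (intro negligible_countable_Union) auto
  moreover have "{x. \<not> lebesgue_point G x} \<subseteq> (\<Union>k::nat. N (1 / real (Suc k)))"
  proof
    fix x assume "x \<in> {x. \<not> lebesgue_point G x}"
    then obtain \<eta> where \<eta>: "\<eta> > 0" "\<And>d. d > 0 \<Longrightarrow> \<exists>r. 0 < r \<and> r < d \<and>
        \<eta> * r ^ DIM('a) < (LINT y|lborel. indicator (cball x r) y * \<bar>G y - G x\<bar>)"
      unfolding lebesgue_point_def by (auto simp: not_le)
    obtain k where k: "1 / real (Suc k) < \<eta>" by (rule nat_approx_posE[OF \<eta>(1)])
    have "\<exists>r. 0 < r \<and> r < d \<and> 1 / real (Suc k) * r ^ DIM('a) < (LINT y|lborel. indicator (cball x r) y * \<bar>G y - G x\<bar>)"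
      if d: "d > 0" for d
    proof -
      obtain r where r: "0 < r" "r < d" "\<eta> * r ^ DIM('a) < (LINT y|lborel. indicator (cball x r) y * \<bar>G y - G x\<bar>)"
        using \<eta>(2)[OF d] by blast
      have "1 / real (Suc k) * r ^ DIM('a) \<le> \<eta> * r ^ DIM('a)"
        using k r(1) by (intro mult_right_mono) auto
      then show ?thesis using r by (meson le_less_trans)
    qed
    then show "x \<in> (\<Union>k::nat. N (1 / real (Suc k)))" unfolding N_def by blast
  qed
  ultimately show ?thesis by (rule negligible_subset)
qed

section \<open>Rademacher's theorem\<close>

text \<open>The derivative in direction \<open>b\<close> of a convolution with \<open>f\<close> is bounded by the Lipschitz constant times
  the \<open>L\<^sup>1\<close> norm of the kernel, so it is represented by a density: the weak derivative of \<open>f\<close>. Restricting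
  to a ball of radius \<open>R\<close> makes the underlying measure finite.\<close>

lemma lipschitz_weak_derivative:
  fixes f :: "'a::euclidean_space \<Rightarrow> real" and b :: 'a
  assumes f: "L-lipschitz_on UNIV f"
  obtains g u where "integrable lborel g" "\<And>n::nat. continuous_on UNIV (u n)" "\<And>n. integrable lborel (u n)"
    "(\<lambda>n. LINT y|lborel. \<bar>u n y - g y\<bar>) \<longlonglongrightarrow> 0"
    "\<And>\<delta> x. \<delta> > 0 \<Longrightarrow> norm x + \<delta> \<le> R \<Longrightarrow> mollify_grad \<delta> f x \<bullet> b = (LINT y|lborel. moll \<delta> (x - y) * g y)"
proof -
  \<comment> \<open>Convolving with the reflected function makes the base point zero serve all kernels: for
    \<open>\<psi> = moll \<delta> (x - _)\<close> the value of \<open>conv \<psi> f'\<close> at \<open>h\<close> is \<open>mollify \<delta> f (x - h)\<close>.\<close>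
  define f' where "f' z = f (- z)" for z
  have fc: "continuous_on UNIV f" using f by (rule lipschitz_imp_continuous)
  have f': "continuous_on UNIV f'"
    unfolding f'_def by (rule continuous_on_compose2[OF fc]) (auto intro: continuous_intros)
  define M where "M = restrict_space lborel (cball (0::'a) R)"
  define V where "V = {\<psi>. continuous_on UNIV \<psi> \<and> (\<forall>y. y \<notin> cball 0 R \<longrightarrow> \<psi> y = 0) \<and> conv \<psi> f' differentiable (at 0)}"
  define T where "T \<psi> = - frechet_derivative (conv \<psi> f') (at 0) b" for \<psi>
  have Vi: "integrable lborel (\<lambda>y. \<psi> y * f' (x - y))" if "\<psi> \<in> V" for \<psi> x
    by (rule integrable_continuous_compact_support[where K="cball 0 R"])
      (use that in \<open>auto simp: V_def intro!: continuous_intros continuous_on_reflect f'\<close>)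
  have Vi': "integrable lborel \<psi>" if "\<psi> \<in> V" for \<psi>
    by (rule integrable_continuous_compact_support[where K="cball 0 R"]) (use that in \<open>auto simp: V_def\<close>)
  have conv_lin: "conv (\<lambda>x. a * u x + c * v x) f' = (\<lambda>x. a * conv u f' x + c * conv v f' x)"
    if "u \<in> V" "v \<in> V" for u v a c
  proof
    fix x
    have "(LINT y|lborel. (a * u y + c * v y) * f' (x - y)) = (LINT y|lborel. a * (u y * f' (x - y)) + c * (v y * f' (x - y)))"
      by (simp add: algebra_simps)
    also have "\<dots> = a * (LINT y|lborel. u y * f' (x - y)) + c * (LINT y|lborel. v y * f' (x - y))"
      using Vi[OF that(1)] Vi[OF that(2)] by simp
    finally show "conv (\<lambda>x. a * u x + c * v x) f' x = a * conv u f' x + c * conv v f' x"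
      by (simp add: conv_def)
  qed
  have der: "(conv \<psi> f' has_derivative frechet_derivative (conv \<psi> f') (at 0)) (at 0)" if "\<psi> \<in> V" for \<psi>
    using that by (simp add: V_def frechet_derivative_works)
  have der_lin: "((\<lambda>x. a * conv u f' x + c * conv v f' x) has_derivative
      (\<lambda>h. a * frechet_derivative (conv u f') (at 0) h + c * frechet_derivative (conv v f') (at 0) h)) (at 0)"
    if "u \<in> V" "v \<in> V" for u v a c
    using der[OF that(1)] der[OF that(2)] by (intro has_derivative_add has_derivative_mult_right)
  have V_lin: "(\<lambda>x. a * u x + c * v x) \<in> V" if uv: "u \<in> V" "v \<in> V" for u v a c
  proof -
    have "conv (\<lambda>x. a * u x + c * v x) f' differentiable (at 0)"
      unfolding conv_lin[OF uv] using der_lin[OF uv] unfolding differentiable_def by blast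
    then show ?thesis using uv by (auto simp: V_def intro!: continuous_intros)
  qed
  have T_lin: "T (\<lambda>x. a * u x + c * v x) = a * T u + c * T v" if uv: "u \<in> V" "v \<in> V" for u v a c
    unfolding T_def conv_lin[OF uv] using frechet_derivative_at[OF der_lin[OF uv, of a c], symmetric]
    by (simp add: algebra_simps)
  have lip: "(L * (LINT y|lborel. \<bar>\<psi> y\<bar>))-lipschitz_on UNIV (conv \<psi> f')" if \<psi>: "\<psi> \<in> V" for \<psi>
  proof (rule lipschitz_onI)
    fix x x' :: 'a
    have eq: "conv \<psi> f' x - conv \<psi> f' x' = (LINT y|lborel. \<psi> y * f' (x - y) - \<psi> y * f' (x' - y))"
      using Vi[OF \<psi>] by (simp add: conv_def)
    have "norm (conv \<psi> f' x - conv \<psi> f' x') \<le> (LINT y|lborel. norm (\<psi> y * f' (x - y) - \<psi> y * f' (x' - y)))"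
      unfolding eq by (rule integral_norm_bound)
    also have "\<dots> \<le> (LINT y|lborel. \<bar>\<psi> y\<bar> * (L * dist x x'))"
    proof (rule integral_mono)
      show "integrable lborel (\<lambda>y. norm (\<psi> y * f' (x - y) - \<psi> y * f' (x' - y)))"
        using Vi[OF \<psi>] by (intro integrable_norm Bochner_Integration.integrable_diff)
      show "integrable lborel (\<lambda>y. \<bar>\<psi> y\<bar> * (L * dist x x'))" using Vi'[OF \<psi>] by simp
      fix y
      have "norm (f' (x - y) - f' (x' - y)) \<le> L * dist x x'"
        using lipschitz_onD[OF f, of "- (x - y)" "- (x' - y)"] by (simp add: f'_def dist_norm norm_minus_commute)
      then show "norm (\<psi> y * f' (x - y) - \<psi> y * f' (x' - y)) \<le> \<bar>\<psi> y\<bar> * (L * dist x x')"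
        by (simp add: abs_mult mult_left_mono flip: right_diff_distrib)
    qed
    also have "\<dots> = L * (LINT y|lborel. \<bar>\<psi> y\<bar>) * dist x x'" by simp
    finally show "dist (conv \<psi> f' x) (conv \<psi> f' x') \<le> L * (LINT y|lborel. \<bar>\<psi> y\<bar>) * dist x x'"
      by (simp add: dist_norm)
  next
    show "0 \<le> L * (LINT y|lborel. \<bar>\<psi> y\<bar>)"
      using lipschitz_on_nonneg[OF f] by (intro mult_nonneg_nonneg integral_nonneg_AE) auto
  qed
  have intM: "integral\<^sup>L M (\<lambda>y. \<bar>\<psi> y\<bar>) = (LINT y|lborel. \<bar>\<psi> y\<bar>)" if "\<psi> \<in> V" for \<psi>
  proof -
    have "(\<lambda>y. indicator (cball 0 R) y *\<^sub>R \<bar>\<psi> y\<bar>) = (\<lambda>y. \<bar>\<psi> y\<bar>)"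
      using that by (auto simp: V_def indicator_def fun_eq_iff)
    then show ?thesis unfolding M_def by (subst integral_restrict_space) auto
  qed
  have T_le: "\<bar>T \<psi>\<bar> \<le> (L * norm b) * integral\<^sup>L M (\<lambda>y. \<bar>\<psi> y\<bar>)" if \<psi>: "\<psi> \<in> V" for \<psi>
  proof -
    obtain g where g: "(conv \<psi> f' has_derivative (\<lambda>v. g \<bullet> v)) (at 0)"
    proof (rule that)
      interpret D: bounded_linear "frechet_derivative (conv \<psi> f') (at 0)"
        using der[OF \<psi>] by (rule has_derivative_bounded_linear)
      have "frechet_derivative (conv \<psi> f') (at 0) = (\<lambda>v. (\<Sum>i\<in>Basis. frechet_derivative (conv \<psi> f') (at 0) i *\<^sub>R i) \<bullet> v)"
      proof
        fix v :: 'a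
        have "frechet_derivative (conv \<psi> f') (at 0) v = frechet_derivative (conv \<psi> f') (at 0) (\<Sum>i\<in>Basis. (v \<bullet> i) *\<^sub>R i)"
          by (simp only: euclidean_representation)
        also have "\<dots> = (\<Sum>i\<in>Basis. (v \<bullet> i) * frechet_derivative (conv \<psi> f') (at 0) i)"
          by (simp add: D.sum D.scaleR)
        also have "\<dots> = (\<Sum>i\<in>Basis. frechet_derivative (conv \<psi> f') (at 0) i *\<^sub>R i) \<bullet> v"
          by (simp add: inner_sum_right inner_commute[of _ v] mult.commute)
        finally show "frechet_derivative (conv \<psi> f') (at 0) v = (\<Sum>i\<in>Basis. frechet_derivative (conv \<psi> f') (at 0) i *\<^sub>R i) \<bullet> v" .
      qed
      then show "(conv \<psi> f' has_derivative (\<lambda>v. (\<Sum>i\<in>Basis. frechet_derivative (conv \<psi> f') (at 0) i *\<^sub>R i) \<bullet> v)) (at 0)"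
        using der[OF \<psi>] by simp
    qed
    have "norm g \<le> L * (LINT y|lborel. \<bar>\<psi> y\<bar>)"
      by (rule lipschitz_grad_norm_le[OF lip[OF \<psi>] g])
    moreover have "T \<psi> = - (g \<bullet> b)" unfolding T_def frechet_derivative_at[OF g, symmetric] ..
    moreover have "\<bar>g \<bullet> b\<bar> \<le> norm g * norm b" by (rule Cauchy_Schwarz_ineq2)
    moreover have "norm g * norm b \<le> L * (LINT y|lborel. \<bar>\<psi> y\<bar>) * norm b"
      using calculation(1) by (intro mult_right_mono) auto
    ultimately show ?thesis unfolding intM[OF \<psi>] by (simp add: mult_ac)
  qed
  have fM: "finite_measure M"
    using emeasure_bounded_finite[OF bounded_cball, of 0 R]
    by (intro finite_measureI) (simp add: M_def emeasure_restrict_space space_restrict_space less_top)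
  have measM: "\<psi> \<in> borel_measurable M" if "\<psi> \<in> V" for \<psi>
    using that unfolding M_def V_def
    by (intro measurable_restrict_space1) (auto intro: borel_measurable_continuous_onI)
  have bdd: "\<exists>K. \<forall>x\<in>space M. \<bar>\<psi> x\<bar> \<le> K" if "\<psi> \<in> V" for \<psi>
  proof -
    have "compact (\<psi> ` cball 0 R)"
      using that by (intro compact_continuous_image) (auto simp: V_def intro: continuous_on_subset)
    then obtain K where "\<forall>x\<in>cball 0 R. \<bar>\<psi> x\<bar> \<le> K"
      by (force dest!: compact_imp_bounded simp: bounded_iff)
    then show ?thesis by (auto simp: M_def space_restrict_space)
  qed
  have V0: "(\<lambda>_. 0) \<in> V"
  proof -
    have "conv (\<lambda>_. 0) f' = (\<lambda>_. 0)" by (simp add: conv_def fun_eq_iff)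
    then show ?thesis by (simp add: V_def)
  qed
  obtain g0 u where u: "\<And>n::nat. u n \<in> V" and g0: "integrable M g0"
    and "AE x in M. (\<lambda>n. u n x) \<longlonglongrightarrow> g0 x"
    and lim: "(\<lambda>n. integral\<^sup>L M (\<lambda>x. \<bar>u n x - g0 x\<bar>)) \<longlonglongrightarrow> 0"
    and rep: "\<And>\<phi>. \<phi> \<in> V \<Longrightarrow> integral\<^sup>L M (\<lambda>x. \<phi> x * g0 x) = T \<phi>"
  proof (rule L1_bounded_functional_representation[of M V "\<lambda>_. 0" T "L * norm b"])
    show "finite_measure M" by (rule fM)
    show "u \<in> borel_measurable M" if "u \<in> V" for u using that by (rule measM)
    show "\<exists>K. \<forall>x\<in>space M. \<bar>u x\<bar> \<le> K" if "u \<in> V" for u using that by (rule bdd)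
    show "(\<lambda>_. 0) \<in> V" by (rule V0)
    show "(\<lambda>x. a * u x + b * v x) \<in> V" if "u \<in> V" "v \<in> V" for u v a b using that by (rule V_lin)
    show "T (\<lambda>x. a * u x + b * v x) = a * T u + b * T v" if "u \<in> V" "v \<in> V" for u v a b using that by (rule T_lin)
    show "\<bar>T u\<bar> \<le> L * norm b * integral\<^sup>L M (\<lambda>x. \<bar>u x\<bar>)" if "u \<in> V" for u using that by (rule T_le)
  qed (rule that)
  define g where "g y = indicator (cball 0 R) y *\<^sub>R g0 y" for y
  have g: "integrable lborel g"
    using g0 unfolding g_def[abs_def] M_def by (subst (asm) integrable_restrict_space) (auto simp: set_integrable_def)
  have int_eq: "integral\<^sup>L M (\<lambda>x. \<bar>u n x - g0 x\<bar>) = (LINT y|lborel. \<bar>u n y - g y\<bar>)" for n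
  proof -
    have "(\<lambda>y. indicator (cball 0 R) y *\<^sub>R \<bar>u n y - g0 y\<bar>) = (\<lambda>y. \<bar>u n y - g y\<bar>)"
      using u[of n] by (auto simp: V_def g_def indicator_def fun_eq_iff)
    then show ?thesis unfolding M_def by (subst integral_restrict_space) auto
  qed
  show ?thesis
  proof (rule that[OF g])
    show "continuous_on UNIV (u n)" "integrable lborel (u n)" for n
      using u[of n] Vi'[OF u[of n]] by (auto simp: V_def)
    show "(\<lambda>n. LINT y|lborel. \<bar>u n y - g y\<bar>) \<longlonglongrightarrow> 0" using lim unfolding int_eq .
    fix \<delta> :: real and x :: 'a assume \<delta>: "\<delta> > 0" "norm x + \<delta> \<le> R"
    define \<psi> where "\<psi> y = moll \<delta> (x - y)" for y
    have \<psi>c: "continuous_on UNIV \<psi>" unfolding \<psi>_def by (rule continuous_on_reflect[OF continuous_on_moll])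
    have \<psi>0: "\<psi> y = 0" if "y \<notin> cball 0 R" for y
    proof -
      have "R < norm y" using that by simp
      moreover have "norm y \<le> norm x + norm (x - y)" using norm_triangle_ineq4[of x "x - y"] by simp
      ultimately show ?thesis unfolding \<psi>_def using \<delta> by (intro moll_eq_0) auto
    qed
    have eq: "conv \<psi> f' h = mollify \<delta> f (x - h)" for h
    proof -
      have m: "(\<lambda>y. \<psi> y * f' (h - y)) \<in> borel_measurable borel"
        by (intro borel_measurable_continuous_onI continuous_intros \<psi>c continuous_on_reflect f')
      have "conv \<psi> f' h = (LINT z|lborel. \<psi> (x - z) * f' (h - (x - z)))"
        unfolding conv_def using lborel_integral_affine[OF m, of "- 1" x] by simp
      also have "\<dots> = (LINT z|lborel. moll \<delta> z * f (x - h - z))"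
        by (simp add: \<psi>_def f'_def algebra_simps)
      finally show ?thesis by (simp add: mollify_alt[OF fc])
    qed
    have "((\<lambda>h. x - h) has_derivative (\<lambda>h. - h)) (at 0)" by (auto intro!: derivative_eq_intros)
    moreover have "(mollify \<delta> f has_derivative (\<lambda>v. mollify_grad \<delta> f x \<bullet> v)) (at (x - 0))"
      using mollify_has_derivative[OF fc \<delta>(1), of x] by simp
    ultimately have "((\<lambda>h. mollify \<delta> f (x - h)) has_derivative (\<lambda>h. mollify_grad \<delta> f x \<bullet> (- h))) (at 0)"
      by (rule has_derivative_compose)
    then have D: "(conv \<psi> f' has_derivative (\<lambda>h. mollify_grad \<delta> f x \<bullet> (- h))) (at 0)"
      by (simp add: eq[abs_def])
    then have \<psi>V: "\<psi> \<in> V" using \<psi>c \<psi>0 by (auto simp: V_def differentiable_def)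
    have "T \<psi> = mollify_grad \<delta> f x \<bullet> b"
      unfolding T_def frechet_derivative_at[OF D, symmetric] by simp
    moreover have "T \<psi> = (LINT y|lborel. \<psi> y * g y)"
      unfolding rep[OF \<psi>V, symmetric] M_def
      by (subst integral_restrict_space) (auto simp: g_def mult_ac)
    ultimately show "mollify_grad \<delta> f x \<bullet> b = (LINT y|lborel. moll \<delta> (x - y) * g y)"
      by (simp add: \<psi>_def)
  qed
qed

text \<open>At a common Lebesgue point of the weak derivatives, the gradient of the mollification at scale
  \<open>\<kappa> r\<close> is nearly constant on the ball of radius \<open>r\<close>, while the mollification itself differs from the
  function by at most \<open>L \<kappa> r\<close>.\<close>

lemma differentiable_at_lebesgue_point:
  fixes f :: "'a::euclidean_space \<Rightarrow> real" and g :: "'a \<Rightarrow> 'a \<Rightarrow> real"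
  assumes f: "L-lipschitz_on UNIV f"
    and g: "\<And>b. b \<in> Basis \<Longrightarrow> integrable lborel (g b)"
    and rep: "\<And>b \<delta> x. b \<in> Basis \<Longrightarrow> \<delta> > 0 \<Longrightarrow> norm x + \<delta> \<le> R \<Longrightarrow>
      mollify_grad \<delta> f x \<bullet> b = (LINT y|lborel. moll \<delta> (x - y) * g b y)"
    and x0: "norm x0 + 2 \<le> R" and leb: "\<And>b. b \<in> Basis \<Longrightarrow> lebesgue_point (g b) x0"
  shows "f differentiable (at x0)"
proof -
  define I where "I = (LINT z|lborel. bump 0 (z::'a))"
  have I: "I > 0" using bump_integral_pos by (simp add: I_def)
  have L: "L \<ge> 0" using f by (rule lipschitz_on_nonneg)
  have fc: "continuous_on UNIV f" using f by (rule lipschitz_imp_continuous)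
  define G where "G = (\<Sum>b\<in>Basis. g b x0 *\<^sub>R b)"
  have Gb: "G \<bullet> b = g b x0" if "b \<in> Basis" for b
    using that by (simp add: G_def inner_sum_left_Basis)
  have "(f has_derivative (\<lambda>v. G \<bullet> v)) (at x0)"
    unfolding has_derivative_at_alt
  proof (intro conjI allI impI)
    show "bounded_linear (\<lambda>v. G \<bullet> v)" by (rule bounded_linear_inner_right)
    fix e :: real assume e: "e > 0"
    define \<kappa> where "\<kappa> = min 1 (e / (4 * (L + 1)))"
    have \<kappa>: "0 < \<kappa>" "\<kappa> \<le> 1" "2 * L * \<kappa> \<le> e / 2"
    proof -
      show "0 < \<kappa>" "\<kappa> \<le> 1" using e L by (auto simp: \<kappa>_def)
      have "L * \<kappa> \<le> (L + 1) * (e / (4 * (L + 1)))" using L e by (intro mult_mono) (auto simp: \<kappa>_def)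
      also have "\<dots> = e / 4" using L by (simp add: field_simps)
      finally show "2 * L * \<kappa> \<le> e / 2" by simp
    qed
    \<comment> \<open>The kernel at scale \<open>\<kappa> r\<close> is at most \<open>1 / ((\<kappa> r)\<^sup>d I)\<close>, and all kernels in question live in the ball
      of radius \<open>2 r\<close> around \<open>x0\<close>.\<close>
    define \<eta> where "\<eta> = e / (2 * DIM('a)) * (\<kappa> ^ DIM('a) * I) / 2 ^ DIM('a)"
    have \<eta>: "\<eta> > 0" using e \<kappa> I by (simp add: \<eta>_def)
    have "\<forall>b\<in>Basis. \<exists>d>0. \<forall>r. 0 < r \<and> r < d \<longrightarrow> (LINT y|lborel. indicator (cball x0 r) y * \<bar>g b y - g b x0\<bar>) \<le> \<eta> * r ^ DIM('a)"
      using leb \<eta> unfolding lebesgue_point_def by blast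
    from bchoice[OF this] obtain d where d: "\<And>b. b \<in> Basis \<Longrightarrow> d b > 0"
      "\<And>b r. b \<in> Basis \<Longrightarrow> 0 < r \<Longrightarrow> r < d b \<Longrightarrow> (LINT y|lborel. indicator (cball x0 r) y * \<bar>g b y - g b x0\<bar>) \<le> \<eta> * r ^ DIM('a)"
      by blast
    define D where "D = min 1 (Min (d ` Basis) / 2)"
    have D: "D > 0" using d(1) by (auto simp: D_def)
    have D_le: "2 * D \<le> d b" if "b \<in> Basis" for b
    proof -
      have "Min (d ` Basis) \<le> d b" using that by (intro Min_le) auto
      then show ?thesis by (simp add: D_def)
    qed
    have grad_close: "norm (mollify_grad (\<kappa> * r) f x - G) \<le> e / 2"
      if r: "0 < r" "r < D" and x: "norm (x - x0) \<le> r" for r x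
    proof -
      define \<delta> where "\<delta> = \<kappa> * r"
      have \<delta>: "0 < \<delta>" "\<delta> \<le> r" using \<kappa> r by (auto simp: \<delta>_def)
      have r1: "r < 1" using r by (simp add: D_def)
      have b: "\<bar>(mollify_grad \<delta> f x - G) \<bullet> b\<bar> \<le> e / (2 * DIM('a))" if b: "b \<in> Basis" for b
      proof -
        have "norm x \<le> norm x0 + r" using x norm_triangle_ineq2[of x x0] by linarith
        then have "norm x + \<delta> \<le> R" using \<delta> x0 r1 by linarith
        then have 1: "mollify_grad \<delta> f x \<bullet> b = (LINT y|lborel. moll \<delta> (x - y) * g b y)"
          using rep[OF b \<delta>(1)] by blast
        have im: "integrable lborel (\<lambda>y. moll \<delta> (x - y))"
          by (rule integrable_continuous_compact_support[OF continuous_on_reflect[OF continuous_on_moll], of "cball x \<delta>"])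
            (use \<delta> in \<open>auto intro!: moll_eq_0 simp: dist_norm\<close>)
        have m1: "(LINT y|lborel. moll \<delta> (x - y)) = 1"
        proof -
          have "(moll \<delta> :: 'a \<Rightarrow> real) \<in> borel_measurable borel"
            by (rule borel_measurable_continuous_onI[OF continuous_on_moll])
          from lborel_integral_affine[OF this, of "- 1" x] show ?thesis
            using moll_integral[OF \<delta>(1), where 'a='a] by simp
        qed
        have ml: "moll \<delta> z \<le> 1 / (\<delta> ^ DIM('a) * I)" for z :: 'a
          unfolding moll_def I_def[symmetric] using \<delta> I bump_le_1 by (intro divide_right_mono) auto
        have img: "integrable lborel (\<lambda>y. moll \<delta> (x - y) * g b y)"
        proof (rule Bochner_Integration.integrable_bound)
          show "integrable lborel (\<lambda>y. 1 / (\<delta> ^ DIM('a) * I) * g b y)" using g[OF b] by simp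
          show "(\<lambda>y. moll \<delta> (x - y) * g b y) \<in> borel_measurable lborel"
            using im g[OF b] by (intro borel_measurable_times) auto
          show "AE y in lborel. norm (moll \<delta> (x - y) * g b y) \<le> norm (1 / (\<delta> ^ DIM('a) * I) * g b y)"
          proof (rule AE_I2)
            fix y
            have "\<bar>moll \<delta> (x - y)\<bar> * \<bar>g b y\<bar> \<le> 1 / (\<delta> ^ DIM('a) * I) * \<bar>g b y\<bar>"
              using ml[of "x - y"] moll_nonneg[OF \<delta>(1), of "x - y"] by (intro mult_right_mono) auto
            then show "norm (moll \<delta> (x - y) * g b y) \<le> norm (1 / (\<delta> ^ DIM('a) * I) * g b y)"
              using \<delta> I by (simp add: abs_mult)
          qed
        qed
        have eq: "(mollify_grad \<delta> f x - G) \<bullet> b = (LINT y|lborel. moll \<delta> (x - y) * g b y - moll \<delta> (x - y) * g b x0)"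
          using img im m1 by (simp add: inner_diff_left 1 Gb[OF b])
        have i3: "integrable lborel (\<lambda>y. indicator (cball x0 (2 * r)) y * \<bar>g b y - g b x0\<bar>)"
        proof -
          have "integrable lborel (\<lambda>y. indicator (cball x0 (2 * r)) y * g b y - indicator (cball x0 (2 * r)) y * g b x0)"
            using integrable_mult_indicator[of "cball x0 (2 * r)" lborel "g b"] g[OF b]
            by (intro Bochner_Integration.integrable_diff integrable_indicator_cball) auto
          from integrable_abs[OF this] show ?thesis by (simp add: abs_mult flip: right_diff_distrib)
        qed
        have "norm ((mollify_grad \<delta> f x - G) \<bullet> b) \<le> (LINT y|lborel. norm (moll \<delta> (x - y) * g b y - moll \<delta> (x - y) * g b x0))"
          unfolding eq by (rule integral_norm_bound)
        also have "\<dots> \<le> (LINT y|lborel. 1 / (\<delta> ^ DIM('a) * I) * (indicator (cball x0 (2 * r)) y * \<bar>g b y - g b x0\<bar>))"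
        proof (rule integral_mono)
          show "integrable lborel (\<lambda>y. norm (moll \<delta> (x - y) * g b y - moll \<delta> (x - y) * g b x0))"
            using img im by (intro integrable_norm Bochner_Integration.integrable_diff) auto
          show "integrable lborel (\<lambda>y. 1 / (\<delta> ^ DIM('a) * I) * (indicator (cball x0 (2 * r)) y * \<bar>g b y - g b x0\<bar>))"
            by (rule integrable_mult_right[OF i3])
          fix y
          have eq': "norm (moll \<delta> (x - y) * g b y - moll \<delta> (x - y) * g b x0) = moll \<delta> (x - y) * \<bar>g b y - g b x0\<bar>"
            using moll_nonneg[OF \<delta>(1), of "x - y"] by (simp add: abs_mult flip: right_diff_distrib)
          show "norm (moll \<delta> (x - y) * g b y - moll \<delta> (x - y) * g b x0)
              \<le> 1 / (\<delta> ^ DIM('a) * I) * (indicator (cball x0 (2 * r)) y * \<bar>g b y - g b x0\<bar>)"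
          proof (cases "y \<in> cball x0 (2 * r)")
            case True
            then show ?thesis unfolding eq' using mult_right_mono[OF ml[of "x - y"], of "\<bar>g b y - g b x0\<bar>"] by simp
          next
            case False
            then have "2 * r < norm (x0 - y)" by (simp add: dist_norm)
            also have "\<dots> \<le> norm (x - y) + norm (x - x0)" using norm_triangle_ineq4[of "x - y" "x - x0"] by simp
            finally have "\<delta> \<le> norm (x - y)" using x \<delta> by linarith
            then have "moll \<delta> (x - y) = 0" by (rule moll_eq_0[OF \<delta>(1)])
            then show ?thesis unfolding eq' using False by simp
          qed
        qed
        also have "\<dots> = 1 / (\<delta> ^ DIM('a) * I) * (LINT y|lborel. indicator (cball x0 (2 * r)) y * \<bar>g b y - g b x0\<bar>)"
          by simp
        also have "\<dots> \<le> 1 / (\<delta> ^ DIM('a) * I) * (\<eta> * (2 * r) ^ DIM('a))"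
          using d(2)[OF b, of "2 * r"] D_le[OF b] r \<delta> I by (intro mult_left_mono) auto
        also have "\<dots> = e / (2 * DIM('a))"
          using \<kappa> I r by (simp add: \<eta>_def \<delta>_def power_mult_distrib)
        finally show ?thesis by simp
      qed
      have "norm (mollify_grad \<delta> f x - G) \<le> (\<Sum>b\<in>Basis. \<bar>(mollify_grad \<delta> f x - G) \<bullet> b\<bar>)" by (rule norm_le_l1)
      also have "\<dots> \<le> (\<Sum>b\<in>(Basis::'a set). e / (2 * DIM('a)))" by (rule sum_mono[OF b])
      finally show ?thesis by (simp add: \<delta>_def)
    qed
    show "\<exists>d>0. \<forall>y. norm (y - x0) < d \<longrightarrow> norm (f y - f x0 - G \<bullet> (y - x0)) \<le> e * norm (y - x0)"
    proof (intro exI[of _ D] conjI allI impI D)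
      fix y assume y: "norm (y - x0) < D"
      show "norm (f y - f x0 - G \<bullet> (y - x0)) \<le> e * norm (y - x0)"
      proof (cases "y = x0")
        case False
        define r where "r = norm (y - x0)"
        have r: "0 < r" "r < D" using False y by (auto simp: r_def)
        define \<delta> where "\<delta> = \<kappa> * r"
        have \<delta>: "0 < \<delta>" using \<kappa> r by (simp add: \<delta>_def)
        have "norm ((mollify \<delta> f y - G \<bullet> y) - (mollify \<delta> f x0 - G \<bullet> x0)) \<le> e / 2 * norm (y - x0)"
        proof (rule differentiable_bound[OF convex_cball[of x0 r]])
          fix x assume "x \<in> cball x0 r"
          then have "norm (x - x0) \<le> r" by (simp add: dist_norm norm_minus_commute)
          then have le: "norm (mollify_grad \<delta> f x - G) \<le> e / 2"
            unfolding \<delta>_def by (rule grad_close[OF r])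
          show "((\<lambda>x. mollify \<delta> f x - G \<bullet> x) has_derivative (\<lambda>v. (mollify_grad \<delta> f x - G) \<bullet> v)) (at x within cball x0 r)"
            unfolding inner_diff_left
            by (intro has_derivative_diff has_derivative_at_withinI[OF mollify_has_derivative[OF fc \<delta>]]
                bounded_linear_imp_has_derivative bounded_linear_inner_right)
          have "onorm (\<lambda>v. (mollify_grad \<delta> f x - G) \<bullet> v) \<le> norm (mollify_grad \<delta> f x - G)"
            by (rule onorm_le) (simp add: Cauchy_Schwarz_ineq2)
          then show "onorm (\<lambda>v. (mollify_grad \<delta> f x - G) \<bullet> v) \<le> e / 2" using le by simp
        qed (use r in \<open>auto simp: r_def dist_norm norm_minus_commute\<close>)
        moreover have "\<bar>mollify \<delta> f y - f y\<bar> \<le> L * \<delta>" "\<bar>mollify \<delta> f x0 - f x0\<bar> \<le> L * \<delta>"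
          by (rule mollify_lipschitz_diff_le[OF f \<delta>])+
        moreover have "2 * (L * \<delta>) \<le> e / 2 * norm (y - x0)"
          using mult_right_mono[OF \<kappa>(3), of r] r by (simp add: \<delta>_def r_def mult_ac)
        ultimately show ?thesis
          unfolding real_norm_def inner_diff_right by linarith
      qed simp
    qed
  qed
  then show ?thesis by (auto simp: differentiable_def)
qed

text \<open>On a bounded set, differentiability fails only where some weak partial derivative has no Lebesgue
  point.\<close>

theorem rademacher:
  fixes f :: "'a::euclidean_space \<Rightarrow> real"
  assumes f: "L-lipschitz_on UNIV f"
  shows "negligible {x. \<not> f differentiable (at x)}"
proof -
  have "negligible ({x. \<not> f differentiable (at x)} \<inter> ball 0 (real n))" for n
  proof -
    have "\<exists>g. integrable lborel g \<and> negligible {x. \<not> lebesgue_point g x} \<and>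
        (\<forall>\<delta> x. \<delta> > 0 \<longrightarrow> norm x + \<delta> \<le> real n + 2 \<longrightarrow> mollify_grad \<delta> f x \<bullet> b = (LINT y|lborel. moll \<delta> (x - y) * g y))" for b
    proof -
      obtain g u where g: "integrable lborel g" "\<And>n::nat. continuous_on UNIV (u n)" "\<And>n. integrable lborel (u n)"
        "(\<lambda>n. LINT y|lborel. \<bar>u n y - g y\<bar>) \<longlonglongrightarrow> 0"
        "\<And>\<delta> x. \<delta> > 0 \<Longrightarrow> norm x + \<delta> \<le> real n + 2 \<Longrightarrow> mollify_grad \<delta> f x \<bullet> b = (LINT y|lborel. moll \<delta> (x - y) * g y)"
        using lipschitz_weak_derivative[OF f, of "real n + 2" b] by blast
      have "negligible {x. \<not> lebesgue_point g x}"
        by (rule negligible_not_lebesgue_point[OF g(1-4)])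
      then show ?thesis by (intro exI[of _ g] conjI allI impI g(1) g(5))
    qed
    then have "\<forall>b. \<exists>g. integrable lborel g \<and> negligible {x. \<not> lebesgue_point g x} \<and>
        (\<forall>\<delta> x. \<delta> > 0 \<longrightarrow> norm x + \<delta> \<le> real n + 2 \<longrightarrow> mollify_grad \<delta> f x \<bullet> b = (LINT y|lborel. moll \<delta> (x - y) * g y))"
      by (rule allI)
    from choice[OF this] obtain g where g: "\<And>b. integrable lborel (g b)" "\<And>b. negligible {x. \<not> lebesgue_point (g b) x}"
      "\<And>b \<delta> x. \<delta> > 0 \<Longrightarrow> norm x + \<delta> \<le> real n + 2 \<Longrightarrow> mollify_grad \<delta> f x \<bullet> b = (LINT y|lborel. moll \<delta> (x - y) * g b y)"
      by blast
    have "negligible (\<Union>b\<in>Basis. {x. \<not> lebesgue_point (g b) x})"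
      by (rule negligible_Union) (use g(2) in auto)
    moreover have "{x. \<not> f differentiable (at x)} \<inter> ball 0 (real n) \<subseteq> (\<Union>b\<in>Basis. {x. \<not> lebesgue_point (g b) x})"
    proof (rule subsetI, rule ccontr)
      fix x assume x: "x \<in> {x. \<not> f differentiable (at x)} \<inter> ball 0 (real n)"
        and "x \<notin> (\<Union>b\<in>Basis. {x. \<not> lebesgue_point (g b) x})"
      then have "\<And>b. b \<in> Basis \<Longrightarrow> lebesgue_point (g b) x" by blast
      moreover have "norm x + 2 \<le> real n + 2" using x by simp
      ultimately have "f differentiable (at x)"
        using differentiable_at_lebesgue_point[OF f g(1) g(3)] by blast
      then show False using x by simp
    qed
    ultimately show ?thesis by (rule negligible_subset)
  qed
  then have "negligible (\<Union>n. {x. \<not> f differentiable (at x)} \<inter> ball 0 (real n))"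
    by (intro negligible_countable_Union) auto
  moreover have "{x. \<not> f differentiable (at x)} \<subseteq> (\<Union>n. {x. \<not> f differentiable (at x)} \<inter> ball 0 (real n))"
  proof
    fix x assume "x \<in> {x. \<not> f differentiable (at x)}"
    moreover obtain n where "norm x < real n" using reals_Archimedean2 by blast
    ultimately have "x \<in> {x. \<not> f differentiable (at x)} \<inter> ball 0 (real n)" by simp
    then show "x \<in> (\<Union>n. {x. \<not> f differentiable (at x)} \<inter> ball 0 (real n))" by blast
  qed
  ultimately show ?thesis by (rule negligible_subset)
qed

section \<open>Lipschitz boundaries\<close>

lemma dim_real_2: "DIM(real^2) = 2"
  by simp

text \<open>A Lipschitz boundary is locally the zero set of \<open>u(y) = (R y)\<^sub>3 - \<gamma>((R y)\<^sub>1, (R y)\<^sub>2)\<close>, a Lipschitz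
  function that increases at unit speed in the direction \<open>e\<close> of the third axis; \<open>p\<close> is the projection
  along \<open>e\<close> and \<open>\<Gamma>\<close> the graph parametrisation.\<close>

lemma lipschitz_boundary_chart:
  fixes U :: "(real^3) set"
  assumes U: "open U" "lipschitz_boundary U" and x: "x \<in> frontier U"
  obtains r u e and p :: "real^3 \<Rightarrow> real^2" and \<Gamma> M N where
    "r > 0" "M > 0" "M-lipschitz_on UNIV u" "\<And>y s. u (y + s *\<^sub>R e) = u y + s"
    "frontier U \<inter> ball x r = {y \<in> ball x r. u y = 0}"
    "1-lipschitz_on UNIV p" "M-lipschitz_on UNIV \<Gamma>" "\<And>z. p (\<Gamma> z) = z" "\<And>z. u (\<Gamma> z) = 0"
    "\<And>y. u y = 0 \<Longrightarrow> \<Gamma> (p y) = y" "negligible N" "\<And>y. p y \<notin> N \<Longrightarrow> u differentiable (at y)"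
proof -
  obtain r and R :: "real^3 \<Rightarrow> real^3" and L and \<gamma> :: "real^2 \<Rightarrow> real" where r: "r > 0"
    and R: "orthogonal_transformation R" and \<gamma>: "L-lipschitz_on UNIV \<gamma>"
    and UR: "U \<inter> ball x r = {y \<in> ball x r. \<gamma> (vector [R y $ 1, R y $ 2]) < R y $ 3}"
    using U(2) x unfolding lipschitz_boundary_def by blast
  have L: "L \<ge> 0" using \<gamma> by (rule lipschitz_on_nonneg)
  define Q where "Q = inv R"
  have Q: "orthogonal_transformation Q" unfolding Q_def by (rule orthogonal_transformation_inv[OF R])
  have RQ: "R (Q z) = z" for z
    unfolding Q_def by (rule surj_f_inv_f[OF orthogonal_transformation_surj[OF R]])
  have QR: "Q (R z) = z" for z
    unfolding Q_def by (rule inv_f_f[OF orthogonal_transformation_inj[OF R]])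
  note linR = orthogonal_transformation_linear[OF R]
  note linQ = orthogonal_transformation_linear[OF Q]
  define p :: "real^3 \<Rightarrow> real^2" where "p y = vector [R y $ 1, R y $ 2]" for y
  define u where "u y = R y $ 3 - \<gamma> (p y)" for y
  define e where "e = Q (axis 3 1)"
  define \<Gamma> where "\<Gamma> z = Q (vector [z $ 1, z $ 2, \<gamma> z])" for z :: "real^2"
  define M where "M = L + 1"
  have norm2: "norm z \<le> norm w" if "z $ 1 = w $ 1" "z $ 2 = w $ 2" for z :: "real^2" and w :: "real^3"
    unfolding norm_le using that by (simp add: inner_vec_def sum_2 sum_3)
  have norm3: "norm w \<le> norm z + \<bar>w $ 3\<bar>" if "z $ 1 = w $ 1" "z $ 2 = w $ 2" for z :: "real^2" and w :: "real^3"
  proof -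
    have w: "w = vector [z $ 1, z $ 2, 0] + vector [0, 0, w $ 3]"
      using that by (simp add: vec_eq_iff forall_3)
    have "norm w \<le> norm (vector [z $ 1, z $ 2, 0] :: real^3) + norm (vector [0, 0, w $ 3] :: real^3)"
      by (subst w) (rule norm_triangle_ineq)
    also have "norm (vector [z $ 1, z $ 2, 0] :: real^3) = norm z"
      by (simp add: norm_eq inner_vec_def sum_2 sum_3)
    also have "norm (vector [0, 0, w $ 3] :: real^3) = \<bar>w $ 3\<bar>"
      by (simp add: norm_eq_sqrt_inner inner_vec_def sum_3)
    finally show ?thesis .
  qed
  have p_diff: "p y - p y' = vector [R (y - y') $ 1, R (y - y') $ 2]" for y y'
    by (simp add: p_def vec_eq_iff forall_2 linear_diff[OF linR])
  have p_le: "norm (p y - p y') \<le> norm (y - y')" for y y'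
    using norm2[of "p y - p y'" "R (y - y')"] orthogonal_transformation_norm[OF R, of "y - y'"]
    by (simp add: p_diff)
  have p: "1-lipschitz_on UNIV p"
    by (rule lipschitz_onI) (simp_all add: dist_norm p_le)
  have p\<Gamma>: "p (\<Gamma> z) = z" for z
    by (simp add: p_def \<Gamma>_def RQ vec_eq_iff forall_2)
  have u\<Gamma>: "u (\<Gamma> z) = 0" for z
    by (simp add: u_def p\<Gamma>) (simp add: \<Gamma>_def RQ)
  have \<Gamma>p: "\<Gamma> (p y) = y" if "u y = 0" for y
  proof -
    have "vector [p y $ 1, p y $ 2, \<gamma> (p y)] = R y"
      using that by (simp add: p_def u_def vec_eq_iff forall_3)
    then show ?thesis by (simp add: \<Gamma>_def QR)
  qed
  have Re: "R e = axis 3 1" by (simp add: e_def RQ)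
  have R_add: "R (y + s *\<^sub>R e) = R y + s *\<^sub>R axis 3 1" for y s
    by (simp add: linear_add[OF linR] linear_scale[OF linR] Re)
  have ue: "u (y + s *\<^sub>R e) = u y + s" for y s
    by (simp add: u_def p_def R_add axis_def)
  have e: "norm e = 1" using orthogonal_transformation_norm[OF Q, of "axis 3 1"] by (simp add: e_def)
  have lipu: "M-lipschitz_on UNIV u"
  proof (rule lipschitz_onI)
    fix y y'
    have "\<bar>R (y - y') $ 3\<bar> \<le> norm (y - y')"
      using component_le_norm_cart[of "R (y - y')" 3] orthogonal_transformation_norm[OF R, of "y - y'"] by simp
    moreover have "\<bar>\<gamma> (p y) - \<gamma> (p y')\<bar> \<le> L * norm (y - y')"
    proof -
      have "\<bar>\<gamma> (p y) - \<gamma> (p y')\<bar> \<le> L * norm (p y - p y')"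
        using lipschitz_onD[OF \<gamma>, of "p y" "p y'"] by (simp add: dist_norm)
      also have "\<dots> \<le> L * norm (y - y')" using L p_le by (intro mult_left_mono) auto
      finally show ?thesis .
    qed
    ultimately show "dist (u y) (u y') \<le> M * dist y y'"
      by (simp add: u_def M_def dist_norm linear_diff[OF linR] algebra_simps)
  qed (use L in \<open>simp add: M_def\<close>)
  have lip\<Gamma>: "M-lipschitz_on UNIV \<Gamma>"
  proof (rule lipschitz_onI)
    fix z z' :: "real^2"
    have "norm (\<Gamma> z - \<Gamma> z') = norm (vector [z $ 1, z $ 2, \<gamma> z] - vector [z' $ 1, z' $ 2, \<gamma> z'] :: real^3)"
      using orthogonal_transformation_norm[OF Q] by (simp add: \<Gamma>_def flip: linear_diff[OF linQ])
    also have "\<dots> \<le> norm (z - z') + \<bar>\<gamma> z - \<gamma> z'\<bar>"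
      using norm3[of "z - z'" "vector [z $ 1, z $ 2, \<gamma> z] - vector [z' $ 1, z' $ 2, \<gamma> z']"] by simp
    also have "\<dots> \<le> M * norm (z - z')"
      using lipschitz_onD[OF \<gamma>, of z z'] by (simp add: dist_norm M_def algebra_simps)
    finally show "dist (\<Gamma> z) (\<Gamma> z') \<le> M * dist z z'" by (simp add: dist_norm)
  qed (use L in \<open>simp add: M_def\<close>)
  have Upos: "y \<in> U \<longleftrightarrow> 0 < u y" if "y \<in> ball x r" for y
  proof -
    have "y \<in> U \<longleftrightarrow> y \<in> U \<inter> ball x r" using that by blast
    also have "\<dots> \<longleftrightarrow> \<gamma> (p y) < R y $ 3" unfolding UR p_def using that by simp
    finally show ?thesis by (simp add: u_def)
  qed
  have uc: "continuous_on UNIV u" using lipu by (rule lipschitz_imp_continuous)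
  have front: "frontier U \<inter> ball x r = {y \<in> ball x r. u y = 0}"
  proof (intro equalityI subsetI)
    fix y assume y: "y \<in> frontier U \<inter> ball x r"
    then have "y \<notin> U" using U(1) by (simp add: frontier_def interior_open)
    then have "u y \<le> 0" using y Upos[of y] by (simp add: not_less)
    moreover have "\<not> u y < 0"
    proof
      assume "u y < 0"
      have "open ({y. u y < 0} \<inter> ball x r)"
        by (intro open_Int open_Collect_less uc continuous_on_const open_ball)
      moreover have "({y. u y < 0} \<inter> ball x r) \<inter> U = {}"
      proof (rule equals0I)
        fix z assume z: "z \<in> ({y. u y < 0} \<inter> ball x r) \<inter> U"
        then have "0 < u z" using Upos[of z] by blast
        then show False using z by simp
      qed
      ultimately have "({y. u y < 0} \<inter> ball x r) \<inter> closure U = {}"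
        by (simp only: open_Int_closure_eq_empty)
      then show False using y \<open>u y < 0\<close> by (auto simp: frontier_def)
    qed
    ultimately show "y \<in> {y \<in> ball x r. u y = 0}" using y by simp
  next
    fix y assume y: "y \<in> {y \<in> ball x r. u y = 0}"
    then have "y \<notin> U" using Upos[of y] by simp
    moreover have "y \<in> closure U"
    proof (rule closure_approachable[THEN iffD2], intro allI impI)
      fix \<epsilon> :: real assume "\<epsilon> > 0"
      define s where "s = min (\<epsilon> / 2) ((r - dist x y) / 2)"
      have s: "s > 0" "s < \<epsilon>" "s < r - dist x y" using \<open>\<epsilon> > 0\<close> y by (auto simp: s_def min_def)
      have d: "dist (y + s *\<^sub>R e) y = s" using s(1) e by (simp add: dist_norm)
      have "dist x (y + s *\<^sub>R e) < r"
        using dist_triangle[of x "y + s *\<^sub>R e" y] d s(3) by (simp add: dist_commute)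
      then have "y + s *\<^sub>R e \<in> U" using Upos[of "y + s *\<^sub>R e"] ue[of y s] y s(1) by simp
      then show "\<exists>z\<in>U. dist z y < \<epsilon>" using d s(2) by (intro bexI[of _ "y + s *\<^sub>R e"]) auto
    qed
    ultimately show "y \<in> frontier U \<inter> ball x r"
      using y U(1) by (simp add: frontier_def interior_open)
  qed
  define N where "N = {z. \<not> \<gamma> differentiable (at z)}"
  have N: "negligible N" unfolding N_def by (rule rademacher[OF \<gamma>])
  have blp: "bounded_linear p"
  proof -
    have "linear p"
      by (intro linearI) (simp_all add: p_def vec_eq_iff forall_2 linear_add[OF linR] linear_scale[OF linR])
    then show ?thesis by (simp add: linear_conv_bounded_linear)
  qed
  have blR: "bounded_linear (\<lambda>y. R y $ 3)"
    using linear_compose[OF linR, of "\<lambda>y. y $ 3"] bounded_linear_vec_nth[of 3]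
    by (simp add: linear_conv_bounded_linear o_def)
  have udiff: "u differentiable (at y)" if "p y \<notin> N" for y
  proof -
    have "\<gamma> differentiable (at (p y))" using that by (simp add: N_def)
    then have "(\<lambda>y. \<gamma> (p y)) differentiable (at y)"
      using differentiable_chain_at[of p y \<gamma>] bounded_linear_imp_differentiable[OF blp] by (simp add: o_def)
    moreover have "(\<lambda>y. R y $ 3) differentiable (at y)"
      by (rule bounded_linear_imp_differentiable[OF blR])
    ultimately show ?thesis unfolding u_def[abs_def] by (intro differentiable_diff)
  qed
  show ?thesis
    by (rule that[of r M u e p \<Gamma> N])
      (use r e L lipu ue front p lip\<Gamma> p\<Gamma> u\<Gamma> \<Gamma>p N udiff in \<open>auto simp: M_def\<close>)
qed

subsection \<open>Hausdorff measure of a Lipschitz boundary\<close>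

lemma compact_finite_ball_cover:
  fixes S :: "'a::metric_space set"
  assumes "compact S" "\<And>x. x \<in> S \<Longrightarrow> (r x :: real) > 0"
  obtains C where "finite C" "C \<subseteq> S" "S \<subseteq> (\<Union>x\<in>C. ball x (r x))"
proof -
  have "S \<subseteq> (\<Union>x\<in>S. ball x (r x))" using assms(2) centre_in_ball by blast
  from compactE_image[OF assms(1) _ this] obtain C where "C \<subseteq> S" "finite C" "S \<subseteq> (\<Union>x\<in>C. ball x (r x))"
    by auto
  then show ?thesis by (intro that)
qed

text \<open>Finitely many charts cover the boundary, and in each of them it is the Lipschitz image of a bounded
  planar set.\<close>

lemma hausdorff_boundary_finite:
  fixes U :: "(real^3) set"
  assumes U: "open U" "lipschitz_boundary U" "compact (frontier U)"
  shows "hausdorff_outer 2 (frontier U) < top"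
proof -
  have "\<exists>r>0. hausdorff_outer 2 (frontier U \<inter> ball x r) < top" if "x \<in> frontier U" for x
  proof (rule lipschitz_boundary_chart[OF U(1,2) that])
    fix r u e and p :: "real^3 \<Rightarrow> real^2" and \<Gamma> M N
    assume *: "r > 0" "frontier U \<inter> ball x r = {y \<in> ball x r. u y = (0::real)}"
      "1-lipschitz_on UNIV p" "M-lipschitz_on UNIV \<Gamma>" "\<And>y. u y = 0 \<Longrightarrow> \<Gamma> (p y) = y"
    have "bounded (p ` ball x r)"
    proof -
      have "dist (p x) (p y) \<le> r" if "y \<in> ball x r" for y
        using lipschitz_onD[OF *(3), of x y] that by simp
      then have "p ` ball x r \<subseteq> cball (p x) r" by auto
      then show ?thesis using bounded_cball bounded_subset by blast
    qed
    then have "hausdorff_outer DIM(real^2) (\<Gamma> ` p ` ball x r) < top"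
      by (rule hausdorff_outer_lipschitz_image_finite[OF *(4)])
    moreover have "frontier U \<inter> ball x r \<subseteq> \<Gamma> ` p ` ball x r"
    proof
      fix y assume "y \<in> frontier U \<inter> ball x r"
      then have "y \<in> ball x r" "\<Gamma> (p y) = y" using *(2,5) by auto
      then show "y \<in> \<Gamma> ` p ` ball x r" by (intro image_eqI[of y \<Gamma> "p y"]) auto
    qed
    ultimately have "hausdorff_outer 2 (frontier U \<inter> ball x r) < top"
      using le_less_trans[OF hausdorff_outer_mono] unfolding dim_real_2 by blast
    then show ?thesis using *(1) by blast
  qed
  then have "\<forall>x\<in>frontier U. \<exists>r>0. hausdorff_outer 2 (frontier U \<inter> ball x r) < top" by blast
  from bchoice[OF this] obtain r
    where r: "\<And>x. x \<in> frontier U \<Longrightarrow> r x > 0 \<and> hausdorff_outer 2 (frontier U \<inter> ball x (r x)) < top" by blast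
  obtain C where C: "finite C" "C \<subseteq> frontier U" "frontier U \<subseteq> (\<Union>x\<in>C. ball x (r x))"
    by (rule compact_finite_ball_cover[OF U(3), of r]) (use r in auto)
  have "hausdorff_outer 2 (\<Union>x\<in>D. frontier U \<inter> ball x (r x)) < top" if "finite D" "D \<subseteq> C" for D
    using that
  proof (induction D rule: finite_induct)
    case empty then show ?case by (simp add: hausdorff_outer_empty)
  next
    case (insert x D)
    have "hausdorff_outer 2 (\<Union>x\<in>insert x D. frontier U \<inter> ball x (r x))
        \<le> hausdorff_outer 2 (frontier U \<inter> ball x (r x)) + hausdorff_outer 2 (\<Union>x\<in>D. frontier U \<inter> ball x (r x))"
      by (simp only: UN_insert hausdorff_outer_Un)
    also have "\<dots> < top" using insert r C(2) by auto
    finally show ?case .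
  qed
  from this[OF C(1)] have "hausdorff_outer 2 (\<Union>x\<in>C. frontier U \<inter> ball x (r x)) < top" by simp
  moreover have "frontier U = (\<Union>x\<in>C. frontier U \<inter> ball x (r x))" using C(3) by blast
  ultimately show ?thesis by simp
qed

text \<open>Over a disc of radius comparable to \<open>\<rho>\<close> the graph stays within distance \<open>\<rho>\<close> of its centre, and
  projecting it back does not increase Hausdorff measure.\<close>

lemma hausdorff_boundary_ball_ge:
  fixes U :: "(real^3) set"
  assumes U: "open U" "lipschitz_boundary U" "compact (frontier U)"
  obtains c \<rho>0 where "c > 0" "\<rho>0 > 0"
    "\<And>y \<rho>. y \<in> frontier U \<Longrightarrow> 0 < \<rho> \<Longrightarrow> \<rho> \<le> \<rho>0 \<Longrightarrow> ennreal (c * \<rho>\<^sup>2) \<le> hausdorff_outer 2 (frontier U \<inter> cball y \<rho>)"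
proof -
  have "\<exists>r c. r > 0 \<and> c > 0 \<and> (\<forall>y\<in>frontier U \<inter> ball x r. \<forall>\<rho>. 0 < \<rho> \<and> \<rho> < r \<longrightarrow>
      ennreal (c * \<rho>\<^sup>2) \<le> hausdorff_outer 2 (frontier U \<inter> cball y \<rho>))" if "x \<in> frontier U" for x
  proof (rule lipschitz_boundary_chart[OF U(1,2) that])
    fix r u e and p :: "real^3 \<Rightarrow> real^2" and \<Gamma> M N
    assume *: "r > 0" "M > 0" "frontier U \<inter> ball x r = {y \<in> ball x r. u y = (0::real)}"
      "1-lipschitz_on UNIV p" "M-lipschitz_on UNIV \<Gamma>" "\<And>z. p (\<Gamma> z) = z" "\<And>z. u (\<Gamma> z) = 0" "\<And>y. u y = 0 \<Longrightarrow> \<Gamma> (p y) = y"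
    define c where "c = unit_ball_vol 2 * (1 / (2 * M))\<^sup>2"
    have "ennreal (c * \<rho>\<^sup>2) \<le> hausdorff_outer 2 (frontier U \<inter> cball y \<rho>)"
      if y: "y \<in> frontier U \<inter> ball x (r / 2)" and \<rho>: "0 < \<rho>" "\<rho> < r / 2" for y \<rho>
    proof -
      have yx: "dist x y < r / 2" using y by simp
      then have "y \<in> frontier U \<inter> ball x r" using y *(1) by simp
      then have "u y = 0" using *(3) by auto
      then have \<Gamma>y: "\<Gamma> (p y) = y" by (rule *(8))
      have "cball (p y) (\<rho> / M) \<subseteq> p ` (frontier U \<inter> cball y \<rho>)"
      proof
        fix z assume z: "z \<in> cball (p y) (\<rho> / M)"
        have "dist y (\<Gamma> z) \<le> M * dist (p y) z" using lipschitz_onD[OF *(5), of "p y" z] \<Gamma>y by simp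
        also have "\<dots> \<le> M * (\<rho> / M)" using z *(2) by (intro mult_left_mono) auto
        finally have d: "dist y (\<Gamma> z) \<le> \<rho>" using *(2) by simp
        then have "dist x (\<Gamma> z) < r" using yx \<rho> dist_triangle[of x "\<Gamma> z" y] by linarith
        then have "\<Gamma> z \<in> frontier U \<inter> ball x r" using *(3,7) by simp
        then show "z \<in> p ` (frontier U \<inter> cball y \<rho>)" using d *(6)[of z] by (intro image_eqI[of _ _ "\<Gamma> z"]) auto
      qed
      from hausdorff_outer_projection_ge[OF *(4) this] \<rho> *(2)
      have "ennreal (unit_ball_vol 2 * (\<rho> / M / 2)\<^sup>2) \<le> hausdorff_outer 2 (frontier U \<inter> cball y \<rho>)"
        by (simp add: less_imp_le)
      moreover have "unit_ball_vol 2 * (\<rho> / M / 2)\<^sup>2 = c * \<rho>\<^sup>2"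
        by (simp add: c_def power_divide power_mult_distrib)
      ultimately show ?thesis by simp
    qed
    moreover have "c > 0" using *(2) by (simp add: c_def)
    ultimately show ?thesis using *(1) by (intro exI[of _ "r / 2"] exI[of _ c]) auto
  qed
  then have "\<forall>x\<in>frontier U. \<exists>r c. r > 0 \<and> c > 0 \<and> (\<forall>y\<in>frontier U \<inter> ball x r. \<forall>\<rho>. 0 < \<rho> \<and> \<rho> < r \<longrightarrow>
      ennreal (c * \<rho>\<^sup>2) \<le> hausdorff_outer 2 (frontier U \<inter> cball y \<rho>))" by blast
  from bchoice[OF this] obtain r where "\<forall>x\<in>frontier U. \<exists>c. r x > 0 \<and> c > 0 \<and> (\<forall>y\<in>frontier U \<inter> ball x (r x). \<forall>\<rho>. 0 < \<rho> \<and> \<rho> < r x \<longrightarrow>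
      ennreal (c * \<rho>\<^sup>2) \<le> hausdorff_outer 2 (frontier U \<inter> cball y \<rho>))" by blast
  from bchoice[OF this] obtain c where rc: "\<And>x. x \<in> frontier U \<Longrightarrow> r x > 0 \<and> c x > 0"
    "\<And>x y \<rho>. x \<in> frontier U \<Longrightarrow> y \<in> frontier U \<inter> ball x (r x) \<Longrightarrow> 0 < \<rho> \<Longrightarrow> \<rho> < r x \<Longrightarrow>
      ennreal (c x * \<rho>\<^sup>2) \<le> hausdorff_outer 2 (frontier U \<inter> cball y \<rho>)" by blast
  obtain C where C: "finite C" "C \<subseteq> frontier U" "frontier U \<subseteq> (\<Union>x\<in>C. ball x (r x))"
    by (rule compact_finite_ball_cover[OF U(3), of r]) (use rc(1) in auto)
  define c0 where "c0 = Min (insert 1 (c ` C))"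
  define \<rho>0 where "\<rho>0 = Min (insert 1 (r ` C)) / 2"
  show ?thesis
  proof (rule that[of c0 \<rho>0])
    show "c0 > 0" "\<rho>0 > 0" using C rc(1) by (auto simp: c0_def \<rho>0_def)
    fix y \<rho> assume y: "y \<in> frontier U" and \<rho>: "0 < \<rho>" "\<rho> \<le> \<rho>0"
    obtain x where x: "x \<in> C" "y \<in> ball x (r x)" using C(3) y by blast
    have "Min (insert 1 (r ` C)) \<le> r x" "c0 \<le> c x" using C(1) x(1) by (auto simp: c0_def)
    moreover have "Min (insert 1 (r ` C)) > 0" using C rc(1) by auto
    ultimately have "\<rho> < r x" "c0 * \<rho>\<^sup>2 \<le> c x * \<rho>\<^sup>2"
      using \<rho> by (auto simp: \<rho>0_def intro: mult_right_mono)
    then show "ennreal (c0 * \<rho>\<^sup>2) \<le> hausdorff_outer 2 (frontier U \<inter> cball y \<rho>)"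
      using order_trans[OF ennreal_leI rc(2)[of x y \<rho>]] x y \<rho>(1) C(2) by auto
  qed
qed

lemma space_boundary_measure: "space (boundary_measure U) = frontier U"
  by (simp add: space_restrict_space)

lemma sets_boundary_measure: "sets (boundary_measure U) = sets (restrict_space borel (frontier U))"
  by (rule sets_restrict_space_cong) simp

lemma emeasure_boundary_measure:
  assumes "A \<in> sets borel" "A \<subseteq> frontier U"
  shows "emeasure (boundary_measure U) A = hausdorff_outer 2 A"
  using assms by (subst emeasure_restrict_space) (auto simp: emeasure_hausdorff_measure)

lemma finite_boundary_measure:
  assumes "open U" "lipschitz_boundary U" "compact (frontier U)"
  shows "finite_measure (boundary_measure U)"
proof (rule finite_measureI)
  have "emeasure (boundary_measure U) (frontier U) = hausdorff_outer 2 (frontier U)"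
    by (rule emeasure_boundary_measure) auto
  then show "emeasure (boundary_measure U) (space (boundary_measure U)) \<noteq> \<infinity>"
    using hausdorff_boundary_finite[OF assms] by (simp add: space_boundary_measure less_top)
qed

lemma boundary_measure_ball_ge:
  fixes U :: "(real^3) set"
  assumes U: "open U" "lipschitz_boundary U" "compact (frontier U)"
  obtains c \<rho>0 where "c > 0" "\<rho>0 > 0"
    "\<And>y \<rho>. y \<in> frontier U \<Longrightarrow> 0 < \<rho> \<Longrightarrow> \<rho> \<le> \<rho>0 \<Longrightarrow> c * \<rho>\<^sup>2 \<le> measure (boundary_measure U) (frontier U \<inter> cball y \<rho>)"
proof -
  interpret finite_measure "boundary_measure U" by (rule finite_boundary_measure[OF U])
  obtain c \<rho>0 where c: "c > 0" "\<rho>0 > 0"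
    "\<And>y \<rho>. y \<in> frontier U \<Longrightarrow> 0 < \<rho> \<Longrightarrow> \<rho> \<le> \<rho>0 \<Longrightarrow> ennreal (c * \<rho>\<^sup>2) \<le> hausdorff_outer 2 (frontier U \<inter> cball y \<rho>)"
    using hausdorff_boundary_ball_ge[OF U] by blast
  show ?thesis
  proof (rule that[OF c(1,2)])
    fix y \<rho> assume y: "y \<in> frontier U" "0 < \<rho>" "\<rho> \<le> \<rho>0"
    have "ennreal (c * \<rho>\<^sup>2) \<le> emeasure (boundary_measure U) (frontier U \<inter> cball y \<rho>)"
      using c(3)[OF y] by (subst emeasure_boundary_measure) (auto intro!: borel_closed closed_Int)
    then show "c * \<rho>\<^sup>2 \<le> measure (boundary_measure U) (frontier U \<inter> cball y \<rho>)"
      unfolding emeasure_eq_measure using ennreal_le_iff[OF measure_nonneg] by blast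
  qed
qed

subsection \<open>Tangent planes\<close>

text \<open>If \<open>g \<bullet> v = 0\<close>, then \<open>u (x + s v) = o(s)\<close>, and moving this point along \<open>e\<close> by that amount brings it back to
  the level set; so \<open>v\<close> is tangent. The converse is the definition of the derivative.\<close>

lemma tangent_cone_level_set:
  fixes S :: "'a::euclidean_space set" and u :: "'a \<Rightarrow> real"
  assumes r: "r > 0" and xS: "x \<in> S" and S: "S \<inter> ball x r = {y \<in> ball x r. u y = 0}"
    and ue: "\<And>y s. u (y + s *\<^sub>R e) = u y + s" and D: "(u has_derivative (\<lambda>v. g \<bullet> v)) (at x)"
  shows "tangent_cone S x = {v. g \<bullet> v = 0}"
proof -
  have ux: "u x = 0"
  proof -
    have "x \<in> S \<inter> ball x r" using xS r by simp
    then show ?thesis using S by blast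
  qed
  have alt: "\<exists>d>0. \<forall>y. norm (y - x) < d \<longrightarrow> \<bar>u y - g \<bullet> (y - x)\<bar> \<le> \<epsilon> * norm (y - x)" if "\<epsilon> > 0" for \<epsilon>
    using D that unfolding has_derivative_at_alt by (auto simp: ux)
  have np: "norm v + 1 > 0" for v :: 'a using norm_ge_zero[of v] by linarith
  show ?thesis
  proof (intro equalityI subsetI CollectI)
    fix v assume "v \<in> tangent_cone S x"
    then obtain y t where yt: "\<And>n::nat. y n \<in> S" "\<And>n. t n > (0::real)" "t \<longlonglongrightarrow> 0" "(\<lambda>n. (y n - x) /\<^sub>R t n) \<longlonglongrightarrow> v"
      unfolding tangent_cone_def by blast
    define h where "h n = (y n - x) /\<^sub>R t n" for n
    have h: "h \<longlonglongrightarrow> v" using yt(4) by (simp add: h_def[abs_def])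
    have yh: "y n - x = t n *\<^sub>R h n" for n using yt(2)[of n] by (simp add: h_def)
    have "(\<lambda>n. t n *\<^sub>R h n) \<longlonglongrightarrow> 0 *\<^sub>R v" by (intro tendsto_intros yt(3) h)
    then have small: "(\<lambda>n. norm (y n - x)) \<longlonglongrightarrow> 0" unfolding yh using tendsto_norm_zero[of "\<lambda>n. t n *\<^sub>R h n"] by simp
    have "\<bar>g \<bullet> v\<bar> \<le> \<epsilon> * norm v" if \<epsilon>: "\<epsilon> > 0" for \<epsilon>
    proof (rule tendsto_le[OF sequentially_bot])
      show "(\<lambda>n. \<epsilon> * norm (h n)) \<longlonglongrightarrow> \<epsilon> * norm v" by (intro tendsto_intros h)
      show "(\<lambda>n. \<bar>g \<bullet> h n\<bar>) \<longlonglongrightarrow> \<bar>g \<bullet> v\<bar>" by (intro tendsto_intros h)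
      obtain d where d: "d > 0" "\<And>y. norm (y - x) < d \<Longrightarrow> \<bar>u y - g \<bullet> (y - x)\<bar> \<le> \<epsilon> * norm (y - x)"
        using alt[OF \<epsilon>] by blast
      have "eventually (\<lambda>n. norm (y n - x) < min d r) sequentially"
        using small d(1) r by (intro order_tendstoD(2)) auto
      then show "eventually (\<lambda>n. \<bar>g \<bullet> h n\<bar> \<le> \<epsilon> * norm (h n)) sequentially"
      proof eventually_elim
        case (elim n)
        then have "y n \<in> S \<inter> ball x r" using yt(1) by (simp add: dist_norm norm_minus_commute)
        then have "u (y n) = 0" using S by blast
        then have "\<bar>g \<bullet> (y n - x)\<bar> \<le> \<epsilon> * norm (y n - x)" using d(2)[of "y n"] elim by simp
        then show ?case unfolding yh using yt(2)[of n] by (simp add: abs_mult)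
      qed
    qed
    then have "\<bar>g \<bullet> v\<bar> \<le> 0 + \<epsilon>" if "\<epsilon> > 0" for \<epsilon>
    proof -
      have "\<bar>g \<bullet> v\<bar> \<le> \<epsilon> / (norm v + 1) * norm v"
        using that by (intro \<open>\<And>\<epsilon>. \<epsilon> > 0 \<Longrightarrow> \<bar>g \<bullet> v\<bar> \<le> \<epsilon> * norm v\<close>) (use that np[of v] in simp)
      also have "\<dots> \<le> \<epsilon>" using that np[of v] by (simp add: field_simps)
      finally show ?thesis by simp
    qed
    then have "\<bar>g \<bullet> v\<bar> \<le> 0" by (rule field_le_epsilon)
    then show "g \<bullet> v = 0" by simp
  next
    fix v assume "v \<in> {v. g \<bullet> v = 0}"
    then have gv: "g \<bullet> v = 0" by simp
    define s where "s n = 1 / real (Suc n)" for n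
    have s: "s n > 0" "s \<longlonglongrightarrow> 0" for n
      unfolding s_def using LIMSEQ_Suc[OF lim_1_over_n] by auto
    define w where "w n = u (x + s n *\<^sub>R v)" for n
    define y where "y n = x + s n *\<^sub>R v + (- w n) *\<^sub>R e" for n
    have uy: "u (y n) = 0" for n unfolding y_def ue by (simp add: w_def)
    have ws: "(\<lambda>n. w n / s n) \<longlonglongrightarrow> 0"
    proof (rule LIMSEQ_I)
      fix \<epsilon> :: real assume "\<epsilon> > 0"
      define \<epsilon>' where "\<epsilon>' = \<epsilon> / (norm v + 1)"
      have \<epsilon>': "\<epsilon>' > 0" "\<epsilon>' * norm v < \<epsilon>"
        using \<open>\<epsilon> > 0\<close> np[of v] by (simp_all add: \<epsilon>'_def field_simps)
      obtain d where d: "d > 0" "\<And>y. norm (y - x) < d \<Longrightarrow> \<bar>u y - g \<bullet> (y - x)\<bar> \<le> \<epsilon>' * norm (y - x)"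
        using alt[OF \<epsilon>'(1)] by blast
      have "(\<lambda>n. norm (s n *\<^sub>R v)) \<longlonglongrightarrow> norm (0 *\<^sub>R v)" by (intro tendsto_intros s(2))
      then have "eventually (\<lambda>n. norm (s n *\<^sub>R v) < d) sequentially"
        using d(1) by (intro order_tendstoD(2)) auto
      then have "eventually (\<lambda>n. norm (w n / s n - 0) < \<epsilon>) sequentially"
      proof eventually_elim
        case (elim n)
        then have "\<bar>w n\<bar> \<le> \<epsilon>' * norm (s n *\<^sub>R v)"
          using d(2)[of "x + s n *\<^sub>R v"] gv by (simp add: w_def)
        then have "\<bar>w n / s n\<bar> \<le> \<epsilon>' * norm v" using s(1)[of n] by (simp add: field_simps)
        then show ?case using \<epsilon>'(2) by simp
      qed
      then show "\<exists>N. \<forall>n\<ge>N. norm (w n / s n - 0) < \<epsilon>" by (simp add: eventually_sequentially)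
    qed
    have quot: "(y n - x) /\<^sub>R s n = v - (w n / s n) *\<^sub>R e" for n
      using s(1)[of n] by (simp add: y_def scaleR_add_right scaleR_diff_right divide_inverse mult.commute)
    have lim: "(\<lambda>n. (y n - x) /\<^sub>R s n) \<longlonglongrightarrow> v - 0 *\<^sub>R e"
      unfolding quot by (intro tendsto_intros ws)
    have "(\<lambda>n. s n *\<^sub>R ((y n - x) /\<^sub>R s n)) \<longlonglongrightarrow> 0 *\<^sub>R (v - 0 *\<^sub>R e)"
      by (intro tendsto_intros s(2) lim)
    moreover have "s n *\<^sub>R ((y n - x) /\<^sub>R s n) = y n - x" for n using s(1)[of n] by simp
    ultimately have "(\<lambda>n. norm (y n - x)) \<longlonglongrightarrow> 0" by (simp add: tendsto_norm_zero)
    then have "eventually (\<lambda>n. norm (y n - x) < r) sequentially" using r by (rule order_tendstoD(2))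
    then obtain K where K: "\<And>n. n \<ge> K \<Longrightarrow> norm (y n - x) < r" by (auto simp: eventually_sequentially)
    have "y (n + K) \<in> S \<and> s (n + K) > 0" for n
    proof -
      have "y (n + K) \<in> {y \<in> ball x r. u y = 0}" using K[of "n + K"] uy by (simp add: dist_norm norm_minus_commute)
      then show ?thesis using S s(1) by blast
    qed
    moreover have "(\<lambda>n. s (n + K)) \<longlonglongrightarrow> 0" by (rule LIMSEQ_ignore_initial_segment[OF s(2)])
    moreover have "(\<lambda>n. (y (n + K) - x) /\<^sub>R s (n + K)) \<longlonglongrightarrow> v"
      using LIMSEQ_ignore_initial_segment[OF lim, of K] by simp
    ultimately show "v \<in> tangent_cone S x"
      unfolding tangent_cone_def
      by (intro CollectI exI[of _ "\<lambda>n. y (n + K)"] exI[of _ "\<lambda>n. s (n + K)"]) simp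
  qed
qed

lemma derivative_unit_speed:
  fixes u :: "'a::euclidean_space \<Rightarrow> real"
  assumes ue: "\<And>y s. u (y + s *\<^sub>R e) = u y + s" and D: "(u has_derivative (\<lambda>v. g \<bullet> v)) (at x)"
  shows "g \<bullet> e = 1"
proof -
  have "((\<lambda>s. x + s *\<^sub>R e) has_derivative (\<lambda>s. s *\<^sub>R e)) (at 0)" by (auto intro!: derivative_eq_intros)
  moreover have "(u has_derivative (\<lambda>v. g \<bullet> v)) (at (x + 0 *\<^sub>R e))" using D by simp
  ultimately have "((\<lambda>s. u (x + s *\<^sub>R e)) has_derivative (\<lambda>s. g \<bullet> (s *\<^sub>R e))) (at 0)"
    by (rule has_derivative_compose)
  then have "((\<lambda>s. u x + s) has_derivative (\<lambda>s. s * (g \<bullet> e))) (at 0)" by (simp add: ue)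
  moreover have "((\<lambda>s. u x + s) has_derivative (\<lambda>s. s)) (at 0)" by (auto intro!: derivative_eq_intros)
  ultimately have "(\<lambda>s. s * (g \<bullet> e)) = (\<lambda>s. s)" by (rule has_derivative_unique)
  then show ?thesis by (metis mult_1)
qed

lemma is_tangent_space_level_set:
  fixes S :: "(real^3) set"
  assumes "r > 0" "x \<in> S" "S \<inter> ball x r = {y \<in> ball x r. u y = 0}"
    "\<And>y s. u (y + s *\<^sub>R e) = u y + s" "(u has_derivative (\<lambda>v. g \<bullet> v)) (at x)"
  shows "is_tangent_space S x {v. g \<bullet> v = 0}"
proof -
  have "g \<noteq> 0" using derivative_unit_speed[OF assms(4,5)] by auto
  then have "dim {v. g \<bullet> v = 0} = 2" by (simp add: dim_hyperplane)
  then show ?thesis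
    unfolding is_tangent_space_def using tangent_cone_level_set[OF assms] subspace_hyperplane by blast
qed

section \<open>The volume of a neighbourhood weighted by a continuous function\<close>

text \<open>Cover the neighbourhood by balls whose shrunken copies, centred on \<open>S\<close>, are disjoint. On each of
  them the function varies little, and the volume of the ball is at most a multiple of \<open>\<epsilon>\<close> times the
  measure of the shrunken copy.\<close>

lemma neighbourhood_integral_le:
  fixes S :: "(real^3) set" and M :: "(real^3) measure" and f :: "real^3 \<Rightarrow> real"
  assumes S: "compact S" and "finite_measure M" and sets: "sets M = sets (restrict_space borel S)"
    and c: "c > 0" and \<rho>0: "\<rho>0 > 0"
    and lower: "\<And>y \<rho>. y \<in> S \<Longrightarrow> 0 < \<rho> \<Longrightarrow> \<rho> \<le> \<rho>0 \<Longrightarrow> c * \<rho>\<^sup>2 \<le> measure M (S \<inter> cball y \<rho>)"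
    and f: "continuous_on UNIV f" "\<And>y. 0 \<le> f y" and \<eta>: "\<eta> > 0"
  obtains \<epsilon>0 where "\<epsilon>0 > 0" "\<And>\<epsilon>. 0 < \<epsilon> \<Longrightarrow> \<epsilon> < \<epsilon>0 \<Longrightarrow>
    (LINT y|lborel. indicator {y. \<exists>x\<in>S. dist x y < \<epsilon>} y * f y)
      \<le> 125 * unit_ball_vol 3 / c * \<epsilon> * ((LINT x|M. f x) + \<eta> * measure M S)"
proof -
  interpret finite_measure M by fact
  have space: "space M = S" using sets_eq_imp_space_eq[OF sets] by (simp add: space_restrict_space)
  have Sb: "S \<in> sets borel" using S by (simp add: compact_imp_closed borel_closed)
  have Mset: "A \<in> sets M" if "A \<in> sets borel" "A \<subseteq> S" for A
    using that Sb unfolding sets by (auto simp: sets_restrict_space image_iff)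
  have fM: "f \<in> borel_measurable M"
    unfolding measurable_cong_sets[OF sets refl]
    by (intro measurable_restrict_space1 borel_measurable_continuous_onI f)
  obtain B where B: "\<And>x. x \<in> S \<Longrightarrow> norm x \<le> B"
    using compact_imp_bounded[OF S] by (auto simp: bounded_iff)
  have "uniformly_continuous_on (cball 0 (B + 1)) f"
    by (intro compact_uniformly_continuous continuous_on_subset[OF f(1)]) auto
  then obtain d where d: "d > 0"
    "\<And>x y. x \<in> cball 0 (B + 1) \<Longrightarrow> y \<in> cball 0 (B + 1) \<Longrightarrow> dist y x < d \<Longrightarrow> dist (f y) (f x) < \<eta>"
    using \<eta> unfolding uniformly_continuous_on_def by blast
  have fint: "integrable M f"
  proof -
    have "compact (f ` S)" by (intro compact_continuous_image S continuous_on_subset[OF f(1)]) auto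
    then obtain K where "\<forall>x\<in>S. \<bar>f x\<bar> \<le> K" by (force dest!: compact_imp_bounded simp: bounded_iff)
    then show ?thesis using fM space by (intro integrable_const_bound[of _ K]) auto
  qed
  define V where "V = unit_ball_vol 3"
  have V: "V > 0" by (simp add: V_def)
  define \<epsilon>0 where "\<epsilon>0 = min (min \<rho>0 (1/5)) (d / 6)"
  show ?thesis
  proof (rule that[of \<epsilon>0])
    show "\<epsilon>0 > 0" using \<rho>0 d(1) by (simp add: \<epsilon>0_def)
    fix \<epsilon> assume \<epsilon>: "0 < \<epsilon>" "\<epsilon> < \<epsilon>0"
    have \<epsilon>': "\<epsilon> \<le> \<rho>0" "5 * \<epsilon> < 1" "6 * \<epsilon> < d" using \<epsilon> by (auto simp: \<epsilon>0_def)
    obtain C where C: "countable C" "C \<subseteq> S" "pairwise (\<lambda>i j. disjnt (cball i \<epsilon>) (cball j \<epsilon>)) C"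
      "\<And>i. i \<in> S \<Longrightarrow> \<exists>j. j \<in> C \<and> \<not> disjnt (cball i \<epsilon>) (cball j \<epsilon>) \<and> cball i \<epsilon> \<subseteq> ball j (5 * \<epsilon>)"
      using Vitali_covering_lemma_cballs_balls[of S "\<lambda>_. \<epsilon>" \<epsilon> "\<lambda>x. x"] \<epsilon>(1) by blast
    define Z where "Z j = S \<inter> cball j \<epsilon>" for j
    have Zs: "Z j \<in> sets M" for j unfolding Z_def using Sb by (intro Mset) auto
    have Zm: "c * \<epsilon>\<^sup>2 \<le> measure M (Z j)" if "j \<in> C" for j
      unfolding Z_def using lower[of j \<epsilon>] that C(2) \<epsilon>(1) \<epsilon>'(1) by blast
    have disj: "disjoint_family_on Z D" if "D \<subseteq> C" for D
      using C(3) that unfolding disjoint_family_on_def pairwise_def disjnt_def Z_def by blast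
    have c\<epsilon>: "c * \<epsilon>\<^sup>2 > 0" using c \<epsilon>(1) by simp
    have "finite C"
    proof -
      have "card D \<le> nat \<lceil>measure M (space M) / (c * \<epsilon>\<^sup>2)\<rceil>" if D: "D \<subseteq> C" "finite D" for D
      proof -
        have "card D * (c * \<epsilon>\<^sup>2) \<le> (\<Sum>j\<in>D. measure M (Z j))"
          using Zm D sum_mono[of D "\<lambda>_. c * \<epsilon>\<^sup>2" "\<lambda>j. measure M (Z j)"] by auto
        also have "\<dots> = measure M (\<Union>j\<in>D. Z j)"
          by (rule finite_measure_finite_Union[symmetric]) (use D disj Zs in auto)
        also have "\<dots> \<le> measure M (space M)" by (rule bounded_measure)
        finally have "real (card D) \<le> measure M (space M) / (c * \<epsilon>\<^sup>2)" using c\<epsilon> by (simp add: pos_le_divide_eq)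
        then show ?thesis by linarith
      qed
      then show ?thesis using finite_if_finite_subsets_card_bdd by blast
    qed
    define a where "a j = (1 / (c * \<epsilon>\<^sup>2)) * (LINT x|M. indicator (Z j) x * (f x + \<eta>))" for j
    have intZ: "integrable M (\<lambda>x. indicator (Z j) x * (f x + \<eta>))" for j
      using integrable_mult_indicator[OF Zs[of j], of "\<lambda>x. f x + \<eta>"] fint by simp
    have a: "f y \<le> a j" if j: "j \<in> C" and y: "y \<in> ball j (5 * \<epsilon>)" for j y
    proof -
      have jS: "j \<in> S" using j C(2) by blast
      have yb: "y \<in> cball 0 (B + 1)"
      proof -
        have "norm y \<le> norm j + dist j y" using norm_triangle_ineq2[of y j] by (simp add: dist_norm norm_minus_commute)
        then show ?thesis using y B[OF jS] \<epsilon>'(2) by simp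
      qed
      have "f y \<le> f x + \<eta>" if x: "x \<in> Z j" for x
      proof -
        have "dist y x < d" using x y \<epsilon>'(3) dist_triangle[of y x j] by (simp add: Z_def dist_commute)
        moreover have "x \<in> cball 0 (B + 1)" using x B[of x] by (simp add: Z_def)
        ultimately have "dist (f y) (f x) < \<eta>" using yb by (intro d(2)) auto
        then show ?thesis by (simp add: dist_real_def)
      qed
      then have "(LINT x|M. indicator (Z j) x * f y) \<le> (LINT x|M. indicator (Z j) x * (f x + \<eta>))"
      proof (intro integral_mono intZ)
        show "integrable M (\<lambda>x. indicator (Z j) x * f y)"
          using Zs[of j] by (intro integrable_mult_left integrable_real_indicator) (simp_all add: emeasure_eq_measure)
      qed (auto simp: indicator_def)
      then have le: "f y * measure M (Z j) \<le> (LINT x|M. indicator (Z j) x * (f x + \<eta>))"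
        using Zs[of j] sets.sets_into_space[OF Zs[of j]] by (simp add: Int_absorb1 mult.commute)
      have "f y * (c * \<epsilon>\<^sup>2) \<le> f y * measure M (Z j)" by (rule mult_left_mono[OF Zm[OF j] f(2)])
      with le have "f y * (c * \<epsilon>\<^sup>2) \<le> (LINT x|M. indicator (Z j) x * (f x + \<eta>))" by linarith
      then show ?thesis using c\<epsilon> by (simp add: a_def pos_le_divide_eq)
    qed
    have a0: "0 \<le> a j" if "j \<in> C" for j
    proof -
      have "j \<in> ball j (5 * \<epsilon>)" using \<epsilon>(1) by simp
      from a[OF that this] show ?thesis using f(2)[of j] by linarith
    qed
    have "(LINT y|lborel. indicator {y. \<exists>x\<in>S. dist x y < \<epsilon>} y * f y)
        \<le> (LINT y|lborel. (\<Sum>j\<in>C. a j * indicator (ball j (5 * \<epsilon>)) y))"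
    proof (rule integral_mono_AE')
      show "integrable lborel (\<lambda>y. \<Sum>j\<in>C. a j * indicator (ball j (5 * \<epsilon>)) y)"
        using emeasure_bounded_finite[OF bounded_ball]
        by (intro Bochner_Integration.integrable_sum integrable_mult_right integrable_real_indicator) auto
      show "AE y in lborel. 0 \<le> (\<Sum>j\<in>C. a j * indicator (ball j (5 * \<epsilon>)) y)"
        using a0 by (intro AE_I2 sum_nonneg) auto
      show "AE y in lborel. indicator {y. \<exists>x\<in>S. dist x y < \<epsilon>} y * f y \<le> (\<Sum>j\<in>C. a j * indicator (ball j (5 * \<epsilon>)) y)"
      proof (rule AE_I2)
        fix y
        show "indicator {y. \<exists>x\<in>S. dist x y < \<epsilon>} y * f y \<le> (\<Sum>j\<in>C. a j * indicator (ball j (5 * \<epsilon>)) y)"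
        proof (cases "\<exists>x\<in>S. dist x y < \<epsilon>")
          case True
          then obtain x where x: "x \<in> S" "dist x y < \<epsilon>" by blast
          obtain j where j: "j \<in> C" "cball x \<epsilon> \<subseteq> ball j (5 * \<epsilon>)" using C(4)[OF x(1)] by blast
          have yj: "y \<in> ball j (5 * \<epsilon>)" using j(2) x(2) by (meson less_imp_le mem_cball subsetD)
          have "f y \<le> a j * indicator (ball j (5 * \<epsilon>)) y" using a[OF j(1) yj] yj by simp
          also have "\<dots> \<le> (\<Sum>j\<in>C. a j * indicator (ball j (5 * \<epsilon>)) y)"
            by (rule member_le_sum[OF j(1)]) (use a0 \<open>finite C\<close> in auto)
          finally show ?thesis using True by simp
        next
          case False
          then show ?thesis using a0 by (simp add: sum_nonneg)
        qed
      qed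
    qed
    also have "\<dots> = (\<Sum>j\<in>C. a j * measure lborel (ball j (5 * \<epsilon>)))"
      using emeasure_bounded_finite[OF bounded_ball]
      by (subst Bochner_Integration.integral_sum) (auto intro!: integrable_mult_right integrable_real_indicator)
    also have "\<dots> = (\<Sum>j\<in>C. 125 * V / c * \<epsilon> * (LINT x|M. indicator (Z j) x * (f x + \<eta>)))"
    proof (rule sum.cong[OF refl])
      fix j :: "real^3"
      have "measure lborel (ball j (5 * \<epsilon>)) = 125 * V * \<epsilon> ^ 3"
        using \<epsilon>(1) by (simp add: content_ball V_def power_mult_distrib)
      then show "a j * measure lborel (ball j (5 * \<epsilon>)) = 125 * V / c * \<epsilon> * (LINT x|M. indicator (Z j) x * (f x + \<eta>))"
        using \<epsilon>(1) c by (simp add: a_def power2_eq_square power3_eq_cube)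
    qed
    also have "\<dots> = 125 * V / c * \<epsilon> * (LINT x|M. (\<Sum>j\<in>C. indicator (Z j) x * (f x + \<eta>)))"
      using intZ by (subst Bochner_Integration.integral_sum) (auto simp: sum_distrib_left)
    also have "\<dots> \<le> 125 * V / c * \<epsilon> * (LINT x|M. f x + \<eta>)"
    proof (intro mult_left_mono integral_mono)
      show "integrable M (\<lambda>x. \<Sum>j\<in>C. indicator (Z j) x * (f x + \<eta>))"
        using intZ by (intro Bochner_Integration.integrable_sum)
      show "integrable M (\<lambda>x. f x + \<eta>)" using fint by simp
      fix x
      have "(\<Sum>j\<in>C. indicator (Z j) x) = (indicator (\<Union>j\<in>C. Z j) x :: real)"
        by (rule indicator_UN_disjoint[OF \<open>finite C\<close> disj[OF order_refl], symmetric])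
      then have "(\<Sum>j\<in>C. indicator (Z j) x * (f x + \<eta>)) = indicator (\<Union>j\<in>C. Z j) x * (f x + \<eta>)"
        by (simp flip: sum_distrib_right)
      also have "\<dots> \<le> f x + \<eta>" using f(2)[of x] \<eta> by (simp add: indicator_def)
      finally show "(\<Sum>j\<in>C. indicator (Z j) x * (f x + \<eta>)) \<le> f x + \<eta>" .
    qed (use V c \<epsilon> in auto)
    also have "(LINT x|M. f x + \<eta>) = (LINT x|M. f x) + \<eta> * measure M S"
      using fint by (simp add: space)
    finally show "(LINT y|lborel. indicator {y. \<exists>x\<in>S. dist x y < \<epsilon>} y * f y)
      \<le> 125 * unit_ball_vol 3 / c * \<epsilon> * ((LINT x|M. f x) + \<eta> * measure M S)"
      by (simp add: V_def)
  qed
qed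

section \<open>Calculus of the test function classes\<close>

lemma pd_eqI: "(f has_derivative f') (at x) \<Longrightarrow> pd i f x = f' (axis i 1)"
  unfolding pd_def by (simp only: frechet_derivative_at[symmetric])

lemma pd_eq_grad: "(f has_derivative (\<lambda>v. g \<bullet> v)) (at x) \<Longrightarrow> pd i f x = g $ i"
  by (drule pd_eqI[where i=i]) (simp add: inner_axis)

lemma grad_eqI: "(f has_derivative (\<lambda>v. g \<bullet> v)) (at x) \<Longrightarrow> grad f x = g"
  by (simp add: grad_def vec_eq_iff pd_eq_grad)

lemma differentiable_has_derivative_pd:
  assumes "f differentiable (at x)"
  shows "(f has_derivative (\<lambda>v. \<Sum>i\<in>UNIV. v $ i *\<^sub>R pd i f x)) (at x)"
proof -
  have D: "(f has_derivative frechet_derivative f (at x)) (at x)"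
    using assms by (simp add: frechet_derivative_works)
  interpret L: bounded_linear "frechet_derivative f (at x)"
    using D by (rule has_derivative_bounded_linear)
  have "frechet_derivative f (at x) v = (\<Sum>i\<in>UNIV. v $ i *\<^sub>R pd i f x)" for v
  proof -
    have "frechet_derivative f (at x) v = frechet_derivative f (at x) (\<Sum>i\<in>UNIV. v $ i *\<^sub>R axis i 1)"
      by (simp add: basis_expansion scalar_mult_eq_scaleR[symmetric])
    then show ?thesis by (simp add: L.sum L.scaleR pd_def)
  qed
  then have "frechet_derivative f (at x) = (\<lambda>v. \<Sum>i\<in>UNIV. v $ i *\<^sub>R pd i f x)" by blast
  then show ?thesis using D by simp
qed

lemma has_derivative_grad:
  "f differentiable (at x) \<Longrightarrow> (f has_derivative (\<lambda>v. grad f x \<bullet> v)) (at x)"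
  using differentiable_has_derivative_pd[of f x]
  by (simp add: grad_def inner_vec_def mult.commute)

lemma C_k_imp_continuous: "C_k k f \<Longrightarrow> continuous_on UNIV f"
  by (cases k) (auto simp: continuous_on_eq_continuous_at intro: differentiable_imp_continuous_within)

lemma C_k_pred: "C_k (Suc k) f \<Longrightarrow> C_k k f"
proof (induction k arbitrary: f)
  case 0
  then show ?case using C_k_imp_continuous[of "Suc 0" f] by simp
next
  case (Suc k)
  then show ?case by simp
qed

lemma C_k_le: "C_k k f \<Longrightarrow> j \<le> k \<Longrightarrow> C_k j f"
proof (induction k)
  case (Suc k)
  then show ?case using C_k_pred by (cases "j = Suc k") auto
qed simp

lemma C_k_cong_local:
  assumes "\<And>x. \<exists>U h. open U \<and> x \<in> U \<and> C_k k h \<and> (\<forall>y\<in>U. f y = h y)"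
  shows "C_k k f"
  using assms
proof (induction k arbitrary: f)
  case 0
  show ?case
    unfolding C_k.simps continuous_on_eq_continuous_at[OF open_UNIV]
  proof
    fix x
    obtain U h where h: "open U" "x \<in> U" "C_k 0 h" "\<And>y. y \<in> U \<Longrightarrow> f y = h y" using 0[of x] by blast
    have "isCont h x" using h(3) by (simp add: continuous_on_eq_continuous_at)
    moreover have "eventually (\<lambda>y. h y = f y) (nhds x)"
      using eventually_nhds_in_open[OF h(1,2)] by eventually_elim (simp add: h(4))
    ultimately show "isCont f x" using isCont_cong by blast
  qed
next
  case (Suc k)
  have D: "(f has_derivative (\<lambda>v. \<Sum>i\<in>UNIV. v $ i *\<^sub>R pd i h x)) (at x)"
    if h: "open U" "x \<in> U" "C_k (Suc k) h" "\<And>y. y \<in> U \<Longrightarrow> f y = h y" for U h x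
  proof (rule has_derivative_transform_within_open[OF _ h(1,2)])
    show "(h has_derivative (\<lambda>v. \<Sum>i\<in>UNIV. v $ i *\<^sub>R pd i h x)) (at x)"
      using h(3) by (intro differentiable_has_derivative_pd) simp
  qed (simp add: h(4))
  have pd_eq: "pd i f x = pd i h x"
    if h: "open U" "x \<in> U" "C_k (Suc k) h" "\<And>y. y \<in> U \<Longrightarrow> f y = h y" for U h x i
    using pd_eqI[OF D[OF h], of i] by (simp add: axis_def if_distrib[of "\<lambda>c. c *\<^sub>R _"] cong: if_cong)
  show ?case
    unfolding C_k.simps
  proof (intro conjI allI)
    fix x show "f differentiable (at x)"
      using Suc.prems[of x] D unfolding differentiable_def by meson
  next
    fix i show "C_k k (pd i f)"
    proof (rule Suc.IH)
      fix x
      obtain U h where h: "open U" "x \<in> U" "C_k (Suc k) h" "\<And>y. y \<in> U \<Longrightarrow> f y = h y" using Suc.prems[of x] by blast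
      have "\<forall>y\<in>U. pd i f y = pd i h y" using pd_eq[OF h(1) _ h(3,4)] by blast
      moreover have "C_k k (pd i h)" using h(3) by simp
      ultimately show "\<exists>U h. open U \<and> x \<in> U \<and> C_k k h \<and> (\<forall>y\<in>U. pd i f y = h y)" using h(1,2) by blast
    qed
  qed
qed

lemma C_k_const: "C_k k (\<lambda>_. c)"
proof (induction k arbitrary: c)
  case (Suc k)
  have "pd i (\<lambda>_. c) = (\<lambda>_. 0)" for i by (rule ext) (simp add: pd_def)
  then show ?case using Suc by simp
qed simp

lemma C_k_bounded_linear:
  assumes "bounded_linear f"
  shows "C_k k f"
proof (cases k)
  case 0
  then show ?thesis using assms by (simp add: linear_continuous_on)
next
  case (Suc j)
  have "pd i f = (\<lambda>_. f (axis i 1))" for i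
    by (rule ext) (rule pd_eqI[OF bounded_linear_imp_has_derivative[OF assms]])
  then show ?thesis using Suc by (simp add: C_k_const bounded_linear_imp_differentiable[OF assms])
qed

lemma C_k_add:
  "C_k k f \<Longrightarrow> C_k k g \<Longrightarrow> C_k k (\<lambda>x. f x + g x)"
proof (induction k arbitrary: f g)
  case 0
  then show ?case by (simp add: continuous_on_add)
next
  case (Suc k)
  have "pd i (\<lambda>x. f x + g x) = (\<lambda>x. pd i f x + pd i g x)" for i
  proof
    fix x
    have "((\<lambda>x. f x + g x) has_derivative (\<lambda>h. frechet_derivative f (at x) h + frechet_derivative g (at x) h)) (at x)"
      using Suc.prems by (intro has_derivative_add) (simp_all add: frechet_derivative_works[symmetric])
    from pd_eqI[OF this] show "pd i (\<lambda>x. f x + g x) x = pd i f x + pd i g x" by (simp only: pd_def)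
  qed
  then show ?case using Suc by simp
qed

lemma C_k_scaleR:
  fixes f :: "real^3 \<Rightarrow> real"
  shows "C_k k f \<Longrightarrow> C_k k g \<Longrightarrow> C_k k (\<lambda>x. f x *\<^sub>R g x)"
proof (induction k arbitrary: f g)
  case 0
  then show ?case by (simp add: continuous_on_scaleR)
next
  case (Suc k)
  have D: "((\<lambda>x. f x *\<^sub>R g x) has_derivative
      (\<lambda>h. f x *\<^sub>R frechet_derivative g (at x) h + frechet_derivative f (at x) h *\<^sub>R g x)) (at x)" for x
    using Suc.prems by (intro has_derivative_scaleR) (simp_all add: frechet_derivative_works[symmetric])
  have "pd i (\<lambda>x. f x *\<^sub>R g x) = (\<lambda>x. f x *\<^sub>R pd i g x + pd i f x *\<^sub>R g x)" for i
    unfolding pd_def[of i f] pd_def[of i g] by (rule ext) (rule pd_eqI[OF D])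
  moreover have "C_k k (\<lambda>x. f x *\<^sub>R pd i g x + pd i f x *\<^sub>R g x)" for i
    using Suc.prems C_k_pred[OF Suc.prems(1)] C_k_pred[OF Suc.prems(2)]
    by (intro C_k_add Suc.IH) simp_all
  ultimately show ?case using D by (auto simp: differentiable_def)
qed

lemma C_k_mult:
  fixes f g :: "real^3 \<Rightarrow> real"
  shows "C_k k f \<Longrightarrow> C_k k g \<Longrightarrow> C_k k (\<lambda>x. f x * g x)"
  using C_k_scaleR[of k f g] by simp

lemma C_k_cmult: "C_k k f \<Longrightarrow> C_k k (\<lambda>x. c * f x :: real)"
  by (rule C_k_mult[OF C_k_const])

lemma C_k_component: "C_k k (\<lambda>x. x $ i)"
  by (rule C_k_bounded_linear[OF bounded_linear_vec_nth])

lemma C_k_compose_bounded_linear: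
  assumes "bounded_linear L"
  shows "C_k k f \<Longrightarrow> C_k k (\<lambda>x. L (f x))"
proof (induction k arbitrary: f)
  case 0
  then show ?case using assms by (simp add: bounded_linear.continuous_on)
next
  case (Suc k)
  have D: "((\<lambda>x. L (f x)) has_derivative (\<lambda>h. L (frechet_derivative f (at x) h))) (at x)" for x
    using Suc.prems by (intro bounded_linear.has_derivative[OF assms]) (simp add: frechet_derivative_works[symmetric])
  have "pd i (\<lambda>x. L (f x)) = (\<lambda>x. L (pd i f x))" for i
    unfolding pd_def[of i f] by (rule ext) (rule pd_eqI[OF D])
  then show ?case using Suc D by (auto simp: differentiable_def)
qed

lemma C_k_vec_lambda:
  assumes "\<And>i. C_k k (f i)"
  shows "C_k k (\<lambda>x. \<chi> i. f i x :: real^3)"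
proof -
  have "C_k k (\<lambda>x. \<Sum>i\<in>I. f i x *\<^sub>R axis i 1 :: real^3)" if "finite I" for I
    using that
  proof (induction I rule: finite_induct)
    case empty then show ?case by (simp add: C_k_const)
  next
    case (insert i I)
    then show ?case using assms by (simp add: C_k_add C_k_scaleR C_k_const)
  qed
  moreover have "(\<Sum>i\<in>UNIV. f i x *\<^sub>R axis i 1) = (\<chi> i. f i x)" for x
    using basis_expansion[of "\<chi> i. f i x"] by (simp add: scalar_mult_eq_scaleR)
  ultimately show ?thesis by (metis (no_types, lifting) ext finite)
qed

lemma C_1_iff_grad:
  fixes f :: "real^3 \<Rightarrow> real"
  assumes "\<And>x. (f has_derivative (\<lambda>v. g x \<bullet> v)) (at x)" "continuous_on UNIV g"
  shows "C_k 1 f"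
proof -
  have "pd i f = (\<lambda>x. g x $ i)" for i by (rule ext) (rule pd_eq_grad[OF assms(1)])
  then show ?thesis using assms by (auto simp: differentiable_def intro: continuous_on_component)
qed

lemma C_1D:
  fixes f :: "real^3 \<Rightarrow> real"
  assumes "C_k 1 f"
  shows "continuous_on UNIV f" "f differentiable (at x)" "(f has_derivative (\<lambda>v. grad f x \<bullet> v)) (at x)"
    "continuous_on UNIV (grad f)" "continuous_on UNIV (pd i f)"
proof -
  show "continuous_on UNIV f" by (rule C_k_imp_continuous[OF assms])
  show *: "f differentiable (at x)" using assms by simp
  show "(f has_derivative (\<lambda>v. grad f x \<bullet> v)) (at x)" by (rule has_derivative_grad[OF *])
  show "continuous_on UNIV (pd i f)" using assms by simp
  show "continuous_on UNIV (grad f)"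
    unfolding grad_def[abs_def] using assms by (intro continuous_on_vec_lambda) simp
qed

lemma grad_eq_0:
  assumes "open U" "x \<in> U" "\<And>y. y \<in> U \<Longrightarrow> f y = 0"
  shows "pd i f x = 0" "grad f x = 0"
proof -
  have "(f has_derivative (\<lambda>v. 0)) (at x)"
    by (rule has_derivative_transform_within_open[OF has_derivative_const[of 0] assms(1,2)]) (simp add: assms(3))
  then show pd: "pd i f x = 0" for i by (simp add: pd_eqI)
  then show "grad f x = 0" by (simp add: grad_def vec_eq_iff)
qed

lemma grad_mult:
  assumes "f differentiable (at x)" "g differentiable (at x)"
  shows "grad (\<lambda>x. f x * g x) x = f x *\<^sub>R grad g x + g x *\<^sub>R grad f x"
proof (rule grad_eqI)
  show "((\<lambda>x. f x * g x) has_derivative (\<lambda>v. (f x *\<^sub>R grad g x + g x *\<^sub>R grad f x) \<bullet> v)) (at x)"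
    using has_derivative_mult[OF has_derivative_grad[OF assms(1)] has_derivative_grad[OF assms(2)]]
    by (simp add: inner_add_left mult.commute)
qed

section \<open>Smoothness of mollified functions\<close>

lemma bump_scaled_has_derivative:
  "((\<lambda>z::real^3. bump n (a *\<^sub>R z)) has_derivative (\<lambda>v. (a *\<^sub>R bump_grad n (a *\<^sub>R z)) \<bullet> v)) (at z)"
proof -
  have "((\<lambda>z::real^3. a *\<^sub>R z) has_derivative (\<lambda>v. a *\<^sub>R v)) (at z)" by (auto intro!: derivative_eq_intros)
  from has_derivative_compose[OF this bump_has_derivative[of n "a *\<^sub>R z"]] show ?thesis by simp
qed

lemma pd_bump_scaled:
  "pd i (\<lambda>z::real^3. bump n (a *\<^sub>R z)) z
    = (- 2 * a\<^sup>2) * ((bump (n + 2) (a *\<^sub>R z) + (- real n) * bump (n + 1) (a *\<^sub>R z)) * z $ i)"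
  by (simp add: pd_eq_grad[OF bump_scaled_has_derivative] bump_grad_def power2_eq_square algebra_simps)

text \<open>The partial derivatives are linear combinations of members of the same family multiplied by
  coordinates.\<close>

lemma C_k_bump_scaled: "C_k k (\<lambda>z. bump n (a *\<^sub>R z))"
proof (induction k arbitrary: n)
  case 0
  show ?case by (simp, rule continuous_on_compose2[OF continuous_on_bump[of UNIV]]) (auto intro: continuous_intros)
next
  case (Suc k)
  have "C_k k (pd i (\<lambda>z. bump n (a *\<^sub>R z)))" for i
    unfolding pd_bump_scaled[abs_def] by (intro C_k_mult C_k_const C_k_add C_k_component Suc)
  moreover have "(\<lambda>z::real^3. bump n (a *\<^sub>R z)) differentiable (at x)" for x
    unfolding differentiable_def using bump_scaled_has_derivative by blast
  ultimately show ?case by simp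
qed

lemma moll_altdef: "moll \<delta> = (\<lambda>z::real^3. (1 / (\<delta> ^ 3 * (LINT z|lborel. bump 0 (z::real^3)))) * bump 0 ((1 / \<delta>) *\<^sub>R z))"
  by (rule ext) (simp add: moll_def divide_inverse mult.commute)

lemma C_k_moll: "C_k k (moll \<delta>)"
  unfolding moll_altdef by (intro C_k_cmult C_k_bump_scaled)

lemma pd_cmult:
  assumes "f differentiable (at x)"
  shows "pd i (\<lambda>x. c * f x :: real) x = c * pd i f x"
  using pd_eqI[OF has_derivative_mult_right[OF assms[unfolded frechet_derivative_works], of c]]
  by (simp only: pd_def)

lemma pd_mult_component:
  assumes "f differentiable (at x)"
  shows "pd i (\<lambda>x. f x * x $ j) x = pd i f x * x $ j + (if i = j then f x else 0)"
proof -
  have "((\<lambda>x. x $ j) has_derivative (\<lambda>v. v $ j)) (at x)"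
    by (rule bounded_linear_imp_has_derivative[OF bounded_linear_vec_nth])
  from pd_eqI[OF has_derivative_mult[OF assms[unfolded frechet_derivative_works] this], of i]
  show ?thesis unfolding pd_def[of i f] by (simp add: axis_def)
qed

lemma pd_pd_bump_commute:
  fixes i j :: 3
  shows "pd i (pd j (\<lambda>z. bump 0 (a *\<^sub>R z))) z = pd j (pd i (\<lambda>z. bump 0 (a *\<^sub>R z))) z"
proof -
  define b where "b n z = bump n (a *\<^sub>R z)" for n and z :: "real^3"
  have diff: "b n differentiable (at z)" for n z
    unfolding b_def using bump_scaled_has_derivative by (auto simp: differentiable_def)
  have pdb: "pd i (b n) z = (- 2 * a\<^sup>2) * ((b (n + 2) z + (- real n) * b (n + 1) z) * z $ i)" for i n z
    unfolding b_def by (rule pd_bump_scaled)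
  have "pd j (b 0) = (\<lambda>z. (- 2 * a\<^sup>2) * (b 2 z * z $ j))" for j
    by (rule ext) (simp add: pdb numeral_2_eq_2)
  moreover have "pd i (\<lambda>z. (- 2 * a\<^sup>2) * (b 2 z * z $ j)) z
      = (- 2 * a\<^sup>2) * (pd i (b 2) z * z $ j + (if i = j then b 2 z else 0))" for i j z
  proof -
    have "(\<lambda>z. b 2 z * z $ j) differentiable (at z)"
      by (intro differentiable_mult diff bounded_linear_imp_differentiable bounded_linear_vec_nth)
    from pd_cmult[OF this] show ?thesis by (simp only: pd_mult_component[OF diff])
  qed
  ultimately have "pd i (pd j (b 0)) z = (- 2 * a\<^sup>2) * (pd i (b 2) z * z $ j + (if i = j then b 2 z else 0))" for i j z
    by (simp only:)
  then have "pd i (pd j (b 0)) z = pd j (pd i (b 0)) z"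
    by (simp add: pdb mult_ac)
  then show ?thesis by (simp add: b_def[abs_def])
qed

lemma pd_pd_moll_commute: "pd i (pd j (moll \<delta>)) z = pd j (pd i (moll \<delta>)) (z::real^3)"
proof -
  define c where "c = 1 / (\<delta> ^ 3 * (LINT z|lborel. bump 0 (z::real^3)))"
  define b where "b z = bump 0 ((1 / \<delta>) *\<^sub>R z)" for z :: "real^3"
  have b: "C_k k b" for k unfolding b_def[abs_def] by (rule C_k_bump_scaled)
  have d1: "b differentiable (at z)" for z using b[of 1] by simp
  have d2: "pd j b differentiable (at z)" for j z using b[of 2] by (simp add: numeral_2_eq_2)
  have m: "moll \<delta> = (\<lambda>z. c * b z)" unfolding moll_altdef by (simp add: c_def b_def)
  have p: "pd j (moll \<delta>) = (\<lambda>z. c * pd j b z)" for j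
    unfolding m by (rule ext) (rule pd_cmult[OF d1])
  have "pd i (pd j b) z = pd j (pd i b) z"
    unfolding b_def[abs_def] by (rule pd_pd_bump_commute)
  then show ?thesis unfolding p pd_cmult[OF d2] by (simp only:)
qed

lemma pd_conv:
  fixes f k :: "real^3 \<Rightarrow> real"
  assumes f: "continuous_on UNIV f" and k: "C_k 1 k" and supp: "\<And>z. R < norm z \<Longrightarrow> k z = 0"
  shows "pd i (conv f k) x = conv f (pd i k) x" and "conv f k differentiable (at x)"
proof -
  note kD = C_1D[OF k]
  have op: "open {z::real^3. R < norm z}"
    by (intro open_Collect_less continuous_intros)
  have supp': "grad k z = 0" if "R < norm z" for z
    by (rule grad_eq_0(2)[OF op]) (use that supp in auto)
  have D: "(conv f k has_derivative (\<lambda>v. (LINT y|lborel. f y *\<^sub>R grad k (x - y)) \<bullet> v)) (at x)"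
    by (rule conv_has_derivative[where R=R]) (use f kD supp supp' in auto)
  show "conv f k differentiable (at x)" using D by (auto simp: differentiable_def)
  have int: "integrable lborel (\<lambda>y. f y *\<^sub>R grad k (x - y))"
    by (rule integrable_continuous_compact_support[where K="cball x R"])
      (use supp' in \<open>auto intro!: continuous_intros continuous_on_reflect f kD simp: dist_norm\<close>)
  have "pd i (conv f k) x = (LINT y|lborel. f y *\<^sub>R grad k (x - y)) \<bullet> axis i 1"
    by (simp add: pd_eqI[OF D])
  also have "\<dots> = (LINT y|lborel. (f y *\<^sub>R grad k (x - y)) \<bullet> axis i 1)"
    by (rule integral_inner_left[symmetric]) (rule int)
  also have "\<dots> = conv f (pd i k) x"
    by (simp add: conv_def inner_axis grad_def)
  finally show "pd i (conv f k) x = conv f (pd i k) x" .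
qed

lemma C_k_conv:
  fixes f k :: "real^3 \<Rightarrow> real"
  assumes f: "continuous_on UNIV f" and k: "\<And>j. C_k j k" and supp: "\<And>z. R < norm z \<Longrightarrow> k z = 0"
  shows "C_k m (conv f k)"
  using k supp
proof (induction m arbitrary: k)
  case 0
  have "conv f k differentiable (at x)" for x
    using pd_conv(2)[OF f 0(1)[of 1] 0(2)] by blast
  then show ?case by (simp add: continuous_on_eq_continuous_at differentiable_imp_continuous_within)
next
  case (Suc m)
  have "pd i (conv f k) = conv f (pd i k)" for i
    by (rule ext) (rule pd_conv(1)[OF f Suc.prems(1)[of 1] Suc.prems(2)])
  moreover have "C_k m (conv f (pd i k))" for i
  proof (rule Suc.IH)
    show "C_k j (pd i k)" for j using Suc.prems(1)[of "Suc j"] by simp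
    have op: "open {z::real^3. R < norm z}" by (intro open_Collect_less continuous_intros)
    show "pd i k z = 0" if "R < norm z" for z
      by (rule grad_eq_0(1)[OF op]) (use that Suc.prems(2) in auto)
  qed
  ultimately show ?case using pd_conv(2)[OF f Suc.prems(1)[of 1] Suc.prems(2)] by simp
qed

lemma C_k_mollify:
  fixes f :: "real^3 \<Rightarrow> real"
  assumes "continuous_on UNIV f" "\<delta> > 0"
  shows "C_k m (mollify \<delta> f)"
  by (rule C_k_conv[where R=\<delta>]) (use assms in \<open>auto intro: C_k_moll moll_eq_0\<close>)

lemma grad_mollify:
  fixes f :: "real^3 \<Rightarrow> real"
  assumes "continuous_on UNIV f" "\<delta> > 0"
  shows "grad (mollify \<delta> f) x = mollify_grad \<delta> f x"
  by (rule grad_eqI[OF mollify_has_derivative[OF assms]])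

lemma pd_mollify:
  fixes f :: "real^3 \<Rightarrow> real"
  assumes f: "C_k 1 f" and supp: "\<And>z. R < norm z \<Longrightarrow> f z = 0"
  shows "pd i (mollify \<delta> f) x = mollify \<delta> (pd i f) x"
proof -
  note fD = C_1D[OF f]
  have "mollify \<delta> f = conv (moll \<delta>) f"
    by (rule ext) (rule conv_commute[OF fD(1) continuous_on_moll])
  then have "pd i (mollify \<delta> f) x = conv (moll \<delta>) (pd i f) x"
    using pd_conv(1)[OF continuous_on_moll f supp] by simp
  also have "\<dots> = mollify \<delta> (pd i f) x"
    by (rule conv_commute[OF continuous_on_moll fD(5)])
  finally show ?thesis .
qed

lemma mollify_uniform_limit:
  fixes f :: "'a::euclidean_space \<Rightarrow> real"
  assumes f: "continuous_on UNIV f" and supp: "\<And>z. R < norm z \<Longrightarrow> f z = 0" and e: "e > 0"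
  obtains d where "d > 0" "\<And>\<delta> x. 0 < \<delta> \<Longrightarrow> \<delta> < d \<Longrightarrow> \<bar>mollify \<delta> f x - f x\<bar> \<le> e"
proof -
  obtain d where d: "d > 0" "\<And>z h. norm h < d \<Longrightarrow> norm (f (z + h) - f z) < e"
    using uniformly_continuous_compact_support[OF f supp e] by blast
  show ?thesis
  proof (rule that[OF d(1)])
    fix \<delta> x assume \<delta>: "0 < \<delta>" "\<delta> < d"
    show "\<bar>mollify \<delta> f x - f x\<bar> \<le> e"
    proof (rule mollify_diff_le[OF f \<delta>(1)])
      fix z :: 'a assume "norm z < \<delta>"
      then show "\<bar>f (x - z) - f x\<bar> \<le> e" using d(2)[of "- z" x] \<delta> by simp
    qed
  qed
qed

lemma mollify_pointwise_limit:
  fixes f :: "'a::euclidean_space \<Rightarrow> real"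
  assumes f: "continuous_on UNIV f"
  shows "((\<lambda>\<delta>. mollify \<delta> f x) \<longlongrightarrow> f x) (at_right 0)"
proof (rule tendstoI)
  fix e :: real assume e: "e > 0"
  have "isCont f x" using f by (simp add: continuous_on_eq_continuous_at)
  moreover have "e / 2 > 0" using e by simp
  ultimately have "eventually (\<lambda>y. dist (f y) (f x) < e / 2) (nhds x)"
    unfolding isCont_def tendsto_at_iff_tendsto_nhds by (rule tendstoD)
  then obtain d where d: "d > 0" "\<And>y. dist y x < d \<Longrightarrow> dist (f y) (f x) < e / 2"
    by (auto simp: eventually_nhds_metric)
  show "eventually (\<lambda>\<delta>. dist (mollify \<delta> f x) (f x) < e) (at_right 0)"
    unfolding eventually_at_right_field
  proof (intro exI[of _ d] conjI allI impI d(1))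
    fix \<delta> assume \<delta>: "0 < \<delta>" "\<delta> < d"
    have "\<bar>mollify \<delta> f x - f x\<bar> \<le> e / 2"
    proof (rule mollify_diff_le[OF f \<delta>(1)])
      fix z :: 'a assume "norm z < \<delta>"
      then show "\<bar>f (x - z) - f x\<bar> \<le> e / 2" using d(2)[of "x - z"] \<delta> by (simp add: dist_norm)
    qed
    then show "dist (mollify \<delta> f x) (f x) < e" using e by (simp add: dist_real_def)
  qed
qed

text \<open>Both mixed derivatives are limits of those of the mollifications, where the derivatives can be moved
  to the kernel, for which they commute by inspection.\<close>

lemma pd_commute:
  fixes f :: "real^3 \<Rightarrow> real"
  assumes f: "C_k 2 f" and supp: "\<And>z. R < norm z \<Longrightarrow> f z = 0"
  shows "pd i (pd j f) x = pd j (pd i f) x"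
proof -
  have f1: "C_k 1 f" using f by (rule C_k_le) simp
  have pf1: "C_k 1 (pd j f)" for j using f by (simp add: numeral_2_eq_2)
  note fc = C_1D(1)[OF f1]
  have op: "open {z::real^3. R < norm z}" by (intro open_Collect_less continuous_intros)
  have supp': "pd j f z = 0" if "R < norm z" for z j
    by (rule grad_eq_0(1)[OF op]) (use that supp in auto)
  have lim: "((\<lambda>\<delta>. pd i (pd j (mollify \<delta> f)) x) \<longlongrightarrow> pd i (pd j f) x) (at_right 0)" for i j
  proof -
    have "pd i (pd j (mollify \<delta> f)) x = mollify \<delta> (pd i (pd j f)) x" for \<delta>
    proof -
      have "pd j (mollify \<delta> f) = mollify \<delta> (pd j f)" by (rule ext) (rule pd_mollify[OF f1 supp])
      then show ?thesis using pd_mollify[OF pf1 supp'] by simp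
    qed
    then show ?thesis using mollify_pointwise_limit[OF C_1D(5)[OF pf1]] by simp
  qed
  have comm: "pd i (pd j (mollify \<delta> f)) x = pd j (pd i (mollify \<delta> f)) x" if \<delta>: "\<delta> > 0" for \<delta>
  proof -
    have m0: "moll \<delta> z = 0" if "\<delta> < norm z" for z :: "real^3" using that \<delta> by (intro moll_eq_0) auto
    have op: "open {z::real^3. \<delta> < norm z}" by (intro open_Collect_less continuous_intros)
    have m0': "pd j (moll \<delta>) z = 0" if "\<delta> < norm z" for z j
      by (rule grad_eq_0(1)[OF op]) (use that m0 in auto)
    have m1: "C_k 1 (pd j (moll \<delta>))" for j using C_k_moll[of 2 \<delta>] by (simp add: numeral_2_eq_2)
    have "pd j (mollify \<delta> f) = conv f (pd j (moll \<delta>))" for j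
      by (rule ext) (rule pd_conv(1)[OF fc C_k_moll m0])
    then have "pd i (pd j (mollify \<delta> f)) x = conv f (pd i (pd j (moll \<delta>))) x" for i j
      using pd_conv(1)[OF fc m1 m0'] by simp
    moreover have "pd i (pd j (moll \<delta>)) = pd j (pd i (moll \<delta>))"
      by (rule ext) (rule pd_pd_moll_commute)
    ultimately show ?thesis by simp
  qed
  have "((\<lambda>\<delta>. pd j (pd i (mollify \<delta> f)) x) \<longlongrightarrow> pd i (pd j f) x) (at_right 0)"
    by (rule Lim_transform_eventually[OF lim]) (auto simp: eventually_at_right_field comm intro: exI[of _ 1])
  from tendsto_unique[OF _ this lim] show ?thesis by simp
qed

section \<open>Test functions with compact support\<close>

lemma CcI:
  fixes \<phi> :: "real^3 \<Rightarrow> 'b::real_normed_vector"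
  assumes "C_k k \<phi>" "compact K" "K \<subseteq> \<Omega>" "\<And>x. x \<notin> K \<Longrightarrow> \<phi> x = 0"
  shows "\<phi> \<in> Cc k \<Omega>"
proof -
  have "{x. \<phi> x \<noteq> 0} \<subseteq> K" using assms(4) by blast
  then have sub: "closure {x. \<phi> x \<noteq> 0} \<subseteq> K" using assms(2) compact_imp_closed closure_minimal by blast
  moreover have "compact (closure {x. \<phi> x \<noteq> 0})"
    using compact_Int_closed[OF assms(2) closed_closure, of "{x. \<phi> x \<noteq> 0}"] sub by (simp add: Int_absorb1)
  ultimately show ?thesis using assms(1,3) by (auto simp: Cc_def)
qed

lemma CcE:
  fixes \<phi> :: "real^3 \<Rightarrow> 'b::real_normed_vector"
  assumes "\<phi> \<in> Cc k \<Omega>"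
  obtains K where "C_k k \<phi>" "compact K" "K \<subseteq> \<Omega>" "\<And>x. x \<notin> K \<Longrightarrow> \<phi> x = 0"
proof (rule that[of "closure {x. \<phi> x \<noteq> 0}"])
  show "\<phi> x = 0" if "x \<notin> closure {x. \<phi> x \<noteq> 0}" for x
    using that closure_subset[of "{x. \<phi> x \<noteq> 0}"] by blast
qed (use assms in \<open>auto simp: Cc_def\<close>)

lemma Cc_inftyI:
  fixes \<phi> :: "real^3 \<Rightarrow> 'b::real_normed_vector"
  assumes "\<And>k. C_k k \<phi>" "compact K" "K \<subseteq> \<Omega>" "\<And>x. x \<notin> K \<Longrightarrow> \<phi> x = 0"
  shows "\<phi> \<in> Cc_infty \<Omega>"
  unfolding Cc_infty_def by (rule INT_I) (rule CcI[OF assms])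

lemma Cc_lin:
  fixes \<phi> \<psi> :: "real^3 \<Rightarrow> real"
  assumes "\<phi> \<in> Cc k \<Omega>" "\<psi> \<in> Cc k \<Omega>"
  shows "(\<lambda>x. a * \<phi> x + b * \<psi> x) \<in> Cc k \<Omega>"
proof -
  obtain K where K: "C_k k \<phi>" "compact K" "K \<subseteq> \<Omega>" "\<And>x. x \<notin> K \<Longrightarrow> \<phi> x = 0" using CcE[OF assms(1)] by blast
  obtain L where L: "C_k k \<psi>" "compact L" "L \<subseteq> \<Omega>" "\<And>x. x \<notin> L \<Longrightarrow> \<psi> x = 0" using CcE[OF assms(2)] by blast
  show ?thesis
    by (rule CcI[where K="K \<union> L"]) (use K L in \<open>auto intro!: C_k_add C_k_cmult\<close>)
qed

lemma Cc_mult: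
  fixes \<phi> \<psi> :: "real^3 \<Rightarrow> real"
  assumes "\<phi> \<in> Cc k \<Omega>" "C_k k \<psi>"
  shows "(\<lambda>x. \<phi> x * \<psi> x) \<in> Cc k \<Omega>"
proof -
  obtain K where K: "C_k k \<phi>" "compact K" "K \<subseteq> \<Omega>" "\<And>x. x \<notin> K \<Longrightarrow> \<phi> x = 0" using CcE[OF assms(1)] by blast
  show ?thesis by (rule CcI[where K=K]) (use K assms(2) in \<open>auto intro!: C_k_mult\<close>)
qed

lemma Cc_pd:
  fixes \<phi> :: "real^3 \<Rightarrow> real"
  assumes "\<phi> \<in> Cc (Suc k) \<Omega>"
  shows "pd i \<phi> \<in> Cc k \<Omega>"
proof -
  obtain K where K: "C_k (Suc k) \<phi>" "compact K" "K \<subseteq> \<Omega>" "\<And>x. x \<notin> K \<Longrightarrow> \<phi> x = 0" using CcE[OF assms(1)] by blast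
  have "pd i \<phi> x = 0" if "x \<notin> K" for x
    by (rule grad_eq_0(1)[of "- K"]) (use that K compact_imp_closed in auto)
  then show ?thesis using K by (intro CcI[where K=K]) auto
qed

lemma compact_support_norm:
  assumes "compact (K :: 'a::real_normed_vector set)" "\<And>x. x \<notin> K \<Longrightarrow> f x = 0"
  obtains R where "\<And>z. R < norm z \<Longrightarrow> f z = 0"
proof -
  obtain R where "\<forall>x\<in>K. norm x \<le> R" using compact_imp_bounded[OF assms(1)] by (auto simp: bounded_iff)
  then show ?thesis using assms(2) that[of R] by force
qed

lemma continuous_bounded_on:
  fixes f :: "'a::euclidean_space \<Rightarrow> 'b::real_normed_vector"
  assumes "continuous_on UNIV f" "bounded A"
  obtains c where "c \<ge> 0" "\<And>x. x \<in> A \<Longrightarrow> norm (f x) \<le> c"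
proof -
  have "compact (f ` closure A)"
    using assms by (intro compact_continuous_image continuous_on_subset[OF assms(1)]) (auto simp: compact_closure)
  then obtain c where c: "\<forall>x\<in>closure A. norm (f x) \<le> c"
    by (force dest!: compact_imp_bounded simp: bounded_iff)
  show ?thesis
  proof (rule that[of "\<bar>c\<bar>"])
    fix x assume "x \<in> A"
    then have "norm (f x) \<le> c" using c closure_subset by blast
    then show "norm (f x) \<le> \<bar>c\<bar>" by linarith
  qed simp
qed

lemma mollify_Cc_infty:
  fixes f :: "real^3 \<Rightarrow> real"
  assumes f: "continuous_on UNIV f" and K: "compact K" "K \<subseteq> \<Omega>" "\<And>x. x \<notin> K \<Longrightarrow> f x = 0" and \<Omega>: "open \<Omega>"
  obtains d where "d > 0" "\<And>\<delta>. 0 < \<delta> \<Longrightarrow> \<delta> < d \<Longrightarrow> mollify \<delta> f \<in> Cc_infty \<Omega>"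
proof (cases "K = {}")
  case True
  show ?thesis
  proof (rule that[of 1])
    fix \<delta> :: real assume "0 < \<delta>"
    then show "mollify \<delta> f \<in> Cc_infty \<Omega>"
      using True K(3) by (intro Cc_inftyI[where K="{}"] C_k_mollify[OF f] mollify_eq_0) auto
  qed simp
next
  case False
  obtain e where e: "e > 0" "(\<Union>x\<in>K. cball x e) \<subseteq> \<Omega>"
    using compact_subset_open_imp_cball_epsilon_subset[OF K(1) \<Omega> K(2)] by blast
  show ?thesis
  proof (rule that[OF e(1)])
    fix \<delta> assume \<delta>: "0 < \<delta>" "\<delta> < e"
    show "mollify \<delta> f \<in> Cc_infty \<Omega>"
    proof (rule Cc_inftyI[where K="\<Union>x\<in>K. cball x e"])
      show "C_k k (mollify \<delta> f)" for k by (rule C_k_mollify[OF f \<delta>(1)])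
      show "compact (\<Union>x\<in>K. cball x e)" by (rule compact_minkowski_sum_cball[OF K(1)])
      fix x assume x: "x \<notin> (\<Union>x\<in>K. cball x e)"
      show "mollify \<delta> f x = 0"
      proof (rule mollify_eq_0[OF \<delta>(1)])
        fix y assume "norm (y - x) < \<delta>"
        then have "x \<in> cball y e" using \<delta>(2) by (simp add: dist_norm)
        then have "y \<notin> K" using x by blast
        then show "f y = 0" by (rule K(3))
      qed
    qed (rule e(2))
  qed
qed

lemma norm_cross3_le: "norm (cross3 a b) \<le> norm a * norm b"
proof -
  have "(norm (cross3 a b))\<^sup>2 \<le> (norm a * norm b)\<^sup>2" using norm_cross_dot[of a b] zero_le_power2[of "a \<bullet> b"] by linarith
  then show ?thesis by (rule power2_le_imp_le) simp
qed

section \<open>Fields whose curl is a measure\<close>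

locale curl_measure_field =
  fixes \<Omega> :: "(real^3) set" and F :: "real^3 \<Rightarrow> real^3" and \<mu> :: "(real^3) set \<Rightarrow> real^3" and B :: real
  assumes open_dom: "open \<Omega>" and bounded_dom: "bounded \<Omega>"
    and F_meas: "F \<in> borel_measurable (lebesgue_on \<Omega>)"
    and F_bound: "AE x in lebesgue_on \<Omega>. norm (F x) \<le> B" and B_nonneg: "0 \<le> B"
    and curl_measure: "has_curl_measure \<Omega> F \<mu>"
begin

text \<open>The positive and negative parts of the components of the measure \<open>\<mu>\<close>.\<close>

definition P :: "3 \<Rightarrow> (real^3) measure" where "P i = pos_part_measure \<Omega> (\<lambda>B. \<mu> B $ i)"
definition N :: "3 \<Rightarrow> (real^3) measure" where "N i = pos_part_measure \<Omega> (\<lambda>B. - (\<mu> B $ i))"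

text \<open>The total variation of the \<open>i\<close>-th component of \<open>\<mu>\<close>.\<close>

definition var :: "3 \<Rightarrow> (real^3) set \<Rightarrow> real" where "var i A = measure (P i) A + measure (N i) A"

text \<open>The two integrals in the trace functionals, componentwise against \<open>\<mu>\<close> and against the field \<open>F\<close>, and the
  \<open>i\<close>-th component of the trace functional of the set \<open>A\<close> itself, with the sign of the interior trace.\<close>

definition SI :: "3 \<Rightarrow> (real^3) set \<Rightarrow> (real^3 \<Rightarrow> real) \<Rightarrow> real" where
  "SI i A f = signed_integral \<Omega> (\<lambda>B. \<mu> B $ i) A f"

definition FI :: "(real^3) set \<Rightarrow> (real^3 \<Rightarrow> real^3) \<Rightarrow> real^3" where
  "FI A G = (LINT x:A|lebesgue. cross3 (F x) (G x))"

definition T :: "3 \<Rightarrow> (real^3) set \<Rightarrow> (real^3 \<Rightarrow> real) \<Rightarrow> real" where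
  "T i A \<phi> = SI i A \<phi> - FI A (grad \<phi>) $ i"

lemma SI_eq: "SI i A f = (LINT x:A|P i. f x) - (LINT x:A|N i. f x)"
  by (simp add: SI_def signed_integral_def P_def N_def)

lemma component_sums:
  fixes A :: "nat \<Rightarrow> (real^3) set"
  assumes "range A \<subseteq> {B \<in> sets borel. B \<subseteq> \<Omega>}" "disjoint_family A"
  shows "(\<lambda>n. \<mu> (A n) $ i) sums (\<mu> (\<Union>n. A n) $ i)"
    and "(\<lambda>n. - (\<mu> (A n) $ i)) sums (- (\<mu> (\<Union>n. A n) $ i))"
proof -
  have "(\<lambda>n. \<mu> (A n)) sums \<mu> (\<Union>n. A n)"
    using curl_measure assms unfolding has_curl_measure_def vector_radon_measure_def by blast
  then show "(\<lambda>n. \<mu> (A n) $ i) sums (\<mu> (\<Union>n. A n) $ i)"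
    by (rule bounded_linear.sums[OF bounded_linear_vec_nth])
  then show "(\<lambda>n. - (\<mu> (A n) $ i)) sums (- (\<mu> (\<Union>n. A n) $ i))" by (rule sums_minus)
qed

lemma finite_P: "finite_measure (P i)" and sets_P: "sets (P i) = sets (restrict_space borel \<Omega>)" and space_P: "space (P i) = \<Omega>"
  unfolding P_def using pos_part_measure_finite[OF open_dom component_sums(1)] by auto

lemma finite_N: "finite_measure (N i)" and sets_N: "sets (N i) = sets (restrict_space borel \<Omega>)" and space_N: "space (N i) = \<Omega>"
  unfolding N_def using pos_part_measure_finite[OF open_dom component_sums(2)] by auto

lemma borel_sets_dom: "A \<in> sets borel \<Longrightarrow> A \<subseteq> \<Omega> \<Longrightarrow> A \<in> sets (restrict_space borel \<Omega>)"
  using open_dom by (auto simp: sets_restrict_space image_iff)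

lemma integrable_dom:
  fixes f :: "real^3 \<Rightarrow> real"
  assumes Q: "finite_measure Q" "sets Q = sets (restrict_space borel \<Omega>)" "space Q = \<Omega>"
    and A: "A \<in> sets borel" "A \<subseteq> \<Omega>" and f: "continuous_on UNIV f"
  shows "integrable Q (\<lambda>x. indicator A x *\<^sub>R f x)"
proof -
  interpret finite_measure Q by fact
  obtain c where c: "c \<ge> 0" "\<And>x. x \<in> \<Omega> \<Longrightarrow> norm (f x) \<le> c"
    using continuous_bounded_on[OF f bounded_dom] by blast
  have fm: "f \<in> borel_measurable Q"
    unfolding measurable_cong_sets[OF Q(2) refl]
    by (intro measurable_restrict_space1 borel_measurable_continuous_onI f)
  have "A \<in> sets Q" using borel_sets_dom[OF A] Q(2) by simp
  then have "(\<lambda>x. indicator A x *\<^sub>R f x) \<in> borel_measurable Q" using fm by (intro borel_measurable_scaleR) auto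
  then show ?thesis
    using c Q(3) by (intro integrable_const_bound[of _ c]) (auto simp: indicator_def)
qed

lemmas integrable_P = integrable_dom[OF finite_P sets_P space_P]
lemmas integrable_N = integrable_dom[OF finite_N sets_N space_N]

lemma SI_lin:
  assumes A: "A \<in> sets borel" "A \<subseteq> \<Omega>" and f: "continuous_on UNIV f" "continuous_on UNIV g"
  shows "SI i A (\<lambda>x. a * f x + b * g x) = a * SI i A f + b * SI i A g"
proof -
  have "(LINT x|Q. indicator A x *\<^sub>R (a * f x + b * g x)) = a * (LINT x|Q. indicator A x *\<^sub>R f x) + b * (LINT x|Q. indicator A x *\<^sub>R g x)"
    if "integrable Q (\<lambda>x. indicator A x *\<^sub>R f x)" "integrable Q (\<lambda>x. indicator A x *\<^sub>R g x)" for Q :: "(real^3) measure"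
  proof -
    have "(LINT x|Q. indicator A x *\<^sub>R (a * f x + b * g x)) = (LINT x|Q. a * (indicator A x *\<^sub>R f x) + b * (indicator A x *\<^sub>R g x))"
      by (simp add: algebra_simps)
    then show ?thesis using that by simp
  qed
  then show ?thesis
    using integrable_P[OF A f(1)] integrable_P[OF A f(2)] integrable_N[OF A f(1)] integrable_N[OF A f(2)]
    unfolding SI_eq set_lebesgue_integral_def by (simp add: algebra_simps)
qed

lemma SI_extend: "E \<subseteq> A \<Longrightarrow> SI i A (\<lambda>x. if x \<in> E then f x else 0) = SI i E f"
proof -
  assume "E \<subseteq> A"
  then have "(\<lambda>x. indicator A x *\<^sub>R (if x \<in> E then f x else 0)) = (\<lambda>x. indicator E x *\<^sub>R f x)"
    by (intro ext) (auto simp: indicator_def)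
  then show ?thesis unfolding SI_eq set_lebesgue_integral_def by simp
qed

lemma SI_le:
  assumes A: "A \<in> sets borel" "A \<subseteq> \<Omega>" and D: "D \<in> sets borel" "D \<subseteq> \<Omega>" and f: "continuous_on UNIV f"
    and c: "c \<ge> 0" "\<And>x. x \<in> A \<Longrightarrow> x \<in> D \<Longrightarrow> \<bar>f x\<bar> \<le> c" "\<And>x. x \<in> A \<Longrightarrow> x \<notin> D \<Longrightarrow> f x = 0"
  shows "\<bar>SI i A f\<bar> \<le> c * var i D"
proof -
  have *: "\<bar>LINT x:A|Q. f x\<bar> \<le> c * measure Q D"
    if Q: "finite_measure Q" "sets Q = sets (restrict_space borel \<Omega>)" "space Q = \<Omega>" for Q
  proof -
    interpret finite_measure Q by fact
    have i: "integrable Q (\<lambda>x. indicator A x *\<^sub>R f x)" by (rule integrable_dom[OF Q A f])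
    have Ds: "D \<in> sets Q" using borel_sets_dom[OF D] Q(2) by simp
    have "\<bar>LINT x|Q. indicator A x *\<^sub>R f x\<bar> \<le> (LINT x|Q. \<bar>indicator A x *\<^sub>R f x\<bar>)"
      by (rule integral_abs_bound)
    also have "\<dots> \<le> (LINT x|Q. c * indicator D x)"
    proof (rule integral_mono)
      show "integrable Q (\<lambda>x. \<bar>indicator A x *\<^sub>R f x\<bar>)" by (rule integrable_abs[OF i])
      show "integrable Q (\<lambda>x. c * indicator D x)"
        using Ds by (intro integrable_mult_right integrable_real_indicator) (simp_all add: emeasure_eq_measure)
      show "\<bar>indicator A x *\<^sub>R f x\<bar> \<le> c * indicator D x" for x
        using c by (auto simp: indicator_def)
    qed
    also have "\<dots> = c * measure Q D" using Ds D(2) Q(3) by (simp add: Int_absorb2)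
    finally show ?thesis by (simp add: set_lebesgue_integral_def)
  qed
  show ?thesis
    unfolding SI_eq var_def
    using *[OF finite_P[of i] sets_P[of i] space_P[of i]] *[OF finite_N[of i] sets_N[of i] space_N[of i]]
    by (simp add: distrib_left)
qed

lemma var_nonneg: "0 \<le> var i A"
  by (simp add: var_def)

lemma var_decreasing_limit:
  assumes A: "\<And>n. A n \<in> sets borel" "\<And>n. A n \<subseteq> \<Omega>" "decseq A" "(\<Inter>n. A n) = {}"
  shows "(\<lambda>n. var i (A n)) \<longlonglongrightarrow> 0"
proof -
  have *: "(\<lambda>n. measure Q (A n)) \<longlonglongrightarrow> 0"
    if Q: "finite_measure Q" "sets Q = sets (restrict_space borel \<Omega>)" for Q
  proof -
    interpret finite_measure Q by fact
    have "range A \<subseteq> sets Q" using borel_sets_dom A Q(2) by auto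
    from finite_Lim_measure_decseq[OF this A(3)] show ?thesis using A(4) by simp
  qed
  show ?thesis unfolding var_def
    using tendsto_add[OF *[OF finite_P sets_P] *[OF finite_N sets_N]] by simp
qed

lemma F0_meas: "(\<lambda>x. indicator \<Omega> x *\<^sub>R F x) \<in> borel_measurable lebesgue"
  using F_meas open_dom by (subst (asm) borel_measurable_restrict_space_iff) auto

lemma F0_bound: "AE x in lebesgue. norm (indicator \<Omega> x *\<^sub>R F x) \<le> B"
proof -
  have "AE x in lebesgue. x \<in> \<Omega> \<longrightarrow> norm (F x) \<le> B"
    using F_bound open_dom by (subst (asm) AE_restrict_space_iff) auto
  then show ?thesis by eventually_elim (use B_nonneg in \<open>auto simp: indicator_def\<close>)
qed

lemma FI_integrable:
  assumes A: "A \<in> sets lebesgue" "A \<subseteq> \<Omega>" and G: "continuous_on UNIV G"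
  shows "integrable lebesgue (\<lambda>x. indicator A x *\<^sub>R cross3 (F x) (G x))"
proof -
  have eq: "(\<lambda>x. indicator A x *\<^sub>R cross3 (F x) (G x)) = (\<lambda>x. indicator A x *\<^sub>R cross3 (indicator \<Omega> x *\<^sub>R F x) (G x))"
    using A(2) by (intro ext) (auto simp: indicator_def)
  have Gm: "G \<in> borel_measurable lebesgue"
    using borel_measurable_continuous_onI[OF G] by (simp add: measurable_completion)
  have "(\<lambda>x. cross3 (indicator \<Omega> x *\<^sub>R F x) (G x)) \<in> borel_measurable lebesgue"
    by (rule borel_measurable_continuous_Pair[OF F0_meas Gm])
      (intro continuous_on_cross continuous_intros)
  then have m: "(\<lambda>x. indicator A x *\<^sub>R cross3 (indicator \<Omega> x *\<^sub>R F x) (G x)) \<in> borel_measurable lebesgue"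
    using A(1) by (intro borel_measurable_scaleR) auto
  obtain c where c: "c \<ge> 0" "\<And>x. x \<in> \<Omega> \<Longrightarrow> norm (G x) \<le> c"
    using continuous_bounded_on[OF G bounded_dom] by blast
  have i: "integrable lebesgue (\<lambda>x. indicator \<Omega> x * (B * c))"
    using lmeasurable_open[OF bounded_dom open_dom]
    by (intro integrable_mult_left integrable_real_indicator) (auto simp: fmeasurable_def)
  show ?thesis
    unfolding eq
  proof (rule Bochner_Integration.integrable_bound[OF i m])
    show "AE x in lebesgue. norm (indicator A x *\<^sub>R cross3 (indicator \<Omega> x *\<^sub>R F x) (G x)) \<le> norm (indicator \<Omega> x * (B * c))"
      using F0_bound
    proof eventually_elim
      case (elim x)
      show ?case
      proof (cases "x \<in> A")
        case True
        then have x: "x \<in> \<Omega>" using A(2) by blast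
        have "norm (cross3 (F x) (G x)) \<le> norm (F x) * norm (G x)" by (rule norm_cross3_le)
        also have "\<dots> \<le> B * c" using elim x c B_nonneg by (intro mult_mono) auto
        finally show ?thesis using True x B_nonneg c by simp
      qed simp
    qed
  qed
qed

lemma FI_lin:
  assumes A: "A \<in> sets lebesgue" "A \<subseteq> \<Omega>" and G: "continuous_on UNIV G" "continuous_on UNIV H"
  shows "FI A (\<lambda>x. a *\<^sub>R G x + b *\<^sub>R H x) = a *\<^sub>R FI A G + b *\<^sub>R FI A H"
proof -
  have "FI A (\<lambda>x. a *\<^sub>R G x + b *\<^sub>R H x)
      = (LINT x|lebesgue. a *\<^sub>R (indicator A x *\<^sub>R cross3 (F x) (G x)) + b *\<^sub>R (indicator A x *\<^sub>R cross3 (F x) (H x)))"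
    unfolding FI_def set_lebesgue_integral_def
    by (rule Bochner_Integration.integral_cong)
      (simp_all only: cross_add_right cross_mult_right scaleR_add_right scaleR_left_commute[of "indicator A _"])
  also have "\<dots> = (LINT x|lebesgue. a *\<^sub>R (indicator A x *\<^sub>R cross3 (F x) (G x)))
      + (LINT x|lebesgue. b *\<^sub>R (indicator A x *\<^sub>R cross3 (F x) (H x)))"
    by (rule Bochner_Integration.integral_add[OF integrable_scaleR_right[OF FI_integrable[OF A G(1)]]
          integrable_scaleR_right[OF FI_integrable[OF A G(2)]]])
  also have "\<dots> = a *\<^sub>R FI A G + b *\<^sub>R FI A H"
    unfolding FI_def set_lebesgue_integral_def by (simp only: integral_scaleR_right)
  finally show ?thesis .
qed

lemma FI_le:
  fixes h :: "real^3 \<Rightarrow> real"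
  assumes A: "A \<in> sets lebesgue" "A \<subseteq> \<Omega>" and G: "continuous_on UNIV G"
    and h: "integrable lebesgue h" "\<And>x. x \<in> A \<Longrightarrow> norm (G x) \<le> h x" "\<And>x. 0 \<le> h x"
  shows "\<bar>FI A G $ i\<bar> \<le> B * (LINT x|lebesgue. h x)"
proof -
  have "\<bar>FI A G $ i\<bar> \<le> norm (FI A G)" by (rule component_le_norm_cart)
  also have "\<dots> \<le> (LINT x|lebesgue. norm (indicator A x *\<^sub>R cross3 (F x) (G x)))"
    unfolding FI_def set_lebesgue_integral_def by (rule integral_norm_bound)
  also have "\<dots> \<le> (LINT x|lebesgue. B * h x)"
  proof (rule integral_mono_AE)
    show "integrable lebesgue (\<lambda>x. norm (indicator A x *\<^sub>R cross3 (F x) (G x)))"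
      by (rule integrable_norm[OF FI_integrable[OF A G]])
    show "integrable lebesgue (\<lambda>x. B * h x)" using h(1) by simp
    show "AE x in lebesgue. norm (indicator A x *\<^sub>R cross3 (F x) (G x)) \<le> B * h x"
      using F0_bound
    proof eventually_elim
      case (elim x)
      show ?case
      proof (cases "x \<in> A")
        case True
        then have x: "x \<in> \<Omega>" using A(2) by blast
        have "norm (cross3 (F x) (G x)) \<le> norm (F x) * norm (G x)" by (rule norm_cross3_le)
        also have "\<dots> \<le> B * h x" using elim x h(2)[OF True] B_nonneg by (intro mult_mono) auto
        finally show ?thesis using True by simp
      next
        case False
        then show ?thesis using B_nonneg h(3) by simp
      qed
    qed
  qed
  finally show ?thesis by simp
qed

lemma grad_lin:
  fixes \<phi> \<psi> :: "real^3 \<Rightarrow> real"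
  assumes "\<phi> differentiable (at x)" "\<psi> differentiable (at x)"
  shows "grad (\<lambda>x. a * \<phi> x + b * \<psi> x) x = a *\<^sub>R grad \<phi> x + b *\<^sub>R grad \<psi> x"
proof (rule grad_eqI)
  show "((\<lambda>x. a * \<phi> x + b * \<psi> x) has_derivative (\<lambda>v. (a *\<^sub>R grad \<phi> x + b *\<^sub>R grad \<psi> x) \<bullet> v)) (at x)"
    using has_derivative_add[OF has_derivative_mult_right[OF has_derivative_grad[OF assms(1)], of a]
        has_derivative_mult_right[OF has_derivative_grad[OF assms(2)], of b]]
    by (simp add: inner_add_left)
qed

lemma T_lin:
  assumes A: "A \<in> sets borel" "A \<subseteq> \<Omega>" and f: "C_k 1 \<phi>" "C_k 1 \<psi>"
  shows "T i A (\<lambda>x. a * \<phi> x + b * \<psi> x) = a * T i A \<phi> + b * T i A \<psi>"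
proof -
  have "grad (\<lambda>x. a * \<phi> x + b * \<psi> x) = (\<lambda>x. a *\<^sub>R grad \<phi> x + b *\<^sub>R grad \<psi> x)"
    by (rule ext) (rule grad_lin[OF C_1D(2)[OF f(1)] C_1D(2)[OF f(2)]])
  moreover have "A \<in> sets lebesgue" using A(1) by simp
  ultimately show ?thesis
    unfolding T_def using SI_lin[OF A C_1D(1)[OF f(1)] C_1D(1)[OF f(2)], of i a b]
      FI_lin[OF _ A(2) C_1D(4)[OF f(1)] C_1D(4)[OF f(2)], of a b]
    by (simp add: algebra_simps)
qed

subsection \<open>The defining identity for continuously differentiable test functions\<close>

text \<open>The vector-valued test function \<open>\<phi>\<close> times the \<open>i\<close>-th unit vector extracts the \<open>i\<close>-th component.\<close>

lemma curl_identity_smooth: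
  fixes \<phi> :: "real^3 \<Rightarrow> real"
  assumes "\<phi> \<in> Cc_infty \<Omega>"
  shows "SI i \<Omega> \<phi> = FI \<Omega> (grad \<phi>) $ i"
proof -
  have \<phi>: "\<phi> \<in> Cc k \<Omega>" for k using assms by (simp add: Cc_infty_def)
  obtain K where K: "C_k 1 \<phi>" "compact K" "K \<subseteq> \<Omega>" "\<And>x. x \<notin> K \<Longrightarrow> \<phi> x = 0" using CcE[OF \<phi>[of 1]] by blast
  have C: "C_k k \<phi>" for k using \<phi>[of k] by (rule CcE)
  define \<Phi> :: "real^3 \<Rightarrow> real^3" where "\<Phi> x = \<phi> x *\<^sub>R axis i 1" for x
  have \<Phi>C: "C_k k \<Phi>" for k unfolding \<Phi>_def by (intro C_k_scaleR C C_k_const)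
  have \<Phi>: "\<Phi> \<in> Cc_infty \<Omega>"
    by (rule Cc_inftyI[OF \<Phi>C K(2,3)]) (simp add: \<Phi>_def K(4))
  have pd\<Phi>: "pd j \<Phi> x = pd j \<phi> x *\<^sub>R axis i 1" for j x
  proof -
    have "(\<phi> has_derivative (\<lambda>v. grad \<phi> x \<bullet> v)) (at x)" by (rule C_1D(3)[OF C])
    then have "(\<Phi> has_derivative (\<lambda>v. (grad \<phi> x \<bullet> v) *\<^sub>R axis i 1)) (at x)"
      unfolding \<Phi>_def by (rule has_derivative_scaleR_left)
    from pd_eqI[OF this] show ?thesis by (simp add: inner_axis grad_def)
  qed
  have pw: "F x \<bullet> curl \<Phi> x = cross3 (F x) (grad \<phi> x) $ i" for x
  proof -
    consider "i = 1" | "i = 2" | "i = 3" using exhaust_3[of i] by blast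
    then show ?thesis
      by cases (simp_all add: curl_def pd\<Phi> cross3_def grad_def inner_vec_def sum_3 axis_def algebra_simps)
  qed
  have "FI \<Omega> (grad \<phi>) $ i = (LINT x|lebesgue. indicator \<Omega> x *\<^sub>R cross3 (F x) (grad \<phi> x)) \<bullet> axis i 1"
    by (simp add: FI_def set_lebesgue_integral_def inner_axis)
  also have "\<dots> = (LINT x|lebesgue. (indicator \<Omega> x *\<^sub>R cross3 (F x) (grad \<phi> x)) \<bullet> axis i 1)"
    by (rule integral_inner_left[symmetric]) (use FI_integrable[OF _ order_refl C_1D(4)[OF C]] open_dom in auto)
  also have "\<dots> = (LINT x:\<Omega>|lebesgue. F x \<bullet> curl \<Phi> x)"
    by (simp add: set_lebesgue_integral_def inner_axis pw)
  also have "\<dots> = vm_integral_dot \<Omega> \<mu> \<Omega> \<Phi>"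
    using curl_measure \<Phi> unfolding has_curl_measure_def by blast
  also have "\<dots> = (\<Sum>j\<in>UNIV. if j = i then SI i \<Omega> \<phi> else 0)"
    unfolding vm_integral_dot_def
  proof (rule sum.cong[OF refl])
    fix j
    have "signed_integral \<Omega> (\<lambda>B. \<mu> B $ j) \<Omega> (\<lambda>x. 0) = 0"
      by (simp add: signed_integral_def set_lebesgue_integral_def)
    then show "signed_integral \<Omega> (\<lambda>B. \<mu> B $ j) \<Omega> (\<lambda>x. \<Phi> x $ j) = (if j = i then SI i \<Omega> \<phi> else 0)"
      by (simp add: \<Phi>_def SI_def axis_def)
  qed
  also have "\<dots> = SI i \<Omega> \<phi>" by simp
  finally show ?thesis by simp
qed

text \<open>The mollifications of \<open>\<phi>\<close> converge uniformly together with their first derivatives, and both sides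
  are continuous in this sense because the measures are finite and \<open>\<Omega>\<close> is bounded.\<close>

lemma curl_identity:
  fixes \<phi> :: "real^3 \<Rightarrow> real"
  assumes \<phi>: "\<phi> \<in> Cc 1 \<Omega>"
  shows "SI i \<Omega> \<phi> = FI \<Omega> (grad \<phi>) $ i"
proof -
  obtain K where K: "C_k 1 \<phi>" "compact K" "K \<subseteq> \<Omega>" "\<And>x. x \<notin> K \<Longrightarrow> \<phi> x = 0" using CcE[OF \<phi>] by blast
  note c = C_1D[OF K(1)]
  obtain R where R: "\<And>z. R < norm z \<Longrightarrow> \<phi> z = 0" using compact_support_norm[of K \<phi>] K(2,4) by blast
  have op: "open {z::real^3. R < norm z}" by (intro open_Collect_less continuous_intros)
  have R': "pd j \<phi> z = 0" if "R < norm z" for z j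
    by (rule grad_eq_0(1)[OF op]) (use that R in auto)
  have \<Omega>m: "\<Omega> \<in> lmeasurable" by (rule lmeasurable_open[OF bounded_dom open_dom])
  have \<Omega>b: "\<Omega> \<in> sets borel" "\<Omega> \<in> sets lebesgue" using open_dom by auto
  define C where "C = var i \<Omega> + B * (3 * measure lebesgue \<Omega>)"
  have "\<bar>SI i \<Omega> \<phi> - FI \<Omega> (grad \<phi>) $ i\<bar> \<le> 0 + e" if e: "e > 0" for e
  proof -
    have C0: "0 \<le> C" using var_nonneg B_nonneg by (simp add: C_def)
    define e' where "e' = e / (C + 1)"
    have e': "e' > 0" "e' * C \<le> e" using e C0 by (auto simp: e'_def field_simps)
    obtain d0 where d0: "d0 > 0" "\<And>\<delta>. 0 < \<delta> \<Longrightarrow> \<delta> < d0 \<Longrightarrow> mollify \<delta> \<phi> \<in> Cc_infty \<Omega>"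
      using mollify_Cc_infty[OF c(1) K(2,3,4) open_dom] by blast
    obtain d1 where d1: "d1 > 0" "\<And>\<delta> x. 0 < \<delta> \<Longrightarrow> \<delta> < d1 \<Longrightarrow> \<bar>mollify \<delta> \<phi> x - \<phi> x\<bar> \<le> e'"
      using mollify_uniform_limit[OF c(1) R e'(1)] by blast
    have "\<exists>d>0. \<forall>\<delta> x. 0 < \<delta> \<longrightarrow> \<delta> < d \<longrightarrow> \<bar>mollify \<delta> (pd j \<phi>) x - pd j \<phi> x\<bar> \<le> e'" for j
      by (rule mollify_uniform_limit[OF c(5)[of j] R' e'(1)]) blast+
    then obtain d2 where d2: "\<And>j. d2 j > 0" "\<And>j \<delta> x. 0 < \<delta> \<Longrightarrow> \<delta> < d2 j \<Longrightarrow> \<bar>mollify \<delta> (pd j \<phi>) x - pd j \<phi> x\<bar> \<le> e'"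
      by metis
    define \<delta> where "\<delta> = Min {d0, d1, d2 1, d2 2, d2 3} / 2"
    have \<delta>0: "\<delta> > 0" unfolding \<delta>_def using d0(1) d1(1) d2(1) by simp
    have min: "Min {d0, d1, d2 1, d2 2, d2 3} > 0" using \<delta>0 by (simp add: \<delta>_def)
    have \<delta>: "\<delta> < d0" "\<delta> < d1" "\<delta> < d2 j" for j
    proof -
      have "d2 j \<in> {d0, d1, d2 1, d2 2, d2 3}" using exhaust_3[of j] by auto
      then have "Min {d0, d1, d2 1, d2 2, d2 3} \<le> d2 j" by (intro Min_le) auto
      then show "\<delta> < d2 j" using min unfolding \<delta>_def by linarith
      have "Min {d0, d1, d2 1, d2 2, d2 3} \<le> d0" "Min {d0, d1, d2 1, d2 2, d2 3} \<le> d1" by (rule Min_le; simp)+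
      then show "\<delta> < d0" "\<delta> < d1" using min unfolding \<delta>_def by linarith+
    qed
    define \<psi> where "\<psi> = mollify \<delta> \<phi>"
    have \<psi>: "\<psi> \<in> Cc_infty \<Omega>" unfolding \<psi>_def by (rule d0(2)[OF \<delta>0 \<delta>(1)])
    have \<psi>1: "C_k 1 \<psi>" unfolding \<psi>_def by (rule C_k_mollify[OF c(1) \<delta>0])
    have T0: "T i \<Omega> \<psi> = 0" using curl_identity_smooth[OF \<psi>] by (simp add: T_def)
    define \<xi> where "\<xi> x = 1 * \<phi> x + (- 1) * \<psi> x" for x
    have \<xi>1: "C_k 1 \<xi>" unfolding \<xi>_def by (intro C_k_add C_k_cmult K(1) \<psi>1)
    have "T i \<Omega> \<phi> = T i \<Omega> \<xi>"
      using T_lin[OF \<Omega>b(1) order_refl K(1) \<psi>1, of i 1 "- 1"] T0 by (simp add: \<xi>_def[abs_def])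
    also have "\<bar>\<dots>\<bar> \<le> \<bar>SI i \<Omega> \<xi>\<bar> + \<bar>FI \<Omega> (grad \<xi>) $ i\<bar>" unfolding T_def by linarith
    also have "\<bar>SI i \<Omega> \<xi>\<bar> \<le> e' * var i \<Omega>"
      using d1(2)[OF \<delta>0 \<delta>(2)] e'
      by (intro SI_le \<Omega>b order_refl C_1D(1)[OF \<xi>1]) (auto simp: \<xi>_def \<psi>_def abs_minus_commute)
    also have "\<bar>FI \<Omega> (grad \<xi>) $ i\<bar> \<le> B * (LINT x|lebesgue. indicator \<Omega> x * (3 * e'))"
    proof (rule FI_le[OF \<Omega>b(2) order_refl C_1D(4)[OF \<xi>1]])
      show "integrable lebesgue (\<lambda>x. indicator \<Omega> x * (3 * e'))"
        using \<Omega>m by (intro integrable_mult_left integrable_real_indicator) (auto simp: fmeasurable_def)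
      fix x assume x: "x \<in> \<Omega>"
      have g: "grad \<xi> x = 1 *\<^sub>R grad \<phi> x + (- 1) *\<^sub>R grad \<psi> x"
        unfolding \<xi>_def by (rule grad_lin[OF c(2) C_1D(2)[OF \<psi>1]])
      have "norm (grad \<xi> x) \<le> (\<Sum>j\<in>UNIV. \<bar>grad \<xi> x $ j\<bar>)" by (rule norm_le_l1_cart)
      also have "\<dots> \<le> (\<Sum>j\<in>(UNIV::3 set). e')"
      proof (rule sum_mono)
        fix j :: 3
        have "grad \<xi> x $ j = grad \<phi> x $ j - grad \<psi> x $ j" by (simp add: g)
        also have "\<dots> = pd j \<phi> x - mollify \<delta> (pd j \<phi>) x"
          using pd_mollify[where i=j and \<delta>=\<delta> and x=x and R=R, OF K(1) R] by (simp add: grad_def \<psi>_def)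
        finally have "grad \<xi> x $ j = pd j \<phi> x - mollify \<delta> (pd j \<phi>) x" .
        then show "\<bar>grad \<xi> x $ j\<bar> \<le> e'" using d2(2)[OF \<delta>0 \<delta>(3)[of j], of x] by (simp add: abs_minus_commute)
      qed
      finally show "norm (grad \<xi> x) \<le> indicator \<Omega> x * (3 * e')" using x by simp
    qed (use e' in auto)
    also have "(LINT x|lebesgue. indicator \<Omega> x * (3 * e')) = measure lebesgue \<Omega> * (3 * e')" by simp
    finally have "\<bar>T i \<Omega> \<phi>\<bar> \<le> e' * C" by (simp add: C_def algebra_simps)
    then show ?thesis using e'(2) by (simp add: T_def)
  qed
  then have "\<bar>SI i \<Omega> \<phi> - FI \<Omega> (grad \<phi>) $ i\<bar> \<le> 0" by (rule field_le_epsilon)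
  then show ?thesis by simp
qed

text \<open>A test function that vanishes near the relative boundary of \<open>E\<close> can be cut off there without
  losing regularity.\<close>

lemma T_eq_0:
  fixes \<phi> :: "real^3 \<Rightarrow> real"
  assumes \<phi>: "\<phi> \<in> Cc 1 \<Omega>" and E: "open E" "E \<subseteq> \<Omega>"
    and W: "open W" "\<And>x. x \<in> W \<Longrightarrow> \<phi> x = 0" "\<Omega> \<subseteq> E \<union> interior (- E) \<union> W"
  shows "T i E \<phi> = 0"
proof -
  obtain K where K: "C_k 1 \<phi>" "compact K" "K \<subseteq> \<Omega>" "\<And>x. x \<notin> K \<Longrightarrow> \<phi> x = 0" using CcE[OF \<phi>] by blast
  define \<psi> where "\<psi> x = (if x \<in> E then \<phi> x else 0)" for x
  define V where "V = interior (- E) \<union> W \<union> - K"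
  have V: "open V"
    unfolding V_def by (intro open_Un open_interior W(1) open_Compl compact_imp_closed K(2))
  have \<psi>V: "\<psi> x = 0" if "x \<in> V" for x
    using that W(2) K(4) interior_subset[of "- E"] by (auto simp: V_def \<psi>_def)
  have cover: "x \<in> E \<or> x \<in> V" for x using W(3) K(3) by (auto simp: V_def)
  have "C_k 1 \<psi>"
  proof (rule C_k_cong_local)
    fix x
    show "\<exists>U h. open U \<and> x \<in> U \<and> C_k 1 h \<and> (\<forall>y\<in>U. \<psi> y = h y)"
    proof (cases "x \<in> E")
      case True
      then show ?thesis using E(1) K(1) by (intro exI[of _ E] exI[of _ \<phi>]) (auto simp: \<psi>_def)
    next
      case False
      then have "x \<in> V" using cover by blast
      then show ?thesis using V \<psi>V by (intro exI[of _ V] exI[of _ "\<lambda>_. 0"]) (auto simp: C_k_const simp del: C_k.simps One_nat_def)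
    qed
  qed
  then have \<psi>: "\<psi> \<in> Cc 1 \<Omega>"
    by (rule CcI[OF _ K(2,3)]) (simp add: \<psi>_def K(4))
  have g: "indicator \<Omega> x *\<^sub>R cross3 (F x) (grad \<psi> x) = indicator E x *\<^sub>R cross3 (F x) (grad \<phi> x)" for x
  proof (cases "x \<in> E")
    case True
    have "(\<psi> has_derivative (\<lambda>v. grad \<phi> x \<bullet> v)) (at x)"
      by (rule has_derivative_transform_within_open[OF C_1D(3)[OF K(1)] E(1) True]) (simp add: \<psi>_def)
    then show ?thesis using True E(2) by (simp add: grad_eqI subset_eq)
  next
    case False
    then have "x \<in> V" using cover by blast
    then have "grad \<psi> x = 0" by (rule grad_eq_0(2)[OF V _ \<psi>V])
    then show ?thesis using False by simp
  qed
  have "SI i E \<phi> = SI i \<Omega> \<psi>" unfolding \<psi>_def by (rule SI_extend[OF E(2), symmetric])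
  also have "\<dots> = FI \<Omega> (grad \<psi>) $ i" by (rule curl_identity[OF \<psi>])
  also have "\<dots> = FI E (grad \<phi>) $ i" by (simp add: FI_def set_lebesgue_integral_def g)
  finally show ?thesis by (simp add: T_def)
qed

end

section \<open>Cutoff functions near a compact set\<close>

text \<open>The mollification at scale \<open>\<epsilon>/6\<close> of a piecewise linear function of the distance to \<open>S\<close> that falls from
  one to zero between the distances \<open>\<epsilon>/3\<close> and \<open>2\<epsilon>/3\<close>.\<close>

lemma cutoff_exists:
  fixes S :: "(real^3) set" and \<epsilon> :: real
  assumes S: "compact S" and \<epsilon>: "\<epsilon> > 0"
  obtains \<kappa> W where "\<And>k. C_k k \<kappa>" "\<And>x. 0 \<le> \<kappa> x" "\<And>x. \<kappa> x \<le> 1" "open W" "S \<subseteq> W" "\<And>x. x \<in> W \<Longrightarrow> \<kappa> x = (1::real)"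
    "\<And>x. \<kappa> x \<noteq> 0 \<or> grad \<kappa> x \<noteq> 0 \<Longrightarrow> \<exists>s\<in>S. dist s x < \<epsilon>" "\<And>x. norm (grad \<kappa> x) \<le> 3 / \<epsilon>"
proof (cases "S = {}")
  case True
  have "grad (\<lambda>_. 0) x = 0" for x by (rule grad_eq_0(2)[of UNIV]) auto
  then show ?thesis using True \<epsilon> by (intro that[of "\<lambda>_. 0" "{}"]) (auto simp: C_k_const)
next
  case False
  define D where "D x = infdist x S" for x
  have D1: "\<bar>D x - D y\<bar> \<le> dist x y" for x y
    using infdist_triangle[of x S y] infdist_triangle[of y S x] by (auto simp: D_def dist_commute abs_le_iff)
  define h where "h x = min 1 (max 0 (2 - 3 * D x / \<epsilon>))" for x
  have h_lip: "(3 / \<epsilon>)-lipschitz_on UNIV h"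
  proof (rule lipschitz_onI)
    fix x y
    have clamp: "\<bar>min 1 (max 0 (2 - s)) - min 1 (max 0 (2 - t))\<bar> \<le> \<bar>s - t\<bar>" for s t :: real
      by linarith
    have "\<bar>h x - h y\<bar> \<le> \<bar>3 * D x / \<epsilon> - 3 * D y / \<epsilon>\<bar>" unfolding h_def by (rule clamp)
    also have "3 * D x / \<epsilon> - 3 * D y / \<epsilon> = 3 / \<epsilon> * (D x - D y)" by (simp add: right_diff_distrib)
    also have "\<bar>3 / \<epsilon> * (D x - D y)\<bar> = 3 / \<epsilon> * \<bar>D x - D y\<bar>"
      by (subst abs_mult) (use \<epsilon> in simp)
    also have "\<dots> \<le> 3 / \<epsilon> * dist x y" using D1 \<epsilon> by (intro mult_left_mono) auto
    finally show "dist (h x) (h y) \<le> 3 / \<epsilon> * dist x y" by (simp add: dist_real_def)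
  qed (use \<epsilon> in simp)
  have hc: "continuous_on UNIV h" by (rule lipschitz_imp_continuous[OF h_lip])
  define \<kappa> where "\<kappa> = mollify (\<epsilon> / 6) h"
  have \<delta>: "\<epsilon> / 6 > 0" using \<epsilon> by simp
  have close: "\<bar>D (x - z) - D x\<bar> < \<epsilon> / 6" if "norm z < \<epsilon> / 6" for x z
    using D1[of "x - z" x] that by (simp add: dist_norm)
  have Dc: "continuous_on UNIV D" unfolding D_def by (intro continuous_intros)
  have half: "\<bar>\<kappa> x - 1/2\<bar> \<le> 1/2" for x
  proof -
    have "\<bar>h y - 1/2\<bar> \<le> 1/2" for y
    proof -
      have "0 \<le> h y" "h y \<le> 1" by (auto simp: h_def)
      then show ?thesis by linarith
    qed
    then show ?thesis unfolding \<kappa>_def by (intro mollify_diff_le[OF hc \<delta>])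
  qed
  have zero: "\<kappa> x = 0" if "5 * \<epsilon> / 6 < D x" for x
  proof -
    have "\<bar>\<kappa> x - 0\<bar> \<le> 0"
      unfolding \<kappa>_def
    proof (rule mollify_diff_le[OF hc \<delta>])
      fix z :: "real^3" assume "norm z < \<epsilon> / 6"
      then have "2 * \<epsilon> / 3 < D (x - z)" using close[of z x] that by linarith
      then have "2 - 3 * D (x - z) / \<epsilon> \<le> 0" using \<epsilon> by (simp add: field_simps)
      then show "\<bar>h (x - z) - 0\<bar> \<le> 0" by (simp add: h_def)
    qed
    then show ?thesis by simp
  qed
  have op: "open {x. 5 * \<epsilon> / 6 < D x}" by (intro open_Collect_less Dc continuous_intros)
  have gzero: "grad \<kappa> x = 0" if "5 * \<epsilon> / 6 < D x" for x
    by (rule grad_eq_0(2)[OF op]) (use that zero in auto)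
  show ?thesis
  proof (rule that[of \<kappa> "{x. D x < \<epsilon> / 6}"])
    show "C_k k \<kappa>" for k unfolding \<kappa>_def by (rule C_k_mollify[OF hc \<delta>])
    show "0 \<le> \<kappa> x" "\<kappa> x \<le> 1" for x using half[of x] by linarith+
    show "open {x. D x < \<epsilon> / 6}" by (intro open_Collect_less Dc continuous_intros)
    show "S \<subseteq> {x. D x < \<epsilon> / 6}" using \<epsilon> by (auto simp: D_def)
    show "\<kappa> x = 1" if "x \<in> {x. D x < \<epsilon> / 6}" for x
    proof -
      have "\<bar>\<kappa> x - 1\<bar> \<le> 0"
        unfolding \<kappa>_def
      proof (rule mollify_diff_le[OF hc \<delta>])
        fix z :: "real^3" assume "norm z < \<epsilon> / 6"
        moreover have "D x < \<epsilon> / 6" using that by simp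
        ultimately have "D (x - z) < \<epsilon> / 3" using close[of z x] by linarith
        then have "1 \<le> 2 - 3 * D (x - z) / \<epsilon>" using \<epsilon> by (simp add: field_simps)
        then show "\<bar>h (x - z) - 1\<bar> \<le> 0" by (simp add: h_def)
      qed
      then show ?thesis by simp
    qed
    show "\<exists>s\<in>S. dist s x < \<epsilon>" if "\<kappa> x \<noteq> 0 \<or> grad \<kappa> x \<noteq> 0" for x
    proof -
      have "D x \<le> 5 * \<epsilon> / 6" using that zero[of x] gzero[of x] by force
      then have "D x < \<epsilon>" using \<epsilon> by linarith
      moreover obtain s where "s \<in> S" "infdist x S = dist x s"
        using infdist_attains_inf[OF compact_imp_closed[OF S] False] by blast
      ultimately show ?thesis by (auto simp: D_def dist_commute)
    qed
    show "norm (grad \<kappa> x) \<le> 3 / \<epsilon>" for x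
      unfolding \<kappa>_def grad_mollify[OF hc \<delta>] by (rule mollify_grad_norm_le[OF h_lip \<delta>])
  qed
qed

section \<open>Boundedness of the trace functional\<close>

text \<open>The set \<open>E\<close> is one side of the surface \<open>S\<close>, and \<open>M\<close> is the surface measure. The lower density bound is
  what compares \<open>M\<close> with the volume of thin neighbourhoods of \<open>S\<close>.\<close>

locale trace_surface = curl_measure_field +
  fixes S E :: "(real^3) set" and M :: "(real^3) measure" and c \<rho>0 :: real
  assumes compact_S: "compact S" and open_E: "open E" and E_dom: "E \<subseteq> \<Omega>"
    and E_S: "E \<inter> S = {}" and cover: "\<Omega> \<subseteq> E \<union> interior (- E) \<union> S"
    and finite_M: "finite_measure M" and sets_M: "sets M = sets (restrict_space borel S)"
    and c_pos: "c > 0" and \<rho>0_pos: "\<rho>0 > 0"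
    and lower: "\<And>y \<rho>. y \<in> S \<Longrightarrow> 0 < \<rho> \<Longrightarrow> \<rho> \<le> \<rho>0 \<Longrightarrow> c * \<rho>\<^sup>2 \<le> measure M (S \<inter> cball y \<rho>)"
begin

sublocale M: finite_measure M by (rule finite_M)

lemma space_M: "space M = S"
  using sets_eq_imp_space_eq[OF sets_M] by (simp add: space_restrict_space)

lemma measurable_M:
  fixes f :: "real^3 \<Rightarrow> 'b::topological_space"
  assumes "continuous_on UNIV f"
  shows "f \<in> borel_measurable M"
  unfolding measurable_cong_sets[OF sets_M refl]
  by (intro measurable_restrict_space1 borel_measurable_continuous_onI assms)

lemma bounded_on_S:
  fixes f :: "real^3 \<Rightarrow> 'b::real_normed_vector"
  assumes "continuous_on UNIV f"
  obtains k where "k \<ge> 0" "\<And>x. x \<in> S \<Longrightarrow> norm (f x) \<le> k"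
  using continuous_bounded_on[OF assms compact_imp_bounded[OF compact_S]] by blast

definition nbhd :: "real \<Rightarrow> (real^3) set" where "nbhd \<epsilon> = {y. \<exists>x\<in>S. dist x y < \<epsilon>}"

lemma open_nbhd: "open (nbhd \<epsilon>)"
proof -
  have "nbhd \<epsilon> = (\<Union>x\<in>S. ball x \<epsilon>)" by (auto simp: nbhd_def)
  then show ?thesis by auto
qed

lemma bounded_nbhd: "bounded (nbhd \<epsilon>)"
proof -
  obtain b where b: "\<And>x. x \<in> S \<Longrightarrow> norm x \<le> b"
    using compact_imp_bounded[OF compact_S] by (auto simp: bounded_iff)
  have "norm y \<le> b + \<epsilon>" if yN: "y \<in> nbhd \<epsilon>" for y
  proof -
    obtain x where x: "x \<in> S" "dist x y < \<epsilon>" using yN by (auto simp: nbhd_def)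
    have "norm y \<le> norm x + dist x y" using norm_triangle_ineq2[of y x] by (simp add: dist_norm norm_minus_commute)
    then show ?thesis using x b[of x] by linarith
  qed
  then show ?thesis by (auto simp: bounded_iff)
qed

lemma E_nbhd_seq:
  shows "E \<inter> nbhd (1 / real (Suc n)) \<in> sets borel" "E \<inter> nbhd (1 / real (Suc n)) \<subseteq> \<Omega>"
    "decseq (\<lambda>n. E \<inter> nbhd (1 / real (Suc n)))" "(\<Inter>n. E \<inter> nbhd (1 / real (Suc n))) = {}"
proof -
  show "E \<inter> nbhd (1 / real (Suc n)) \<in> sets borel" using open_E open_nbhd by auto
  show "E \<inter> nbhd (1 / real (Suc n)) \<subseteq> \<Omega>" using E_dom by blast
  show "decseq (\<lambda>n. E \<inter> nbhd (1 / real (Suc n)))"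
  proof (rule decseq_SucI)
    fix n
    have "1 / real (Suc (Suc n)) \<le> 1 / real (Suc n)" by (simp add: frac_le)
    then show "E \<inter> nbhd (1 / real (Suc (Suc n))) \<subseteq> E \<inter> nbhd (1 / real (Suc n))"
      unfolding nbhd_def using less_le_trans by blast
  qed
  show "(\<Inter>n. E \<inter> nbhd (1 / real (Suc n))) = {}"
  proof (rule equals0I)
    fix y assume y: "y \<in> (\<Inter>n. E \<inter> nbhd (1 / real (Suc n)))"
    have "y \<in> closure S"
    proof (rule closure_approachable[THEN iffD2], intro allI impI)
      fix e :: real assume "e > 0"
      then obtain n where n: "1 / real (Suc n) < e" by (rule nat_approx_posE)
      have "y \<in> nbhd (1 / real (Suc n))" using y by blast
      then obtain x where "x \<in> S" "dist x y < 1 / real (Suc n)" unfolding nbhd_def by blast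
      then show "\<exists>x\<in>S. dist x y < e" using n less_trans by blast
    qed
    then have "y \<in> S" using compact_imp_closed[OF compact_S] by simp
    then show False using y E_S by blast
  qed
qed

text \<open>Only the values near \<open>S\<close> matter, so the test function may be multiplied by a cutoff function at
  scale \<open>\<epsilon>\<close>. As \<open>\<epsilon>\<close> tends to zero, the measure term and the term with the gradient of the test function
  disappear, while the gradient of the cutoff function is compensated by the volume of the
  neighbourhood.\<close>

lemma T_bound:
  fixes \<phi> :: "real^3 \<Rightarrow> real"
  assumes \<phi>: "\<phi> \<in> Cc 1 \<Omega>"
  shows "\<bar>T i E \<phi>\<bar> \<le> 3 * B * (125 * unit_ball_vol 3 / c) * (LINT x|M. \<bar>\<phi> x\<bar>)"
proof -
  obtain K where K: "C_k 1 \<phi>" "compact K" "K \<subseteq> \<Omega>" "\<And>x. x \<notin> K \<Longrightarrow> \<phi> x = 0" using CcE[OF \<phi>] by blast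
  note cc = C_1D[OF K(1)]
  obtain a where a: "a \<ge> 0" "\<And>x. x \<in> \<Omega> \<Longrightarrow> norm (\<phi> x) \<le> a" using continuous_bounded_on[OF cc(1) bounded_dom] by blast
  obtain b where b: "b \<ge> 0" "\<And>x. x \<in> \<Omega> \<Longrightarrow> norm (grad \<phi> x) \<le> b" using continuous_bounded_on[OF cc(4) bounded_dom] by blast
  define V where "V = 125 * unit_ball_vol 3 / c"
  have V: "V \<ge> 0" using c_pos by (simp add: V_def)
  have Eb: "E \<in> sets borel" "E \<in> sets lebesgue" using open_E by auto
  define \<epsilon> where "\<epsilon> n = 1 / real (Suc n)" for n
  have \<epsilon>: "\<epsilon> n > 0" for n by (simp add: \<epsilon>_def)
  define A where "A n = E \<inter> nbhd (\<epsilon> n)" for n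
  have A: "A n \<in> sets borel" "A n \<subseteq> \<Omega>" "decseq A" "(\<Inter>n. A n) = {}" for n
    using E_nbhd_seq unfolding A_def \<epsilon>_def by blast+
  have Am: "A n \<in> lmeasurable" for n
  proof -
    have "open (A n)" "bounded (A n)" using open_E open_nbhd bounded_nbhd by (auto simp: A_def intro: bounded_Int)
    then show ?thesis by (rule lmeasurable_open[rotated])
  qed
  have volA: "(\<lambda>n. measure lebesgue (A n)) \<longlonglongrightarrow> 0"
  proof -
    have "(\<lambda>n. measure lebesgue (A n)) \<longlonglongrightarrow> measure lebesgue (\<Inter>n. A n)"
    proof (rule Lim_measure_decseq)
      show "range A \<subseteq> sets lebesgue" using fmeasurableD[OF Am] by blast
      show "emeasure lebesgue (A n) \<noteq> \<infinity>" for n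
        using fmeasurableD2[OF Am[of n]] by (simp only: infinity_ennreal_def) blast
    qed (rule A(3))
    then show ?thesis using A(4) by simp
  qed
  define I where "I = (LINT x|M. \<bar>\<phi> x\<bar>)"
  have step: "\<bar>T i E \<phi>\<bar> \<le> 3 * B * V * (I + \<eta> * measure M S)" if \<eta>: "\<eta> > 0" for \<eta>
  proof -
    obtain \<epsilon>0 where \<epsilon>0: "\<epsilon>0 > 0" "\<And>\<epsilon>. 0 < \<epsilon> \<Longrightarrow> \<epsilon> < \<epsilon>0 \<Longrightarrow>
        (LINT y|lborel. indicator (nbhd \<epsilon>) y * \<bar>\<phi> y\<bar>) \<le> V * \<epsilon> * (I + \<eta> * measure M S)"
    proof (rule neighbourhood_integral_le[OF compact_S finite_M sets_M c_pos \<rho>0_pos lower, of "\<lambda>y. \<bar>\<phi> y\<bar>" \<eta>])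
      show "continuous_on UNIV (\<lambda>y. \<bar>\<phi> y\<bar>)" using cc(1) by (intro continuous_intros)
    qed (use \<eta> in \<open>auto simp: V_def I_def nbhd_def\<close>)
    have est: "\<bar>T i E \<phi>\<bar> \<le> a * var i (A n) + B * (b * measure lebesgue (A n)) + 3 * B * V * (I + \<eta> * measure M S)"
      if n: "\<epsilon> n < \<epsilon>0" for n
    proof -
      obtain \<kappa> W where \<kappa>: "\<And>k. C_k k \<kappa>" "\<And>x. 0 \<le> \<kappa> x" "\<And>x. \<kappa> x \<le> 1" "open W" "S \<subseteq> W" "\<And>x. x \<in> W \<Longrightarrow> \<kappa> x = (1::real)"
        "\<And>x. \<kappa> x \<noteq> 0 \<or> grad \<kappa> x \<noteq> 0 \<Longrightarrow> \<exists>s\<in>S. dist s x < \<epsilon> n" "\<And>x. norm (grad \<kappa> x) \<le> 3 / \<epsilon> n"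
        using cutoff_exists[OF compact_S \<epsilon>[of n]] by metis
      define \<psi> where "\<psi> x = \<phi> x * \<kappa> x" for x
      define \<xi> where "\<xi> x = 1 * \<phi> x + (- 1) * \<psi> x" for x
      have \<psi>: "\<psi> \<in> Cc 1 \<Omega>" unfolding \<psi>_def by (rule Cc_mult[OF \<phi> \<kappa>(1)])
      then have \<psi>1: "C_k 1 \<psi>" by (rule CcE)
      have \<xi>: "\<xi> \<in> Cc 1 \<Omega>" unfolding \<xi>_def by (rule Cc_lin[OF \<phi> \<psi>])
      have T\<xi>: "T i E \<xi> = 0"
        by (rule T_eq_0[OF \<xi> open_E E_dom \<kappa>(4)]) (use \<kappa>(5,6) cover in \<open>auto simp: \<xi>_def \<psi>_def\<close>)
      have "T i E \<xi> = T i E \<phi> - T i E \<psi>"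
        using T_lin[OF Eb(1) E_dom K(1) \<psi>1, of i 1 "- 1"] by (simp add: \<xi>_def[abs_def])
      then have "\<bar>T i E \<phi>\<bar> \<le> \<bar>SI i E \<psi>\<bar> + \<bar>FI E (grad \<psi>) $ i\<bar>" using T\<xi> unfolding T_def by linarith
      moreover have "\<bar>SI i E \<psi>\<bar> \<le> a * var i (A n)"
      proof (rule SI_le[OF Eb(1) E_dom A(1,2) C_1D(1)[OF \<psi>1] a(1)])
        fix x assume x: "x \<in> E"
        have "\<bar>\<psi> x\<bar> \<le> \<bar>\<phi> x\<bar> * 1" unfolding \<psi>_def abs_mult using \<kappa>(2,3)[of x] by (intro mult_left_mono) auto
        then show "\<bar>\<psi> x\<bar> \<le> a" using a(2)[of x] x E_dom by auto
        show "\<psi> x = 0" if "x \<notin> A n"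
          using that x \<kappa>(7)[of x] by (auto simp: A_def nbhd_def \<psi>_def)
      qed
      moreover have "\<bar>FI E (grad \<psi>) $ i\<bar> \<le> B * (b * measure lebesgue (A n)) + 3 * B * V * (I + \<eta> * measure M S)"
      proof -
        define h where "h x = indicator (A n) x * b + 3 / \<epsilon> n * (indicator (nbhd (\<epsilon> n)) x * \<bar>\<phi> x\<bar>)" for x
        have i1: "integrable lebesgue (\<lambda>x. indicator (A n) x * b)"
          using Am[of n] by (intro integrable_mult_left integrable_real_indicator) (auto simp: fmeasurable_def)
        have i2': "integrable lborel (\<lambda>x. indicator (nbhd (\<epsilon> n)) x * \<bar>\<phi> x\<bar>)"
        proof -
          have "integrable lborel (\<lambda>x. \<bar>\<phi> x\<bar>)"
            by (rule integrable_continuous_compact_support[OF _ _ K(2)]) (use cc(1) K(4) in \<open>auto intro: continuous_intros\<close>)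
          then show ?thesis
            using integrable_mult_indicator[of "nbhd (\<epsilon> n)" lborel "\<lambda>x. \<bar>\<phi> x\<bar>"] open_nbhd by simp
        qed
        then have i2: "integrable lebesgue (\<lambda>x. indicator (nbhd (\<epsilon> n)) x * \<bar>\<phi> x\<bar>)"
          by (simp add: integrable_completion)
        have "\<bar>FI E (grad \<psi>) $ i\<bar> \<le> B * (LINT x|lebesgue. h x)"
        proof (rule FI_le[OF Eb(2) E_dom C_1D(4)[OF \<psi>1]])
          show "integrable lebesgue h" unfolding h_def by (intro Bochner_Integration.integrable_add i1 integrable_mult_right i2)
          show "0 \<le> h x" for x using b(1) \<epsilon>[of n] by (auto simp: h_def)
          fix x assume x: "x \<in> E"
          have g: "grad \<psi> x = \<phi> x *\<^sub>R grad \<kappa> x + \<kappa> x *\<^sub>R grad \<phi> x"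
            unfolding \<psi>_def by (rule grad_mult[OF cc(2) C_1D(2)[OF \<kappa>(1)]])
          show "norm (grad \<psi> x) \<le> h x"
          proof (cases "x \<in> nbhd (\<epsilon> n)")
            case True
            have "norm (grad \<psi> x) \<le> \<bar>\<phi> x\<bar> * norm (grad \<kappa> x) + \<bar>\<kappa> x\<bar> * norm (grad \<phi> x)"
              unfolding g by (rule order_trans[OF norm_triangle_ineq]) simp
            also have "\<dots> \<le> \<bar>\<phi> x\<bar> * (3 / \<epsilon> n) + 1 * b"
              using \<kappa>(2,3)[of x] \<kappa>(8)[of x] b x E_dom by (intro add_mono mult_mono) auto
            finally show ?thesis using True x by (simp add: h_def A_def mult.commute)
          next
            case False
            then have "\<kappa> x = 0" "grad \<kappa> x = 0" using \<kappa>(7)[of x] by (auto simp: nbhd_def)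
            then show ?thesis unfolding g using False by (simp add: h_def A_def)
          qed
        qed
        also have "(LINT x|lebesgue. h x) = b * measure lebesgue (A n) + 3 / \<epsilon> n * (LINT x|lborel. indicator (nbhd (\<epsilon> n)) x * \<bar>\<phi> x\<bar>)"
        proof -
          have "(LINT x|lebesgue. h x) = (LINT x|lebesgue. indicator (A n) x * b) + (LINT x|lebesgue. 3 / \<epsilon> n * (indicator (nbhd (\<epsilon> n)) x * \<bar>\<phi> x\<bar>))"
            unfolding h_def by (rule Bochner_Integration.integral_add[OF i1 integrable_mult_right[OF i2]])
          moreover have "(LINT x|lebesgue. indicator (nbhd (\<epsilon> n)) x * \<bar>\<phi> x\<bar>) = (LINT x|lborel. indicator (nbhd (\<epsilon> n)) x * \<bar>\<phi> x\<bar>)"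
            using i2' by (intro integral_completion) auto
          ultimately show ?thesis by (simp add: mult.commute)
        qed
        also have "B * \<dots> \<le> B * (b * measure lebesgue (A n) + 3 / \<epsilon> n * (V * \<epsilon> n * (I + \<eta> * measure M S)))"
          using \<epsilon>0(2)[OF \<epsilon> n] \<epsilon>[of n] B_nonneg by (intro mult_left_mono add_left_mono) auto
        also have "\<dots> = B * (b * measure lebesgue (A n)) + 3 * B * V * (I + \<eta> * measure M S)"
          using \<epsilon>[of n] by (simp add: distrib_left)
        finally show ?thesis .
      qed
      ultimately show ?thesis by linarith
    qed
    have "(\<lambda>n. a * var i (A n) + B * (b * measure lebesgue (A n)) + 3 * B * V * (I + \<eta> * measure M S))
        \<longlonglongrightarrow> a * 0 + B * (b * 0) + 3 * B * V * (I + \<eta> * measure M S)"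
      by (intro tendsto_intros var_decreasing_limit A volA)
    moreover have "eventually (\<lambda>n. \<bar>T i E \<phi>\<bar> \<le> a * var i (A n) + B * (b * measure lebesgue (A n)) + 3 * B * V * (I + \<eta> * measure M S)) sequentially"
    proof -
      have "\<epsilon> \<longlonglongrightarrow> 0" unfolding \<epsilon>_def using LIMSEQ_Suc[OF lim_1_over_n] by simp
      then have "eventually (\<lambda>n. \<epsilon> n < \<epsilon>0) sequentially" using \<epsilon>0(1) by (rule order_tendstoD(2))
      then show ?thesis by eventually_elim (rule est)
    qed
    ultimately show ?thesis by (intro tendsto_lowerbound[of _ _ sequentially]) auto
  qed
  have "((\<lambda>\<eta>. 3 * B * V * (I + \<eta> * measure M S)) \<longlongrightarrow> 3 * B * V * (I + 0 * measure M S)) (at_right 0)"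
    by (intro tendsto_intros)
  then have "\<bar>T i E \<phi>\<bar> \<le> 3 * B * V * (I + 0 * measure M S)"
    by (rule tendsto_lowerbound) (auto simp: eventually_at_right_field intro!: exI[of _ 1] step)
  then show ?thesis by (simp add: V_def I_def)
qed

text \<open>The \<open>L\<^sup>1\<close> bound of the functional yields a density and its pointwise bound. The function \<open>h\<close> that detects
  where the density exceeds \<open>C\<close> is continuously differentiable, so that composing with it preserves the
  test functions.\<close>

lemma trace_density:
  obtains g u where "\<And>n::nat. u n \<in> Cc 1 \<Omega>" "integrable M g" "AE x in M. (\<lambda>n. u n x) \<longlonglongrightarrow> g x"
    "AE x in M. \<bar>g x\<bar> \<le> 3 * B * (125 * unit_ball_vol 3 / c)"
    "\<And>\<phi>. \<phi> \<in> Cc 1 \<Omega> \<Longrightarrow> (LINT x|M. \<phi> x * g x) = T i E \<phi>"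
proof -
  define C where "C = 3 * B * (125 * unit_ball_vol 3 / c)"
  have C: "C \<ge> 0" using B_nonneg c_pos by (simp add: C_def)
  have C1: "C_k 1 \<phi>" if "\<phi> \<in> Cc 1 \<Omega>" for \<phi> :: "real^3 \<Rightarrow> real" using that by (rule CcE)
  have Eb: "E \<in> sets borel" using open_E by auto
  have meas: "u \<in> borel_measurable M" if "u \<in> Cc 1 \<Omega>" for u :: "real^3 \<Rightarrow> real"
    by (rule measurable_M[OF C_1D(1)[OF C1[OF that]]])
  have bdd: "\<exists>K. \<forall>x\<in>space M. \<bar>u x\<bar> \<le> K" if uV: "u \<in> Cc 1 \<Omega>" for u :: "real^3 \<Rightarrow> real"
  proof -
    obtain k where "k \<ge> 0" "\<And>x. x \<in> S \<Longrightarrow> norm (u x) \<le> k" using bounded_on_S[OF C_1D(1)[OF C1[OF uV]]] by blast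
    then show ?thesis using space_M by auto
  qed
  have zero: "(\<lambda>_. 0::real) \<in> Cc 1 \<Omega>" by (rule CcI[where K="{}"]) (auto simp: C_k_const simp del: C_k.simps One_nat_def)
  have Tlin: "T i E (\<lambda>x. a * u x + b * v x) = a * T i E u + b * T i E v"
    if "u \<in> Cc 1 \<Omega>" "v \<in> Cc 1 \<Omega>" for u v :: "real^3 \<Rightarrow> real" and a b
    by (rule T_lin[OF Eb E_dom C1[OF that(1)] C1[OF that(2)]])
  have Tle: "\<bar>T i E u\<bar> \<le> C * (LINT x|M. \<bar>u x\<bar>)" if "u \<in> Cc 1 \<Omega>" for u
    unfolding C_def by (rule T_bound[OF that])
  obtain g u where u: "\<And>n::nat. u n \<in> Cc 1 \<Omega>" and g: "integrable M g" and lim: "AE x in M. (\<lambda>n. u n x) \<longlonglongrightarrow> g x"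
    and "(\<lambda>n. LINT x|M. \<bar>u n x - g x\<bar>) \<longlonglongrightarrow> 0"
    and rep: "\<And>\<phi>. \<phi> \<in> Cc 1 \<Omega> \<Longrightarrow> (LINT x|M. \<phi> x * g x) = T i E \<phi>"
  proof (rule L1_bounded_functional_representation[of M "Cc 1 \<Omega>" "\<lambda>_. 0" "T i E" C])
    show "finite_measure M" by (rule finite_M)
    show "u \<in> borel_measurable M" if "u \<in> Cc 1 \<Omega>" for u :: "real^3 \<Rightarrow> real" using that by (rule meas)
    show "\<exists>K. \<forall>x\<in>space M. \<bar>u x\<bar> \<le> K" if "u \<in> Cc 1 \<Omega>" for u :: "real^3 \<Rightarrow> real" using that by (rule bdd)
    show "(\<lambda>_. 0::real) \<in> Cc 1 \<Omega>" by (rule zero)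
    show "(\<lambda>x. a * u x + b * v x) \<in> Cc 1 \<Omega>" if "u \<in> Cc 1 \<Omega>" "v \<in> Cc 1 \<Omega>" for u v :: "real^3 \<Rightarrow> real" and a b
      using that by (rule Cc_lin)
    show "T i E (\<lambda>x. a * u x + b * v x) = a * T i E u + b * T i E v"
      if "u \<in> Cc 1 \<Omega>" "v \<in> Cc 1 \<Omega>" for u v :: "real^3 \<Rightarrow> real" and a b using that by (rule Tlin)
    show "\<bar>T i E u\<bar> \<le> C * (LINT x|M. \<bar>u x\<bar>)" if "u \<in> Cc 1 \<Omega>" for u using that by (rule Tle)
  qed (rule that)
  define h where "h t = flat_exp 0 (t - C) - flat_exp 0 (- t - C)" for t
  define h' where "h' t = flat_exp 2 (t - C) + flat_exp 2 (- t - C)" for t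
  have hD: "(h has_real_derivative h' t) (at t)" for t
  proof -
    have 1: "((\<lambda>t. flat_exp 0 (t - C)) has_real_derivative flat_exp 2 (t - C) * 1) (at t)"
      by (rule DERIV_chain2[of "flat_exp 0"])
        (use flat_exp_has_derivative[of 0 "t - C"] in \<open>auto intro!: derivative_eq_intros simp: numeral_2_eq_2\<close>)
    have 2: "((\<lambda>t. flat_exp 0 (- t - C)) has_real_derivative flat_exp 2 (- t - C) * (- 1)) (at t)"
      by (rule DERIV_chain2[of "flat_exp 0"])
        (use flat_exp_has_derivative[of 0 "- t - C"] in \<open>auto intro!: derivative_eq_intros simp: numeral_2_eq_2\<close>)
    show ?thesis unfolding h_def h'_def using DERIV_diff[OF 1 2] by simp
  qed
  have hc: "continuous_on UNIV h" using hD by (meson DERIV_isCont continuous_at_imp_continuous_on)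
  have h'c: "continuous_on UNIV h'"
    unfolding h'_def[abs_def]
    by (intro continuous_on_add continuous_on_compose2[OF continuous_on_flat_exp[of UNIV]]) (auto intro!: continuous_intros)
  have h_pos: "h t = flat_exp 0 (t - C)" if "t \<ge> - C" for t using that by (simp add: h_def flat_exp_def)
  have h_neg: "h t = - flat_exp 0 (- t - C)" if "t \<le> C" for t using that by (simp add: h_def flat_exp_def)
  have h_bd: "\<bar>h t\<bar> \<le> 1" for t
    using flat_exp_nonneg[of 0] flat_exp_0_less_1[of "t - C"] flat_exp_0_less_1[of "- t - C"] h_pos[of t] h_neg[of t] C
    by (cases "t \<ge> 0") (auto simp: less_imp_le)
  have h_sgn: "h t * t = \<bar>h t\<bar> * \<bar>t\<bar>" for t
    using flat_exp_nonneg[of 0] h_pos[of t] h_neg[of t] C by (cases "t \<ge> 0") auto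
  have h_0: "h t = 0 \<longleftrightarrow> \<bar>t\<bar> \<le> C" for t
    using h_pos[of t] h_neg[of t] C flat_exp_0_eq_0_iff by (cases "t \<ge> 0") auto
  have hV: "(\<lambda>x. h (v x)) \<in> Cc 1 \<Omega>" if v: "v \<in> Cc 1 \<Omega>" for v :: "real^3 \<Rightarrow> real"
  proof -
    obtain K where K: "C_k 1 v" "compact K" "K \<subseteq> \<Omega>" "\<And>x. x \<notin> K \<Longrightarrow> v x = 0" using CcE[OF v] by blast
    have D: "((\<lambda>x. h (v x)) has_derivative (\<lambda>w. (h' (v x) *\<^sub>R grad v x) \<bullet> w)) (at x)" for x
    proof -
      have "(*) (h' (v x)) = (\<lambda>t. t * h' (v x))" by (auto simp: fun_eq_iff)
      then have "(h has_derivative (\<lambda>t. t * h' (v x))) (at (v x))"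
        using hD[of "v x"] by (simp add: has_field_derivative_def)
      from has_derivative_compose[OF C_1D(3)[OF K(1)] this] show ?thesis by (simp add: mult.commute)
    qed
    have "C_k 1 (\<lambda>x. h (v x))"
      by (rule C_1_iff_grad[OF D])
        (intro continuous_on_scaleR C_1D(4)[OF K(1)] continuous_on_compose2[OF h'c C_1D(1)[OF K(1)]], simp)
    then show ?thesis by (rule CcI[OF _ K(2,3)]) (use K(4) h_0[of 0] C in auto)
  qed
  have "AE x in M. \<bar>g x\<bar> \<le> C"
    by (rule L1_bounded_functional_density_le[OF finite_M, of "Cc 1 \<Omega>" "T i E" C h u g])
      (fact meas Tle hc h_bd h_sgn h_0 hV u g lim rep)+
  then show ?thesis using that[OF u g lim _ rep] by (simp add: C_def)
qed

end

section \<open>Tangentiality of the trace\<close>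

context trace_surface
begin

lemma FI_component:
  assumes "A \<in> sets lebesgue" "A \<subseteq> \<Omega>" "continuous_on UNIV G"
  shows "FI A G $ i = (LINT x|lebesgue. indicator A x * (cross3 (F x) (G x) $ i))"
    and "integrable lebesgue (\<lambda>x. indicator A x * (cross3 (F x) (G x) $ i))"
proof -
  have int: "integrable lebesgue (\<lambda>x. indicator A x *\<^sub>R cross3 (F x) (G x))" by (rule FI_integrable[OF assms])
  have eq: "(indicator A x *\<^sub>R cross3 (F x) (G x)) \<bullet> axis i 1 = indicator A x * (cross3 (F x) (G x) $ i)" for x
    by (simp add: inner_axis)
  have "FI A G $ i = (LINT x|lebesgue. indicator A x *\<^sub>R cross3 (F x) (G x)) \<bullet> axis i 1"
    by (simp add: FI_def set_lebesgue_integral_def inner_axis)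
  also have "\<dots> = (LINT x|lebesgue. (indicator A x *\<^sub>R cross3 (F x) (G x)) \<bullet> axis i 1)"
    by (rule integral_inner_left[symmetric]) (rule int)
  finally show "FI A G $ i = (LINT x|lebesgue. indicator A x * (cross3 (F x) (G x) $ i))" unfolding eq .
  have "integrable lebesgue (\<lambda>x. (indicator A x *\<^sub>R cross3 (F x) (G x)) \<bullet> axis i 1)"
    by (rule integrable_inner_left) (rule int)
  then show "integrable lebesgue (\<lambda>x. indicator A x * (cross3 (F x) (G x) $ i))" unfolding eq .
qed

text \<open>Pointwise, the sum is the inner product of \<open>F\<close> with the curl of the gradient of \<open>w\<close>.\<close>

lemma FI_gradient_sum:
  fixes w :: "real^3 \<Rightarrow> real"
  assumes w: "w \<in> Cc 2 \<Omega>" and A: "A \<in> sets lebesgue" "A \<subseteq> \<Omega>"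
  shows "(\<Sum>i\<in>UNIV. FI A (grad (pd i w)) $ i) = 0"
proof -
  obtain K where K: "C_k 2 w" "compact K" "K \<subseteq> \<Omega>" "\<And>x. x \<notin> K \<Longrightarrow> w x = 0" using CcE[OF w] by blast
  obtain R where R: "\<And>z. R < norm z \<Longrightarrow> w z = 0" using compact_support_norm[of K w] K(2,4) by blast
  have pd1: "C_k 1 (pd i w)" for i using K(1) by (simp add: numeral_2_eq_2)
  have comm: "pd i (pd j w) x = pd j (pd i w) x" for i j x
    by (rule pd_commute[OF K(1)]) (rule R)
  have pw: "(\<Sum>i\<in>UNIV. cross3 (F x) (grad (pd i w) x) $ i) = 0" for x
    using comm[of 1 2 x] comm[of 1 3 x] comm[of 2 3 x]
    by (simp add: sum_3 cross3_def grad_def)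
  have "(\<Sum>i\<in>UNIV. FI A (grad (pd i w)) $ i)
      = (\<Sum>i\<in>UNIV. LINT x|lebesgue. indicator A x * (cross3 (F x) (grad (pd i w) x) $ i))"
    by (intro sum.cong refl FI_component(1) A C_1D(4)[OF pd1])
  also have "\<dots> = (LINT x|lebesgue. (\<Sum>i\<in>UNIV. indicator A x * (cross3 (F x) (grad (pd i w) x) $ i)))"
    by (intro Bochner_Integration.integral_sum[symmetric] FI_component(2) A C_1D(4)[OF pd1])
  also have "\<dots> = 0" by (simp add: pw flip: sum_distrib_left)
  finally show ?thesis .
qed

text \<open>For gradients, the part of the test function away from \<open>S\<close> contributes nothing, and near \<open>S\<close> only
  the curl measure of a thin one-sided neighbourhood is left.\<close>

lemma T_gradient_le:
  fixes w :: "real^3 \<Rightarrow> real"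
  assumes w: "w \<in> Cc 2 \<Omega>" and \<epsilon>: "\<epsilon> > 0" and ab: "a \<ge> 0" "b \<ge> 0"
    and wa: "\<And>x. x \<in> E \<Longrightarrow> x \<in> nbhd \<epsilon> \<Longrightarrow> \<bar>w x\<bar> \<le> a * \<epsilon>" and wb: "\<And>x. norm (grad w x) \<le> b"
  shows "\<bar>\<Sum>i\<in>UNIV. T i E (pd i w)\<bar> \<le> (3 * a + b) * (\<Sum>i\<in>UNIV. var i (E \<inter> nbhd \<epsilon>))"
proof -
  obtain K where K: "C_k 2 w" "compact K" "K \<subseteq> \<Omega>" "\<And>x. x \<notin> K \<Longrightarrow> w x = 0" using CcE[OF w] by blast
  have Eb: "E \<in> sets borel" "E \<in> sets lebesgue" using open_E by auto
  obtain \<kappa> W where \<kappa>: "\<And>k. C_k k \<kappa>" "\<And>x. 0 \<le> \<kappa> x" "\<And>x. \<kappa> x \<le> 1" "open W" "S \<subseteq> W" "\<And>x. x \<in> W \<Longrightarrow> \<kappa> x = (1::real)"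
    "\<And>x. \<kappa> x \<noteq> 0 \<or> grad \<kappa> x \<noteq> 0 \<Longrightarrow> \<exists>s\<in>S. dist s x < \<epsilon>" "\<And>x. norm (grad \<kappa> x) \<le> 3 / \<epsilon>"
    using cutoff_exists[OF compact_S \<epsilon>] by metis
  define v where "v x = w x * \<kappa> x" for x
  define y where "y x = 1 * w x + (- 1) * v x" for x
  have v: "v \<in> Cc 2 \<Omega>" unfolding v_def by (rule Cc_mult[OF w \<kappa>(1)])
  have y: "y \<in> Cc 2 \<Omega>" unfolding y_def by (rule Cc_lin[OF w v])
  have two: "2 = Suc 1" by simp
  have pdC: "pd i f \<in> Cc 1 \<Omega>" if "f \<in> Cc 2 \<Omega>" for f :: "real^3 \<Rightarrow> real" and i
    using that unfolding two by (rule Cc_pd)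
  have C1: "C_k 1 f" if "f \<in> Cc 2 \<Omega>" for f :: "real^3 \<Rightarrow> real"
  proof -
    have "C_k 2 f" using that by (rule CcE)
    then show ?thesis by (rule C_k_le) simp
  qed
  have pdC1: "C_k 1 (pd i f)" if "f \<in> Cc 2 \<Omega>" for f :: "real^3 \<Rightarrow> real" and i
    using pdC[OF that, of i] by (rule CcE)
  have Ty: "T i E (pd i y) = 0" for i
  proof (rule T_eq_0[OF pdC[OF y] open_E E_dom \<kappa>(4)])
    fix x assume x: "x \<in> W"
    show "pd i y x = 0"
      by (rule grad_eq_0(1)[OF \<kappa>(4) x]) (simp add: y_def v_def \<kappa>(6))
  qed (use cover \<kappa>(5) in blast)
  have "T i E (pd i w) = T i E (pd i v)" for i
  proof -
    have "pd i y = (\<lambda>x. 1 * pd i w x + (- 1) * pd i v x)"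
    proof
      fix x
      have "grad y x = 1 *\<^sub>R grad w x + (- 1) *\<^sub>R grad v x"
        unfolding y_def by (rule grad_lin[OF C_1D(2)[OF C1[OF w]] C_1D(2)[OF C1[OF v]]])
      then have "grad y x $ i = grad w x $ i - grad v x $ i" by simp
      then show "pd i y x = 1 * pd i w x + (- 1) * pd i v x" by (simp add: grad_def)
    qed
    then have "T i E (pd i y) = 1 * T i E (pd i w) + (- 1) * T i E (pd i v)"
      using T_lin[OF Eb(1) E_dom pdC1[OF w, of i] pdC1[OF v, of i], of i 1 "- 1"] by simp
    then show ?thesis using Ty by simp
  qed
  then have "(\<Sum>i\<in>UNIV. T i E (pd i w)) = (\<Sum>i\<in>UNIV. SI i E (pd i v)) - (\<Sum>i\<in>UNIV. FI E (grad (pd i v)) $ i)"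
    by (simp add: T_def sum_subtractf)
  also have "(\<Sum>i\<in>UNIV. FI E (grad (pd i v)) $ i) = 0" by (rule FI_gradient_sum[OF v Eb(2) E_dom])
  finally have eq: "(\<Sum>i\<in>UNIV. T i E (pd i w)) = (\<Sum>i\<in>UNIV. SI i E (pd i v))" by simp
  have SIv: "\<bar>SI i E (pd i v)\<bar> \<le> (3 * a + b) * var i (E \<inter> nbhd \<epsilon>)" for i
  proof (rule SI_le[OF Eb(1) E_dom])
    show "E \<inter> nbhd \<epsilon> \<in> sets borel" using open_E open_nbhd by auto
    show "E \<inter> nbhd \<epsilon> \<subseteq> \<Omega>" using E_dom by blast
    show "continuous_on UNIV (pd i v)" by (rule C_1D(5)[OF C1[OF v]])
    show "0 \<le> 3 * a + b" using ab by simp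
    fix x assume x: "x \<in> E"
    have g: "grad v x = w x *\<^sub>R grad \<kappa> x + \<kappa> x *\<^sub>R grad w x"
      unfolding v_def by (rule grad_mult[OF C_1D(2)[OF C1[OF w]] C_1D(2)[OF \<kappa>(1)]])
    have pdv: "pd i v x = grad v x $ i" by (simp add: grad_def)
    show "\<bar>pd i v x\<bar> \<le> 3 * a + b" if xn: "x \<in> E \<inter> nbhd \<epsilon>"
    proof -
      have "\<bar>pd i v x\<bar> \<le> norm (grad v x)" unfolding pdv by (rule component_le_norm_cart)
      also have "\<dots> \<le> \<bar>w x\<bar> * norm (grad \<kappa> x) + \<bar>\<kappa> x\<bar> * norm (grad w x)"
        unfolding g by (rule order_trans[OF norm_triangle_ineq]) simp
      also have "\<dots> \<le> (a * \<epsilon>) * (3 / \<epsilon>) + 1 * b"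
        using \<kappa>(2,3)[of x] \<kappa>(8)[of x] wa[of x] wb[of x] xn ab \<epsilon> by (intro add_mono mult_mono) auto
      also have "\<dots> = 3 * a + b" using \<epsilon> by simp
      finally show ?thesis .
    qed
    show "pd i v x = 0" if xn: "x \<notin> E \<inter> nbhd \<epsilon>"
    proof -
      have "\<kappa> x = 0" "grad \<kappa> x = 0" using \<kappa>(7)[of x] xn x by (auto simp: nbhd_def)
      then show ?thesis unfolding pdv g by simp
    qed
  qed
  have "\<bar>\<Sum>i\<in>UNIV. SI i E (pd i v)\<bar> \<le> (\<Sum>i\<in>UNIV. \<bar>SI i E (pd i v)\<bar>)" by (rule sum_abs)
  also have "\<dots> \<le> (\<Sum>i\<in>UNIV. (3 * a + b) * var i (E \<inter> nbhd \<epsilon>))" by (rule sum_mono[OF SIv])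
  finally show ?thesis unfolding eq by (simp add: sum_distrib_left)
qed

text \<open>Let \<open>\<psi>\<close> be a smooth function supported in the ball, and \<open>u\<^sub>k\<close> the mollification of \<open>u\<close> at scale
  \<open>1/(k + 1)\<close>. The gradients of \<open>\<psi> u\<^sub>k\<close> are bounded, while \<open>\<psi> u\<^sub>k\<close> is of order \<open>1/(k + 1)\<close> near \<open>S\<close>, so the sum
  of the trace functionals tends to zero by the preceding estimate. On \<open>S\<close> the gradients converge to
  \<open>\<psi> \<nabla>u\<close> wherever \<open>u\<close> is differentiable, because \<open>u\<close> vanishes there.\<close>

lemma trace_orthogonal_gradient:
  fixes g :: "3 \<Rightarrow> real^3 \<Rightarrow> real" and un :: "3 \<Rightarrow> nat \<Rightarrow> real^3 \<Rightarrow> real" and u :: "real^3 \<Rightarrow> real"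
  assumes un: "\<And>i n. un i n \<in> Cc 1 \<Omega>" and g: "\<And>i. integrable M (g i)"
    and un_lim: "\<And>i. AE x in M. (\<lambda>n. un i n x) \<longlonglongrightarrow> g i x"
    and g_bd: "\<And>i. AE x in M. \<bar>g i x\<bar> \<le> C"
    and rep: "\<And>i \<phi>. \<phi> \<in> Cc 1 \<Omega> \<Longrightarrow> (LINT x|M. \<phi> x * g i x) = T i E \<phi>"
    and r: "r > 0" and ball: "ball x0 r \<subseteq> \<Omega>"
    and u: "L-lipschitz_on UNIV u" and u0: "\<And>x. x \<in> S \<Longrightarrow> x \<in> ball x0 r \<Longrightarrow> u x = 0"
    and diff: "AE x in M. x \<in> ball x0 r \<longrightarrow> u differentiable (at x)"
  shows "AE x in M. x \<in> ball x0 (r / 2) \<longrightarrow> (\<Sum>i\<in>UNIV. g i x * grad u x $ i) = 0"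
proof -
  have L: "L \<ge> 0" using u by (rule lipschitz_on_nonneg)
  have uc: "continuous_on UNIV u" using u by (rule lipschitz_imp_continuous)
  have gm [measurable]: "g i \<in> borel_measurable M" for i using g by auto
  define C' where "C' = \<bar>C\<bar>"
  have C': "C' \<ge> 0" by (simp add: C'_def)
  have g_bd': "AE x in M. \<forall>i\<in>UNIV. \<bar>g i x\<bar> \<le> C'"
  proof (rule AE_finite_allI)
    show "AE x in M. \<bar>g i x\<bar> \<le> C'" for i using g_bd[of i] by eventually_elim (simp add: C'_def)
  qed simp
  have un_lim': "AE x in M. \<forall>i\<in>UNIV. (\<lambda>n. un i n x) \<longlonglongrightarrow> g i x"
    by (rule AE_finite_allI) (use un_lim in auto)
  define \<delta> where "\<delta> k = 1 / real (Suc k)" for k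
  have \<delta>: "\<delta> k > 0" "\<delta> k \<le> 1" for k by (auto simp: \<delta>_def)
  have \<delta>0: "\<delta> \<longlonglongrightarrow> 0" unfolding \<delta>_def using LIMSEQ_Suc[OF lim_1_over_n] by simp
  have \<delta>r: "filterlim \<delta> (at_right 0) sequentially"
    unfolding filterlim_at using \<delta>0 \<delta> by (auto intro!: always_eventually simp: less_imp_neq[THEN not_sym])
  define uk where "uk k = mollify (\<delta> k) u" for k
  have uk: "C_k m (uk k)" for m k unfolding uk_def by (rule C_k_mollify[OF uc \<delta>(1)])
  define G where "G k x = grad (uk k) x" for k x
  have Gc: "continuous_on UNIV (G k)" for k unfolding G_def[abs_def] by (rule C_1D(4)[OF uk])
  have GL: "norm (G k x) \<le> L" for k x
    unfolding G_def uk_def grad_mollify[OF uc \<delta>(1)] by (rule mollify_grad_norm_le[OF u \<delta>(1)])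
  have Gi: "\<bar>G k x $ i\<bar> \<le> L" for k x i
    using component_le_norm_cart[of "G k x" i] GL[of k x] by linarith
  have Glim: "(\<lambda>k. G k x) \<longlonglongrightarrow> grad u x" if "u differentiable (at x)" for x
  proof -
    have "((\<lambda>\<delta>. mollify_grad \<delta> u x) \<longlongrightarrow> grad u x) (at_right 0)"
      by (rule mollify_grad_tendsto[OF uc has_derivative_grad[OF that]])
    from filterlim_compose[OF this \<delta>r] show ?thesis
      by (simp add: G_def uk_def grad_mollify[OF uc \<delta>(1)])
  qed
  have ukL: "\<bar>uk k x - u x\<bar> \<le> L * \<delta> k" for k x unfolding uk_def by (rule mollify_lipschitz_diff_le[OF u \<delta>(1)])
  define s where "s k x = (\<Sum>i\<in>UNIV. g i x * G k x $ i)" for k x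
  \<comment> \<open>The normal component \<open>g \<bullet> \<nabla>u\<close>, as a pointwise limit of measurable functions.\<close>
  define a where "a x = lim (\<lambda>k. s k x)" for x
  have Gm [measurable]: "(\<lambda>x. G k x $ i) \<in> borel_measurable M" for k i
    by (rule measurable_M) (intro continuous_intros Gc)
  have sm [measurable]: "s k \<in> borel_measurable M" for k unfolding s_def[abs_def] by measurable
  have am [measurable]: "a \<in> borel_measurable M" unfolding a_def[abs_def] by (rule borel_measurable_lim_metric) measurable
  have s_lim: "(\<lambda>k. s k x) \<longlonglongrightarrow> (\<Sum>i\<in>UNIV. g i x * grad u x $ i)" if "u differentiable (at x)" for x
    unfolding s_def by (intro tendsto_intros Glim that)
  have a_eq: "a x = (\<Sum>i\<in>UNIV. g i x * grad u x $ i)" if "u differentiable (at x)" for x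
    unfolding a_def by (rule limI[OF s_lim[OF that]])
  define Ca where "Ca = 3 * (C' * L)"
  have Ca: "Ca \<ge> 0" using C' L by (simp add: Ca_def)
  have s_bd: "\<bar>s k x\<bar> \<le> Ca" if "\<forall>i\<in>UNIV. \<bar>g i x\<bar> \<le> C'" for k x
  proof -
    have "\<bar>s k x\<bar> \<le> (\<Sum>i\<in>UNIV. \<bar>g i x * G k x $ i\<bar>)" unfolding s_def by (rule sum_abs)
    also have "\<dots> \<le> (\<Sum>i\<in>(UNIV::3 set). C' * L)"
      unfolding abs_mult using that Gi C' by (intro sum_mono mult_mono) auto
    finally show ?thesis by (simp add: Ca_def)
  qed
  have a_bd: "AE x in M. x \<in> ball x0 r \<longrightarrow> \<bar>a x\<bar> \<le> Ca"
    using g_bd' diff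
  proof eventually_elim
    case (elim x)
    show ?case
    proof
      assume "x \<in> ball x0 r"
      then have d: "u differentiable (at x)" using elim by blast
      have "(\<lambda>k. \<bar>s k x\<bar>) \<longlonglongrightarrow> \<bar>a x\<bar>" unfolding a_eq[OF d] by (intro tendsto_rabs s_lim d)
      then show "\<bar>a x\<bar> \<le> Ca" by (rule tendsto_upperbound) (use s_bd elim in auto)
    qed
  qed
  \<comment> \<open>First for smooth \<open>\<psi>\<close>, then by mollification for all continuous \<open>\<psi>\<close> supported in the ball.\<close>
  have step1: "(LINT x|M. \<psi> x * a x) = 0" if \<psi>: "\<psi> \<in> Cc_infty (ball x0 r)" for \<psi> :: "real^3 \<Rightarrow> real"
  proof -
    have \<psi>k: "\<psi> \<in> Cc k (ball x0 r)" for k using \<psi> by (simp add: Cc_infty_def)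
    obtain K where K: "C_k 2 \<psi>" "compact K" "K \<subseteq> ball x0 r" "\<And>x. x \<notin> K \<Longrightarrow> \<psi> x = 0" using CcE[OF \<psi>k] by blast
    have \<psi>1: "C_k 1 \<psi>" using K(1) by (rule C_k_le) simp
    have g\<psi>0: "grad \<psi> x = 0" if "x \<notin> K" for x
      by (rule grad_eq_0(2)[of "- K"]) (use that K compact_imp_closed in auto)
    obtain p0 where p0: "p0 \<ge> 0" "\<And>x. x \<in> K \<Longrightarrow> norm (\<psi> x) \<le> p0"
      using continuous_bounded_on[OF C_1D(1)[OF \<psi>1] compact_imp_bounded[OF K(2)]] by blast
    obtain p1 where p1: "p1 \<ge> 0" "\<And>x. x \<in> K \<Longrightarrow> norm (grad \<psi> x) \<le> p1"
      using continuous_bounded_on[OF C_1D(4)[OF \<psi>1] compact_imp_bounded[OF K(2)]] by blast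
    obtain q where q: "q \<ge> 0" "\<And>x. x \<in> K \<Longrightarrow> norm (u x) \<le> q"
      using continuous_bounded_on[OF uc compact_imp_bounded[OF K(2)]] by blast
    have p0': "\<bar>\<psi> x\<bar> \<le> p0" for x using p0 K(4) by (cases "x \<in> K") auto
    define w where "w k x = \<psi> x * uk k x" for k x
    have w: "w k \<in> Cc 2 \<Omega>" for k
    proof -
      have "C_k 2 (w k)" unfolding w_def by (intro C_k_mult K(1) uk)
      then show ?thesis by (rule CcI[where K=K]) (use K ball in \<open>auto simp: w_def\<close>)
    qed
    have gw: "grad (w k) x = \<psi> x *\<^sub>R G k x + uk k x *\<^sub>R grad \<psi> x" for k x
      unfolding w_def G_def by (rule grad_mult[OF C_1D(2)[OF \<psi>1] C_1D(2)[OF uk]])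
    define b where "b = p0 * L + (q + L) * p1"
    have b: "b \<ge> 0" using p0 p1 q L by (simp add: b_def)
    have gwb: "norm (grad (w k) x) \<le> b" for k x
    proof (cases "x \<in> K")
      case True
      have "L * \<delta> k \<le> L * 1" using \<delta>[of k] L by (intro mult_left_mono) auto
      then have "\<bar>uk k x\<bar> \<le> q + L" using ukL[of k x] q(2)[OF True] by simp
      then have "norm (\<psi> x *\<^sub>R G k x) + norm (uk k x *\<^sub>R grad \<psi> x) \<le> b"
        unfolding b_def norm_scaleR using p0 p1 q L True GL[of k x] by (intro add_mono mult_mono) auto
      then show ?thesis unfolding gw by (rule order_trans[OF norm_triangle_ineq])
    next
      case False
      then show ?thesis unfolding gw using K(4) g\<psi>0 b by simp
    qed
    obtain e0 where e0: "e0 > 0" "(\<Union>x\<in>K. cball x e0) \<subseteq> ball x0 r"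
      using compact_subset_open_imp_cball_epsilon_subset[OF K(2) open_ball K(3)] by blast
    define A where "A k = (\<Sum>i\<in>UNIV. T i E (pd i (w k)))" for k
    have A_le: "\<bar>A k\<bar> \<le> (3 * (2 * p0 * L) + b) * (\<Sum>i\<in>UNIV. var i (E \<inter> nbhd (\<delta> k)))" if k: "\<delta> k < e0" for k
      unfolding A_def
    proof (rule T_gradient_le[OF w \<delta>(1) _ b _ gwb])
      show "0 \<le> 2 * p0 * L" using p0 L by simp
      fix x assume x: "x \<in> nbhd (\<delta> k)"
      show "\<bar>w k x\<bar> \<le> 2 * p0 * L * \<delta> k"
      proof (cases "x \<in> K")
        case True
        obtain t where t: "t \<in> S" "dist t x < \<delta> k" using x by (auto simp: nbhd_def)
        then have "t \<in> cball x e0" using k by (simp add: dist_commute)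
        then have "t \<in> ball x0 r" using e0(2) True by blast
        then have "u t = 0" using u0 t(1) by blast
        then have "\<bar>u x\<bar> \<le> L * dist x t" using lipschitz_onD[OF u, of x t] by (simp add: dist_real_def)
        also have "\<dots> \<le> L * \<delta> k" using t(2) L by (intro mult_left_mono) (auto simp: dist_commute)
        finally have "\<bar>uk k x\<bar> \<le> 2 * L * \<delta> k" using ukL[of k x] by simp
        then have "\<bar>\<psi> x\<bar> * \<bar>uk k x\<bar> \<le> p0 * (2 * L * \<delta> k)" using p0 p0'[of x] by (intro mult_mono) auto
        then show ?thesis by (simp add: w_def abs_mult mult_ac)
      next
        case False
        then show ?thesis using K(4) p0 L \<delta>(1)[of k] by (simp add: w_def)
      qed
    qed
    have "(\<lambda>k. (3 * (2 * p0 * L) + b) * (\<Sum>i\<in>UNIV. var i (E \<inter> nbhd (\<delta> k)))) \<longlonglongrightarrow> (3 * (2 * p0 * L) + b) * (\<Sum>i\<in>(UNIV::3 set). 0)"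
      unfolding \<delta>_def by (intro tendsto_intros var_decreasing_limit E_nbhd_seq)
    moreover have "eventually (\<lambda>k. norm (A k) \<le> (3 * (2 * p0 * L) + b) * (\<Sum>i\<in>UNIV. var i (E \<inter> nbhd (\<delta> k)))) sequentially"
    proof -
      have "eventually (\<lambda>k. \<delta> k < e0) sequentially" using \<delta>0 e0(1) by (rule order_tendstoD(2))
      then show ?thesis by eventually_elim (unfold real_norm_def, rule A_le)
    qed
    ultimately have A0: "A \<longlonglongrightarrow> 0" by (intro Lim_null_comparison[of A]) auto
    have pdw: "pd i (w k) \<in> Cc 1 \<Omega>" for i k
    proof -
      have "w k \<in> Cc (Suc 1) \<Omega>" using w[of k] by (simp add: numeral_2_eq_2)
      then show ?thesis by (rule Cc_pd)
    qed
    have pdw_m: "pd i (w k) \<in> borel_measurable M" for i k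
    proof -
      have "C_k 1 (pd i (w k))" using pdw by (rule CcE)
      then show ?thesis by (intro measurable_M C_1D(1))
    qed
    have pdw_le: "\<bar>pd i (w k) x\<bar> \<le> b" for i k x
      using component_le_norm_cart[of "grad (w k) x" i] gwb[of k x] by (simp add: grad_def)
    have int_i: "integrable M (\<lambda>x. pd i (w k) x * g i x)" for i k
      by (rule Bochner_Integration.integrable_bound[OF integrable_mult_right[OF g[of i], of b]])
        (use pdw_m pdw_le b in \<open>auto simp: abs_mult intro!: mult_right_mono\<close>)
    have A_int: "A k = (LINT x|M. (\<Sum>i\<in>UNIV. pd i (w k) x * g i x))" for k
      unfolding A_def using int_i by (simp add: rep[OF pdw, symmetric])
    have "(\<lambda>k. LINT x|M. (\<Sum>i\<in>UNIV. pd i (w k) x * g i x)) \<longlonglongrightarrow> (LINT x|M. \<psi> x * a x)"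
    proof (rule integral_dominated_convergence[where w="\<lambda>_. 3 * (b * C')"])
      show "(\<lambda>x. \<psi> x * a x) \<in> borel_measurable M"
        using measurable_M[OF C_1D(1)[OF \<psi>1]] am by (intro borel_measurable_times)
      show "(\<lambda>x. \<Sum>i\<in>UNIV. pd i (w k) x * g i x) \<in> borel_measurable M" for k
        using pdw_m by (intro borel_measurable_sum borel_measurable_times gm)
      show "integrable M (\<lambda>_. 3 * (b * C'))" by simp
      show "AE x in M. norm (\<Sum>i\<in>UNIV. pd i (w k) x * g i x) \<le> 3 * (b * C')" for k
        using g_bd'
      proof eventually_elim
        case (elim x)
        have "norm (\<Sum>i\<in>UNIV. pd i (w k) x * g i x) \<le> (\<Sum>i\<in>UNIV. norm (pd i (w k) x * g i x))" by (rule norm_sum)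
        also have "\<dots> \<le> (\<Sum>i\<in>(UNIV::3 set). b * C')"
          unfolding real_norm_def abs_mult using elim pdw_le b by (intro sum_mono mult_mono) auto
        finally show ?case by simp
      qed
      show "AE x in M. (\<lambda>k. \<Sum>i\<in>UNIV. pd i (w k) x * g i x) \<longlonglongrightarrow> \<psi> x * a x"
        using diff AE_space
      proof eventually_elim
        case (elim x)
        have eq: "(\<Sum>i\<in>UNIV. pd i (w k) x * g i x) = \<psi> x * s k x + uk k x * (\<Sum>i\<in>UNIV. pd i \<psi> x * g i x)" for k
        proof -
          have "pd i (w k) x = \<psi> x * G k x $ i + uk k x * pd i \<psi> x" for i
            using arg_cong[OF gw[of k x], of "\<lambda>v. v $ i"] by (simp add: grad_def)
          then show ?thesis by (simp add: s_def sum_distrib_left sum.distrib algebra_simps)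
        qed
        show ?case
        proof (cases "x \<in> ball x0 r")
          case True
          then have d: "u differentiable (at x)" using elim by blast
          have ux: "u x = 0" using u0 True elim space_M by simp
          have "(\<lambda>k. L * \<delta> k) \<longlonglongrightarrow> L * 0" by (intro tendsto_intros \<delta>0)
          then have "(\<lambda>k. uk k x) \<longlonglongrightarrow> 0"
            using ukL[of _ x] ux by (intro Lim_null_comparison[of "\<lambda>k. uk k x" "\<lambda>k. L * \<delta> k"]) auto
          then have "(\<lambda>k. \<psi> x * s k x + uk k x * (\<Sum>i\<in>UNIV. pd i \<psi> x * g i x)) \<longlonglongrightarrow> \<psi> x * a x + 0 * (\<Sum>i\<in>UNIV. pd i \<psi> x * g i x)"
            unfolding a_eq[OF d] by (intro tendsto_intros s_lim d)
          then show ?thesis unfolding eq by simp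
        next
          case False
          then have "x \<notin> K" using K(3) by blast
          then have "\<psi> x = 0" "pd i \<psi> x = 0" for i
            using K(4) arg_cong[OF g\<psi>0[of x], of "\<lambda>v. v $ i"] by (auto simp: grad_def)
          then show ?thesis unfolding eq by simp
        qed
      qed
    qed
    then have "A \<longlonglongrightarrow> (LINT x|M. \<psi> x * a x)" by (simp add: A_int[abs_def])
    then show ?thesis using A0 LIMSEQ_unique by blast
  qed
  have step2: "(LINT x|M. \<psi> x * a x) = 0" "integrable M (\<lambda>x. \<psi> x * a x)"
    if \<psi>: "continuous_on UNIV \<psi>" "compact K" "K \<subseteq> ball x0 r" "\<And>x. x \<notin> K \<Longrightarrow> \<psi> x = 0"
    for \<psi> :: "real^3 \<Rightarrow> real" and K
  proof -
    have int: "integrable M (\<lambda>x. \<psi> x * a x)"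
      if \<psi>: "continuous_on UNIV \<psi>" "\<And>x. x \<notin> ball x0 r \<Longrightarrow> \<psi> x = 0" for \<psi> :: "real^3 \<Rightarrow> real"
    proof -
      obtain k where k: "k \<ge> 0" "\<And>x. x \<in> S \<Longrightarrow> norm (\<psi> x) \<le> k" using bounded_on_S[OF \<psi>(1)] by blast
      have "AE x in M. norm (\<psi> x * a x) \<le> k * Ca"
        using a_bd AE_space
      proof eventually_elim
        case (elim x)
        then have xS: "x \<in> S" using space_M by simp
        show ?case
        proof (cases "x \<in> ball x0 r")
          case True
          then show ?thesis unfolding norm_mult using k(1) k(2)[OF xS] elim by (intro mult_mono) auto
        next
          case False
          then show ?thesis using \<psi>(2) k(1) Ca by simp
        qed
      qed
      moreover have "(\<lambda>x. \<psi> x * a x) \<in> borel_measurable M"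
        using measurable_M[OF \<psi>(1)] am by (intro borel_measurable_times)
      ultimately show ?thesis by (intro M.integrable_const_bound[of _ "k * Ca"])
    qed
    have out: "\<psi> x = 0" if "x \<notin> ball x0 r" for x using that \<psi>(3,4) by blast
    show int\<psi>: "integrable M (\<lambda>x. \<psi> x * a x)" by (rule int[OF \<psi>(1) out])
    obtain R where R: "\<And>z. R < norm z \<Longrightarrow> \<psi> z = 0" using compact_support_norm[of K \<psi>] \<psi>(2,4) by blast
    have "\<bar>LINT x|M. \<psi> x * a x\<bar> \<le> 0 + e" if e: "e > 0" for e
    proof -
      define e' where "e' = e / (Ca * measure M (space M) + 1)"
      have pos: "0 \<le> Ca * measure M (space M)" using Ca by simp
      have e': "e' > 0" "e' * (Ca * measure M (space M)) \<le> e" using e pos by (auto simp: e'_def field_simps)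
      obtain d0 where d0: "d0 > 0" "\<And>\<delta>. 0 < \<delta> \<Longrightarrow> \<delta> < d0 \<Longrightarrow> mollify \<delta> \<psi> \<in> Cc_infty (ball x0 r)"
        using mollify_Cc_infty[OF \<psi>(1,2,3,4) open_ball] by blast
      obtain d1 where d1: "d1 > 0" "\<And>\<delta> x. 0 < \<delta> \<Longrightarrow> \<delta> < d1 \<Longrightarrow> \<bar>mollify \<delta> \<psi> x - \<psi> x\<bar> \<le> e'"
        using mollify_uniform_limit[OF \<psi>(1) R e'(1)] by blast
      define d where "d = min d0 d1 / 2"
      have d: "0 < d" "d < d0" "d < d1" using d0(1) d1(1) by (auto simp: d_def)
      define \<xi> where "\<xi> = mollify d \<psi>"
      have \<xi>C: "\<xi> \<in> Cc_infty (ball x0 r)" unfolding \<xi>_def by (rule d0(2)[OF d(1,2)])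
      then have \<xi>C1: "\<xi> \<in> Cc 1 (ball x0 r)" unfolding Cc_infty_def by blast
      obtain K' where K': "C_k 1 \<xi>" "compact K'" "K' \<subseteq> ball x0 r" "\<And>x. x \<notin> K' \<Longrightarrow> \<xi> x = 0" using CcE[OF \<xi>C1] by blast
      have \<xi>out: "\<xi> x = 0" if "x \<notin> ball x0 r" for x using that K'(3,4) by blast
      have int\<xi>: "integrable M (\<lambda>x. \<xi> x * a x)" by (rule int[OF C_1D(1)[OF K'(1)] \<xi>out])
      have eq: "(LINT x|M. \<psi> x * a x) = (LINT x|M. \<psi> x * a x - \<xi> x * a x)"
        using int\<psi> int\<xi> step1[OF \<xi>C] by simp
      have "\<bar>LINT x|M. \<psi> x * a x\<bar> \<le> (LINT x|M. \<bar>\<psi> x * a x - \<xi> x * a x\<bar>)"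
        unfolding eq by (rule integral_abs_bound)
      also have "\<dots> \<le> (LINT x|M. e' * Ca)"
      proof (rule integral_mono_AE)
        show "integrable M (\<lambda>x. \<bar>\<psi> x * a x - \<xi> x * a x\<bar>)" using int\<psi> int\<xi> by (intro integrable_abs Bochner_Integration.integrable_diff)
        show "AE x in M. \<bar>\<psi> x * a x - \<xi> x * a x\<bar> \<le> e' * Ca"
          using a_bd
        proof eventually_elim
          case (elim x)
          have eq: "\<bar>\<psi> x * a x - \<xi> x * a x\<bar> = \<bar>\<psi> x - \<xi> x\<bar> * \<bar>a x\<bar>" by (simp add: abs_mult flip: left_diff_distrib)
          show ?case
          proof (cases "x \<in> ball x0 r")
            case True
            have "\<bar>\<psi> x - \<xi> x\<bar> \<le> e'" using d1(2)[OF d(1,3), of x] by (simp add: \<xi>_def abs_minus_commute)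
            then show ?thesis unfolding eq using elim True e' by (intro mult_mono) auto
          next
            case False
            then show ?thesis using out \<xi>out e' Ca by simp
          qed
        qed
      qed simp
      also have "\<dots> = e' * (Ca * measure M (space M))" by simp
      finally show ?thesis using e'(2) by simp
    qed
    then have "\<bar>LINT x|M. \<psi> x * a x\<bar> \<le> 0" by (rule field_le_epsilon)
    then show "(LINT x|M. \<psi> x * a x) = 0" by simp
  qed
  \<comment> \<open>Testing with \<open>\<psi>0\<close> times bounded continuous functions that approximate \<open>arctan a\<close> gives
    \<open>\<integral> \<psi>0 a arctan a = 0\<close> with a nonnegative integrand.\<close>
  define \<psi>0 where "\<psi>0 y = max 0 (3 * r / 4 - dist x0 y)" for y
  have \<psi>0c: "continuous_on UNIV \<psi>0" unfolding \<psi>0_def by (intro continuous_intros)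
  have \<psi>0n: "0 \<le> \<psi>0 y" for y by (simp add: \<psi>0_def)
  have \<psi>0out: "\<psi>0 y = 0" if "y \<notin> cball x0 (3 * r / 4)" for y using that by (simp add: \<psi>0_def)
  have sub: "cball x0 (3 * r / 4) \<subseteq> ball x0 r" using r by auto
  have \<psi>0le: "\<psi>0 y \<le> 3 * r / 4" for y unfolding \<psi>0_def using r zero_le_dist[of x0 y] by linarith
  define t where "t n x = (\<Sum>i\<in>UNIV. un i n x * G n x $ i)" for n x
  have tc: "continuous_on UNIV (t n)" for n
  proof -
    have "C_k 1 (un i n)" for i using un[of i n] by (rule CcE)
    then show ?thesis unfolding t_def[abs_def] by (intro continuous_intros C_1D(1) Gc)
  qed
  have prod0: "(LINT x|M. \<psi>0 x * arctan (t n x) * a x) = 0" for n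
  proof (rule step2(1)[of "\<lambda>x. \<psi>0 x * arctan (t n x)", OF _ compact_cball sub])
    show "continuous_on UNIV (\<lambda>x. \<psi>0 x * arctan (t n x))" by (intro continuous_intros \<psi>0c tc)
  qed (simp add: \<psi>0out)
  have "(\<lambda>n. LINT x|M. \<psi>0 x * arctan (t n x) * a x) \<longlonglongrightarrow> (LINT x|M. \<psi>0 x * arctan (a x) * a x)"
  proof (rule integral_dominated_convergence[where w="\<lambda>_. 3 * r / 4 * (pi / 2) * Ca"])
    have [measurable]: "\<psi>0 \<in> borel_measurable M" by (rule measurable_M[OF \<psi>0c])
    have [measurable]: "t n \<in> borel_measurable M" for n by (rule measurable_M[OF tc])
    show "(\<lambda>x. \<psi>0 x * arctan (a x) * a x) \<in> borel_measurable M" by measurable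
    show "(\<lambda>x. \<psi>0 x * arctan (t n x) * a x) \<in> borel_measurable M" for n by measurable
    show "integrable M (\<lambda>_. 3 * r / 4 * (pi / 2) * Ca)" by simp
    show "AE x in M. norm (\<psi>0 x * arctan (t n x) * a x) \<le> 3 * r / 4 * (pi / 2) * Ca" for n
      using a_bd
    proof eventually_elim
      case (elim x)
      show ?case
      proof (cases "x \<in> ball x0 r")
        case True
        have "\<bar>arctan (t n x)\<bar> \<le> pi / 2" using arctan_bounded[of "t n x"] by (simp add: abs_le_iff less_imp_le) linarith
        then show ?thesis unfolding real_norm_def abs_mult
          using elim True \<psi>0n[of x] \<psi>0le[of x] r by (intro mult_mono) auto
      next
        case False
        then have "\<psi>0 x = 0" using \<psi>0out sub by blast
        then show ?thesis using r Ca by simp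
      qed
    qed
    show "AE x in M. (\<lambda>n. \<psi>0 x * arctan (t n x) * a x) \<longlonglongrightarrow> \<psi>0 x * arctan (a x) * a x"
      using diff un_lim'
    proof eventually_elim
      case (elim x)
      show ?case
      proof (cases "x \<in> ball x0 r")
        case True
        then have d: "u differentiable (at x)" using elim by blast
        have "(\<lambda>n. t n x) \<longlonglongrightarrow> a x"
          unfolding t_def a_eq[OF d] using elim by (intro tendsto_intros Glim d) auto
        then show ?thesis by (intro tendsto_intros)
      next
        case False
        then have "\<psi>0 x = 0" using \<psi>0out sub by blast
        then show ?thesis by simp
      qed
    qed
  qed
  then have zero: "(LINT x|M. \<psi>0 x * arctan (a x) * a x) = 0"
    unfolding prod0 by (simp add: LIMSEQ_const_iff)
  have nn: "0 \<le> arctan z * z" for z :: real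
    by (cases "z \<ge> 0") (auto intro: mult_nonneg_nonneg mult_nonpos_nonpos)
  have int0: "integrable M (\<lambda>x. \<psi>0 x * arctan (a x) * a x)"
  proof (rule Bochner_Integration.integrable_bound)
    have "integrable M (\<lambda>x. \<psi>0 x * a x)" by (rule step2(2)[OF \<psi>0c compact_cball sub \<psi>0out])
    then show "integrable M (\<lambda>x. pi / 2 * (\<psi>0 x * a x))" by simp
    have [measurable]: "\<psi>0 \<in> borel_measurable M" by (rule measurable_M[OF \<psi>0c])
    show "(\<lambda>x. \<psi>0 x * arctan (a x) * a x) \<in> borel_measurable M" by measurable
    show "AE x in M. norm (\<psi>0 x * arctan (a x) * a x) \<le> norm (pi / 2 * (\<psi>0 x * a x))"
    proof (rule AE_I2)
      fix x
      have "\<bar>arctan (a x)\<bar> \<le> pi / 2" using arctan_bounded[of "a x"] by (simp add: abs_le_iff less_imp_le) linarith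
      then have "\<bar>arctan (a x)\<bar> * \<bar>\<psi>0 x * a x\<bar> \<le> pi / 2 * \<bar>\<psi>0 x * a x\<bar>" by (rule mult_right_mono) simp
      then show "norm (\<psi>0 x * arctan (a x) * a x) \<le> norm (pi / 2 * (\<psi>0 x * a x))" by (simp add: abs_mult mult_ac)
    qed
  qed
  have "AE x in M. \<psi>0 x * arctan (a x) * a x = 0"
    using zero int0 nn \<psi>0n by (subst (asm) integral_nonneg_eq_0_iff_AE) (auto simp: mult.assoc)
  then show ?thesis
    using diff
  proof eventually_elim
    case (elim x)
    show ?case
    proof
      assume x: "x \<in> ball x0 (r / 2)"
      then have xr: "x \<in> ball x0 r" using r by auto
      have "\<psi>0 x > 0" using x r by (simp add: \<psi>0_def)
      then have "a x = 0" using elim(1) by auto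
      then show "(\<Sum>i\<in>UNIV. g i x * grad u x $ i) = 0" using a_eq elim(2) xr by auto
    qed
  qed
qed

end

section \<open>The trace as a vector field on the surface\<close>

lemma curl_inner_eq:
  fixes \<phi> :: "real^3 \<Rightarrow> real^3"
  assumes "\<phi> differentiable (at x)"
  shows "curl \<phi> x \<bullet> F = (\<Sum>i\<in>UNIV. cross3 F (grad (\<lambda>y. \<phi> y $ i) x) $ i)"
proof -
  have *: "pd i (\<lambda>y. \<phi> y $ j) x = pd i \<phi> x $ j" for i j
    using pd_eqI[OF bounded_linear.has_derivative[OF bounded_linear_vec_nth[of j] assms[unfolded frechet_derivative_works]], of i]
    by (simp add: pd_def[of i \<phi>])
  show "curl \<phi> x \<bullet> F = (\<Sum>i\<in>UNIV. cross3 F (grad (\<lambda>y. \<phi> y $ i) x) $ i)"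
    by (simp add: curl_def cross3_def grad_def * sum_3 inner_vec_def algebra_simps)
qed

lemma Cc_component:
  fixes \<phi> :: "real^3 \<Rightarrow> real^3"
  assumes "\<phi> \<in> Cc k \<Omega>"
  shows "(\<lambda>x. \<phi> x $ i) \<in> Cc k \<Omega>"
proof -
  obtain K where K: "C_k k \<phi>" "compact K" "K \<subseteq> \<Omega>" "\<And>x. x \<notin> K \<Longrightarrow> \<phi> x = 0" using CcE[OF assms] by blast
  show ?thesis
    using C_k_compose_bounded_linear[OF bounded_linear_vec_nth K(1)] K(2,3) by (rule CcI) (simp add: K(4))
qed

context trace_surface
begin

lemma trace_field:
  obtains g C where "g \<in> borel_measurable M" "AE x in M. norm (g x) \<le> C"
    "\<And>i \<phi>. \<phi> \<in> Cc 1 \<Omega> \<Longrightarrow> (LINT x|M. \<phi> x * g x $ i) = T i E \<phi>"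
    "\<And>x0 r L u. r > 0 \<Longrightarrow> ball x0 r \<subseteq> \<Omega> \<Longrightarrow> L-lipschitz_on UNIV u \<Longrightarrow>
      (\<And>x. x \<in> S \<Longrightarrow> x \<in> ball x0 r \<Longrightarrow> u x = 0) \<Longrightarrow>
      (AE x in M. x \<in> ball x0 r \<longrightarrow> u differentiable (at x)) \<Longrightarrow>
      (AE x in M. x \<in> ball x0 (r / 2) \<longrightarrow> grad u x \<bullet> g x = 0)"
proof -
  define C where "C = 3 * B * (125 * unit_ball_vol 3 / c)"
  define good where "good i g un \<longleftrightarrow> (\<forall>n::nat. un n \<in> Cc 1 \<Omega>) \<and> integrable M g \<and>
    (AE x in M. (\<lambda>n. un n x) \<longlonglongrightarrow> g x) \<and> (AE x in M. \<bar>g x\<bar> \<le> C) \<and>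
    (\<forall>\<phi>. \<phi> \<in> Cc 1 \<Omega> \<longrightarrow> (LINT x|M. \<phi> x * g x) = T i E \<phi>)" for i g un
  have "\<exists>g un. good i g un" for i
  proof (rule trace_density[of i])
    fix g un
    assume "\<And>n::nat. un n \<in> Cc 1 \<Omega>" "integrable M g" "AE x in M. (\<lambda>n. un n x) \<longlonglongrightarrow> g x"
      "AE x in M. \<bar>g x\<bar> \<le> 3 * B * (125 * unit_ball_vol 3 / c)"
      "\<And>\<phi>. \<phi> \<in> Cc 1 \<Omega> \<Longrightarrow> (LINT x|M. \<phi> x * g x) = T i E \<phi>"
    then have "good i g un" unfolding good_def C_def by blast
    then show ?thesis by blast
  qed
  then obtain h un where "\<And>i. good i (h i) (un i)" by metis
  then have un: "un i n \<in> Cc 1 \<Omega>" and h: "integrable M (h i)"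
    and lim: "AE x in M. (\<lambda>n. un i n x) \<longlonglongrightarrow> h i x" and bd: "AE x in M. \<bar>h i x\<bar> \<le> C"
    and rep: "\<phi> \<in> Cc 1 \<Omega> \<Longrightarrow> (LINT x|M. \<phi> x * h i x) = T i E \<phi>" for i n \<phi>
    by (auto simp: good_def)
  define g :: "real^3 \<Rightarrow> real^3" where "g x = (\<chi> i. h i x)" for x
  have gi: "g x $ i = h i x" for x i by (simp add: g_def)
  have g_eq: "g = (\<lambda>x. \<Sum>i\<in>UNIV. h i x *\<^sub>R axis i 1)"
    by (rule ext) (simp add: vec_eq_iff gi axis_def if_distrib cong: if_cong)
  show ?thesis
  proof (rule that[of g "3 * C"])
    show "g \<in> borel_measurable M"
      unfolding g_eq using h by (intro borel_measurable_sum borel_measurable_scaleR) auto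
    have "AE x in M. \<forall>i\<in>UNIV. \<bar>h i x\<bar> \<le> C" by (rule AE_finite_allI) (use bd in auto)
    then show "AE x in M. norm (g x) \<le> 3 * C"
    proof eventually_elim
      case (elim x)
      have "norm (g x) \<le> (\<Sum>i\<in>UNIV. \<bar>h i x\<bar>)" using norm_le_l1_cart[of "g x"] by (simp add: gi)
      also have "\<dots> \<le> (\<Sum>i\<in>(UNIV::3 set). C)" using elim by (intro sum_mono) auto
      finally show ?case by simp
    qed
    show "(LINT x|M. \<phi> x * g x $ i) = T i E \<phi>" if "\<phi> \<in> Cc 1 \<Omega>" for i \<phi>
      using rep[OF that] by (simp add: gi)
    show "AE x in M. x \<in> ball x0 (r / 2) \<longrightarrow> grad u x \<bullet> g x = 0"
      if "r > 0" "ball x0 r \<subseteq> \<Omega>" "L-lipschitz_on UNIV u" "\<And>x. x \<in> S \<Longrightarrow> x \<in> ball x0 r \<Longrightarrow> u x = 0"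
        "AE x in M. x \<in> ball x0 r \<longrightarrow> u differentiable (at x)" for x0 r L u
      using trace_orthogonal_gradient[of un h C r x0 L u, OF un h lim bd rep that]
      by (simp add: inner_vec_def gi mult.commute)
  qed
qed

lemma trace_test_integrable:
  assumes "g \<in> borel_measurable M" "AE x in M. norm (g x :: real^3) \<le> C" "C_k 1 \<phi>"
  shows "integrable M (\<lambda>x. \<phi> x * g x $ i)"
proof -
  obtain k where k: "k \<ge> 0" "\<And>x. x \<in> S \<Longrightarrow> norm (\<phi> x) \<le> k" using bounded_on_S[OF C_1D(1)[OF assms(3)]] by blast
  have "(\<lambda>x. g x \<bullet> axis i 1) \<in> borel_measurable M" using assms(1) by (intro borel_measurable_inner) auto
  then have m: "(\<lambda>x. \<phi> x * g x $ i) \<in> borel_measurable M"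
    using measurable_M[OF C_1D(1)[OF assms(3)]] by (intro borel_measurable_times) (auto simp: inner_axis)
  have "AE x in M. norm (\<phi> x * g x $ i) \<le> k * \<bar>C\<bar>"
    using assms(2) AE_space
  proof eventually_elim
    case (elim x)
    have "\<bar>g x $ i\<bar> \<le> \<bar>C\<bar>" using component_le_norm_cart[of "g x" i] elim by linarith
    then show ?case unfolding real_norm_def abs_mult using k elim space_M by (intro mult_mono) auto
  qed
  then show ?thesis using m by (intro M.integrable_const_bound)
qed

lemma trace_scalar_test:
  assumes "g \<in> borel_measurable M" "AE x in M. norm (g x :: real^3) \<le> C"
    and rep: "\<And>i \<phi>. \<phi> \<in> Cc 1 \<Omega> \<Longrightarrow> (LINT x|M. \<phi> x * g x $ i) = T i E \<phi>" and \<phi>: "\<phi> \<in> Cc 1 \<Omega>"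
  shows "(LINT x|M. \<phi> x *\<^sub>R g x) = vm_integral \<Omega> \<mu> E \<phi> - (LINT x:E|lebesgue. cross3 (F x) (grad \<phi> x))"
proof -
  have C1: "C_k 1 \<phi>" using \<phi> by (rule CcE)
  have int: "integrable M (\<lambda>x. \<phi> x *\<^sub>R g x)"
  proof -
    have "integrable M (\<lambda>x. \<Sum>i\<in>UNIV. (\<phi> x * g x $ i) *\<^sub>R axis i (1::real))"
      by (intro Bochner_Integration.integrable_sum integrable_scaleR_left trace_test_integrable[OF assms(1,2) C1])
    moreover have "(\<Sum>i\<in>UNIV. (\<phi> x * g x $ i) *\<^sub>R axis i (1::real)) = \<phi> x *\<^sub>R g x" for x
      by (simp add: vec_eq_iff axis_def if_distrib cong: if_cong)
    ultimately show ?thesis by simp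
  qed
  have "(LINT x|M. \<phi> x *\<^sub>R g x) $ i = T i E \<phi>" for i
  proof -
    have "(LINT x|M. \<phi> x *\<^sub>R g x) $ i = (LINT x|M. (\<phi> x *\<^sub>R g x) $ i)"
      using integral_bounded_linear[OF bounded_linear_vec_nth int, of i] by simp
    then show ?thesis using rep[OF \<phi>, of i] by simp
  qed
  then show ?thesis by (simp add: vec_eq_iff T_def SI_def FI_def vm_integral_def)
qed

text \<open>The scalar identity applies to each component of \<open>\<phi>\<close>, and the field terms add up to \<open>curl \<phi> \<bullet> F\<close>.\<close>

lemma trace_vector_test:
  assumes g: "g \<in> borel_measurable M" "AE x in M. norm (g x :: real^3) \<le> C"
    and rep: "\<And>i \<phi>. \<phi> \<in> Cc 1 \<Omega> \<Longrightarrow> (LINT x|M. \<phi> x * g x $ i) = T i E \<phi>" and \<phi>: "\<phi> \<in> Cc 1 \<Omega>"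
  shows "(LINT x|M. g x \<bullet> \<phi> x) = vm_integral_dot \<Omega> \<mu> E \<phi> - (LINT x:E|lebesgue. curl \<phi> x \<bullet> F x)"
proof -
  have \<phi>i: "(\<lambda>x. \<phi> x $ i) \<in> Cc 1 \<Omega>" for i by (rule Cc_component[OF \<phi>])
  have C1: "C_k 1 (\<lambda>x. \<phi> x $ i)" for i using \<phi>i by (rule CcE)
  have "C_k 1 \<phi>" using \<phi> by (rule CcE)
  then have diff: "\<phi> differentiable (at x)" for x by simp
  have E: "E \<in> sets lebesgue" using open_E by auto
  note FI_i = FI_component[OF E E_dom C_1D(4)[OF C1]]
  have "(LINT x|M. g x \<bullet> \<phi> x) = (LINT x|M. (\<Sum>i\<in>UNIV. \<phi> x $ i * g x $ i))"
    by (simp add: inner_vec_def mult.commute)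
  also have "\<dots> = (\<Sum>i\<in>UNIV. T i E (\<lambda>x. \<phi> x $ i))"
    using trace_test_integrable[OF g C1] by (simp add: rep[OF \<phi>i])
  also have "\<dots> = (\<Sum>i\<in>UNIV. SI i E (\<lambda>x. \<phi> x $ i)) - (\<Sum>i\<in>UNIV. FI E (grad (\<lambda>x. \<phi> x $ i)) $ i)"
    by (simp add: T_def sum_subtractf)
  also have "(\<Sum>i\<in>UNIV. FI E (grad (\<lambda>x. \<phi> x $ i)) $ i)
      = (LINT x|lebesgue. (\<Sum>i\<in>UNIV. indicator E x * (cross3 (F x) (grad (\<lambda>x. \<phi> x $ i) x) $ i)))"
    unfolding FI_i(1) by (rule Bochner_Integration.integral_sum[symmetric]) (rule FI_i(2))
  also have "\<dots> = (LINT x:E|lebesgue. curl \<phi> x \<bullet> F x)"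
    by (simp add: set_lebesgue_integral_def curl_inner_eq[OF diff] sum_distrib_left)
  finally show ?thesis by (simp add: SI_def vm_integral_dot_def)
qed

end

section \<open>Tangent spaces almost everywhere\<close>

text \<open>The points where \<open>u\<close> may fail to be differentiable lie over a null set of the plane, and the graph
  parametrisation maps it to a set of Hausdorff measure zero.\<close>

lemma lipschitz_boundary_level_set:
  fixes U :: "(real^3) set"
  assumes U: "open U" "lipschitz_boundary U" and x: "x \<in> frontier U" and \<Omega>: "open \<Omega>" "frontier U \<subseteq> \<Omega>"
  obtains r u e L where "r > 0" "ball x r \<subseteq> \<Omega>" "L-lipschitz_on UNIV u" "\<And>y s. u (y + s *\<^sub>R e) = u y + s"
    "frontier U \<inter> ball x r = {y \<in> ball x r. u y = 0}"
    "AE y in boundary_measure U. y \<in> ball x r \<longrightarrow> u differentiable (at y)"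
proof (rule lipschitz_boundary_chart[OF U x])
  fix r0 u e and p :: "real^3 \<Rightarrow> real^2" and \<Gamma> L N
  assume r0: "r0 > 0" and u: "L-lipschitz_on UNIV u" and ue: "\<And>y s. u (y + s *\<^sub>R e) = u y + s"
    and lev: "frontier U \<inter> ball x r0 = {y \<in> ball x r0. u y = 0}" and p: "1-lipschitz_on UNIV p"
    and \<Gamma>: "L-lipschitz_on UNIV \<Gamma>" and \<Gamma>p: "\<And>y. u y = 0 \<Longrightarrow> \<Gamma> (p y) = y"
    and N: "negligible N" and diff: "\<And>y. p y \<notin> N \<Longrightarrow> u differentiable (at y)"
  obtain r1 where r1: "r1 > 0" "ball x r1 \<subseteq> \<Omega>" using \<Omega> x open_contains_ball by blast
  define r where "r = min r0 r1"
  have r: "r > 0" "ball x r \<subseteq> ball x r0" "ball x r \<subseteq> \<Omega>" using r0 r1 by (auto simp: r_def)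
  have lev': "frontier U \<inter> ball x r = {y \<in> ball x r. u y = 0}" using lev r(2) by blast
  have "N \<in> null_sets lebesgue" using N by (simp add: negligible_iff_null_sets)
  then obtain N' where N': "N' \<in> null_sets lborel" "N \<subseteq> N'" unfolding null_sets_completion_iff2 by blast
  have negN': "negligible N'" using N'(1) by (simp add: negligible_iff_null_sets null_sets_completionI)
  define Z where "Z = frontier U \<inter> ball x r \<inter> p -` N'"
  have "p \<in> borel_measurable borel"
    using lipschitz_imp_continuous[OF p] by (rule borel_measurable_continuous_onI)
  then have "p -` N' \<inter> space borel \<in> sets borel" using N'(1) by (intro measurable_sets) auto
  then have Zb: "Z \<in> sets borel" unfolding Z_def by (intro sets.Int) auto
  have "Z \<subseteq> \<Gamma> ` (N' \<inter> p ` ball x r)"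
  proof
    fix y assume y: "y \<in> Z"
    then have "\<Gamma> (p y) = y" using lev' by (intro \<Gamma>p) (auto simp: Z_def)
    then show "y \<in> \<Gamma> ` (N' \<inter> p ` ball x r)" using y by (intro image_eqI[of _ _ "p y"]) (auto simp: Z_def)
  qed
  moreover have "hausdorff_outer DIM(real^2) (\<Gamma> ` (N' \<inter> p ` ball x r)) = 0"
  proof (rule hausdorff_outer_lipschitz_image_null[OF \<Gamma>])
    show "negligible (N' \<inter> p ` ball x r)" using negN' by (rule negligible_subset) auto
    show "bounded (N' \<inter> p ` ball x r)"
    proof (rule bounded_subset)
      show "bounded (p ` cball x r)"
        by (intro compact_imp_bounded compact_continuous_image compact_cball
            continuous_on_subset[OF lipschitz_imp_continuous[OF p]]) auto
      show "N' \<inter> p ` ball x r \<subseteq> p ` cball x r" using ball_subset_cball[of x r] by blast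
    qed
  qed
  ultimately have "hausdorff_outer 2 Z \<le> 0" using hausdorff_outer_mono[of Z "\<Gamma> ` (N' \<inter> p ` ball x r)" 2] by simp
  then have "Z \<in> null_sets (boundary_measure U)"
    using Zb emeasure_boundary_measure[of Z U]
    by (auto simp: null_sets_def sets_boundary_measure sets_restrict_space Z_def)
  then have "AE y in boundary_measure U. y \<notin> Z" by (rule AE_not_in)
  moreover have "AE y in boundary_measure U. y \<in> frontier U" using AE_space[of "boundary_measure U"] unfolding space_boundary_measure .
  ultimately have "AE y in boundary_measure U. y \<in> ball x r \<longrightarrow> u differentiable (at y)"
  proof eventually_elim
    case (elim y)
    show ?case using elim diff[of y] N'(2) by (auto simp: Z_def)
  qed
  then show thesis using r(1,3) u ue lev' by (intro that)
qed

text \<open>Where a local equation \<open>u\<close> of the boundary is differentiable, the tangent space is the orthogonal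
  complement of its gradient. Finitely many balls, halved as in the hypothesis, cover the boundary.\<close>

lemma AE_tangential:
  fixes U \<Omega> :: "(real^3) set" and g :: "real^3 \<Rightarrow> real^3"
  assumes U: "open U" "lipschitz_boundary U" "compact (frontier U)" and \<Omega>: "open \<Omega>" "frontier U \<subseteq> \<Omega>"
    and orth: "\<And>x0 r L u. r > 0 \<Longrightarrow> ball x0 r \<subseteq> \<Omega> \<Longrightarrow> L-lipschitz_on UNIV u \<Longrightarrow>
      (\<And>x. x \<in> frontier U \<Longrightarrow> x \<in> ball x0 r \<Longrightarrow> u x = 0) \<Longrightarrow>
      (AE x in boundary_measure U. x \<in> ball x0 r \<longrightarrow> u differentiable (at x)) \<Longrightarrow>
      (AE x in boundary_measure U. x \<in> ball x0 (r / 2) \<longrightarrow> grad u x \<bullet> g x = 0)"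
  shows "AE x in boundary_measure U.
    is_tangent_space (frontier U) x (tangent_cone (frontier U) x) \<and> g x \<in> tangent_cone (frontier U) x"
proof -
  define ok where "ok x \<longleftrightarrow> is_tangent_space (frontier U) x (tangent_cone (frontier U) x) \<and> g x \<in> tangent_cone (frontier U) x" for x
  have "\<exists>r>0. AE y in boundary_measure U. y \<in> ball x r \<longrightarrow> ok y" if x: "x \<in> frontier U" for x
  proof (rule lipschitz_boundary_level_set[OF U(1,2) x \<Omega>])
    fix r u e L
    assume r: "r > 0" "ball x r \<subseteq> \<Omega>" and u: "L-lipschitz_on UNIV u" and ue: "\<And>y s. u (y + s *\<^sub>R e) = u y + s"
      and lev: "frontier U \<inter> ball x r = {y \<in> ball x r. u y = 0}"
      and diff: "AE y in boundary_measure U. y \<in> ball x r \<longrightarrow> u differentiable (at y)"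
    have u0: "u y = 0" if "y \<in> frontier U" "y \<in> ball x r" for y using that lev by blast
    have "AE y in boundary_measure U. y \<in> frontier U" using AE_space[of "boundary_measure U"] unfolding space_boundary_measure .
    moreover have "AE y in boundary_measure U. y \<in> ball x (r / 2) \<longrightarrow> grad u y \<bullet> g y = 0"
      by (rule orth[OF r u _ diff]) (rule u0)
    ultimately have "AE y in boundary_measure U. y \<in> ball x (r / 2) \<longrightarrow> ok y"
      using diff
    proof eventually_elim
      case (elim y)
      show ?case
      proof
        assume y: "y \<in> ball x (r / 2)"
        then have "y \<in> ball x r" using r by auto
        then have D: "(u has_derivative (\<lambda>v. grad u y \<bullet> v)) (at y)"
          using elim by (intro has_derivative_grad) blast
        have sub: "ball y (r / 2) \<subseteq> ball x r"
        proof
          fix z assume "z \<in> ball y (r / 2)"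
          then show "z \<in> ball x r" using y dist_triangle[of x z y] by auto
        qed
        have "frontier U \<inter> ball y (r / 2) = {z \<in> ball y (r / 2). u z = 0}" using lev sub by blast
        then have T: "is_tangent_space (frontier U) y {v. grad u y \<bullet> v = 0}"
          using r(1) elim ue D by (intro is_tangent_space_level_set[where r="r / 2" and u=u and e=e]) auto
        then have "tangent_cone (frontier U) y = {v. grad u y \<bullet> v = 0}" by (simp add: is_tangent_space_def)
        then show "ok y" using T y elim by (simp add: ok_def)
      qed
    qed
    then show ?thesis using r(1) by (intro exI[of _ "r / 2"]) simp
  qed
  then have "\<forall>x\<in>frontier U. \<exists>r. r > 0 \<and> (AE y in boundary_measure U. y \<in> ball x r \<longrightarrow> ok y)" by blast
  then obtain \<rho> where "\<forall>x\<in>frontier U. \<rho> x > 0 \<and> (AE y in boundary_measure U. y \<in> ball x (\<rho> x) \<longrightarrow> ok y)"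
    by (rule bchoice[THEN exE])
  then have \<rho>: "\<And>x. x \<in> frontier U \<Longrightarrow> \<rho> x > 0"
    "\<And>x. x \<in> frontier U \<Longrightarrow> AE y in boundary_measure U. y \<in> ball x (\<rho> x) \<longrightarrow> ok y"
    by blast+
  obtain C where C: "finite C" "C \<subseteq> frontier U" "frontier U \<subseteq> (\<Union>x\<in>C. ball x (\<rho> x))"
  proof (rule compact_finite_ball_cover[OF U(3)])
    show "\<rho> x > 0" if x: "x \<in> frontier U" for x using x by (rule \<rho>(1))
  qed (rule that)
  have "AE y in boundary_measure U. \<forall>x\<in>C. y \<in> ball x (\<rho> x) \<longrightarrow> ok y"
  proof (rule AE_finite_allI[OF C(1)])
    fix x assume "x \<in> C"
    with C(2) have "x \<in> frontier U" by (rule subsetD)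
    then show "AE y in boundary_measure U. y \<in> ball x (\<rho> x) \<longrightarrow> ok y" by (rule \<rho>(2))
  qed
  with AE_space have "AE y in boundary_measure U. ok y"
  proof eventually_elim
    case (elim y)
    then show ?case using C(3) by (auto simp: space_boundary_measure)
  qed
  then show ?thesis by (simp add: ok_def)
qed

section \<open>Interior and exterior tangential traces\<close>

text \<open>The set \<open>E\<close> will be \<open>U\<close> itself or the exterior \<open>\<Omega> - closure U\<close>.\<close>

lemma one_sided_trace:
  fixes \<Omega> U E :: "(real^3) set" and F :: "real^3 \<Rightarrow> real^3"
  assumes \<Omega>: "open \<Omega>" "bounded \<Omega>"
    and U: "open U" "compact (closure U)" "closure U \<subseteq> \<Omega>" "lipschitz_boundary U"
    and F: "F \<in> L_infty (lebesgue_on \<Omega>)" "has_curl_measure \<Omega> F \<mu>"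
    and E: "open E" "E \<subseteq> \<Omega>" "E \<inter> frontier U = {}" "\<Omega> \<subseteq> E \<union> interior (- E) \<union> frontier U"
  obtains g where "g \<in> L_infty (boundary_measure U)"
    "\<And>\<phi>. \<phi> \<in> Cc 1 \<Omega> \<Longrightarrow> (LINT x|boundary_measure U. \<phi> x *\<^sub>R g x)
      = vm_integral \<Omega> \<mu> E \<phi> - (LINT x:E|lebesgue. cross3 (F x) (grad \<phi> x))"
    "AE x in boundary_measure U.
      is_tangent_space (frontier U) x (tangent_cone (frontier U) x) \<and> g x \<in> tangent_cone (frontier U) x"
    "\<And>\<phi>. \<phi> \<in> Cc 1 \<Omega> \<Longrightarrow> (LINT x|boundary_measure U. g x \<bullet> \<phi> x)
      = vm_integral_dot \<Omega> \<mu> E \<phi> - (LINT x:E|lebesgue. curl \<phi> x \<bullet> F x)"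
proof -
  have S: "compact (frontier U)" "frontier U \<subseteq> \<Omega>"
    using U(2,3) by (auto simp: frontier_def compact_diff)
  obtain B where F_m: "F \<in> borel_measurable (lebesgue_on \<Omega>)" and B: "AE x in lebesgue_on \<Omega>. norm (F x) \<le> B"
    using F(1) by (auto simp: L_infty_def)
  have B': "AE x in lebesgue_on \<Omega>. norm (F x) \<le> \<bar>B\<bar>" using B by eventually_elim simp
  obtain c \<rho>0 where c: "c > 0" "\<rho>0 > 0"
    "\<And>y \<rho>. y \<in> frontier U \<Longrightarrow> 0 < \<rho> \<Longrightarrow> \<rho> \<le> \<rho>0 \<Longrightarrow> c * \<rho>\<^sup>2 \<le> measure (boundary_measure U) (frontier U \<inter> cball y \<rho>)"
    using boundary_measure_ball_ge[OF U(1,4) S(1)] by blast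
  interpret trace_surface \<Omega> F \<mu> "\<bar>B\<bar>" "frontier U" E "boundary_measure U" c \<rho>0
  proof (intro trace_surface.intro curl_measure_field.intro trace_surface_axioms.intro)
    show "finite_measure (boundary_measure U)" by (rule finite_boundary_measure[OF U(1,4) S(1)])
    show "sets (boundary_measure U) = sets (restrict_space borel (frontier U))" by (rule sets_boundary_measure)
  qed (use \<Omega> S F_m B' F(2) E c in auto)
  show thesis
  proof (rule trace_field)
    fix g C
    assume g: "g \<in> borel_measurable (boundary_measure U)" "AE x in boundary_measure U. norm (g x) \<le> C"
      and rep: "\<And>i \<phi>. \<phi> \<in> Cc 1 \<Omega> \<Longrightarrow> (LINT x|boundary_measure U. \<phi> x * g x $ i) = T i E \<phi>"
      and orth: "\<And>x0 r L u. r > 0 \<Longrightarrow> ball x0 r \<subseteq> \<Omega> \<Longrightarrow> L-lipschitz_on UNIV u \<Longrightarrow>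
        (\<And>x. x \<in> frontier U \<Longrightarrow> x \<in> ball x0 r \<Longrightarrow> u x = 0) \<Longrightarrow>
        (AE x in boundary_measure U. x \<in> ball x0 r \<longrightarrow> u differentiable (at x)) \<Longrightarrow>
        (AE x in boundary_measure U. x \<in> ball x0 (r / 2) \<longrightarrow> grad u x \<bullet> g x = 0)"
    show thesis
    proof (rule that[of g])
      show "g \<in> L_infty (boundary_measure U)" using g by (auto simp: L_infty_def)
      show "AE x in boundary_measure U.
        is_tangent_space (frontier U) x (tangent_cone (frontier U) x) \<and> g x \<in> tangent_cone (frontier U) x"
        by (rule AE_tangential[OF U(1,4) S(1) \<Omega>(1) S(2)]) (rule orth)
    qed (use trace_scalar_test[OF g rep] trace_vector_test[OF g rep] in auto)
  qed
qed

theorem theorem3p9: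
  fixes \<Omega> \<Omega>' :: "(real^3) set" and F :: "real^3 \<Rightarrow> real^3"
    and curlF :: "(real^3) set \<Rightarrow> real^3"
  assumes "open \<Omega>" and "bounded \<Omega>"
    and "open \<Omega>'" and "compact (closure \<Omega>')" and "closure \<Omega>' \<subseteq> \<Omega>"
    and "lipschitz_boundary \<Omega>'"
    and "F \<in> CM_infty \<Omega>" and "has_curl_measure \<Omega> F curlF"
  shows "\<exists>g_int \<in> L_infty (boundary_measure \<Omega>'). \<exists>g_ext \<in> L_infty (boundary_measure \<Omega>').
    (\<forall>\<phi> :: real^3 \<Rightarrow> real. \<phi> \<in> Cc 1 \<Omega> \<longrightarrow>
       (\<integral>x. \<phi> x *\<^sub>R g_int x \<partial>boundary_measure \<Omega>') = int_trace \<Omega> F curlF \<Omega>' \<phi> \<and>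
       (\<integral>x. \<phi> x *\<^sub>R g_ext x \<partial>boundary_measure \<Omega>') = ext_trace \<Omega> F curlF \<Omega>' \<phi>) \<and>
    (AE x in boundary_measure \<Omega>'.
       \<exists>T. is_tangent_space (frontier \<Omega>') x T \<and> g_int x \<in> T \<and> g_ext x \<in> T) \<and>
    (\<forall>\<phi> :: real^3 \<Rightarrow> real^3. \<phi> \<in> Cc 1 \<Omega> \<longrightarrow>
       (\<integral>x. g_int x \<bullet> \<phi> x \<partial>boundary_measure \<Omega>') =
         vm_integral_dot \<Omega> curlF \<Omega>' \<phi> - (LINT x:\<Omega>'|lebesgue. curl \<phi> x \<bullet> F x) \<and>
       (\<integral>x. g_ext x \<bullet> \<phi> x \<partial>boundary_measure \<Omega>') =
         - vm_integral_dot \<Omega> curlF (\<Omega> - closure \<Omega>') \<phi>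
         + (LINT x:\<Omega> - closure \<Omega>'|lebesgue. curl \<phi> x \<bullet> F x))"
proof -
  have F: "F \<in> L_infty (lebesgue_on \<Omega>)" using assms(7) by (simp add: CM_infty_def)
  note common = assms(1-6) F assms(8)
  have fr: "closure \<Omega>' = \<Omega>' \<union> frontier \<Omega>'" "\<Omega>' \<inter> frontier \<Omega>' = {}"
    using assms(3) closure_subset[of \<Omega>'] by (auto simp: frontier_def interior_open)
  have ext: "\<Omega>' \<subseteq> interior (- (\<Omega> - closure \<Omega>'))" and int: "- closure \<Omega>' \<subseteq> interior (- \<Omega>')"
    by (intro interior_maximal open_Compl closed_closure assms(3); use fr(1) in blast)+
  have sub: "\<Omega>' \<subseteq> \<Omega>" using assms(5) fr(1) by blast
  have cov_int: "\<Omega> \<subseteq> \<Omega>' \<union> interior (- \<Omega>') \<union> frontier \<Omega>'" using int fr(1) by blast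
  have cov_ext: "\<Omega> \<subseteq> (\<Omega> - closure \<Omega>') \<union> interior (- (\<Omega> - closure \<Omega>')) \<union> frontier \<Omega>'"
    using ext fr(1) by blast
  have sub_ext: "\<Omega> - closure \<Omega>' \<subseteq> \<Omega>" and disj_ext: "(\<Omega> - closure \<Omega>') \<inter> frontier \<Omega>' = {}" using fr(1) by auto
  have op: "open (\<Omega> - closure \<Omega>')" using assms(1) by (intro open_Diff) auto
  show ?thesis
  proof (rule one_sided_trace[OF common assms(3) sub fr(2) cov_int], rule one_sided_trace[OF common op sub_ext disj_ext cov_ext])
    fix g h
    assume g: "g \<in> L_infty (boundary_measure \<Omega>')"
      "\<And>\<phi>. \<phi> \<in> Cc 1 \<Omega> \<Longrightarrow> (LINT x|boundary_measure \<Omega>'. \<phi> x *\<^sub>R g x)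
        = vm_integral \<Omega> curlF \<Omega>' \<phi> - (LINT x:\<Omega>'|lebesgue. cross3 (F x) (grad \<phi> x))"
      "AE x in boundary_measure \<Omega>'.
        is_tangent_space (frontier \<Omega>') x (tangent_cone (frontier \<Omega>') x) \<and> g x \<in> tangent_cone (frontier \<Omega>') x"
      "\<And>\<phi>. \<phi> \<in> Cc 1 \<Omega> \<Longrightarrow> (LINT x|boundary_measure \<Omega>'. g x \<bullet> \<phi> x)
        = vm_integral_dot \<Omega> curlF \<Omega>' \<phi> - (LINT x:\<Omega>'|lebesgue. curl \<phi> x \<bullet> F x)"
    assume h: "h \<in> L_infty (boundary_measure \<Omega>')"
      "\<And>\<phi>. \<phi> \<in> Cc 1 \<Omega> \<Longrightarrow> (LINT x|boundary_measure \<Omega>'. \<phi> x *\<^sub>R h x)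
        = vm_integral \<Omega> curlF (\<Omega> - closure \<Omega>') \<phi> - (LINT x:(\<Omega> - closure \<Omega>')|lebesgue. cross3 (F x) (grad \<phi> x))"
      "AE x in boundary_measure \<Omega>'.
        is_tangent_space (frontier \<Omega>') x (tangent_cone (frontier \<Omega>') x) \<and> h x \<in> tangent_cone (frontier \<Omega>') x"
      "\<And>\<phi>. \<phi> \<in> Cc 1 \<Omega> \<Longrightarrow> (LINT x|boundary_measure \<Omega>'. h x \<bullet> \<phi> x)
        = vm_integral_dot \<Omega> curlF (\<Omega> - closure \<Omega>') \<phi> - (LINT x:(\<Omega> - closure \<Omega>')|lebesgue. curl \<phi> x \<bullet> F x)"
    \<comment> \<open>The exterior functional carries the opposite sign.\<close>
    have h': "(\<lambda>x. - h x) \<in> L_infty (boundary_measure \<Omega>')" using h(1) by (auto simp: L_infty_def)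
    have tan: "AE x in boundary_measure \<Omega>'. \<exists>T. is_tangent_space (frontier \<Omega>') x T \<and> g x \<in> T \<and> - h x \<in> T"
      using g(3) h(3)
    proof eventually_elim
      case (elim x)
      then have "- h x \<in> tangent_cone (frontier \<Omega>') x" by (intro subspace_neg) (auto simp: is_tangent_space_def)
      then show ?case using elim by blast
    qed
    show ?thesis
    proof (rule bexI[OF _ g(1)], rule bexI[OF _ h'], intro conjI allI impI)
      fix \<phi> :: "real^3 \<Rightarrow> real" assume \<phi>: "\<phi> \<in> Cc 1 \<Omega>"
      show "(\<integral>x. \<phi> x *\<^sub>R g x \<partial>boundary_measure \<Omega>') = int_trace \<Omega> F curlF \<Omega>' \<phi>"
        using g(2)[OF \<phi>] by (simp add: int_trace_def)
      show "(\<integral>x. \<phi> x *\<^sub>R - h x \<partial>boundary_measure \<Omega>') = ext_trace \<Omega> F curlF \<Omega>' \<phi>"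
        using h(2)[OF \<phi>] by (simp add: ext_trace_def)
    next
      show "AE x in boundary_measure \<Omega>'. \<exists>T. is_tangent_space (frontier \<Omega>') x T \<and> g x \<in> T \<and> - h x \<in> T"
        by (rule tan)
    next
      fix \<phi> :: "real^3 \<Rightarrow> real^3" assume \<phi>: "\<phi> \<in> Cc 1 \<Omega>"
      show "(\<integral>x. g x \<bullet> \<phi> x \<partial>boundary_measure \<Omega>') =
        vm_integral_dot \<Omega> curlF \<Omega>' \<phi> - (LINT x:\<Omega>'|lebesgue. curl \<phi> x \<bullet> F x)" by (rule g(4)[OF \<phi>])
      show "(\<integral>x. - h x \<bullet> \<phi> x \<partial>boundary_measure \<Omega>') =
        - vm_integral_dot \<Omega> curlF (\<Omega> - closure \<Omega>') \<phi> + (LINT x:\<Omega> - closure \<Omega>'|lebesgue. curl \<phi> x \<bullet> F x)"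
        using h(4)[OF \<phi>] by simp
    qed
  qed
qed

end
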